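(* Let $v\not\equiv-\infty$ be subharmonic on $\mathbb{C}$ with Riesz measure $\nu$, and let $b\ge0$. Suppose one of the following holds: (i) $\limsup_{r\to+\infty}\frac1{2\pi r}\int_0^{2\pi}v(re^{i\theta})\,d\theta\le b$, and $\nu$ satisfies the Blaschke conditions in the upper and lower half-planes: $\int_{\{\operatorname{Im}z>0\}\setminus D(r_0)}\operatorname{Im}\frac1{\bar z}\,d\nu(z)<\infty$ and $\int_{\{\operatorname{Im}z<0\}\setminus D(r_0)}\bigl|\operatorname{Im}\frac1{z}\bigr|\,d\nu(z)<\infty$ for some $r_0>0$; (ii) for every $\beta\in(0,\pi/4]$, with $U_\beta:=\{z:|\arg z|\le\beta\}\cup\{z:|\arg z-\pi|\le\beta\}$, one has $\limsup_{r\to+\infty}\nu(\overline D(r)\setminus U_\beta)/r=0$, and $\limsup_{r\to+\infty}\nu(\overline D(r))/r\le e\,b$. Then for every $\varepsilon\in(0,1]$ there is an entire function $g\not\equiv0$ such that the growth indicator $h(\theta):=\limsup_{r\to+\infty}\frac{v(re^{i\theta})+\log|g(re^{i\theta})|}{r}$ satisfies $$h(\theta)\le1000\,b\bigl(\varepsilon|\cos\theta|+\varepsilon^{-1}|\sin\theta|\bigr)\quad\text{for all }\theta\in[0,2\pi].$$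
   Context: The Riesz measure of a subharmonic $v$ is $\frac1{2\pi}\Delta v$ (distributional Laplacian). $D(r)$, $\overline D(r)$: open/closed discs of radius $r$ centred at $0$; $\arg z$ is taken in $(-\pi,\pi]$ (the set $U_\beta$ includes $0$ by convention and consists of the pair of vertical closed angles of opening $2\beta$ around the real axis). *)

theory Defs
  imports "HOL-Analysis.Analysis"
begin

definition circle_integral :: "(complex \<Rightarrow> ereal) \<Rightarrow> complex \<Rightarrow> real \<Rightarrow> ereal" where
  "circle_integral v z r =
     enn2ereal (\<integral>\<^sup>+ \<theta>. e2ennreal (v (z + of_real r * cis \<theta>)) * indicator {0..2*pi} \<theta> \<partial>lborel)
   - enn2ereal (\<integral>\<^sup>+ \<theta>. e2ennreal (- v (z + of_real r * cis \<theta>)) * indicator {0..2*pi} \<theta> \<partial>lborel)"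

definition usc :: "(complex \<Rightarrow> ereal) \<Rightarrow> bool" where
  "usc v \<longleftrightarrow> (\<forall>z a. v z < a \<longrightarrow> eventually (\<lambda>w. v w < a) (at z))"

definition subharmonic :: "(complex \<Rightarrow> ereal) \<Rightarrow> bool" where
  "subharmonic v \<longleftrightarrow> (\<forall>z. v z \<noteq> \<infinity>) \<and> usc v \<and>
     (\<forall>z r. r > 0 \<longrightarrow> v z \<le> circle_integral v z r / ereal (2*pi))"

definition pd :: "complex \<Rightarrow> (complex \<Rightarrow> real) \<Rightarrow> complex \<Rightarrow> real" where
  "pd u f z = deriv (\<lambda>t::real. f (z + of_real t * u)) 0"

fun pds :: "complex list \<Rightarrow> (complex \<Rightarrow> real) \<Rightarrow> complex \<Rightarrow> real" where
  "pds [] f = f"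
| "pds (u # us) f = pd u (pds us f)"

definition smooth_R2 :: "(complex \<Rightarrow> real) \<Rightarrow> bool" where
  "smooth_R2 f \<longleftrightarrow> (\<forall>us. set us \<subseteq> {1, \<i>} \<longrightarrow>
       continuous_on UNIV (pds us f) \<and>
       (\<forall>u\<in>{1, \<i>}. \<forall>z. (\<lambda>t::real. pds us f (z + of_real t * u)) differentiable (at 0)))"

definition test_function :: "(complex \<Rightarrow> real) \<Rightarrow> bool" where
  "test_function f \<longleftrightarrow> smooth_R2 f \<and> compact (closure {z. f z \<noteq> 0})"

definition laplacian :: "(complex \<Rightarrow> real) \<Rightarrow> complex \<Rightarrow> real" where
  "laplacian f z = pd 1 (pd 1 f) z + pd \<i> (pd \<i> f) z"

definition riesz_measure :: "(complex \<Rightarrow> ereal) \<Rightarrow> complex measure \<Rightarrow> bool" where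
  "riesz_measure v \<nu> \<longleftrightarrow> sets \<nu> = sets borel \<and>
     (\<forall>R. emeasure \<nu> (cball 0 R) < \<infinity>) \<and>
     (\<forall>\<phi>. test_function \<phi> \<longrightarrow>
        (\<integral>z. \<phi> z \<partial>\<nu>) = (1 / (2*pi)) * (\<integral>z. real_of_ereal (v z) * laplacian \<phi> z \<partial>lborel))"

definition U_angle :: "real \<Rightarrow> complex set" where
  "U_angle \<beta> = {0} \<union> {z. \<bar>Arg z\<bar> \<le> \<beta>} \<union> {z. \<bar>Arg (- z)\<bar> \<le> \<beta>}"

definition log_abs :: "(complex \<Rightarrow> complex) \<Rightarrow> complex \<Rightarrow> ereal" where
  "log_abs g z = (if g z = 0 then - \<infinity> else ereal (ln (norm (g z))))"

end

theory Submission
  imports Defs "HOL-Complex_Analysis.Complex_Analysis"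
begin

text \<open>The Riesz masses of \<open>v\<close> are cancelled by adding reflected masses and balancing the result.
  Write \<open>v\<close>, smoothed at a scale proportional to \<open>|z|\<close>, as a harmonic function plus the potential of \<open>\<nu>\<close> on a large disc.
  Adding the potential of the mass at \<open>-w\<close> for each mass at \<open>w\<close> turns the kernel into \<open>log |1 - (z/w)\<^sup>2|\<close>.
  For \<open>w\<close> outside a narrow pair of angles the total contribution is \<open>o(|z|)\<close>. A mass inside the angles is, in the variable
  \<open>z\<^sup>2\<close>, close to the positive half-axis, and by Poisson's formula its potential is at most that of the mass swept onto the
  real and imaginary axes of \<open>z\<close>. The swept densities are bounded by constants \<open>c = O(b/\<epsilon>)\<close> and \<open>c' = O(b \<epsilon>)\<close>,
  so one may add further nonnegative masses that make them constant, and the potential of constant densities on both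
  axes is \<open>\<pi> (c |Im z| + c' |Re z|)\<close>. All added masses are replaced by zeros of an entire function, dyadic annulus by dyadic
  annulus, with a sublinear error; truncating the logarithms near their poles absorbs the discretization.
  The harmonic function is removed by an exponential factor, and Montel's theorem lets the disc grow.\<close>

text \<open>The kernel log|1 - z/w| decays only like |z/w|, which mass of linear growth cannot sum;
  for the pair \<open>w\<close>, \<open>-w\<close> the decay is |z/w|^2. Only upper bounds on v +
  log|g| are wanted, so every logarithm may be cut off from below at relative distance
  \<open>\<rho>\<close>. The smoothing radius \<open>\<rho> * norm z / 2\<close> is matched to this
  cut-off, so that no exceptional set of z arises. The cut-off costs O(\<open>\<rho>\<close> B |z| /
  \<open>\<eta>\<close>), hence \<open>\<rho>\<close> is chosen of order \<open>\<eta>\<close>^2.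
  The Poisson kernel at angle \<open>\<eta>\<close> has height 1/\<open>\<eta>\<close> on the near
  axis and \<open>\<eta>\<close> on the far one. With \<open>\<eta>\<close> =
  \<open>\<epsilon>\<close>/2 these become the weights 1/\<open>\<epsilon>\<close> of |sin| and
  \<open>\<epsilon>\<close> of |cos|. Errors of order b \<open>\<epsilon>\<close> are harmless
  because |sin| + |cos| is at least 1. Apart from a term that vanishes as the disc grows, the bounds
  do not depend on the disc. The factors with prescribed zeros equal 1 at 0 and the exponential
  factor keeps the exact value there, so |g(0)| is the same for all discs and the limit is not 0.
  The Riesz identity accepts only test functions with partial derivatives of all orders, hence the
  smooth classes.\<close>

section \<open>Smooth functions of one real variable\<close>

text \<open>The clauses are chosen so that the class is closed under differentiation.
  \<open>flat\<close> carries an arbitrary polynomial in 1/x because repeated differentiation of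
  exp(-1/x) produces one; \<open>antideriv\<close> admits the primitives from which the step and the
  truncated logarithm are made.\<close>

inductive_set smooth1 :: "(real \<Rightarrow> real) set" where
  const: "(\<lambda>x. c) \<in> smooth1"
| id: "(\<lambda>x. x) \<in> smooth1"
| add: "\<lbrakk>f \<in> smooth1; g \<in> smooth1\<rbrakk> \<Longrightarrow> (\<lambda>x. f x + g x) \<in> smooth1"
| mult: "\<lbrakk>f \<in> smooth1; g \<in> smooth1\<rbrakk> \<Longrightarrow> (\<lambda>x. f x * g x) \<in> smooth1"
| inverse: "\<lbrakk>f \<in> smooth1; \<And>x. f x > 0\<rbrakk> \<Longrightarrow> (\<lambda>x. inverse (f x)) \<in> smooth1"
| compose: "\<lbrakk>f \<in> smooth1; g \<in> smooth1\<rbrakk> \<Longrightarrow> (\<lambda>x. f (g x)) \<in> smooth1"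
| antideriv: "\<lbrakk>f \<in> smooth1; \<And>x. (F has_real_derivative f x) (at x)\<rbrakk> \<Longrightarrow> F \<in> smooth1"
| flat: "(\<lambda>x. if x > 0 then poly p (1 / x) * exp (- (1 / x)) else 0) \<in> smooth1"

lemma poly_exp_tendsto_0: "((\<lambda>x::real. poly p x * exp (- x)) \<longlongrightarrow> 0) at_top"
proof -
  have "((\<lambda>x. \<Sum>i\<le>degree p. coeff p i * (x ^ i / exp x)) \<longlongrightarrow> (\<Sum>i\<le>degree p. coeff p i * 0)) at_top"
    by (intro tendsto_intros tendsto_power_div_exp_0)
  then show ?thesis
    by (simp add: poly_altdef sum_distrib_right exp_minus divide_inverse mult.assoc)
qed

text \<open>With u = 1/x the chain rule contributes -u^2, and p(u) exp(-u) has u-derivative (p' - p)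
  exp(-u); hence the polynomial u^2 (p - p'). At 0 the difference quotient from the right is again
  of this shape, with u p in place of p, and so tends to 0.\<close>

lemma flat_has_derivative:
  "((\<lambda>x::real. if x > 0 then poly p (1 / x) * exp (- (1 / x)) else 0) has_real_derivative
     (if x > 0 then poly ([:0,0,1:] * (p - pderiv p)) (1 / x) * exp (- (1 / x)) else 0)) (at x)"
proof -
  let ?f = "\<lambda>x::real. if x > 0 then poly p (1 / x) * exp (- (1 / x)) else 0"
  consider "x > 0" | "x < 0" | "x = 0" by linarith
  then show ?thesis
  proof cases
    case 1
    have "((\<lambda>x. poly p (1 / x) * exp (- (1 / x))) has_real_derivative
        poly ([:0,0,1:] * (p - pderiv p)) (1 / x) * exp (- (1 / x))) (at x)"
      using 1 by (auto intro!: derivative_eq_intros DERIV_chain2[OF poly_DERIV]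
          simp: field_simps power2_eq_square)
    moreover have "eventually (\<lambda>y. ?f y = poly p (1 / y) * exp (- (1 / y))) (nhds x)"
      using eventually_gt_at_top eventually_nhds_in_open[of "{0<..}" x] 1
      by (auto elim!: eventually_mono)
    ultimately show ?thesis
      using 1 by (simp add: DERIV_cong_ev)
  next
    case 2
    have "eventually (\<lambda>y. ?f y = 0) (nhds x)"
      using eventually_nhds_in_open[of "{..<0}" x] 2 by (auto elim!: eventually_mono)
    then show ?thesis
      using 2 by (simp add: DERIV_cong_ev[OF refl _ refl, of ?f "\<lambda>_. 0"])
  next
    case 3
    have "((\<lambda>h. ?f h / h) \<longlongrightarrow> 0) (at 0)"
      unfolding filterlim_split_at_real
    proof (intro conjI filterlim_split_at)
      show "((\<lambda>h. ?f h / h) \<longlongrightarrow> 0) (at_left 0)"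
        by (rule tendsto_eventually) (auto simp: eventually_at_filter)
      have "((\<lambda>h::real. poly (pCons 0 p) (1/h) * exp (- (1/h))) \<longlongrightarrow> 0) (at_right 0)"
        using filterlim_compose[OF poly_exp_tendsto_0[of "pCons 0 p"] filterlim_inverse_at_top_right]
        by (simp add: inverse_eq_divide)
      then show "((\<lambda>h. ?f h / h) \<longlongrightarrow> 0) (at_right 0)"
        by (rule Lim_transform_eventually) (auto simp: eventually_at_filter field_simps)
    qed
    then show ?thesis
      using 3 by (simp add: DERIV_def cong: if_cong)
  qed
qed

text \<open>Since the derivative stays in the class, this one step gives derivatives of every
  order.\<close>

lemma smooth1_deriv:
  "f \<in> smooth1 \<Longrightarrow> \<exists>g\<in>smooth1. \<forall>x. (f has_real_derivative g x) (at x)"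
proof (induction rule: smooth1.induct)
  case (const c)
  then show ?case by (intro bexI[of _ "\<lambda>_. 0"]) (auto intro: smooth1.const)
next
  case id
  then show ?case by (intro bexI[of _ "\<lambda>_. 1"]) (auto intro: smooth1.const)
next
  case (add f g)
  then obtain f' g' where "f' \<in> smooth1" "g' \<in> smooth1"
    "\<forall>x. (f has_real_derivative f' x) (at x)" "\<forall>x. (g has_real_derivative g' x) (at x)" by blast
  moreover have "(\<lambda>x. f' x + g' x) \<in> smooth1"
    by (rule smooth1.add) fact+
  ultimately show ?case
    by (intro bexI[of _ "\<lambda>x. f' x + g' x"]) (auto intro!: DERIV_add)
next
  case (mult f g)
  then obtain f' g' where "f' \<in> smooth1" "g' \<in> smooth1"
    "\<forall>x. (f has_real_derivative f' x) (at x)" "\<forall>x. (g has_real_derivative g' x) (at x)" by blast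
  moreover have "(\<lambda>x. f' x * g x + g' x * f x) \<in> smooth1"
    by (rule smooth1.add[OF smooth1.mult smooth1.mult]) fact+
  ultimately show ?case
    by (intro bexI[of _ "\<lambda>x. f' x * g x + g' x * f x"]) (auto intro!: DERIV_mult)
next
  case (inverse f)
  then obtain f' where f': "f' \<in> smooth1" "\<forall>x. (f has_real_derivative f' x) (at x)" by blast
  have "(\<lambda>x. (-1) * (f' x * (inverse (f x) * inverse (f x)))) \<in> smooth1"
    using inverse f' by (intro smooth1.mult smooth1.const smooth1.inverse)
  moreover have "\<forall>x. f x \<noteq> 0" using inverse.hyps(2) by (metis less_irrefl)
  ultimately show ?case
    using f' by (intro bexI[of _ "\<lambda>x. (-1) * (f' x * (inverse (f x) * inverse (f x)))"])
       (auto intro!: derivative_eq_intros simp: power2_eq_square)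
next
  case (compose f g)
  then obtain f' g' where "f' \<in> smooth1" "g' \<in> smooth1"
    "\<forall>x. (f has_real_derivative f' x) (at x)" "\<forall>x. (g has_real_derivative g' x) (at x)" by blast
  moreover have "(\<lambda>x. f' (g x) * g' x) \<in> smooth1"
    by (rule smooth1.mult[OF smooth1.compose]) fact+
  ultimately show ?case
    by (intro bexI[of _ "\<lambda>x. f' (g x) * g' x"]) (auto intro!: DERIV_chain2[of f _ g])
next
  case (antideriv f F)
  then show ?case by blast
next
  case (flat p)
  show ?case
    using flat_has_derivative[of p]
    by (intro bexI[of _ "\<lambda>x. if x > 0 then poly ([:0,0,1:] * (p - pderiv p)) (1 / x) * exp (- (1 / x)) else 0"])
       (simp_all only: smooth1.flat simp_thms)
qed

lemma smooth1_isCont: "f \<in> smooth1 \<Longrightarrow> isCont f x"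
  using smooth1_deriv DERIV_isCont by blast

lemma smooth1_continuous_on: "f \<in> smooth1 \<Longrightarrow> continuous_on S f"
  by (simp add: continuous_at_imp_continuous_on smooth1_isCont)

lemma antiderivative_vanishing_left:
  fixes f :: "real \<Rightarrow> real"
  assumes cont: "continuous_on UNIV f" and f0: "\<And>x. x \<le> a \<Longrightarrow> f x = 0"
  obtains F where "\<And>x. (F has_real_derivative f x) (at x)" "\<And>x. x \<le> a \<Longrightarrow> F x = 0"
proof
  \<comment> \<open>The lower limit lies one unit to the left of \<open>a\<close>, so that every x
    from \<open>a\<close> on is interior to the interval and the derivative is two-sided.\<close>
  let ?F = "\<lambda>x. integral {a - 1..x} f"
  show F0: "?F x = 0" if "x \<le> a" for x
    using that f0 integral_cong[of "{a - 1..x}" f "\<lambda>_. 0"] by simp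
  show "(?F has_real_derivative f x) (at x)" for x
  proof (cases "x < a")
    case True
    have "eventually (\<lambda>y. ?F y = 0) (nhds x)"
      using eventually_nhds_in_open[of "{..<a}" x] True F0 by (auto elim!: eventually_mono)
    then show ?thesis
      using True f0 by (simp add: DERIV_cong_ev[OF refl _ refl, of ?F "\<lambda>_. 0"])
  next
    case False
    have "(?F has_real_derivative f x) (at x within {a - 1..x + 1})"
      using False by (intro integral_has_real_derivative continuous_on_subset[OF cont]) auto
    moreover have "at x within {a - 1..x + 1} = at x"
      using False by (intro at_within_interior) auto
    ultimately show ?thesis
      by simp
  qed
qed


subsection \<open>A smooth truncation of the logarithm\<close>

text \<open>A product of two flat functions, one vanishing up to 1/4 and one from 1 on, is a bump,
  and the step is its normalised primitive. The thresholds are meant for a squared relative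
  distance: 1/4 and 1 stand for the radii \<open>\<rho>\<close>/2 and \<open>\<rho>\<close>.\<close>

lemma smooth_step_exists:
  obtains \<kappa> \<kappa>' where "\<kappa> \<in> smooth1" "\<kappa>' \<in> smooth1" "\<And>s. (\<kappa> has_real_derivative \<kappa>' s) (at s)"
    "\<And>s. 0 \<le> \<kappa>' s" "\<And>s. s \<le> 1/4 \<Longrightarrow> \<kappa> s = 0" "\<And>s. s \<ge> 1 \<Longrightarrow> \<kappa> s = 1"
proof -
  define e :: "real \<Rightarrow> real" where "e = (\<lambda>x. if x > 0 then poly 1 (1 / x) * exp (- (1 / x)) else 0)"
  have e: "e \<in> smooth1" unfolding e_def by (rule smooth1.flat)
  define \<beta> where "\<beta> = (\<lambda>s. e (s + (-1/4)) * e (1 + (-1) * s))"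
  have \<beta>: "\<beta> \<in> smooth1"
    unfolding \<beta>_def
    by (rule smooth1.mult[OF smooth1.compose[OF e] smooth1.compose[OF e]];
        intro smooth1.add smooth1.mult smooth1.const smooth1.id)
  have \<beta>0: "\<beta> s \<ge> 0" for s by (simp add: \<beta>_def e_def)
  have \<beta>pos: "\<beta> s > 0" if "1/4 < s" "s < 1" for s using that by (simp add: \<beta>_def e_def)
  have \<beta>z: "\<beta> s = 0" if "s \<le> 1/4 \<or> s \<ge> 1" for s using that by (auto simp: \<beta>_def e_def)
  obtain F where F: "\<And>x. (F has_real_derivative \<beta> x) (at x)" "\<And>x. x \<le> 1/4 \<Longrightarrow> F x = 0"
    using antiderivative_vanishing_left[OF smooth1_continuous_on[OF \<beta>], of "1/4"] \<beta>z by blast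
  have Fs: "F \<in> smooth1" by (rule smooth1.antideriv[OF \<beta>]) fact
  have Fcont: "continuous_on S F" for S
    using F(1) DERIV_isCont continuous_at_imp_continuous_on by blast
  have "F (1/4) < F 1"
  proof (rule DERIV_pos_imp_increasing_open[of "1/4" 1 F])
    show "\<exists>y. (F has_real_derivative y) (at x) \<and> y > 0" if "1/4 < x" "x < 1" for x
      using F(1)[of x] \<beta>pos[OF that] by blast
  qed (simp_all add: Fcont)
  then have F1: "F 1 > 0" using F(2)[of "1/4"] by simp
  have Fc: "F s = F 1" if "s \<ge> 1" for s
  proof (cases "s = 1")
    case False
    have "(F has_real_derivative 0) (at x)" if "1 < x" for x
      using F(1)[of x] \<beta>z[of x] that by simp
    then show ?thesis
      using that False by (intro DERIV_isconst2[of 1 s F]) (simp_all add: Fcont)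
  qed simp
  show thesis
  proof (rule that[of "\<lambda>s. inverse (F 1) * F s" "\<lambda>s. inverse (F 1) * \<beta> s"])
    show "(\<lambda>s. inverse (F 1) * F s) \<in> smooth1" "(\<lambda>s. inverse (F 1) * \<beta> s) \<in> smooth1"
      by (intro smooth1.mult smooth1.const Fs \<beta>)+
    show "((\<lambda>s. inverse (F 1) * F s) has_real_derivative inverse (F 1) * \<beta> s) (at s)" for s
      by (intro DERIV_cmult F)
    show "0 \<le> inverse (F 1) * \<beta> s" for s using F1 \<beta>0 by simp
    show "inverse (F 1) * F s = 0" if "s \<le> 1/4" for s using F(2)[OF that] by simp
    show "inverse (F 1) * F s = 1" if "s \<ge> 1" for s using Fc[OF that] F1 by simp
  qed
qed

text \<open>One choice for both components keeps \<open>bump\<close> the derivative of this very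
  \<open>step\<close>.\<close>

definition smooth_step_pair :: "(real \<Rightarrow> real) \<times> (real \<Rightarrow> real)" where
  "smooth_step_pair = (SOME q. fst q \<in> smooth1 \<and> snd q \<in> smooth1 \<and> (\<forall>s. (fst q has_real_derivative snd q s) (at s)) \<and>
    (\<forall>s. 0 \<le> snd q s) \<and> (\<forall>s\<le>1/4. fst q s = 0) \<and> (\<forall>s\<ge>1. fst q s = 1))"

definition step :: "real \<Rightarrow> real" where "step = fst smooth_step_pair"
definition bump :: "real \<Rightarrow> real" where "bump = snd smooth_step_pair"

lemma smooth_step_pair:
  "step \<in> smooth1 \<and> bump \<in> smooth1 \<and> (\<forall>s. (step has_real_derivative bump s) (at s)) \<and>
    (\<forall>s. 0 \<le> bump s) \<and> (\<forall>s\<le>1/4. step s = 0) \<and> (\<forall>s\<ge>1. step s = 1)"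
proof -
  have "\<exists>q. fst q \<in> smooth1 \<and> snd q \<in> smooth1 \<and> (\<forall>s. (fst q has_real_derivative snd q s) (at s)) \<and>
    (\<forall>s. 0 \<le> snd q s) \<and> (\<forall>s\<le>1/4. fst q s = (0::real)) \<and> (\<forall>s\<ge>1. fst q s = 1)"
    by (rule smooth_step_exists) (metis fst_conv snd_conv)
  from someI_ex[OF this] show ?thesis
    unfolding step_def bump_def smooth_step_pair_def .
qed

lemma step_smooth: "step \<in> smooth1" and bump_smooth: "bump \<in> smooth1"
  and step_deriv: "(step has_real_derivative bump s) (at s)"
  and bump_nonneg: "0 \<le> bump s"
  and step_eq_0: "s \<le> 1/4 \<Longrightarrow> step s = 0" and step_eq_1: "s \<ge> 1 \<Longrightarrow> step s = 1"
  using smooth_step_pair by auto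

lemma step_mono: "s \<le> t \<Longrightarrow> step s \<le> step t"
  by (rule DERIV_nonneg_imp_nondecreasing[of _ _ step]) (use step_deriv bump_nonneg in blast)+

lemma step_nonneg: "0 \<le> step s" and step_le_1: "step s \<le> 1"
  using step_mono[of "min s 0" s] step_mono[of s "max s 1"] step_eq_0[of "min s 0"] step_eq_1[of "max s 1"]
  by auto

lemma bump_eq_0: assumes "s < 1/4 \<or> s > 1" shows "bump s = 0"
proof -
  have "\<exists>c. eventually (\<lambda>t. step t = c) (nhds s)"
  proof (cases "s < 1/4")
    case True
    then show ?thesis
      using eventually_nhds_in_open[of "{..<1/4}" s] by (auto intro!: exI[of _ 0] elim!: eventually_mono simp: step_eq_0)
  next
    case False
    then show ?thesis
      using assms eventually_nhds_in_open[of "{1<..}" s] by (auto intro!: exI[of _ 1] elim!: eventually_mono simp: step_eq_1)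
  qed
  then obtain c where "eventually (\<lambda>t. step t = c) (nhds s)" ..
  then have "(step has_real_derivative 0) (at s)"
    by (subst DERIV_cong_ev[OF refl _ refl]) auto
  then show ?thesis using step_deriv DERIV_unique by blast
qed

text \<open>Continuity carries the vanishing to the ends. The end 1 is the squared relative distance
  of a point at distance exactly \<open>\<rho>\<close> from the centre.\<close>

lemma bump_eq_0_at_ends: "bump (1/4) = 0" "bump 1 = 0"
proof -
  have "isCont bump x" for x by (rule smooth1_isCont[OF bump_smooth])
  then have c: "(bump \<longlongrightarrow> bump x) (at_left x)" "(bump \<longlongrightarrow> bump x) (at_right x)" for x
    by (auto simp: isCont_def filterlim_at_split)
  have "(bump \<longlongrightarrow> 0) (at_left (1/4))" "(bump \<longlongrightarrow> 0) (at_right 1)"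
    by (rule tendsto_eventually; auto simp: eventually_at_filter bump_eq_0)+
  then show "bump (1/4) = 0" "bump 1 = 0"
    using c tendsto_unique trivial_limit_at_left_real trivial_limit_at_right_real by blast+
qed

text \<open>\<open>F\<close> of the squared modulus is log|z| outside the unit disc. The condition
  on \<open>s * k s\<close> is the one that makes its Laplacian 4 (s F'' + F') = 4 (s k)' equal to
  twice the bump, a nonnegative function of total mass 2 \<pi> on the disc.\<close>

lemma smooth_log_exists:
  obtains F k where "F \<in> smooth1" "k \<in> smooth1" "\<And>s. (F has_real_derivative k s) (at s)"
    "\<And>s. s * k s = step s / 2" "\<And>s. s \<ge> 1 \<Longrightarrow> F s = ln s / 2" "\<And>s. s \<le> 1 \<Longrightarrow> F s \<le> 0" "\<And>s. 0 \<le> k s"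
proof -
  \<comment> \<open>\<open>m\<close> is smooth and positive everywhere and equals s from 1/4 on. As
    \<open>step\<close> vanishes up to 1/4, dividing by \<open>m\<close> realises step(s)/s without
    a singularity at 0.\<close>
  define m where "m = (\<lambda>s. s * step (4 * s) + (1 + (-1) * step (4 * s)))"
  have m: "m \<in> smooth1"
    unfolding m_def
    by (rule smooth1.add[OF smooth1.mult[OF smooth1.id smooth1.compose[OF step_smooth]]
          smooth1.add[OF smooth1.const smooth1.mult[OF smooth1.const smooth1.compose[OF step_smooth]]]];
        intro smooth1.mult smooth1.const smooth1.id)
  have m_eq: "m s = s" if "s \<ge> 1/4" for s using that by (simp add: m_def step_eq_1)
  have mpos: "m s > 0" for s
  proof (cases "s \<le> 1/16 \<or> s \<ge> 1/4")
    case True then show ?thesis by (auto simp: m_def step_eq_1 step_eq_0)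
  next
    case False
    have "s * step (4 * s) + (1 - step (4 * s)) \<ge> s * step (4 * s) + s * (1 - step (4 * s))"
      using False step_le_1[of "4 * s"] mult_right_mono[of s 1 "1 - step (4 * s)"] by simp
    then have "m s \<ge> s" by (simp add: m_def algebra_simps)
    with False show ?thesis by simp
  qed
  define k where "k = (\<lambda>s. (1/2) * (step s * inverse (m s)))"
  have k: "k \<in> smooth1" unfolding k_def
    by (intro smooth1.mult smooth1.const step_smooth smooth1.inverse m mpos)
  have k0: "k s = 0" if "s \<le> 1/4" for s using that by (simp add: k_def step_eq_0)
  have sk: "s * k s = step s / 2" for s
    using mpos[of s] m_eq[of s] by (cases "s \<le> 1/4") (auto simp: k_def step_eq_0)
  have knn: "0 \<le> k s" for s using mpos[of s] step_nonneg[of s] by (simp add: k_def)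
  obtain G where G: "\<And>x. (G has_real_derivative k x) (at x)"
    using antiderivative_vanishing_left[OF smooth1_continuous_on[OF k] k0] by metis
  \<comment> \<open>The shift gives F(1) = 0 = ln 1 / 2; from there on F and ln s / 2 have the same
    derivative.\<close>
  define F where "F = (\<lambda>s. G s - G 1)"
  have F: "(F has_real_derivative k s) (at s)" for s
    unfolding F_def by (auto intro!: derivative_eq_intros G)
  have Fs: "F \<in> smooth1" by (rule smooth1.antideriv[OF k]) (rule F)
  have "F s \<le> F 1" if "s \<le> 1" for s
    by (rule DERIV_nonneg_imp_nondecreasing[OF that, of F]) (use F knn in blast)
  moreover have "F s = ln s / 2" if "s \<ge> 1" for s
  proof (cases "s = 1")
    case False
    have d: "((\<lambda>s. F s - ln s / 2) has_real_derivative 0) (at x)" if "x \<ge> 1" for x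
    proof -
      have "k x = 1 / (2 * x)" using sk[of x] that by (simp add: step_eq_1 field_simps)
      then show ?thesis using that by (auto intro!: derivative_eq_intros F)
    qed
    have "continuous_on {1..s} (\<lambda>s. F s - ln s / 2)"
      by (intro continuous_at_imp_continuous_on ballI DERIV_isCont[OF d]) simp
    then have "F s - ln s / 2 = F 1 - ln 1 / 2"
      using that False d by (intro DERIV_isconst2[of 1 s "\<lambda>s. F s - ln s / 2"]) simp_all
    then show ?thesis by (simp add: F_def)
  qed (simp add: F_def)
  ultimately show thesis using that[of F k] Fs k F sk knn by (simp add: F_def)
qed

definition smooth_log_pair :: "(real \<Rightarrow> real) \<times> (real \<Rightarrow> real)" where
  "smooth_log_pair = (SOME q. fst q \<in> smooth1 \<and> snd q \<in> smooth1 \<and> (\<forall>s. (fst q has_real_derivative snd q s) (at s)) \<and>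
    (\<forall>s. s * snd q s = step s / 2) \<and> (\<forall>s\<ge>1. fst q s = ln s / 2) \<and> (\<forall>s\<le>1. fst q s \<le> 0) \<and> (\<forall>s. 0 \<le> snd q s))"

definition slog :: "real \<Rightarrow> real" where "slog = fst smooth_log_pair"
definition slog' :: "real \<Rightarrow> real" where "slog' = snd smooth_log_pair"

lemma smooth_log_pair:
  "slog \<in> smooth1 \<and> slog' \<in> smooth1 \<and> (\<forall>s. (slog has_real_derivative slog' s) (at s)) \<and>
    (\<forall>s. s * slog' s = step s / 2) \<and> (\<forall>s\<ge>1. slog s = ln s / 2) \<and> (\<forall>s\<le>1. slog s \<le> 0) \<and> (\<forall>s. 0 \<le> slog' s)"
proof -
  have "\<exists>q. fst q \<in> smooth1 \<and> snd q \<in> smooth1 \<and> (\<forall>s. (fst q has_real_derivative snd q s) (at s)) \<and>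
    (\<forall>s. s * snd q s = step s / 2) \<and> (\<forall>s\<ge>1. fst q s = ln s / 2) \<and> (\<forall>s\<le>1. fst q s \<le> 0) \<and> (\<forall>s. 0 \<le> snd q s)"
    by (rule smooth_log_exists) (metis fst_conv snd_conv)
  from someI_ex[OF this] show ?thesis
    unfolding slog_def slog'_def smooth_log_pair_def .
qed

lemma slog_smooth: "slog \<in> smooth1" and slog'_smooth: "slog' \<in> smooth1"
  and slog_deriv: "(slog has_real_derivative slog' s) (at s)"
  and slog'_eq: "s * slog' s = step s / 2"
  and slog_eq_ln: "s \<ge> 1 \<Longrightarrow> slog s = ln s / 2" and slog_le_0: "s \<le> 1 \<Longrightarrow> slog s \<le> 0"
  and slog'_nonneg: "0 \<le> slog' s"
  using smooth_log_pair by auto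

subsection \<open>Smooth functions of two real variables\<close>

text \<open>Outer functions of one variable suffice, because all test functions below are sums and
  products of radial ones.\<close>

inductive_set smooth2 :: "(complex \<Rightarrow> real) set" where
  const: "(\<lambda>z. c) \<in> smooth2"
| Re: "Re \<in> smooth2"
| Im: "Im \<in> smooth2"
| add: "\<lbrakk>f \<in> smooth2; g \<in> smooth2\<rbrakk> \<Longrightarrow> (\<lambda>z. f z + g z) \<in> smooth2"
| mult: "\<lbrakk>f \<in> smooth2; g \<in> smooth2\<rbrakk> \<Longrightarrow> (\<lambda>z. f z * g z) \<in> smooth2"
| compose: "\<lbrakk>h \<in> smooth1; f \<in> smooth2\<rbrakk> \<Longrightarrow> (\<lambda>z. h (f z)) \<in> smooth2"

lemma smooth2_deriv:
  "f \<in> smooth2 \<Longrightarrow> \<exists>g\<in>smooth2. \<forall>z. ((\<lambda>t::real. f (z + of_real t * u)) has_real_derivative g z) (at 0)"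
proof (induction rule: smooth2.induct)
  case (const c)
  then show ?case by (intro bexI[of _ "\<lambda>_. 0"]) (auto intro: smooth2.const)
next
  case Re
  then show ?case
    by (intro bexI[of _ "\<lambda>_. Re u"]) (auto intro!: smooth2.const derivative_eq_intros)
next
  case Im
  then show ?case
    by (intro bexI[of _ "\<lambda>_. Im u"]) (auto intro!: smooth2.const derivative_eq_intros)
next
  case (add f g)
  then obtain f' g' where *: "f' \<in> smooth2" "g' \<in> smooth2"
    "\<forall>z. ((\<lambda>t::real. f (z + of_real t * u)) has_real_derivative f' z) (at 0)"
    "\<forall>z. ((\<lambda>t::real. g (z + of_real t * u)) has_real_derivative g' z) (at 0)" by blast
  have "(\<lambda>x. f' x + g' x) \<in> smooth2" by (rule smooth2.add) fact+
  with * show ?case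
    by (intro bexI[of _ "\<lambda>x. f' x + g' x"]) (auto intro!: DERIV_add)
next
  case (mult f g)
  then obtain f' g' where *: "f' \<in> smooth2" "g' \<in> smooth2"
    "\<forall>z. ((\<lambda>t::real. f (z + of_real t * u)) has_real_derivative f' z) (at 0)"
    "\<forall>z. ((\<lambda>t::real. g (z + of_real t * u)) has_real_derivative g' z) (at 0)" by blast
  have "(\<lambda>x. f' x * g x + g' x * f x) \<in> smooth2"
    by (rule smooth2.add[OF smooth2.mult smooth2.mult]) fact+
  moreover have "((\<lambda>t::real. f (z + of_real t * u) * g (z + of_real t * u)) has_real_derivative
      f' z * g z + g' z * f z) (at 0)" for z
    using DERIV_mult[OF *(3)[rule_format, of z] *(4)[rule_format, of z]] by simp
  ultimately show ?case
    by (intro bexI[of _ "\<lambda>x. f' x * g x + g' x * f x"]) blast+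
next
  case (compose h f)
  then obtain f' where *: "f' \<in> smooth2"
    "\<forall>z. ((\<lambda>t::real. f (z + of_real t * u)) has_real_derivative f' z) (at 0)" by blast
  obtain h' where h': "h' \<in> smooth1" "\<forall>x. (h has_real_derivative h' x) (at x)"
    using smooth1_deriv[OF compose(1)] by blast
  have "(\<lambda>z. h' (f z) * f' z) \<in> smooth2"
    by (rule smooth2.mult[OF smooth2.compose]) fact+
  moreover have "((\<lambda>t::real. h (f (z + of_real t * u))) has_real_derivative h' (f z) * f' z) (at 0)" for z
    using DERIV_chain2[of h _ "\<lambda>t::real. f (z + of_real t * u)" 0] h'(2) *(2) by simp
  ultimately show ?case
    by (intro bexI[of _ "\<lambda>z. h' (f z) * f' z"]) blast+
qed

lemma pd_eqI: "((\<lambda>t::real. f (z + of_real t * u)) has_real_derivative d) (at 0) \<Longrightarrow> pd u f z = d"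
  unfolding pd_def by (rule DERIV_imp_deriv)

lemma smooth2_has_pd:
  assumes "f \<in> smooth2"
  shows "((\<lambda>t::real. f (z + of_real t * u)) has_real_derivative pd u f z) (at 0)"
  using smooth2_deriv[OF assms, of u] pd_eqI by metis

lemma pd_smooth2: assumes "f \<in> smooth2" shows "pd u f \<in> smooth2"
proof -
  obtain g where g: "g \<in> smooth2" "\<forall>z. ((\<lambda>t::real. f (z + of_real t * u)) has_real_derivative g z) (at 0)"
    using smooth2_deriv[OF assms] by blast
  then have "pd u f = g" using pd_eqI by blast
  with g show ?thesis by simp
qed

lemma smooth2_continuous_on: "f \<in> smooth2 \<Longrightarrow> continuous_on S f"
proof (induction rule: smooth2.induct)
  case (compose h f)
  then show ?case
    using continuous_on_compose2[OF smooth1_continuous_on[of h UNIV] compose.IH] by auto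
qed (auto intro!: continuous_intros)

text \<open>Every directional derivative stays in the class, so mixed derivatives of any order
  follow by induction on the list of directions.\<close>

lemma smooth2_imp_smooth_R2: assumes "f \<in> smooth2" shows "smooth_R2 f"
proof -
  have "pds us f \<in> smooth2" for us
    by (induction us) (auto simp: assms pd_smooth2)
  then show ?thesis
    unfolding smooth_R2_def real_differentiable_def
    by (intro allI impI conjI ballI smooth2_continuous_on exI) (auto intro: smooth2_has_pd)
qed

lemma pd_add: "\<lbrakk>f \<in> smooth2; g \<in> smooth2\<rbrakk> \<Longrightarrow> pd u (\<lambda>z. f z + g z) z = pd u f z + pd u g z"
  by (rule pd_eqI) (intro DERIV_add smooth2_has_pd)

lemma pd_mult: "\<lbrakk>f \<in> smooth2; g \<in> smooth2\<rbrakk> \<Longrightarrow> pd u (\<lambda>z. f z * g z) z = pd u f z * g z + f z * pd u g z"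
  using DERIV_mult[OF smooth2_has_pd smooth2_has_pd, of f g z u z u] 
  by (intro pd_eqI) (simp add: mult.commute add.commute)

lemma pd_compose:
  assumes "f \<in> smooth2" "\<And>x. (h has_real_derivative h' x) (at x)"
  shows "pd u (\<lambda>z. h (f z)) z = h' (f z) * pd u f z"
  by (rule pd_eqI) (use DERIV_chain2[of h _ "\<lambda>t::real. f (z + of_real t * u)" 0] assms smooth2_has_pd in auto)

lemma pd_const: "pd u (\<lambda>_. c) z = 0"
  by (rule pd_eqI) auto

lemma laplacian_smooth2: "f \<in> smooth2 \<Longrightarrow> laplacian f \<in> smooth2"
  using smooth2.add[OF pd_smooth2[OF pd_smooth2] pd_smooth2[OF pd_smooth2], of f f 1 1 \<i> \<i>]
  unfolding laplacian_def .

lemma laplacian_mult: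
  assumes "f \<in> smooth2" "g \<in> smooth2"
  shows "laplacian (\<lambda>z. f z * g z) z = laplacian f z * g z
    + 2 * (pd 1 f z * pd 1 g z + pd \<i> f z * pd \<i> g z) + f z * laplacian g z"
proof -
  have "pd u (pd u (\<lambda>z. f z * g z)) z = pd u (pd u f) z * g z + 2 * (pd u f z * pd u g z) + f z * pd u (pd u g) z" for u
  proof -
    have "pd u (\<lambda>z. f z * g z) = (\<lambda>z. pd u f z * g z + f z * pd u g z)"
      by (rule ext) (rule pd_mult[OF assms])
    then show ?thesis
      by (simp add: pd_add pd_mult smooth2.mult pd_smooth2 assms)
  qed
  then show ?thesis by (simp add: laplacian_def algebra_simps)
qed

definition sqdist :: "complex \<Rightarrow> real \<Rightarrow> complex \<Rightarrow> real" where
  "sqdist a \<rho> z = (norm (z - a))\<^sup>2 / \<rho>\<^sup>2"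

lemma sqdist_smooth2: "sqdist a \<rho> \<in> smooth2"
proof -
  have "sqdist a \<rho> = (\<lambda>z. (1/\<rho>\<^sup>2) * ((Re z + (- Re a)) * (Re z + (- Re a)) + (Im z + (- Im a)) * (Im z + (- Im a))))"
    by (rule ext) (simp add: sqdist_def cmod_power2 flip: power2_eq_square)
  also have "\<dots> \<in> smooth2"
    by (intro smooth2.add smooth2.mult smooth2.const smooth2.Re smooth2.Im)
  finally show ?thesis .
qed

lemma pd_sqdist: "pd u (sqdist a \<rho>) z = 2 * ((z - a) \<bullet> u) / \<rho>\<^sup>2"
proof (rule pd_eqI)
  have eq: "(\<lambda>t. sqdist a \<rho> (z + of_real t * u)) = (\<lambda>t. ((Re z + t * Re u - Re a)\<^sup>2 + (Im z + t * Im u - Im a)\<^sup>2) / \<rho>\<^sup>2)"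
    by (auto simp: sqdist_def cmod_power2)
  show "((\<lambda>t. sqdist a \<rho> (z + of_real t * u)) has_real_derivative 2 * ((z - a) \<bullet> u) / \<rho>\<^sup>2) (at 0)"
    unfolding eq inner_complex_def
    by (cases "\<rho> = 0") (auto intro!: derivative_eq_intros simp: field_simps)
qed

lemma pd_inner_affine: "pd u (\<lambda>z. c * ((z - a) \<bullet> w)) z = c * (u \<bullet> w)"
  by (rule pd_eqI) (auto simp: inner_complex_def intro!: derivative_eq_intros simp: algebra_simps)

lemma smooth2_inner_affine: "(\<lambda>z. c * ((z - a) \<bullet> w)) \<in> smooth2"
proof -
  have "(\<lambda>z. c * ((z - a) \<bullet> w)) = (\<lambda>z. c * ((Re z + (- Re a)) * Re w + (Im z + (- Im a)) * Im w))"
    by (auto simp: inner_complex_def algebra_simps)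
  also have "\<dots> \<in> smooth2"
    by (intro smooth2.add smooth2.mult smooth2.const smooth2.Re smooth2.Im)
  finally show ?thesis .
qed

text \<open>For s = |z - a|^2 / \<open>\<rho>\<close>^2 the squared gradient is 4 s /
  \<open>\<rho>\<close>^2 and the Laplacian is 4 / \<open>\<rho>\<close>^2; the chain rule combines
  the two.\<close>

lemma laplacian_sqdist:
  assumes \<rho>: "\<rho> > 0" and h: "\<And>x. (h has_real_derivative h' x) (at x)" "\<And>x. (h' has_real_derivative h'' x) (at x)"
    and sm: "h \<in> smooth1" "h' \<in> smooth1"
  shows "laplacian (\<lambda>z. h (sqdist a \<rho> z)) z = (4 / \<rho>\<^sup>2) * (sqdist a \<rho> z * h'' (sqdist a \<rho> z) + h' (sqdist a \<rho> z))"
proof -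
  have "pd u (pd u (\<lambda>z. h (sqdist a \<rho> z))) z = h'' (sqdist a \<rho> z) * (2 * ((z - a) \<bullet> u) / \<rho>\<^sup>2)\<^sup>2 + h' (sqdist a \<rho> z) * (2/\<rho>\<^sup>2) * (u \<bullet> u)" for u
  proof -
    have "pd u (\<lambda>z. h (sqdist a \<rho> z)) = (\<lambda>z. h' (sqdist a \<rho> z) * ((2/\<rho>\<^sup>2) * ((z - a) \<bullet> u)))"
      by (rule ext) (subst pd_compose[OF sqdist_smooth2 h(1)], simp add: pd_sqdist)
    moreover have "pd u (\<lambda>z. h' (sqdist a \<rho> z) * ((2/\<rho>\<^sup>2) * ((z - a) \<bullet> u))) z
      = pd u (\<lambda>z. h' (sqdist a \<rho> z)) z * ((2/\<rho>\<^sup>2) * ((z - a) \<bullet> u)) + h' (sqdist a \<rho> z) * ((2/\<rho>\<^sup>2) * (u \<bullet> u))"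
      by (subst pd_mult[OF smooth2.compose[OF sm(2) sqdist_smooth2] smooth2_inner_affine]) (simp only: pd_inner_affine)
    moreover have "pd u (\<lambda>z. h' (sqdist a \<rho> z)) z = h'' (sqdist a \<rho> z) * (2 * ((z - a) \<bullet> u) / \<rho>\<^sup>2)"
      by (subst pd_compose[OF sqdist_smooth2 h(2)], simp add: pd_sqdist)
    ultimately show ?thesis by (simp add: power2_eq_square mult.assoc mult.left_commute)
  qed
  then have "laplacian (\<lambda>z. h (sqdist a \<rho> z)) z
      = h'' (sqdist a \<rho> z) * ((2 * ((z - a) \<bullet> 1) / \<rho>\<^sup>2)\<^sup>2 + (2 * ((z - a) \<bullet> \<i>) / \<rho>\<^sup>2)\<^sup>2)
        + h' (sqdist a \<rho> z) * (4 / \<rho>\<^sup>2)"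
    unfolding laplacian_def by (simp add: distrib_left)
  also have "(2 * ((z - a) \<bullet> 1) / \<rho>\<^sup>2)\<^sup>2 + (2 * ((z - a) \<bullet> \<i>) / \<rho>\<^sup>2)\<^sup>2 = 4 / \<rho>\<^sup>2 * sqdist a \<rho> z"
    using \<rho> by (simp add: sqdist_def cmod_power2 inner_complex_def power_divide power_mult_distrib field_simps)
       (simp add: power2_eq_square algebra_simps)
  finally show ?thesis by (simp add: algebra_simps)
qed

text \<open>Differentiating s slog'(s) = step(s)/2 gives s slog'' + slog' = bump/2, which is the
  bracket of the radial Laplacian.\<close>

lemma laplacian_slog_sqdist:
  assumes "\<rho> > 0"
  shows "laplacian (\<lambda>z. slog (sqdist a \<rho> z)) z = (2 / \<rho>\<^sup>2) * bump (sqdist a \<rho> z)"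
proof -
  obtain k where k: "k \<in> smooth1" "\<And>x. (slog' has_real_derivative k x) (at x)"
    using smooth1_deriv[OF slog'_smooth] by blast
  have "((\<lambda>s. s * slog' s) has_real_derivative (s * k s + slog' s)) (at s)" for s
    using DERIV_mult[OF DERIV_ident k(2)[of s]] by (simp add: algebra_simps)
  moreover have "((\<lambda>s. s * slog' s) has_real_derivative bump s / 2) (at s)" for s
    unfolding slog'_eq by (intro DERIV_cdivide step_deriv)
  ultimately have "s * k s + slog' s = bump s / 2" for s
    using DERIV_unique by blast
  from this[of "sqdist a \<rho> z"] show ?thesis
    by (subst laplacian_sqdist[OF assms slog_deriv k(2) slog_smooth slog'_smooth]) simp
qed

subsection \<open>Replacing a measure by zeros of an entire function\<close>

text \<open>The logarithm of the factor 1 - z/w, held above ln \<open>\<rho>\<close>, so that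
  displacing a zero slightly changes it only slightly.\<close>

definition tlog :: "real \<Rightarrow> complex \<Rightarrow> real" where
  "tlog \<rho> t = ln (max (norm (1 - t)) \<rho>)"

lemma tlog_measurable [measurable]: "tlog \<rho> \<in> borel_measurable borel"
  unfolding tlog_def by measurable

lemma tlog_ge_ln: "0 < \<rho> \<Longrightarrow> ln \<rho> \<le> tlog \<rho> t"
  unfolding tlog_def by (intro ln_mono) auto

lemma tlog_le: assumes "0 < \<rho>" "\<rho> \<le> 1" shows "tlog \<rho> t \<le> norm t"
proof -
  have "max (norm (1 - t)) \<rho> \<le> 1 + norm t"
    using norm_triangle_ineq4[of 1 t] assms norm_ge_zero[of t] by (simp del: norm_ge_zero)
  then have "tlog \<rho> t \<le> ln (1 + norm t)"
    unfolding tlog_def using assms by (intro ln_mono) auto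
  also have "\<dots> \<le> norm t" by (rule ln_add_one_self_le_self) simp
  finally show ?thesis .
qed

lemma abs_tlog_le: assumes "0 < \<rho>" "\<rho> \<le> 1" shows "\<bar>tlog \<rho> t\<bar> \<le> norm t + \<bar>ln \<rho>\<bar>"
  using tlog_le[OF assms, of t] tlog_ge_ln[OF assms(1), of t] norm_ge_zero[of t] by linarith

lemma ln_ge_neg_inverse: "0 < \<rho> \<Longrightarrow> - (1/\<rho>) \<le> ln (\<rho>::real)"
  using ln_le_minus_one[of "1/\<rho>"] by (simp add: ln_div)

text \<open>For \<open>s\<close> up to 1/2 the logarithm is at least about -t - 2t^2, so a multiple
  of \<open>s\<close> suffices; for larger \<open>s\<close> the cut-off gives
  -1/\<open>\<rho>\<close>. The minimum covers both ranges and later makes the errors summable over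
  dyadic annuli.\<close>

lemma neg_tlog_le:
  assumes \<rho>: "0 < \<rho>" "\<rho> \<le> 1" and t: "norm t \<le> s"
  shows "- tlog \<rho> t \<le> (2/\<rho>) * min 1 s"
proof -
  have s0: "s \<ge> 0" using t norm_ge_zero[of t] by linarith
  show ?thesis
  proof (cases "s \<le> 1/2")
    case True
    have "1 - norm t \<le> norm (1 - t)" using norm_triangle_ineq2[of 1 t] by simp
    then have "ln (1 - norm t) \<le> tlog \<rho> t"
      unfolding tlog_def using True t by (intro ln_mono) auto
    moreover have "- norm t - 2 * (norm t)\<^sup>2 \<le> ln (1 - norm t)"
      using True t by (intro ln_one_minus_pos_lower_bound) auto
    moreover have "(norm t)\<^sup>2 \<le> (1/2) * norm t"
      using True t mult_right_mono[of "norm t" "1/2" "norm t"] by (simp add: power2_eq_square)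
    ultimately have "- tlog \<rho> t \<le> 2 * s" using t by linarith
    also have "\<dots> \<le> (2/\<rho>) * s"
      using \<rho> s0 by (intro mult_right_mono) (auto simp: field_simps)
    finally show ?thesis using True by simp
  next
    case False
    have "- tlog \<rho> t \<le> 1/\<rho>"
      using tlog_ge_ln[OF \<rho>(1), of t] ln_ge_neg_inverse[OF \<rho>(1)] by linarith
    also have "\<dots> = (2/\<rho>) * (1/2)" by simp
    also have "\<dots> \<le> (2/\<rho>) * min 1 s" using False \<rho> by (intro mult_left_mono) auto
    finally show ?thesis .
  qed
qed

text \<open>Moving the zero from \<open>w\<close> to \<open>a\<close> changes the factor by at most
  2x/n with x = |z|/r. Up to x = 4 this is compared with the cut-off value, at least
  \<open>\<rho>\<close>; beyond that z is far from the annulus and the factor itself is at least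
  x/4.\<close>

lemma tlog_perturb:
  assumes \<rho>: "0 < \<rho>" "\<rho> \<le> 1" and r: "0 < r" and n: "(n::real) \<ge> 1"
    and a: "r \<le> norm a" and w: "r \<le> norm w" "norm w \<le> 2 * r" and d: "norm (a - w) \<le> 2 * r / n"
  shows "norm (1 - z / a) \<le> exp (tlog \<rho> (z / w) + (8 / (n * \<rho>)) * min 1 (norm z / r))"
proof -
  define M where "M = max (norm (1 - z / w)) \<rho>"
  define x where "x = norm z / r"
  have M: "M > 0" "M \<ge> \<rho>" "norm (1 - z/w) \<le> M" using \<rho> by (auto simp: M_def)
  have x0: "x \<ge> 0" using r by (simp add: x_def)
  have a0: "a \<noteq> 0" "w \<noteq> 0" using a w r by auto
  have "norm (z / w - z / a) = norm z * (norm (a - w) / (norm a * norm w))"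
    using a0 by (simp add: norm_divide[symmetric] norm_mult[symmetric] field_simps)
  also have "\<dots> \<le> norm z * ((2 * r / n) / (r * r))"
    using a w r n d by (intro mult_left_mono frac_le mult_mono) auto
  also have "\<dots> = 2 * x / n" using r n by (simp add: x_def field_simps)
  finally have "norm (z / w - z / a) \<le> 2 * x / n" .
  then have le: "norm (1 - z / a) \<le> M + 2 * x / n"
    using norm_triangle_ineq[of "1 - z/w" "z/w - z/a"] M(3) by simp
  have "2 * x / n \<le> M * ((8 / (n * \<rho>)) * min 1 x)"
  proof (cases "x \<le> 4")
    case True
    have "x \<le> 4 * min 1 x" using True x0 by auto
    then have "2 * x / n \<le> 2 * (4 * min 1 x) / n" using n by (intro divide_right_mono mult_left_mono) auto
    also have "\<dots> = \<rho> * ((8 / (n * \<rho>)) * min 1 x)" using \<rho> by (simp add: field_simps)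
    also have "\<dots> \<le> M * ((8 / (n * \<rho>)) * min 1 x)" using M \<rho> n x0 by (intro mult_right_mono) auto
    finally show ?thesis .
  next
    case False
    have "norm z / (2 * r) \<le> norm (z / w)"
      unfolding norm_divide using w r a0 by (intro divide_left_mono) auto
    then have "x / 2 - 1 \<le> norm (1 - z/w)"
      using norm_triangle_ineq3[of "z/w" 1] by (simp add: x_def norm_minus_commute)
    then have Mx: "x / 4 \<le> M" using False M(3) by linarith
    have "2 * x / n = (x / 4) * (8 / n)" by simp
    also have "\<dots> \<le> M * (8 / (n * \<rho>))"
      using Mx M \<rho> n by (intro mult_mono) (auto simp: field_simps mult_left_le)
    finally show ?thesis using False by simp
  qed
  with le have "norm (1 - z / a) \<le> M * (1 + (8 / (n * \<rho>)) * min 1 x)" by (simp add: distrib_left)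
  also have "\<dots> \<le> M * exp ((8 / (n * \<rho>)) * min 1 x)" using M by (intro mult_left_mono exp_ge_add_one_self) auto
  also have "\<dots> = exp (tlog \<rho> (z / w) + (8 / (n * \<rho>)) * min 1 x)"
    using M by (simp add: exp_add tlog_def M_def)
  finally show ?thesis unfolding x_def .
qed

text \<open>Only an upper bound is needed, so all zeros of a cell may sit at one point. The
  displacement estimate averaged over the cell gives the main term. Rounding the mass down drops
  less than one unit, and a unit can lower the potential by at most (2/\<open>\<rho>\<close>) min(1,
  |z|/r).\<close>

lemma cell_quantization:
  fixes p :: "'a \<Rightarrow> complex"
  assumes \<rho>: "0 < \<rho>" "\<rho> \<le> 1" and r: "0 < r" and n: "(n::real) \<ge> 1"
    and Q: "Q \<in> sets \<mu>" "emeasure \<mu> Q < \<infinity>" and [measurable]: "p \<in> borel_measurable \<mu>"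
    and pQ: "\<And>x. x \<in> Q \<Longrightarrow> r \<le> norm (p x) \<and> norm (p x) \<le> 2 * r \<and> norm (a - p x) \<le> 2 * r / n"
    and a: "r \<le> norm a"
  shows "norm (1 - z / a) ^ (nat \<lfloor>measure \<mu> Q\<rfloor>) \<le>
    exp ((LINT x:Q|\<mu>. tlog \<rho> (z / p x)) + (measure \<mu> Q * (8 / (n * \<rho>)) + 2 / \<rho>) * min 1 (norm z / r))"
proof -
  define m where "m = measure \<mu> Q"
  define N where "N = nat \<lfloor>m\<rfloor>"
  define D where "D = min 1 (norm z / r)"
  define I where "I = (LINT x:Q|\<mu>. tlog \<rho> (z / p x))"
  have D0: "D \<ge> 0" using r by (simp add: D_def)
  have m0: "m \<ge> 0" by (simp add: m_def)
  have N: "real N \<le> m" "m < real N + 1" using m0 by (auto simp: N_def)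
  have fin: "emeasure \<mu> Q \<noteq> \<infinity>" using Q(2) by simp
  have int: "set_integrable \<mu> Q (\<lambda>x. tlog \<rho> (z / p x))"
    unfolding set_integrable_def
  proof (rule integrableI_bounded_set[where A = Q and B = "norm z / r + \<bar>ln \<rho>\<bar>"])
    show "AE x in \<mu>. x \<in> Q \<longrightarrow> norm (indicat_real Q x *\<^sub>R tlog \<rho> (z / p x)) \<le> norm z / r + \<bar>ln \<rho>\<bar>"
    proof (rule AE_I2, rule impI)
      fix x assume x: "x \<in> Q"
      have "norm (z / p x) \<le> norm z / r" unfolding norm_divide using pQ[OF x] r by (intro divide_left_mono mult_pos_pos) auto
      then show "norm (indicat_real Q x *\<^sub>R tlog \<rho> (z / p x)) \<le> norm z / r + \<bar>ln \<rho>\<bar>"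
        using x abs_tlog_le[OF \<rho>, of "z / p x"] by simp
    qed
  qed (use Q in \<open>auto simp: less_top[symmetric]\<close>)
  have const: "(LINT x:Q|\<mu>. c) = m * c" for c :: real
    using Q fin by (simp add: set_lebesgue_integral_def m_def)
  have cint: "set_integrable \<mu> Q (\<lambda>_. c)" for c :: real
    unfolding set_integrable_def using Q by simp
  have lower: "- ((2/\<rho>) * D) * m \<le> I"
  proof -
    have "(LINT x:Q|\<mu>. - ((2/\<rho>) * D)) \<le> I"
      unfolding I_def
    proof (rule set_integral_mono[OF cint int])
      fix x assume x: "x \<in> Q"
      have "norm (z / p x) \<le> norm z / r" unfolding norm_divide using pQ[OF x] r by (intro divide_left_mono mult_pos_pos) auto
      from neg_tlog_le[OF \<rho> this] show "- ((2/\<rho>) * D) \<le> tlog \<rho> (z / p x)" by (simp add: D_def)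
    qed
    then show ?thesis unfolding const by (simp add: mult.commute)
  qed
  show ?thesis
  \<comment> \<open>The general argument takes the logarithm of the factor and divides by the mass.
    When no zero is placed, the lower bound on the potential suffices; when the factor vanishes, the
    left side is 0.\<close>
  proof (cases "N = 0 \<or> norm (1 - z / a) = 0")
    case True
    show ?thesis
    proof (cases "N = 0")
      case False
      then have "norm (1 - z / a) ^ N = 0" using True by simp
      then show ?thesis unfolding m_def[symmetric] N_def[symmetric] by (metis exp_ge_zero)
    next
      case True
      have "m * (2 / \<rho> * D) \<le> 1 * (2 / \<rho> * D)" using N True D0 \<rho> by (intro mult_right_mono) auto
      then have "0 \<le> I + 2 / \<rho> * D" using lower by (simp add: mult.commute)
      then have "0 \<le> I + (m * (8 / (n * \<rho>)) + 2 / \<rho>) * D"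
      proof -
        have "0 \<le> m * (8 / (n * \<rho>)) * D" using m0 n \<rho> D0 by simp
        then show ?thesis using \<open>0 \<le> I + 2 / \<rho> * D\<close> by (simp add: distrib_right)
      qed
      then show ?thesis using True unfolding m_def[symmetric] N_def[symmetric] D_def[symmetric] I_def[symmetric] by simp
    qed
  next
    case False
    define l where "l = ln (norm (1 - z / a))"
    have mpos: "m > 0" using False N by linarith
    have "(LINT x:Q|\<mu>. l - (8 / (n * \<rho>)) * D) \<le> I"
      unfolding I_def
    proof (rule set_integral_mono[OF cint int])
      fix x assume x: "x \<in> Q"
      have "norm (1 - z / a) \<le> exp (tlog \<rho> (z / p x) + (8 / (n * \<rho>)) * D)"
        unfolding D_def using pQ[OF x] a by (intro tlog_perturb \<rho> r n) auto
      then have "l \<le> tlog \<rho> (z / p x) + (8 / (n * \<rho>)) * D"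
        unfolding l_def using False by (metis ln_exp ln_mono norm_eq_zero zero_less_norm_iff)
      then show "l - (8 / (n * \<rho>)) * D \<le> tlog \<rho> (z / p x)" by simp
    qed
    then have "m * (l - (8 / (n * \<rho>)) * D) \<le> I" unfolding const .
    then have l: "l \<le> I / m + (8 / (n * \<rho>)) * D"
      using mpos by (simp add: field_simps)
    have "real N * l \<le> real N * (I / m + (8 / (n * \<rho>)) * D)"
      by (intro mult_left_mono l) simp
    also have "\<dots> = real N * (I / m) + real N * ((8 / (n * \<rho>)) * D)" by (simp add: distrib_left)
    also have "real N * ((8 / (n * \<rho>)) * D) \<le> m * ((8 / (n * \<rho>)) * D)"
      using N D0 n \<rho> by (intro mult_right_mono) auto
    \<comment> \<open>\<open>N\<close> zeros carry the share N/m of the potential. The share that is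
      lost, a fraction of one unit, is controlled by the lower bound on \<open>I\<close>.\<close>
    also have "real N * (I / m) = I + (m - real N) * (- I / m)"
      using mpos by (simp add: field_simps)
    also have "(m - real N) * (- I / m) \<le> 1 * ((2/\<rho>) * D)"
    proof -
      have 1: "- I / m \<le> (2/\<rho>) * D" using lower mpos by (simp add: field_simps)
      have "(m - real N) * (- I / m) \<le> (m - real N) * ((2/\<rho>) * D)"
        using N by (intro mult_left_mono 1) auto
      also have "\<dots> \<le> 1 * ((2/\<rho>) * D)" using N D0 \<rho> by (intro mult_right_mono) auto
      finally show ?thesis .
    qed
    finally have "real N * l \<le> I + (m * (8 / (n * \<rho>)) + 2/\<rho>) * D"
      by (simp add: algebra_simps)
    moreover have "norm (1 - z / a) ^ N = exp (real N * l)"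
      using False by (simp add: l_def exp_of_nat_mult)
    ultimately show ?thesis unfolding m_def[symmetric] N_def[symmetric] D_def[symmetric] I_def[symmetric] by simp
  qed
qed

text \<open>The number of zeros in each cell is rounded down, which costs at most one unit of mass per cell.\<close>
lemma annulus_quantization:
  fixes p :: "'a \<Rightarrow> complex" and r :: real and n :: nat
  assumes r: "0 < r" and n: "n \<ge> 1" and [measurable]: "p \<in> borel_measurable \<mu>"
    and fin: "emeasure \<mu> {x \<in> space \<mu>. r \<le> norm (p x) \<and> norm (p x) < 2 * r} < \<infinity>"
    and A_def: "A = {x \<in> space \<mu>. r \<le> norm (p x) \<and> norm (p x) < 2 * r}"
  obtains q where "q holomorphic_on UNIV" "q 0 = 1"
    "\<And>z \<rho>. 0 < \<rho> \<Longrightarrow> \<rho> \<le> 1 \<Longrightarrow> norm (q z) \<le>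
      exp ((LINT x:A|\<mu>. tlog \<rho> (z / p x)) + (8 * measure \<mu> A / n + 50 * real n ^ 2) / \<rho> * min 1 (norm z / r))"
proof -
  have A[measurable]: "A \<in> sets \<mu>" unfolding A_def by measurable
  define cell where "cell = (\<lambda>w::complex. (\<lfloor>real n * Re w / r\<rfloor>, \<lfloor>real n * Im w / r\<rfloor>))"
  define I where "I = {- 2 * int n..2 * int n} \<times> {- 2 * int n..2 * int n}"
  define Q where "Q = (\<lambda>i. {x \<in> A. \<lfloor>real n * Re (p x) / r\<rfloor> = fst i \<and> \<lfloor>real n * Im (p x) / r\<rfloor> = snd i})"
  have Qm[measurable]: "Q i \<in> sets \<mu>" for i
    unfolding Q_def by measurable
  have finI: "finite I" by (simp add: I_def)
  \<comment> \<open>Each cell costs 2/\<open>\<rho>\<close> for rounding, so 25 n^2 cells account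
    for the term 50 n^2 / \<open>\<rho>\<close>.\<close>
  have cardI: "real (card I) \<le> 25 * real n ^ 2"
  proof -
    have "card I = (4 * n + 1)^2"
      by (simp add: I_def card_cartesian_product power2_eq_square nat_add_distrib nat_mult_distrib)
    also have "\<dots> \<le> (5 * n)^2" using n by (intro power_mono) auto
    finally have "card I \<le> (5 * n)^2" .
    then have "real (card I) \<le> real ((5 * n)^2)" by (rule of_nat_mono)
    then show ?thesis by (simp add: power_mult_distrib)
  qed
  have fl: "\<lfloor>real n * t / r\<rfloor> \<in> {- 2 * int n..2 * int n}" if "\<bar>t\<bar> \<le> 2 * r" for t
  proof -
    have "\<bar>real n * t / r\<bar> = real n * (\<bar>t\<bar> / r)" using r by (simp add: abs_mult)
    also have "\<dots> \<le> real n * 2" using that r by (intro mult_left_mono) (auto simp: field_simps)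
    finally have "\<bar>real n * t / r\<bar> \<le> 2 * real n" by simp
    then have "- 2 * real n \<le> real n * t / r" "real n * t / r \<le> 2 * real n" by (simp_all only: abs_le_iff) linarith+
    then have "- 2 * int n \<le> \<lfloor>real n * t / r\<rfloor>" "\<lfloor>real n * t / r\<rfloor> \<le> 2 * int n"
      by (auto simp: le_floor_iff floor_le_iff)
    then show ?thesis by simp
  qed
  have UQ: "A = (\<Union>i\<in>I. Q i)"
  proof
    show "A \<subseteq> (\<Union>i\<in>I. Q i)"
    proof
      fix x assume x: "x \<in> A"
      then have "\<bar>Re (p x)\<bar> \<le> 2 * r" "\<bar>Im (p x)\<bar> \<le> 2 * r"
        using abs_Re_le_cmod[of "p x"] abs_Im_le_cmod[of "p x"] by (auto simp: A_def)
      then have "cell (p x) \<in> I" using fl by (auto simp: cell_def I_def)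
      moreover have "x \<in> Q (cell (p x))" using x by (simp add: Q_def cell_def)
      ultimately show "x \<in> (\<Union>i\<in>I. Q i)" by blast
    qed
  qed (auto simp: Q_def)
  have disj: "disjoint_family_on Q I"
    by (auto simp: disjoint_family_on_def Q_def prod_eq_iff)
  \<comment> \<open>The representative is a value of \<open>p\<close> inside the cell, not a corner,
    so its modulus is at least \<open>r\<close>. An empty cell gets \<open>r\<close> itself, with
    exponent 0.\<close>
  define a where "a = (\<lambda>i. if Q i = {} then of_real r else p (SOME x. x \<in> Q i))"
  have aQ: "\<exists>y\<in>Q i. a i = p y" if "Q i \<noteq> {}" for i
    using that someI_ex[of "\<lambda>x. x \<in> Q i"] by (auto simp: a_def)
  have ar: "r \<le> norm (a i)" for i
  proof (cases "Q i = {}")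
    case False
    then obtain y where "y \<in> Q i" "a i = p y" using aQ by blast
    then show ?thesis by (simp add: Q_def A_def)
  qed (use r in \<open>simp add: a_def\<close>)
  have close: "norm (a i - p x) \<le> 2 * r / n" if xQ: "x \<in> Q i" for i x
  proof -
    have near: "\<bar>s - t\<bar> \<le> r / n" if "\<lfloor>real n * s / r\<rfloor> = \<lfloor>real n * t / r\<rfloor>" for s t
    proof -
      have "\<bar>real n * s / r - real n * t / r\<bar> \<le> 1" using that by linarith
      moreover have "real n * s / r - real n * t / r = (real n / r) * (s - t)"
        by (simp add: diff_divide_distrib right_diff_distrib)
      ultimately have "(real n / r) * \<bar>s - t\<bar> \<le> 1" using r by (simp add: abs_mult)
      then show ?thesis using r n by (simp add: field_simps)
    qed
    obtain y where y: "y \<in> Q i" "a i = p y" using aQ xQ by blast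
    have "norm (a i - p x) \<le> \<bar>Re (p y) - Re (p x)\<bar> + \<bar>Im (p y) - Im (p x)\<bar>"
      using cmod_le[of "p y - p x"] y by simp
    also have "\<dots> \<le> r / n + r / n" using xQ y by (intro add_mono near) (auto simp: Q_def)
    finally show ?thesis by simp
  qed
  define q where "q = (\<lambda>z. \<Prod>i\<in>I. (1 - z / a i) ^ nat \<lfloor>measure \<mu> (Q i)\<rfloor>)"
  have Qfin: "emeasure \<mu> (Q i) < \<infinity>" for i
    using fin unfolding A_def[symmetric] by (rule le_less_trans[rotated]) (rule emeasure_mono, auto simp: Q_def)
  show thesis
  proof (rule that[of q])
    show "q holomorphic_on UNIV" unfolding q_def using ar r
      by (intro holomorphic_intros) (metis less_le_trans norm_zero not_less order_refl)
    show "q 0 = 1" by (simp add: q_def)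
    fix z :: complex and \<rho> :: real
    assume \<rho>: "0 < \<rho>" "\<rho> \<le> 1"
    define D where "D = min 1 (norm z / r)"
    have D0: "D \<ge> 0" using r by (simp add: D_def)
    define J where "J = (\<lambda>B. LINT x:B|\<mu>. tlog \<rho> (z / p x))"
    have intA: "set_integrable \<mu> A (\<lambda>x. tlog \<rho> (z / p x))"
      unfolding set_integrable_def
    proof (rule integrableI_bounded_set[where A = A and B = "norm z / r + \<bar>ln \<rho>\<bar>"])
      show "AE x in \<mu>. x \<in> A \<longrightarrow> norm (indicat_real A x *\<^sub>R tlog \<rho> (z / p x)) \<le> norm z / r + \<bar>ln \<rho>\<bar>"
      proof (rule AE_I2, rule impI)
        fix x assume x: "x \<in> A"
        have "norm (z / p x) \<le> norm z / r" unfolding norm_divide using x r by (intro divide_left_mono mult_pos_pos) (auto simp: A_def)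
        then show "norm (indicat_real A x *\<^sub>R tlog \<rho> (z / p x)) \<le> norm z / r + \<bar>ln \<rho>\<bar>"
          using x abs_tlog_le[OF \<rho>, of "z / p x"] by simp
      qed
    qed (use A fin A_def in \<open>auto simp: less_top[symmetric]\<close>)
    have "norm (q z) = (\<Prod>i\<in>I. norm (1 - z / a i) ^ nat \<lfloor>measure \<mu> (Q i)\<rfloor>)"
      by (simp add: q_def prod_norm[symmetric] norm_power)
    also have "\<dots> \<le> (\<Prod>i\<in>I. exp (J (Q i) + (measure \<mu> (Q i) * (8 / (real n * \<rho>)) + 2 / \<rho>) * D))"
    proof (rule prod_mono, rule conjI)
      fix i assume "i \<in> I"
      show "norm (1 - z / a i) ^ nat \<lfloor>measure \<mu> (Q i)\<rfloor> \<le> exp (J (Q i) + (measure \<mu> (Q i) * (8 / (real n * \<rho>)) + 2 / \<rho>) * D)"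
        unfolding J_def D_def
        by (rule cell_quantization[OF \<rho> r])
           (use n Qfin ar close in \<open>auto simp: Q_def A_def\<close>)
    qed simp
    also have "\<dots> = exp (\<Sum>i\<in>I. J (Q i) + (measure \<mu> (Q i) * (8 / (real n * \<rho>)) + 2 / \<rho>) * D)"
      by (simp add: exp_sum finI)
    also have "(\<Sum>i\<in>I. J (Q i) + (measure \<mu> (Q i) * (8 / (real n * \<rho>)) + 2 / \<rho>) * D)
        = (\<Sum>i\<in>I. J (Q i)) + ((\<Sum>i\<in>I. measure \<mu> (Q i)) * (8 / (real n * \<rho>)) + real (card I) * (2 / \<rho>)) * D"
      by (simp add: sum.distrib sum_distrib_right distrib_right sum_divide_distrib)
    also have "(\<Sum>i\<in>I. J (Q i)) = J A"
      unfolding UQ J_def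
      by (rule set_integral_finite_Union[symmetric])
         (use finI disj Qm in \<open>auto intro!: set_integrable_subset[OF intA] simp: Q_def\<close>)
    also have "(\<Sum>i\<in>I. measure \<mu> (Q i)) = measure \<mu> A"
      unfolding UQ using finI disj Qfin
      by (intro measure_finite_Union[symmetric]) (auto simp: less_top[symmetric] image_subset_iff)
    finally have *: "norm (q z) \<le> exp (J A + (measure \<mu> A * (8 / (real n * \<rho>)) + real (card I) * (2 / \<rho>)) * D)" .
    have "(measure \<mu> A * (8 / (real n * \<rho>)) + real (card I) * (2 / \<rho>)) \<le> measure \<mu> A * (8 / (real n * \<rho>)) + 25 * real n ^ 2 * (2/\<rho>)"
      using cardI \<rho> by (intro add_left_mono mult_right_mono) auto
    also have "\<dots> = (8 * measure \<mu> A / n + 50 * real n ^ 2) / \<rho>"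
      using \<rho> n by (simp add: field_simps)
    finally have "(measure \<mu> A * (8 / (real n * \<rho>)) + real (card I) * (2 / \<rho>)) * D \<le> (8 * measure \<mu> A / n + 50 * real n ^ 2) / \<rho> * D"
      using D0 by (rule mult_right_mono)
    with * show "norm (q z) \<le> exp ((LINT x:A|\<mu>. tlog \<rho> (z / p x)) + (8 * measure \<mu> A / n + 50 * real n ^ 2) / \<rho> * min 1 (norm z / r))"
      unfolding J_def D_def by (meson add_left_mono exp_le_cancel_iff order_trans)
  qed
qed

subsection \<open>Radial integrals in the plane\<close>

lemma nn_integral_translate:
  fixes f :: "complex \<Rightarrow> ennreal"
  assumes [measurable]: "f \<in> borel_measurable borel"
  shows "(\<integral>\<^sup>+x. f (a + x) \<partial>lborel) = (\<integral>\<^sup>+x. f x \<partial>lborel)"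
proof -
  have "(\<integral>\<^sup>+x. f x \<partial>lborel) = (\<integral>\<^sup>+x. f x \<partial>distr lborel borel ((+) a))"
    by (simp add: lborel_distr_plus)
  also have "\<dots> = (\<integral>\<^sup>+x. f (a + x) \<partial>lborel)"
    by (subst nn_integral_distr) simp_all
  finally show ?thesis ..
qed

lemma emeasure_ball_complex: "r \<ge> 0 \<Longrightarrow> emeasure lborel (ball (z::complex) r) = ennreal (pi * r\<^sup>2)"
  and emeasure_cball_complex: "r \<ge> 0 \<Longrightarrow> emeasure lborel (cball (z::complex) r) = ennreal (pi * r\<^sup>2)"
  by (simp_all add: emeasure_ball emeasure_cball unit_ball_vol_2)

text \<open>Uniqueness of Haar measure, in the special case at hand: a rotation-invariant
  test function determines the constant.\<close>
lemma nn_integral_rotate: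
  fixes f :: "complex \<Rightarrow> ennreal"
  assumes [measurable]: "f \<in> borel_measurable borel" and c: "norm c = 1"
  shows "(\<integral>\<^sup>+x. f (c * x) \<partial>lborel) = (\<integral>\<^sup>+x. f x \<partial>lborel)"
proof -
  define g :: "complex \<Rightarrow> ennreal" where "g = indicator (ball 0 1)"
  have [measurable]: "g \<in> borel_measurable borel" unfolding g_def by (intro borel_measurable_indicator) simp
  have gc: "g (c * y) = g y" for y using c by (simp add: g_def indicator_def norm_mult)
  have gm: "g (a - b) = g (b - a)" for a b by (simp add: g_def indicator_def norm_minus_commute)
  have c0: "c \<noteq> 0" using c by auto
  \<comment> \<open>The double integral of f(x) g(cy) is rearranged by translations and exchange of
    integrals until the rotation sits on \<open>f\<close>; rotation invariance and evenness of
    \<open>g\<close> do the rest, and the mass \<pi> of \<open>g\<close> is cancelled at the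
    end.\<close>
  have "(\<integral>\<^sup>+x. f x \<partial>lborel) * (\<integral>\<^sup>+y. g y \<partial>lborel) = (\<integral>\<^sup>+y. (\<integral>\<^sup>+x. f x * g (c * y) \<partial>lborel) \<partial>lborel)"
    by (simp add: gc nn_integral_multc nn_integral_cmult)
  also have "\<dots> = (\<integral>\<^sup>+y. (\<integral>\<^sup>+x. f (c * y + x) * g (c * y) \<partial>lborel) \<partial>lborel)"
    by (rule nn_integral_cong) (simp add: nn_integral_multc nn_integral_translate)
  also have "\<dots> = (\<integral>\<^sup>+x. (\<integral>\<^sup>+y. f (c * y + x) * g (c * y) \<partial>lborel) \<partial>lborel)"
    by (rule lborel_pair.Fubini') measurable
  also have "\<dots> = (\<integral>\<^sup>+x. (\<integral>\<^sup>+y. f (c * y) * g (c * y - x) \<partial>lborel) \<partial>lborel)"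
  proof (rule nn_integral_cong)
    fix x
    have "(\<integral>\<^sup>+y. f (c * y) * g (c * y - x) \<partial>lborel) = (\<integral>\<^sup>+y. f (c * (x / c + y)) * g (c * (x / c + y) - x) \<partial>lborel)"
      by (rule nn_integral_translate[symmetric, where f = "\<lambda>y. f (c * y) * g (c * y - x)"]) measurable
    also have "\<dots> = (\<integral>\<^sup>+y. f (c * y + x) * g (c * y) \<partial>lborel)"
      using c0 by (simp add: distrib_left add.commute)
    finally show "(\<integral>\<^sup>+y. f (c * y + x) * g (c * y) \<partial>lborel) = (\<integral>\<^sup>+y. f (c * y) * g (c * y - x) \<partial>lborel)" ..
  qed
  also have "\<dots> = (\<integral>\<^sup>+y. (\<integral>\<^sup>+x. f (c * y) * g (c * y - x) \<partial>lborel) \<partial>lborel)"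
    by (rule lborel_pair.Fubini') measurable
  also have "\<dots> = (\<integral>\<^sup>+y. f (c * y) * (\<integral>\<^sup>+x. g x \<partial>lborel) \<partial>lborel)"
  proof (rule nn_integral_cong)
    fix y
    have "(\<integral>\<^sup>+x. g (c * y - x) \<partial>lborel) = (\<integral>\<^sup>+x. g (- (c * y) + x) \<partial>lborel)" by (simp add: gm[of "c*y"])
    also have "\<dots> = (\<integral>\<^sup>+x. g x \<partial>lborel)" by (rule nn_integral_translate) measurable
    finally show "(\<integral>\<^sup>+x. f (c * y) * g (c * y - x) \<partial>lborel) = f (c * y) * (\<integral>\<^sup>+x. g x \<partial>lborel)"
      by (simp add: nn_integral_cmult)
  qed
  also have "\<dots> = (\<integral>\<^sup>+y. f (c * y) \<partial>lborel) * (\<integral>\<^sup>+x. g x \<partial>lborel)" by (simp add: nn_integral_multc)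
  finally have "(\<integral>\<^sup>+x. f x \<partial>lborel) * ennreal pi = (\<integral>\<^sup>+y. f (c * y) \<partial>lborel) * ennreal pi"
    by (simp add: g_def emeasure_ball_complex)
  then show ?thesis
    by (simp add: mult.commute[of _ "ennreal pi"] ennreal_mult_cancel_left)
qed

lemma nn_integral_periodic_shift:
  fixes f :: "real \<Rightarrow> ennreal"
  assumes [measurable]: "f \<in> borel_measurable borel" and per: "\<And>x. f (x + p) = f x" and a: "0 \<le> a" "a \<le> p"
  shows "(\<integral>\<^sup>+x. f (a + x) * indicator {0..p} x \<partial>lborel) = (\<integral>\<^sup>+x. f x * indicator {0..p} x \<partial>lborel)"
proof -
  have tr: "(\<integral>\<^sup>+x. h (t + x) \<partial>lborel) = (\<integral>\<^sup>+x. h x \<partial>lborel)" if [measurable]: "h \<in> borel_measurable borel" for h :: "real \<Rightarrow> ennreal" and t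
    using nn_integral_real_affine[of h 1 t] by simp
  have "(\<integral>\<^sup>+x. f (a + x) * indicator {0..p} x \<partial>lborel) = (\<integral>\<^sup>+x. f (a + x) * indicator {a..a + p} (a + x) \<partial>lborel)"
    by (rule nn_integral_cong) (auto simp: indicator_def)
  also have "\<dots> = (\<integral>\<^sup>+x. f x * indicator {a..a + p} x \<partial>lborel)"
    by (rule tr) measurable
  also have "\<dots> = (\<integral>\<^sup>+x. f x * indicator {a..<p} x + f x * indicator {p..a+p} x \<partial>lborel)"
    using a by (intro nn_integral_cong) (auto simp: indicator_def)
  also have "\<dots> = (\<integral>\<^sup>+x. f x * indicator {a..<p} x \<partial>lborel) + (\<integral>\<^sup>+x. f x * indicator {p..a+p} x \<partial>lborel)"
    by (rule nn_integral_add) measurable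
  also have "(\<integral>\<^sup>+x. f x * indicator {p..a+p} x \<partial>lborel) = (\<integral>\<^sup>+x. f (p + x) * indicator {p..a+p} (p + x) \<partial>lborel)"
    by (rule tr[symmetric]) measurable
  also have "\<dots> = (\<integral>\<^sup>+x. f x * indicator {0..<a} x \<partial>lborel)"
  proof (rule nn_integral_cong_AE)
    have "AE x in lborel. x \<noteq> a" by (rule AE_lborel_singleton)
    then show "AE x in lborel. f (p + x) * indicator {p..a+p} (p + x) = f x * indicator {0..<a} x"
      by eventually_elim (use per in \<open>auto simp: indicator_def add.commute\<close>)
  qed
  also have "(\<integral>\<^sup>+x. f x * indicator {a..<p} x \<partial>lborel) + (\<integral>\<^sup>+x. f x * indicator {0..<a} x \<partial>lborel)
      = (\<integral>\<^sup>+x. f x * indicator {a..<p} x + f x * indicator {0..<a} x \<partial>lborel)"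
    by (rule nn_integral_add[symmetric]) measurable
  also have "\<dots> = (\<integral>\<^sup>+x. f x * indicator {0..p} x \<partial>lborel)"
  proof (rule nn_integral_cong_AE)
    have "AE x in lborel. x \<noteq> p" by (rule AE_lborel_singleton)
    then show "AE x in lborel. f x * indicator {a..<p} x + f x * indicator {0..<a} x = f x * indicator {0..p} x"
      by eventually_elim (use a in \<open>auto simp: indicator_def\<close>)
  qed
  finally show ?thesis .
qed

lemma cball_measurable [measurable]: "cball (z::complex) r \<in> sets borel"
  by simp

lemma cis_measurable [measurable]: "cis \<in> borel_measurable borel"
  by (intro borel_measurable_continuous_onI continuous_intros)

text \<open>Rotating \<zeta> leaves the planar integral unchanged. Integrating this over all angles
  and exchanging the integrals turns \<open>u\<close> into its circle integrals, while the radial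
  variable remains |\<zeta>| in the plane.\<close>

lemma nn_integral_circle_average:
  fixes u :: "complex \<Rightarrow> ennreal" and k :: "real \<Rightarrow> ennreal"
  assumes [measurable]: "u \<in> borel_measurable borel" "k \<in> borel_measurable borel"
  shows "ennreal (2 * pi) * (\<integral>\<^sup>+\<zeta>. u (z + \<zeta>) * k (norm \<zeta>) \<partial>lborel) =
    (\<integral>\<^sup>+\<zeta>. (\<integral>\<^sup>+\<theta>. u (z + of_real (norm (\<zeta>::complex)) * cis \<theta>) * indicator {0..2*pi} \<theta> \<partial>lborel) * k (norm \<zeta>) \<partial>lborel)"
proof -
  let ?I = "\<integral>\<^sup>+\<zeta>. u (z + \<zeta>) * k (norm \<zeta>) \<partial>lborel"
  have "(\<integral>\<^sup>+\<zeta>. u (z + cis \<theta> * \<zeta>) * k (norm \<zeta>) \<partial>lborel) = ?I" for \<theta>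
  proof -
    have "(\<integral>\<^sup>+\<zeta>. u (z + cis \<theta> * \<zeta>) * k (norm \<zeta>) \<partial>lborel) = (\<integral>\<^sup>+\<zeta>. u (z + cis \<theta> * \<zeta>) * k (norm (cis \<theta> * \<zeta>)) \<partial>lborel)"
      by (simp add: norm_mult)
    also have "\<dots> = ?I"
      by (rule nn_integral_rotate[where f = "\<lambda>\<zeta>. u (z + \<zeta>) * k (norm \<zeta>)"]) auto
    finally show ?thesis .
  qed
  then have "(\<integral>\<^sup>+\<theta>. (\<integral>\<^sup>+\<zeta>. u (z + cis \<theta> * \<zeta>) * k (norm \<zeta>) \<partial>lborel) * indicator {0..2*pi} \<theta> \<partial>lborel)
      = (\<integral>\<^sup>+\<theta>. ?I * indicator {0..2*pi} \<theta> \<partial>lborel)"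
    by (simp only:)
  also have "\<dots> = ?I * emeasure lborel {0..2*pi}"
    by (rule nn_integral_cmult_indicator) simp
  finally have "ennreal (2 * pi) * ?I = (\<integral>\<^sup>+\<theta>. (\<integral>\<^sup>+\<zeta>. u (z + cis \<theta> * \<zeta>) * k (norm \<zeta>) \<partial>lborel) * indicator {0..2*pi} \<theta> \<partial>lborel)"
    by (simp add: mult.commute)
  also have "\<dots> = (\<integral>\<^sup>+\<theta>. (\<integral>\<^sup>+\<zeta>. (u (z + cis \<theta> * \<zeta>) * indicator {0..2*pi} \<theta>) * k (norm \<zeta>) \<partial>lborel) \<partial>lborel)"
    by (subst nn_integral_multc[symmetric]) (auto intro!: nn_integral_cong simp: mult_ac)
  also have "\<dots> = (\<integral>\<^sup>+\<zeta>. (\<integral>\<^sup>+\<theta>. (u (z + cis \<theta> * \<zeta>) * indicator {0..2*pi} \<theta>) * k (norm \<zeta>) \<partial>lborel) \<partial>lborel)"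
    by (rule lborel_pair.Fubini') measurable
  also have "\<dots> = (\<integral>\<^sup>+\<zeta>. (\<integral>\<^sup>+\<theta>. u (z + cis \<theta> * \<zeta>) * indicator {0..2*pi} \<theta> \<partial>lborel) * k (norm \<zeta>) \<partial>lborel)"
    by (intro nn_integral_cong nn_integral_multc) measurable
  also have "\<dots> = (\<integral>\<^sup>+\<zeta>. (\<integral>\<^sup>+\<theta>. u (z + of_real (norm (\<zeta>::complex)) * cis \<theta>) * indicator {0..2*pi} \<theta> \<partial>lborel) * k (norm \<zeta>) \<partial>lborel)"
  proof (rule nn_integral_cong)
    fix \<zeta> :: complex
    \<comment> \<open>The integral over rotations depends on \<zeta> only through its modulus, since
      the argument is a shift of a periodic integrand.\<close>
    define \<alpha> where "\<alpha> = Arg2pi \<zeta>"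
    have \<zeta>: "\<zeta> = of_real (norm \<zeta>) * cis \<alpha>"
      using Arg2pi_eq[of \<zeta>] by (simp add: \<alpha>_def cis_conv_exp)
    have \<alpha>: "0 \<le> \<alpha>" "\<alpha> \<le> 2 * pi"
      using Arg2pi_ge_0[of \<zeta>] Arg2pi_lt_2pi[of \<zeta>] by (auto simp: \<alpha>_def)
    have per: "cis (x + 2 * pi) = cis x" for x by (simp add: cis_mult[symmetric])
    have "(\<integral>\<^sup>+\<theta>. u (z + cis \<theta> * \<zeta>) * indicator {0..2*pi} \<theta> \<partial>lborel) =
        (\<integral>\<^sup>+\<theta>. u (z + of_real (norm \<zeta>) * cis (\<alpha> + \<theta>)) * indicator {0..2*pi} \<theta> \<partial>lborel)"
      by (subst (1) \<zeta>) (simp add: cis_mult[symmetric] mult_ac)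
    also have "\<dots> = (\<integral>\<^sup>+\<theta>. u (z + of_real (norm \<zeta>) * cis \<theta>) * indicator {0..2*pi} \<theta> \<partial>lborel)"
      by (rule nn_integral_periodic_shift[where f = "\<lambda>\<theta>. u (z + of_real (norm \<zeta>) * cis \<theta>)"]) (use \<alpha> per in auto)
    finally show "(\<integral>\<^sup>+\<theta>. u (z + cis \<theta> * \<zeta>) * indicator {0..2*pi} \<theta> \<partial>lborel) * k (norm \<zeta>) =
      (\<integral>\<^sup>+\<theta>. u (z + of_real (norm \<zeta>) * cis \<theta>) * indicator {0..2*pi} \<theta> \<partial>lborel) * k (norm \<zeta>)" by simp
  qed
  finally show ?thesis .
qed

text \<open>The image of planar measure under |\<zeta>|^2 is \<pi> times length, because the disc of
  squared radius s has area \<pi> s. The minus sign in the proof makes the sets to be compared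
  discs, which have finite area.\<close>

lemma nn_integral_radial:
  fixes g :: "real \<Rightarrow> ennreal"
  assumes [measurable]: "g \<in> borel_measurable borel"
  shows "(\<integral>\<^sup>+\<zeta>. g ((norm (\<zeta>::complex))\<^sup>2) \<partial>lborel) = ennreal pi * (\<integral>\<^sup>+s. g s * indicator {0..} s \<partial>lborel)"
proof -
  let ?M = "distr lborel borel (\<lambda>\<zeta>::complex. - (norm \<zeta>)\<^sup>2)"
  let ?N = "density lborel (\<lambda>t::real. ennreal pi * indicator {..0} t)"
  have M: "emeasure ?M {x<..} = ennreal (pi * max 0 (- x))" for x
  proof -
    have "(\<lambda>\<zeta>::complex. - (norm \<zeta>)\<^sup>2) -` {x<..} = ball 0 (sqrt (max 0 (-x)))"
    proof (cases "x \<ge> 0")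
      case True
      then show ?thesis by (auto simp: max_def) (smt (verit) zero_le_power2)
    next
      case False
      then show ?thesis by (auto simp: max_def real_less_rsqrt) (metis less_minus_iff norm_ge_zero real_less_lsqrt real_sqrt_abs abs_norm_cancel real_sqrt_less_iff real_sqrt_less_mono)
    qed
    then show ?thesis
      by (simp add: emeasure_distr emeasure_ball_complex)
  qed
  have N: "emeasure ?N {x<..} = ennreal (pi * max 0 (- x))" for x
  proof -
    have "emeasure ?N {x<..} = (\<integral>\<^sup>+t. ennreal pi * indicator {x<..0} t \<partial>lborel)"
      by (simp add: emeasure_density) (intro nn_integral_cong, auto simp: indicator_def)
    also have "\<dots> = ennreal pi * emeasure lborel {x<..0}" by (simp add: nn_integral_cmult)
    also have "\<dots> = ennreal (pi * max 0 (- x))"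
      by (cases "x \<le> 0") (auto simp: ennreal_mult[symmetric] max_def)
    finally show ?thesis .
  qed
  have "?M = ?N" by (rule measure_eqI_lessThan) (simp_all only: M N, auto)
  have "(\<integral>\<^sup>+\<zeta>. g ((norm (\<zeta>::complex))\<^sup>2) \<partial>lborel) = (\<integral>\<^sup>+t. g (- t) \<partial>?M)"
    by (subst nn_integral_distr) auto
  also have "\<dots> = (\<integral>\<^sup>+t. g (- t) \<partial>?N)" by (simp only: \<open>?M = ?N\<close>)
  also have "\<dots> = (\<integral>\<^sup>+t. ennreal pi * (g (- t) * indicator {0..} (- t)) \<partial>lborel)"
    by (subst nn_integral_density) (auto intro!: nn_integral_cong simp: indicator_def)
  also have "\<dots> = ennreal pi * (\<integral>\<^sup>+t. g (- t) * indicator {0..} (- t) \<partial>lborel)"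
    by (rule nn_integral_cmult) measurable
  also have "(\<integral>\<^sup>+t. g (- t) * indicator {0..} (- t) \<partial>lborel) = (\<integral>\<^sup>+t. g t * indicator {0..} t \<partial>lborel)"
    using nn_integral_real_affine[of "\<lambda>t. g t * indicator {0..} t" "-1" 0] by simp
  finally show ?thesis .
qed

lemma bump_measurable [measurable]: "bump \<in> borel_measurable borel"
  by (intro borel_measurable_continuous_onI smooth1_continuous_on bump_smooth)

text \<open>In the variable |\<zeta>|^2 the bump is the derivative of a step that rises from 0 to 1.
  This value is the normalising constant of the smoothing below.\<close>

lemma nn_integral_bump:
  assumes \<rho>: "\<rho> > 0"
  shows "(\<integral>\<^sup>+\<zeta>. ennreal (bump ((norm (\<zeta>::complex))\<^sup>2 / \<rho>\<^sup>2)) \<partial>lborel) = ennreal (pi * \<rho>\<^sup>2)"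
proof -
  have "(\<integral>\<^sup>+\<zeta>. ennreal (bump ((norm (\<zeta>::complex))\<^sup>2 / \<rho>\<^sup>2)) \<partial>lborel)
      = ennreal pi * (\<integral>\<^sup>+s. ennreal (bump (s / \<rho>\<^sup>2)) * indicator {0..} s \<partial>lborel)"
    by (rule nn_integral_radial) measurable
  also have "(\<integral>\<^sup>+s. ennreal (bump (s / \<rho>\<^sup>2)) * indicator {0..} s \<partial>lborel) = \<rho>\<^sup>2 - \<rho>\<^sup>2 * step (0 / \<rho>\<^sup>2)"
  proof (rule nn_integral_FTC_atLeast)
    show "((\<lambda>s. \<rho>\<^sup>2 * step (s / \<rho>\<^sup>2)) has_real_derivative bump (x / \<rho>\<^sup>2)) (at x)" for x
    proof -
      have "((\<lambda>s. s / \<rho>\<^sup>2) has_real_derivative 1 / \<rho>\<^sup>2) (at x)" by (rule DERIV_cdivide[OF DERIV_ident])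
      from DERIV_cmult[OF DERIV_chain2[OF step_deriv this], of "\<rho>\<^sup>2"] show ?thesis using \<rho> by simp
    qed
    have "eventually (\<lambda>s. \<rho>\<^sup>2 * step (s / \<rho>\<^sup>2) = \<rho>\<^sup>2) at_top"
      using eventually_ge_at_top[of "\<rho>\<^sup>2"] by eventually_elim (use \<rho> in \<open>simp add: step_eq_1\<close>)
    then show "((\<lambda>s. \<rho>\<^sup>2 * step (s / \<rho>\<^sup>2)) \<longlongrightarrow> \<rho>\<^sup>2) at_top" by (rule tendsto_eventually)
  qed (simp_all add: bump_nonneg)
  finally show ?thesis by (simp add: step_eq_0 ennreal_mult[symmetric])
qed


subsection \<open>Averages of subharmonic functions\<close>

lemma usc_open_less: assumes "usc v" shows "open {z. v z < a}"
proof (subst open_subopen, rule ballI)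
  fix z assume "z \<in> {z. v z < a}"
  then have "eventually (\<lambda>w. v w < a) (nhds z)"
    using assms by (auto simp: usc_def eventually_nhds_conv_at)
  then show "\<exists>T. open T \<and> z \<in> T \<and> T \<subseteq> {z. v z < a}"
    by (auto simp: eventually_nhds)
qed

lemma usc_measurable: assumes "usc v" shows "v \<in> borel_measurable borel"
  by (rule borel_measurableI_less) (use usc_open_less[OF assms] in auto)

lemma usc_bounded_above:
  assumes "usc v" "\<And>z. v z \<noteq> \<infinity>" "compact K"
  obtains M :: real where "M \<ge> 0" "\<And>z. z \<in> K \<Longrightarrow> v z \<le> ereal M"
proof -
  have "\<exists>n::nat. v z < ereal n" for z
    using assms(2)[of z] by (cases "v z") (auto intro: reals_Archimedean2)
  then have "K \<subseteq> (\<Union>n::nat. {z. v z < ereal n})" by auto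
  then obtain C where C: "C \<subseteq> UNIV" "finite C" "K \<subseteq> (\<Union>n\<in>C. {z. v z < ereal (real n)})"
    using compactE_image[OF assms(3), of UNIV "\<lambda>n::nat. {z. v z < ereal n}"] usc_open_less[OF assms(1)] by metis
  show thesis
  proof (rule that[of "real (Max (insert 0 C))"])
    fix z assume "z \<in> K"
    then obtain n where "n \<in> C" "v z < ereal (real n)" using C by auto
    moreover have "n \<le> Max (insert 0 C)" using \<open>n \<in> C\<close> C by (intro Max_ge) auto
    ultimately show "v z \<le> ereal (real (Max (insert 0 C)))"
      by (meson ereal_less_eq(3) less_imp_le of_nat_mono order_trans)
  qed simp
qed

text \<open>With \<open>v\<close> bounded above on the circle, the difference of two integrals
  becomes a constant minus a single nonnegative integral, possibly infinite. Averaging over radii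
  can then be done entirely with nonnegative integrals.\<close>

lemma circle_integral_complement:
  assumes [measurable]: "v \<in> borel_measurable borel" and M: "M \<ge> 0"
    and le: "\<And>\<theta>. v (z + of_real r * cis \<theta>) \<le> ereal M"
  shows "circle_integral v z r = ereal (2 * pi * M)
    - enn2ereal (\<integral>\<^sup>+ \<theta>. e2ennreal (ereal M - v (z + of_real r * cis \<theta>)) * indicator {0..2*pi} \<theta> \<partial>lborel)"
proof -
  define P where "P = (\<integral>\<^sup>+ \<theta>. e2ennreal (v (z + of_real r * cis \<theta>)) * indicator {0..2*pi} \<theta> \<partial>lborel)"
  define N where "N = (\<integral>\<^sup>+ \<theta>. e2ennreal (- v (z + of_real r * cis \<theta>)) * indicator {0..2*pi} \<theta> \<partial>lborel)"
  define U where "U = (\<integral>\<^sup>+ \<theta>. e2ennreal (ereal M - v (z + of_real r * cis \<theta>)) * indicator {0..2*pi} \<theta> \<partial>lborel)"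
  \<comment> \<open>This is (M - x) + x^+ = M + x^-, also valid for x = -\<infinity>, where both
    sides are infinite.\<close>
  have pt: "e2ennreal (ereal M - x) + e2ennreal x = ennreal M + e2ennreal (- x)" if "x \<le> ereal M" for x
  proof (cases x)
    case (real t)
    then show ?thesis
      using that M by (cases "t \<ge> 0") (auto simp: e2ennreal_ereal ennreal_neg ennreal_plus[symmetric] simp del: ennreal_plus)
  next
    case MInf
    then show ?thesis by (simp add: e2ennreal_infty e2ennreal_neg)
  qed (use that in auto)
  have PM: "P \<le> ennreal (2 * pi * M)"
  proof -
    have "P \<le> (\<integral>\<^sup>+ \<theta>. ennreal M * indicator {0..2*pi} \<theta> \<partial>lborel)"
      unfolding P_def
    proof (intro nn_integral_mono mult_right_mono)
      fix \<theta>
      show "e2ennreal (v (z + of_real r * cis \<theta>)) \<le> ennreal M"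
        using e2ennreal_mono[OF le[of \<theta>]] by (simp add: e2ennreal_ereal)
    qed simp
    also have "\<dots> = ennreal (2 * pi * M)" using M by (simp add: nn_integral_cmult_indicator ennreal_mult[symmetric] mult.commute)
    finally show ?thesis .
  qed
  have "U + P = (\<integral>\<^sup>+ \<theta>. ennreal M * indicator {0..2*pi} \<theta> + e2ennreal (- v (z + of_real r * cis \<theta>)) * indicator {0..2*pi} \<theta> \<partial>lborel)"
    unfolding U_def P_def
    by (subst nn_integral_add[symmetric]) (auto intro!: nn_integral_cong simp: pt[OF le] simp flip: distrib_right)
  also have "\<dots> = ennreal (2 * pi * M) + N"
    unfolding N_def using M
    by (subst nn_integral_add) (auto simp: nn_integral_cmult_indicator ennreal_mult[symmetric] mult.commute)
  finally have UP: "U + P = ennreal (2 * pi * M) + N" .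
  have "enn2ereal P - enn2ereal N = ereal (2 * pi * M) - enn2ereal U"
  proof (cases U)
    case top
    then have "ennreal (2 * pi * M) + N = top" using UP by simp
    then have "N = top" by simp
    moreover obtain p where "P = ennreal p" "p \<ge> 0" using PM by (cases P) (auto simp: top_unique)
    ultimately show ?thesis using top by simp
  next
    case (real u)
    obtain p where p: "P = ennreal p" "p \<ge> 0" using PM by (cases P) (auto simp: top_unique)
    obtain n where n: "N = ennreal n" "n \<ge> 0"
      using UP real p M by (cases N) (auto simp: ennreal_plus[symmetric] simp del: ennreal_plus)
    have "u + p = 2 * pi * M + n"
      using UP real p n M by (simp add: ennreal_plus[symmetric] del: ennreal_plus)
    then show ?thesis using real p n by simp
  qed
  then show ?thesis unfolding circle_integral_def P_def N_def U_def .
qed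

section \<open>Local integrability and smoothing of a subharmonic function\<close>

locale subharmonic_fun =
  fixes v :: "complex \<Rightarrow> ereal"
  assumes sh: "subharmonic v" and nontriv: "\<exists>z. v z \<noteq> - \<infinity>"
begin

lemma not_PInf: "v z \<noteq> \<infinity>" and usc: "usc v"
  and submean: "r > 0 \<Longrightarrow> v z \<le> circle_integral v z r / ereal (2*pi)"
  using sh by (auto simp: subharmonic_def)

lemma measurable_v [measurable]: "v \<in> borel_measurable borel"
  by (rule usc_measurable[OF usc])

lemma bounded_above:
  obtains M :: real where "M \<ge> 0" "\<And>\<zeta>. \<zeta> \<in> cball z R \<Longrightarrow> v \<zeta> \<le> ereal M"
  using usc_bounded_above[OF usc not_PInf, of "cball z R"] compact_cball by metis

text \<open>The sub-mean inequality, turned round by passing to M - v; when \<open>v z\<close> is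
  -\<infinity> the right side is infinite.\<close>

lemma circle_complement_le:
  assumes r: "r > 0" and M: "M \<ge> 0" and le: "\<And>\<zeta>. \<zeta> \<in> cball z r \<Longrightarrow> v \<zeta> \<le> ereal M"
  shows "(\<integral>\<^sup>+ \<theta>. e2ennreal (ereal M - v (z + of_real r * cis \<theta>)) * indicator {0..2*pi} \<theta> \<partial>lborel)
    \<le> ennreal (2 * pi) * e2ennreal (ereal M - v z)" (is "?U \<le> _")
proof (cases "v z")
  case (real x)
  have "v z \<le> (ereal (2 * pi * M) - enn2ereal ?U) / ereal (2 * pi)"
    using submean[OF r, of z] r M
    by (subst (asm) circle_integral_complement[where M = M]) (auto intro!: le simp: dist_norm norm_mult)
  then have *: "ereal x \<le> (ereal (2 * pi * M) - enn2ereal ?U) / ereal (2 * pi)" by (simp only: real)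
  show ?thesis
  proof (cases ?U)
    case top
    then show ?thesis using * by (simp add: divide_ereal_def)
  next
    case (real u)
    then have "x \<le> (2 * pi * M - u) / (2 * pi)" using * by simp
    then have "u \<le> 2 * pi * (M - x)" by (simp add: field_simps)
    moreover have "x \<le> M" using le[of z] \<open>v z = ereal x\<close> r by simp
    ultimately show ?thesis
      using real \<open>v z = ereal x\<close> by (simp add: e2ennreal_ereal ennreal_mult[symmetric])
  qed
next
  case MInf
  then show ?thesis by (simp add: e2ennreal_infty ennreal_mult_top)
qed (use not_PInf in auto)

text \<open>The inequality on circles, integrated against a radial weight that vanishes beyond the
  radius up to which the bound \<open>M\<close> is known.\<close>

lemma complement_average_le:
  assumes M: "M \<ge> 0" and le: "\<And>\<zeta>. \<zeta> \<in> cball z R \<Longrightarrow> v \<zeta> \<le> ereal M"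
    and [measurable]: "k \<in> borel_measurable borel" and k: "\<And>r. r > R \<Longrightarrow> k r = 0"
  shows "(\<integral>\<^sup>+\<zeta>. e2ennreal (ereal M - v (z + \<zeta>)) * k (norm \<zeta>) \<partial>lborel)
    \<le> e2ennreal (ereal M - v z) * (\<integral>\<^sup>+\<zeta>. k (norm (\<zeta>::complex)) \<partial>lborel)" (is "?I \<le> _")
proof -
  let ?C = "\<lambda>r. \<integral>\<^sup>+\<theta>. e2ennreal (ereal M - v (z + of_real r * cis \<theta>)) * indicator {0..2*pi} \<theta> \<partial>lborel"
  have "ennreal (2 * pi) * ?I = (\<integral>\<^sup>+\<zeta>. ?C (norm (\<zeta>::complex)) * k (norm \<zeta>) \<partial>lborel)"
    by (rule nn_integral_circle_average) measurable
  also have "\<dots> \<le> (\<integral>\<^sup>+\<zeta>. ennreal (2 * pi) * e2ennreal (ereal M - v z) * k (norm (\<zeta>::complex)) \<partial>lborel)"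
  proof (rule nn_integral_mono_AE)
    have "AE \<zeta> in lborel. \<zeta> \<noteq> (0::complex)" by (rule AE_lborel_singleton)
    then show "AE \<zeta> in lborel. ?C (norm (\<zeta>::complex)) * k (norm \<zeta>) \<le> ennreal (2 * pi) * e2ennreal (ereal M - v z) * k (norm \<zeta>)"
    proof eventually_elim
      fix \<zeta> :: complex assume "\<zeta> \<noteq> 0"
      show "?C (norm \<zeta>) * k (norm \<zeta>) \<le> ennreal (2 * pi) * e2ennreal (ereal M - v z) * k (norm \<zeta>)"
      proof (cases "norm \<zeta> \<le> R")
        case True
        then show ?thesis using \<open>\<zeta> \<noteq> 0\<close> M by (intro mult_right_mono circle_complement_le le) auto
      qed (simp add: k)
    qed
  qed
  also have "\<dots> = ennreal (2 * pi) * (e2ennreal (ereal M - v z) * (\<integral>\<^sup>+\<zeta>. k (norm (\<zeta>::complex)) \<partial>lborel))"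
    by (simp add: nn_integral_cmult mult.assoc)
  finally show ?thesis
    using pi_gt_zero by (subst (asm) ennreal_mult_le_mult_iff) (auto simp: ennreal_mult_le_mult_iff)
qed

abbreviation "rv \<equiv> \<lambda>z. real_of_ereal (v z)"

text \<open>A point \<open>z0\<close> at which \<open>v\<close> is finite bounds the integral of M -
  v over any disc about it; that disc is taken large enough to contain the one about 0.\<close>

lemma complement_finite:
  obtains M where "M \<ge> 0" "\<And>\<zeta>. \<zeta> \<in> cball 0 R \<Longrightarrow> v \<zeta> \<le> ereal M"
    "(\<integral>\<^sup>+\<zeta>. e2ennreal (ereal M - v \<zeta>) * indicator (cball 0 R) \<zeta> \<partial>lborel) < \<infinity>"
proof -
  obtain z0 where z0: "v z0 \<noteq> - \<infinity>" using nontriv by blast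
  obtain x where x: "v z0 = ereal x" using z0 not_PInf[of z0] by (cases "v z0") auto
  define S where "S = \<bar>R\<bar> + norm z0"
  have sub: "cball 0 R \<subseteq> cball z0 S"
  proof
    fix w :: complex assume "w \<in> cball 0 R"
    then have "norm w \<le> \<bar>R\<bar>" by simp
    then show "w \<in> cball z0 S" using norm_triangle_ineq4[of z0 w] by (simp add: S_def dist_norm)
  qed
  obtain M where M: "M \<ge> 0" "\<And>\<zeta>. \<zeta> \<in> cball z0 S \<Longrightarrow> v \<zeta> \<le> ereal M"
    using bounded_above[of z0 S] by blast
  have "(\<integral>\<^sup>+\<zeta>. e2ennreal (ereal M - v \<zeta>) * indicator (cball 0 R) \<zeta> \<partial>lborel)
      \<le> (\<integral>\<^sup>+\<zeta>. e2ennreal (ereal M - v \<zeta>) * indicator (cball z0 S) \<zeta> \<partial>lborel)"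
    using sub by (intro nn_integral_mono mult_left_mono) (auto simp: indicator_def)
  also have "\<dots> = (\<integral>\<^sup>+\<zeta>. e2ennreal (ereal M - v (z0 + \<zeta>)) * indicator (cball z0 S) (z0 + \<zeta>) \<partial>lborel)"
    by (rule nn_integral_translate[symmetric]) measurable
  also have "\<dots> = (\<integral>\<^sup>+\<zeta>. e2ennreal (ereal M - v (z0 + \<zeta>)) * indicator {..S} (norm \<zeta>) \<partial>lborel)"
    by (intro nn_integral_cong) (auto simp: indicator_def dist_norm)
  also have "\<dots> \<le> e2ennreal (ereal M - v z0) * (\<integral>\<^sup>+\<zeta>. indicator {..S} (norm (\<zeta>::complex)) \<partial>lborel)"
    using M by (intro complement_average_le[where R = S]) auto
  also have "(\<integral>\<^sup>+\<zeta>. indicator {..S} (norm (\<zeta>::complex)) \<partial>lborel) = (\<integral>\<^sup>+\<zeta>. indicator (cball 0 S) (\<zeta>::complex) \<partial>lborel)"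
    by (intro nn_integral_cong) (auto simp: indicator_def)
  also have "\<dots> = ennreal (pi * S\<^sup>2)" by (simp add: emeasure_cball_complex S_def)
  finally have "(\<integral>\<^sup>+\<zeta>. e2ennreal (ereal M - v \<zeta>) * indicator (cball 0 R) \<zeta> \<partial>lborel) < \<infinity>"
    by (rule le_less_trans) (simp add: x e2ennreal_ereal ennreal_mult_less_top)
  with M sub show thesis by (intro that[of M]) auto
qed

text \<open>A finite integral of M - v forces \<open>v\<close> to be finite almost everywhere, so
  replacing -\<infinity> by the default real value 0 does not affect integrals.\<close>

lemma rv_local:
  shows rv_integrable: "set_integrable lborel (cball 0 R) rv"
    and rv_AE: "AE \<zeta> in lborel. \<zeta> \<in> cball 0 R \<longrightarrow> v \<zeta> = ereal (rv \<zeta>)"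
proof -
  obtain M where M: "M \<ge> 0" "\<And>\<zeta>. \<zeta> \<in> cball 0 R \<Longrightarrow> v \<zeta> \<le> ereal M"
    "(\<integral>\<^sup>+\<zeta>. e2ennreal (ereal M - v \<zeta>) * indicator (cball 0 R) \<zeta> \<partial>lborel) < \<infinity>"
    using complement_finite[of R] by blast
  have "AE \<zeta> in lborel. e2ennreal (ereal M - v \<zeta>) * indicator (cball 0 R) \<zeta> \<noteq> \<infinity>"
    using M(3) by (intro nn_integral_PInf_AE) auto
  then show "AE \<zeta> in lborel. \<zeta> \<in> cball 0 R \<longrightarrow> v \<zeta> = ereal (rv \<zeta>)"
  proof eventually_elim
    case (elim \<zeta>)
    then show ?case using not_PInf[of \<zeta>] by (cases "v \<zeta>") (auto simp: e2ennreal_infty)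
  qed
  show "set_integrable lborel (cball 0 R) rv"
    unfolding set_integrable_def
  proof (rule integrableI_bounded)
    have "(\<integral>\<^sup>+\<zeta>. ennreal (norm (indicat_real (cball 0 R) \<zeta> *\<^sub>R rv \<zeta>)) \<partial>lborel)
      \<le> (\<integral>\<^sup>+\<zeta>. ennreal M * indicator (cball 0 R) \<zeta> + e2ennreal (ereal M - v \<zeta>) * indicator (cball 0 R) \<zeta> \<partial>lborel)"
    proof (rule nn_integral_mono)
      fix \<zeta> :: complex
      have "ennreal \<bar>rv \<zeta>\<bar> \<le> ennreal M + e2ennreal (ereal M - v \<zeta>)" if "\<zeta> \<in> cball 0 R"
      proof (cases "v \<zeta>")
        case (real x)
        then have "x \<le> M" using M(2)[OF that] by simp
        then show ?thesis using real M(1) by (auto simp: e2ennreal_ereal ennreal_plus[symmetric] simp del: ennreal_plus)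
      qed (use not_PInf in auto)
      then show "ennreal (norm (indicat_real (cball 0 R) \<zeta> *\<^sub>R rv \<zeta>)) \<le> ennreal M * indicator (cball 0 R) \<zeta> + e2ennreal (ereal M - v \<zeta>) * indicator (cball 0 R) \<zeta>"
        by (auto simp: indicator_def)
    qed
    also have "\<dots> < \<infinity>"
    proof -
      have "ennreal M * emeasure lborel (cball (0::complex) R) < \<infinity>"
        using emeasure_lborel_cball_finite[of "0::complex" R] by (simp add: ennreal_mult_less_top)
      then show ?thesis using M by (subst nn_integral_add) (auto simp: nn_integral_cmult_indicator)
    qed
    finally show "(\<integral>\<^sup>+\<zeta>. ennreal (norm (indicat_real (cball 0 R) \<zeta> *\<^sub>R rv \<zeta>)) \<partial>lborel) < \<infinity>" .
  qed measurable
qed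

lemma integrable_rv_mult:
  assumes [measurable]: "f \<in> borel_measurable borel" and f: "\<And>\<zeta>. norm \<zeta> > R \<Longrightarrow> f \<zeta> = 0" "\<And>\<zeta>. norm (f \<zeta>) \<le> B"
  shows "integrable lborel (\<lambda>\<zeta>. rv \<zeta> *\<^sub>R (f \<zeta> :: 'b :: {banach, second_countable_topology}))"
proof (rule Bochner_Integration.integrable_bound)
  have "integrable lborel (\<lambda>\<zeta>. indicat_real (cball 0 R) \<zeta> *\<^sub>R rv \<zeta>)"
    using rv_integrable[of R] by (simp add: set_integrable_def)
  then show "integrable lborel (\<lambda>\<zeta>. B * (indicat_real (cball 0 R) \<zeta> *\<^sub>R rv \<zeta>))" by simp
  show "AE \<zeta> in lborel. norm (rv \<zeta> *\<^sub>R f \<zeta>) \<le> norm (B * (indicat_real (cball 0 R) \<zeta> *\<^sub>R rv \<zeta>))"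
  proof (rule AE_I2)
    fix \<zeta> :: complex
    have "B \<ge> 0" using f(2)[of \<zeta>] norm_ge_zero order_trans by blast
    moreover have "norm (f \<zeta>) * \<bar>rv \<zeta>\<bar> \<le> B * \<bar>rv \<zeta>\<bar>"
      by (rule mult_right_mono[OF f(2)]) (rule abs_ge_zero)
    ultimately show "norm (rv \<zeta> *\<^sub>R f \<zeta>) \<le> norm (B * (indicat_real (cball 0 R) \<zeta> *\<^sub>R rv \<zeta>))"
      using f(1)[of \<zeta>]
      by (cases "norm \<zeta> > R") (auto simp: indicator_def abs_mult mult.commute)
  qed
qed measurable

text \<open>A weighted mean over the annulus between \<open>\<rho>\<close>/2 and
  \<open>\<rho>\<close>. Its kernel is 1/(2 \<pi>) times the Laplacian of the smoothed logarithm
  \<open>slogd z \<rho>\<close>, which is how the Riesz identity will produce it.\<close>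

definition vsm :: "real \<Rightarrow> complex \<Rightarrow> real" where
  "vsm \<rho> z = (\<integral>\<zeta>. rv \<zeta> * bump ((norm (\<zeta> - z))\<^sup>2 / \<rho>\<^sup>2) \<partial>lborel) / (pi * \<rho>\<^sup>2)"

lemma bump_bounded: obtains B where "B > 0" "\<And>s. bump s \<le> B"
proof -
  have "compact (bump ` {0..1})"
    by (intro compact_continuous_image smooth1_continuous_on bump_smooth) simp
  then obtain B where B: "\<And>x. x \<in> bump ` {0..1} \<Longrightarrow> norm x \<le> B"
    using compact_imp_bounded bounded_iff by metis
  show thesis
  proof (rule that[of "max B 1"])
    show "bump s \<le> max B 1" for s
      using B[of "bump s"] bump_eq_0[of s] by (cases "s \<in> {0..1}") auto
  qed simp
qed

lemma bump_sqdist_eq_0: fixes \<zeta> z :: complex assumes "\<rho> > 0" "norm (\<zeta> - z) > \<rho>" shows "bump ((norm (\<zeta> - z))\<^sup>2 / \<rho>\<^sup>2) = 0"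
proof -
  have "\<rho>\<^sup>2 < (norm (\<zeta> - z))\<^sup>2" using assms by (intro power_strict_mono) auto
  then show ?thesis using assms by (intro bump_eq_0) simp
qed

lemma integrable_rv_bump:
  assumes "\<rho> > 0" shows "integrable lborel (\<lambda>\<zeta>. rv \<zeta> * bump ((norm (\<zeta> - z))\<^sup>2 / \<rho>\<^sup>2))"
proof -
  obtain B where B: "B > 0" "\<And>s. bump s \<le> B" using bump_bounded by blast
  have "integrable lborel (\<lambda>\<zeta>. rv \<zeta> *\<^sub>R bump ((norm (\<zeta> - z))\<^sup>2 / \<rho>\<^sup>2))"
  proof (rule integrable_rv_mult[where R = "norm z + \<rho>" and B = B])
    fix \<zeta> :: complex assume "norm \<zeta> > norm z + \<rho>"
    then have "norm (\<zeta> - z) > \<rho>" using norm_triangle_ineq2[of \<zeta> z] by simp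
    then show "bump ((norm (\<zeta> - z))\<^sup>2 / \<rho>\<^sup>2) = 0" by (rule bump_sqdist_eq_0[OF assms])
  qed (use B bump_nonneg in auto)
  then show ?thesis by simp
qed

text \<open>The complement of \<open>v\<close> below a bound \<open>M\<close> on a disc is what the nonnegative integrals see.\<close>
lemma vsm_complement:
  assumes \<rho>: "\<rho> > 0" and M: "M \<ge> 0" and le: "\<And>\<zeta>. \<zeta> \<in> cball z \<rho> \<Longrightarrow> v \<zeta> \<le> ereal M"
  shows "(\<integral>\<^sup>+\<zeta>. e2ennreal (ereal M - v (z + \<zeta>)) * ennreal (bump ((norm \<zeta>)\<^sup>2 / \<rho>\<^sup>2)) \<partial>lborel)
    = ennreal (pi * \<rho>\<^sup>2 * (M - vsm \<rho> z))" and "vsm \<rho> z \<le> M"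
proof -
  let ?b = "\<lambda>\<zeta>. bump ((norm (\<zeta> - z))\<^sup>2 / \<rho>\<^sup>2)"
  have nnb: "(\<integral>\<^sup>+\<zeta>. ennreal (?b \<zeta>) \<partial>lborel) = ennreal (pi * \<rho>\<^sup>2)"
    using nn_integral_bump[OF \<rho>] nn_integral_translate[of "\<lambda>\<zeta>. ennreal (?b \<zeta>)" z] by simp
  have ib: "integrable lborel ?b"
    by (rule integrableI_nonneg) (use nnb bump_nonneg in auto)
  have Lb: "(\<integral>\<zeta>. ?b \<zeta> \<partial>lborel) = pi * \<rho>\<^sup>2"
    using nnb nn_integral_eq_integral[OF ib] bump_nonneg by (simp add: integral_nonneg_AE)
  have ii: "integrable lborel (\<lambda>\<zeta>. (M - rv \<zeta>) * ?b \<zeta>)"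
    using ib integrable_rv_bump[OF \<rho>, of z] by (simp add: left_diff_distrib)
  have ae: "AE \<zeta> in lborel. e2ennreal (ereal M - v \<zeta>) * ennreal (?b \<zeta>) = ennreal ((M - rv \<zeta>) * ?b \<zeta>) \<and> (M - rv \<zeta>) * ?b \<zeta> \<ge> 0"
    using rv_AE[of "norm z + \<rho>"]
  proof eventually_elim
    case (elim \<zeta>)
    show ?case
    proof (cases "norm (\<zeta> - z) > \<rho>")
      case True
      then show ?thesis by (simp add: bump_sqdist_eq_0[OF \<rho>])
    next
      case False
      then have "v \<zeta> = ereal (rv \<zeta>)" using elim norm_triangle_ineq2[of \<zeta> z] by simp
      moreover have "v \<zeta> \<le> ereal M" using le[of \<zeta>] False by (simp add: dist_norm norm_minus_commute)
      ultimately obtain x where "v \<zeta> = ereal x" "x \<le> M" by (metis ereal_less_eq(3))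
      then show ?thesis using bump_nonneg by (simp add: e2ennreal_ereal ennreal_mult[symmetric])
    qed
  qed
  have val: "(\<integral>\<zeta>. (M - rv \<zeta>) * ?b \<zeta> \<partial>lborel) = pi * \<rho>\<^sup>2 * (M - vsm \<rho> z)"
    using ib integrable_rv_bump[OF \<rho>, of z] \<rho> by (simp add: left_diff_distrib Lb vsm_def field_simps)
  have "(\<integral>\<^sup>+\<zeta>. e2ennreal (ereal M - v (z + \<zeta>)) * ennreal (bump ((norm \<zeta>)\<^sup>2 / \<rho>\<^sup>2)) \<partial>lborel)
      = (\<integral>\<^sup>+\<zeta>. e2ennreal (ereal M - v \<zeta>) * ennreal (?b \<zeta>) \<partial>lborel)"
    using nn_integral_translate[of "\<lambda>\<zeta>. e2ennreal (ereal M - v \<zeta>) * ennreal (?b \<zeta>)" z] by simp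
  also have "\<dots> = (\<integral>\<^sup>+\<zeta>. ennreal ((M - rv \<zeta>) * ?b \<zeta>) \<partial>lborel)"
    by (rule nn_integral_cong_AE) (use ae in auto)
  also have "\<dots> = ennreal (\<integral>\<zeta>. (M - rv \<zeta>) * ?b \<zeta> \<partial>lborel)"
    by (rule nn_integral_eq_integral[OF ii]) (use ae in auto)
  finally show "(\<integral>\<^sup>+\<zeta>. e2ennreal (ereal M - v (z + \<zeta>)) * ennreal (bump ((norm \<zeta>)\<^sup>2 / \<rho>\<^sup>2)) \<partial>lborel)
    = ennreal (pi * \<rho>\<^sup>2 * (M - vsm \<rho> z))" unfolding val .
  have "0 \<le> (\<integral>\<zeta>. (M - rv \<zeta>) * ?b \<zeta> \<partial>lborel)"
    by (rule integral_nonneg_AE) (use ae in auto)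
  then show "vsm \<rho> z \<le> M" using mult_pos_pos[OF pi_gt_zero zero_less_power[OF \<rho>, of 2]] by (auto simp: val zero_le_mult_iff)
qed

text \<open>The weight is radial with total mass one, so the sub-mean inequality survives averaging
  over the circles. It allows \<open>v\<close> to be replaced by its smoothing in every upper
  bound.\<close>

lemma v_le_vsm: assumes \<rho>: "\<rho> > 0" shows "v z \<le> ereal (vsm \<rho> z)"
proof (cases "v z")
  case (real x)
  obtain M where M: "M \<ge> 0" "\<And>\<zeta>. \<zeta> \<in> cball z \<rho> \<Longrightarrow> v \<zeta> \<le> ereal M" using bounded_above[of z \<rho>] by blast
  have xM: "x \<le> M" using M(2)[of z] real \<rho> by simp
  have "ennreal (pi * \<rho>\<^sup>2 * (M - vsm \<rho> z)) = (\<integral>\<^sup>+\<zeta>. e2ennreal (ereal M - v (z + \<zeta>)) * ennreal (bump ((norm \<zeta>)\<^sup>2 / \<rho>\<^sup>2)) \<partial>lborel)"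
    by (rule vsm_complement(1)[symmetric, OF \<rho> M])
  also have "\<dots> \<le> e2ennreal (ereal M - v z) * (\<integral>\<^sup>+\<zeta>. ennreal (bump ((norm (\<zeta>::complex))\<^sup>2 / \<rho>\<^sup>2)) \<partial>lborel)"
  proof (rule complement_average_le[OF M, where k = "\<lambda>r. ennreal (bump (r\<^sup>2 / \<rho>\<^sup>2))"])
    show "ennreal (bump (r\<^sup>2 / \<rho>\<^sup>2)) = 0" if "r > \<rho>" for r
      using \<rho> bump_sqdist_eq_0[of \<rho> "of_real r" 0] that by simp
  qed simp_all
  also have "\<dots> = ennreal (pi * \<rho>\<^sup>2 * (M - x))"
    using real xM by (simp add: nn_integral_bump[OF \<rho>] e2ennreal_ereal ennreal_mult[symmetric] mult.commute)
  finally have "pi * \<rho>\<^sup>2 * (M - vsm \<rho> z) \<le> pi * \<rho>\<^sup>2 * (M - x)" using xM \<rho> by (simp add: ennreal_le_iff)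
  then show ?thesis using real \<rho> by simp
qed (use not_PInf in auto)

text \<open>The weight lives on radii from \<open>\<rho>\<close>/2 to \<open>\<rho>\<close>, so a
  bound on those circle integrals passes to the mean. If \<open>c\<close> exceeds the upper bound
  \<open>M\<close> of \<open>v\<close>, there is nothing to compare.\<close>

lemma vsm_le_circle_bound:
  assumes \<rho>: "\<rho> > 0" and c: "\<And>r. \<rho> / 2 \<le> r \<Longrightarrow> r \<le> \<rho> \<Longrightarrow> circle_integral v z r \<le> ereal (2 * pi * c)"
  shows "vsm \<rho> z \<le> c"
proof -
  obtain M where M: "M \<ge> 0" "\<And>\<zeta>. \<zeta> \<in> cball z \<rho> \<Longrightarrow> v \<zeta> \<le> ereal M" using bounded_above[of z \<rho>] by blast
  show ?thesis
  proof (cases "c \<le> M")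
    case False
    then show ?thesis using vsm_complement(2)[of \<rho> M z, OF \<rho> M] by simp
  next
    case True
  let ?C = "\<lambda>r. \<integral>\<^sup>+\<theta>. e2ennreal (ereal M - v (z + of_real r * cis \<theta>)) * indicator {0..2*pi} \<theta> \<partial>lborel"
  let ?k = "\<lambda>r. ennreal (bump (r\<^sup>2 / \<rho>\<^sup>2))"
  have C: "ennreal (2 * pi * (M - c)) \<le> ?C r" if "\<rho> / 2 \<le> r" "r \<le> \<rho>" for r
  proof -
    have r0: "r > 0" using that \<rho> by simp
    have "ereal (2 * pi * M) - enn2ereal (?C r) \<le> ereal (2 * pi * c)"
      using c[OF that] r0 M that
      by (subst (asm) circle_integral_complement[where M = M]) (auto intro!: M(2) simp: dist_norm norm_mult)
    then show ?thesis
      by (cases "?C r") (auto simp: algebra_simps ennreal_leI)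
  qed
  have "ennreal (2 * pi * (M - c)) * ennreal (pi * \<rho>\<^sup>2) = (\<integral>\<^sup>+\<zeta>. ennreal (2 * pi * (M - c)) * ?k (norm (\<zeta>::complex)) \<partial>lborel)"
    by (simp add: nn_integral_cmult nn_integral_bump[OF \<rho>])
  also have "\<dots> \<le> (\<integral>\<^sup>+\<zeta>. ?C (norm (\<zeta>::complex)) * ?k (norm \<zeta>) \<partial>lborel)"
  proof (rule nn_integral_mono)
    fix \<zeta> :: complex
    show "ennreal (2 * pi * (M - c)) * ?k (norm \<zeta>) \<le> ?C (norm \<zeta>) * ?k (norm \<zeta>)"
    proof (cases "\<rho> / 2 \<le> norm \<zeta> \<and> norm \<zeta> \<le> \<rho>")
      case True
      then show ?thesis by (intro mult_right_mono C) auto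
    next
      case False
      have "bump ((norm \<zeta>)\<^sup>2 / \<rho>\<^sup>2) = 0"
      proof (rule bump_eq_0)
        have "(norm \<zeta>)\<^sup>2 < (\<rho>/2)\<^sup>2 \<or> (norm \<zeta>)\<^sup>2 > \<rho>\<^sup>2"
          using False \<rho> by (auto intro!: power_strict_mono simp: not_le)
        then show "(norm \<zeta>)\<^sup>2 / \<rho>\<^sup>2 < 1 / 4 \<or> 1 < (norm \<zeta>)\<^sup>2 / \<rho>\<^sup>2" using \<rho> by (simp add: power_divide field_simps)
      qed
      then show ?thesis by simp
    qed
  qed
  also have "\<dots> = ennreal (2 * pi) * (\<integral>\<^sup>+\<zeta>. e2ennreal (ereal M - v (z + \<zeta>)) * ?k (norm \<zeta>) \<partial>lborel)"
    by (rule nn_integral_circle_average[symmetric]) measurable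
  also have "\<dots> = ennreal (2 * pi * (pi * \<rho>\<^sup>2 * (M - vsm \<rho> z)))"
    using vsm_complement(2)[of \<rho> M z, OF \<rho> M] by (simp only: vsm_complement(1)[of \<rho> M z, OF \<rho> M]) (simp add: ennreal_mult[symmetric])
  finally have "2 * pi * (M - c) * (pi * \<rho>\<^sup>2) \<le> 2 * pi * (pi * \<rho>\<^sup>2 * (M - vsm \<rho> z))"
    using True vsm_complement(2)[of \<rho> M z, OF \<rho> M] by (simp add: ennreal_mult[symmetric] ennreal_le_iff)
  then show ?thesis using \<rho> by simp
  qed
qed

end

lemma ball_measurable [measurable]: "ball (z::complex) r \<in> sets borel"
  by simp

subsection \<open>A smoothed Riesz representation\<close>

text \<open>A smooth substitute for log|\<zeta> - z|, exact from distance \<open>\<rho>\<close> on;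
  the summand ln \<open>\<rho>\<close> undoes the scaling of the argument.\<close>

definition slogd :: "complex \<Rightarrow> real \<Rightarrow> complex \<Rightarrow> real" where
  "slogd z \<rho> \<zeta> = slog (sqdist z \<rho> \<zeta>) + ln \<rho>"

text \<open>Scaling by 2R places the transition between the radii R and 2R.\<close>

definition cutoff :: "real \<Rightarrow> complex \<Rightarrow> real" where
  "cutoff R \<zeta> = 1 + (-1) * step (sqdist 0 (2 * R) \<zeta>)"

lemma slogd_smooth2: "slogd z \<rho> \<in> smooth2"
  unfolding slogd_def[abs_def] by (rule smooth2.add[OF smooth2.compose[OF slog_smooth sqdist_smooth2] smooth2.const])

lemma cutoff_smooth2: "cutoff R \<in> smooth2"
  unfolding cutoff_def[abs_def] by (rule smooth2.add[OF smooth2.const smooth2.mult[OF smooth2.const smooth2.compose[OF step_smooth sqdist_smooth2]]])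

lemma sqdist_ge_1: "\<rho> > 0 \<Longrightarrow> \<rho> \<le> norm (\<zeta> - z) \<Longrightarrow> 1 \<le> sqdist z \<rho> \<zeta>"
  unfolding sqdist_def using power_mono[of \<rho> "norm (\<zeta> - z)" 2] by simp

lemma sqdist_le_1: "\<rho> > 0 \<Longrightarrow> norm (\<zeta> - z) \<le> \<rho> \<Longrightarrow> sqdist z \<rho> \<zeta> \<le> 1"
  unfolding sqdist_def using power_mono[of "norm (\<zeta> - z)" \<rho> 2] by simp

lemma slogd_eq_ln:
  assumes "\<rho> > 0" "\<rho> \<le> norm (\<zeta> - z)" shows "slogd z \<rho> \<zeta> = ln (norm (\<zeta> - z))"
proof -
  have "norm (\<zeta> - z) > 0" by (rule less_le_trans[OF assms])
  then have "ln (sqdist z \<rho> \<zeta>) = 2 * ln (norm (\<zeta> - z)) - 2 * ln \<rho>"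
    using assms by (simp add: sqdist_def ln_div ln_realpow)
  then show ?thesis by (simp add: slogd_def slog_eq_ln[OF sqdist_ge_1[OF assms]] field_simps)
qed

lemma slogd_le:
  assumes "\<rho> > 0" shows "slogd z \<rho> \<zeta> \<le> ln (max (norm (\<zeta> - z)) \<rho>)"
proof (cases "\<rho> \<le> norm (\<zeta> - z)")
  case True then show ?thesis using slogd_eq_ln[OF assms True] by (simp add: max_def)
next
  case False
  then have "slog (sqdist z \<rho> \<zeta>) \<le> 0" by (intro slog_le_0 sqdist_le_1 assms) simp
  then show ?thesis using False by (simp add: slogd_def max_def)
qed

lemma cutoff_eq_1: assumes "R > 0" "norm \<zeta> \<le> R" shows "cutoff R \<zeta> = 1"
proof -
  have "(norm \<zeta>)\<^sup>2 \<le> R\<^sup>2" using assms by (intro power_mono) auto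
  then have "sqdist 0 (2 * R) \<zeta> \<le> 1/4" using assms by (simp add: sqdist_def field_simps)
  then show ?thesis by (simp add: cutoff_def step_eq_0)
qed

lemma cutoff_eq_0: assumes "R > 0" "norm \<zeta> \<ge> 2 * R" shows "cutoff R \<zeta> = 0"
  using assms sqdist_ge_1[of "2 * R" \<zeta> 0] by (simp add: cutoff_def step_eq_1)

lemma cutoff_bounds: "0 \<le> cutoff R \<zeta>" "cutoff R \<zeta> \<le> 1"
  using step_nonneg step_le_1 by (auto simp: cutoff_def)

lemma smooth2_diff: assumes "f \<in> smooth2" "g \<in> smooth2" shows "(\<lambda>z. f z - g z) \<in> smooth2"
  using smooth2.add[OF assms(1) smooth2.mult[OF smooth2.const[of "-1"] assms(2)]] by simp

lemma pd_diff: "\<lbrakk>f \<in> smooth2; g \<in> smooth2\<rbrakk> \<Longrightarrow> pd u (\<lambda>z. f z - g z) = (\<lambda>z. pd u f z - pd u g z)"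
  by (intro ext pd_eqI DERIV_diff smooth2_has_pd)

lemma laplacian_diff:
  "\<lbrakk>f \<in> smooth2; g \<in> smooth2\<rbrakk> \<Longrightarrow> laplacian (\<lambda>z. f z - g z) z = laplacian f z - laplacian g z"
  by (simp add: laplacian_def pd_diff pd_smooth2)

lemma laplacian_add_const:
  "f \<in> smooth2 \<Longrightarrow> laplacian (\<lambda>z. f z + c) = laplacian f"
proof
  fix z assume f: "f \<in> smooth2"
  have "pd u (\<lambda>z. f z + c) = pd u f" for u
    by (rule ext) (simp add: pd_add[OF f smooth2.const] pd_const)
  then show "laplacian (\<lambda>z. f z + c) z = laplacian f z" by (simp add: laplacian_def)
qed

lemma laplacian_slogd: "\<rho> > 0 \<Longrightarrow> laplacian (slogd z \<rho>) \<zeta> = (2 / \<rho>\<^sup>2) * bump (sqdist z \<rho> \<zeta>)"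
  unfolding slogd_def[abs_def]
  by (subst laplacian_add_const) (auto intro: smooth2.compose slog_smooth sqdist_smooth2 simp: laplacian_slog_sqdist)

lemma pd_slogd:
  assumes "\<rho> > 0" "\<rho> \<le> norm (\<zeta> - z)"
  shows "pd u (slogd z \<rho>) \<zeta> = ((\<zeta> - z) \<bullet> u) / (norm (\<zeta> - z))\<^sup>2"
proof -
  have S: "sqdist z \<rho> \<zeta> \<ge> 1" by (rule sqdist_ge_1[OF assms])
  have "pd u (slogd z \<rho>) \<zeta> = slog' (sqdist z \<rho> \<zeta>) * (2 * ((\<zeta> - z) \<bullet> u) / \<rho>\<^sup>2)"
    unfolding slogd_def[abs_def]
    by (simp add: pd_add[OF smooth2.compose[OF slog_smooth sqdist_smooth2] smooth2.const] pd_const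
        pd_compose[OF sqdist_smooth2 slog_deriv] pd_sqdist)
  also have "slog' (sqdist z \<rho> \<zeta>) = 1 / (2 * sqdist z \<rho> \<zeta>)"
    using slog'_eq[of "sqdist z \<rho> \<zeta>"] S by (simp add: step_eq_1 field_simps)
  also have "1 / (2 * sqdist z \<rho> \<zeta>) * (2 * ((\<zeta> - z) \<bullet> u) / \<rho>\<^sup>2) = ((\<zeta> - z) \<bullet> u) / (norm (\<zeta> - z))\<^sup>2"
    using assms by (simp add: sqdist_def field_simps)
  finally show ?thesis .
qed

lemma smooth2_locally_constant:
  assumes "open S" "z \<in> S" "\<And>w. w \<in> S \<Longrightarrow> f w = c"
  shows "pd u f z = 0"
proof (rule pd_eqI)
  have "open ((\<lambda>t::real. z + of_real t * u) -` S)"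
    by (intro open_vimage assms(1) continuous_intros)
  from eventually_nhds_in_open[OF this, of 0] have "eventually (\<lambda>t::real. z + of_real t * u \<in> S) (nhds 0)"
    using assms(2) by simp
  then have ev: "eventually (\<lambda>t::real. f (z + of_real t * u) = c) (nhds 0)"
    by eventually_elim (rule assms(3))
  show "((\<lambda>t::real. f (z + of_real t * u)) has_real_derivative 0) (at 0)"
    by (subst DERIV_cong_ev[OF refl ev refl]) simp
qed

lemma smooth2_locally_constant_laplacian:
  assumes "open S" "z \<in> S" "\<And>w. w \<in> S \<Longrightarrow> f w = c"
  shows "laplacian f z = 0"
proof -
  have "pd u (pd u f) z = 0" for u
    by (rule smooth2_locally_constant[OF assms(1,2)]) (rule smooth2_locally_constant[OF assms(1) _ assms(3)])
  then show ?thesis by (simp add: laplacian_def)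
qed

lemma
  assumes "R > 0" "norm \<zeta> < R \<or> norm \<zeta> > 2 * R"
  shows pd_cutoff_eq_0: "pd u (cutoff R) \<zeta> = 0" and laplacian_cutoff_eq_0: "laplacian (cutoff R) \<zeta> = 0"
proof -
  have "\<exists>S c. open S \<and> \<zeta> \<in> S \<and> (\<forall>w\<in>S. cutoff R w = c)"
  proof (cases "norm \<zeta> < R")
    case True
    then show ?thesis using assms by (intro exI[of _ "ball 0 R"] exI[of _ 1]) (auto intro: cutoff_eq_1)
  next
    case False
    then show ?thesis using assms by (intro exI[of _ "- cball 0 (2*R)"] exI[of _ 0]) (auto intro: cutoff_eq_0)
  qed
  then show "pd u (cutoff R) \<zeta> = 0" "laplacian (cutoff R) \<zeta> = 0"
    using smooth2_locally_constant smooth2_locally_constant_laplacian by metis+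
qed

text \<open>Twice the gradient of the cutoff, read as a complex number. In this form the mixed term
  of the Laplacian of a product with log|\<zeta> - z| is the real part of a Cauchy kernel,
  holomorphic in z.\<close>

definition cutoff_dbar :: "real \<Rightarrow> complex \<Rightarrow> complex" where
  "cutoff_dbar R \<zeta> = 2 * Complex (pd 1 (cutoff R) \<zeta>) (pd \<i> (cutoff R) \<zeta>)"

text \<open>The derivatives of the cutoff vanish inside radius R, and from R on the distance to
  \<open>z\<close> is at least \<open>\<rho>\<close>. Hence the smoothed logarithm meets them only
  where it is the exact logarithm.\<close>

lemma laplacian_slogd_cutoff:
  assumes R: "R > 0" and \<rho>: "\<rho> > 0" and z: "norm z + \<rho> \<le> R"
  shows "laplacian (\<lambda>\<zeta>. slogd z \<rho> \<zeta> * cutoff R \<zeta>) \<zeta> = (2 / \<rho>\<^sup>2) * bump (sqdist z \<rho> \<zeta>)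
    + (if norm \<zeta> < R then 0 else Re (cutoff_dbar R \<zeta> / (\<zeta> - z)) + laplacian (cutoff R) \<zeta> * ln (norm (\<zeta> - z)))"
proof (cases "norm \<zeta> < R")
  case True
  then show ?thesis
    by (simp add: laplacian_mult[OF slogd_smooth2 cutoff_smooth2] pd_cutoff_eq_0[OF R] laplacian_cutoff_eq_0[OF R]
        laplacian_slogd[OF \<rho>] cutoff_eq_1[OF R])
next
  case False
  have d: "\<rho> \<le> norm (\<zeta> - z)" using False z norm_triangle_ineq2[of \<zeta> z] by simp
  have b: "bump (sqdist z \<rho> \<zeta>) = 0"
    using sqdist_ge_1[OF \<rho> d] bump_eq_0[of "sqdist z \<rho> \<zeta>"] bump_eq_0_at_ends(2) by (cases "sqdist z \<rho> \<zeta> = 1") auto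
  have "Re (cutoff_dbar R \<zeta> / (\<zeta> - z)) = 2 * (pd 1 (slogd z \<rho>) \<zeta> * pd 1 (cutoff R) \<zeta> + pd \<i> (slogd z \<rho>) \<zeta> * pd \<i> (cutoff R) \<zeta>)"
  proof -
    have "Re (cutoff_dbar R \<zeta> / (\<zeta> - z)) = (2 * pd 1 (cutoff R) \<zeta> * Re (\<zeta> - z) + 2 * pd \<i> (cutoff R) \<zeta> * Im (\<zeta> - z)) / (norm (\<zeta> - z))\<^sup>2"
      unfolding cmod_power2 by (simp add: cutoff_dbar_def Re_divide)
    then show ?thesis
      unfolding pd_slogd[OF \<rho> d] by (simp add: inner_complex_def add_divide_distrib mult.assoc mult.commute mult.left_commute)
  qed
  then show ?thesis
    using False by (simp add: laplacian_mult[OF slogd_smooth2 cutoff_smooth2] laplacian_slogd[OF \<rho>] b slogd_eq_ln[OF \<rho> d])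
qed

section \<open>Holomorphic dependence of potentials on the exterior mass\<close>

text \<open>The kernel is expanded in powers of z and integrated term by term; coefficients of size
  R^(-n) give convergence in the disc. The conditions are imposed only where \<open>f\<close> is
  nonzero, so the kernel may be singular inside.\<close>

lemma holomorphic_power_series_integral:
  fixes f :: "'a \<Rightarrow> complex" and c :: "nat \<Rightarrow> 'a \<Rightarrow> complex"
  assumes f: "integrable \<mu> f" and R: "R > 0" and [measurable]: "\<And>n. c n \<in> borel_measurable \<mu>"
    and c: "\<And>n x. f x \<noteq> 0 \<Longrightarrow> norm (c n x) \<le> B / R ^ n"
    and K: "\<And>z x. f x \<noteq> 0 \<Longrightarrow> norm z < R \<Longrightarrow> (\<lambda>n. c n x * z ^ n) sums K z x"
  shows "(\<lambda>z. \<integral>x. f x * K z x \<partial>\<mu>) holomorphic_on ball 0 R"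
    and "norm z < R \<Longrightarrow> integrable \<mu> (\<lambda>x. f x * K z x)"
proof -
  have [measurable]: "f \<in> borel_measurable \<mu>" using f by auto
  have main: "(\<lambda>n. (\<integral>x. f x * c n x \<partial>\<mu>) * (z - 0) ^ n) sums (\<integral>x. f x * K z x \<partial>\<mu>) \<and> integrable \<mu> (\<lambda>x. f x * K z x)"
    if z: "norm z < R" for z
  proof -
    define q where "q = norm z / R"
    have q: "0 \<le> q" "q < 1" using z R by (auto simp: q_def)
    let ?g = "\<lambda>n x. f x * c n x * z ^ n"
    have bd: "norm (?g n x) \<le> B * q ^ n * norm (f x)" for n x
    proof (cases "f x = 0")
      case False
      have "norm (?g n x) = norm (f x) * (norm (c n x) * norm z ^ n)" by (simp add: norm_mult norm_power)
      also have "\<dots> \<le> norm (f x) * (B / R ^ n * norm z ^ n)" using c[OF False] by (intro mult_left_mono mult_right_mono) auto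
      finally show ?thesis by (simp add: q_def power_divide mult_ac)
    qed simp
    have int: "integrable \<mu> (?g n)" for n
    proof (rule Bochner_Integration.integrable_bound)
      show "integrable \<mu> (\<lambda>x. (B * q ^ n) * norm (f x))" using f by simp
      show "AE x in \<mu>. norm (?g n x) \<le> norm ((B * q ^ n) * norm (f x))"
        using bd by (intro AE_I2) (metis abs_ge_self order_trans real_norm_def)
    qed measurable
    have sm: "AE x in \<mu>. summable (\<lambda>n. norm (?g n x))"
    proof (rule AE_I2)
      fix x
      have "summable (\<lambda>n. norm (f x) * B * q ^ n)" using q by (intro summable_mult summable_geometric) simp
      then show "summable (\<lambda>n. norm (?g n x))"
        by (rule summable_comparison_test'[where N = 0]) (use bd in \<open>simp add: mult_ac\<close>)
    qed
    have si: "summable (\<lambda>n. \<integral>x. norm (?g n x) \<partial>\<mu>)"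
    proof (rule summable_comparison_test'[where N = 0])
      show "summable (\<lambda>n. (\<integral>x. norm (f x) \<partial>\<mu>) * B * q ^ n)" using q by (intro summable_mult summable_geometric) simp
      show "norm (\<integral>x. norm (?g n x) \<partial>\<mu>) \<le> (\<integral>x. norm (f x) \<partial>\<mu>) * B * q ^ n" for n
      proof -
        have "(\<integral>x. norm (?g n x) \<partial>\<mu>) \<le> (\<integral>x. B * q ^ n * norm (f x) \<partial>\<mu>)"
          by (intro integral_mono integrable_norm int bd) (use f in simp)
        then show ?thesis by (simp add: mult_ac)
      qed
    qed
    have sumK: "(\<Sum>n. ?g n x) = f x * K z x" for x
    proof (cases "f x = 0")
      case False
      from sums_mult[OF K[OF False z], of "f x"] show ?thesis by (simp add: sums_iff mult.assoc)
    qed simp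
    have "(\<lambda>n. \<integral>x. ?g n x \<partial>\<mu>) sums (\<integral>x. (\<Sum>n. ?g n x) \<partial>\<mu>)" "integrable \<mu> (\<lambda>x. \<Sum>n. ?g n x)"
      using sums_integral[OF int sm si] integrable_suminf[OF int sm si] by auto
    then show ?thesis by (simp only: sumK) simp
  qed
  then show "norm z < R \<Longrightarrow> integrable \<mu> (\<lambda>x. f x * K z x)" by blast
  show "(\<lambda>z. \<integral>x. f x * K z x \<partial>\<mu>) holomorphic_on ball 0 R"
    by (rule power_series_holomorphic[where a = "\<lambda>n. \<integral>x. f x * c n x \<partial>\<mu>"]) (use main in auto)
qed

lemma holomorphic_Cauchy_integral:
  fixes f :: "complex \<Rightarrow> complex"
  assumes s: "sets \<mu> = sets borel" and f: "integrable \<mu> f" and R: "R > 0" and supp: "\<And>\<zeta>. norm \<zeta> < R \<Longrightarrow> f \<zeta> = 0"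
  shows "(\<lambda>z. \<integral>\<zeta>. f \<zeta> * (1 / (\<zeta> - z)) \<partial>\<mu>) holomorphic_on ball 0 R"
    and "norm z < R \<Longrightarrow> integrable \<mu> (\<lambda>\<zeta>. f \<zeta> * (1 / (\<zeta> - z)))"
proof -
  note [measurable_cong] = s
  have 1: "(\<lambda>\<zeta>. 1 / \<zeta> ^ Suc n) \<in> borel_measurable \<mu>" for n :: nat by measurable
  have 2: "norm (1 / \<zeta> ^ Suc n) \<le> (1/R) / R ^ n" if "f \<zeta> \<noteq> 0" for n \<zeta>
  proof -
    have "R \<le> norm \<zeta>" using supp[of \<zeta>] that by force
    then have "R ^ Suc n \<le> norm \<zeta> ^ Suc n" using R by (intro power_mono) auto
    then show ?thesis using R by (simp add: norm_divide norm_power norm_mult frac_le)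
  qed
  have 3: "(\<lambda>n. 1 / \<zeta> ^ Suc n * z ^ n) sums (1 / (\<zeta> - z))" if "f \<zeta> \<noteq> 0" "norm z < R" for z \<zeta>
  proof -
    have "R \<le> norm \<zeta>" using supp[of \<zeta>] that by force
    then have "norm (z / \<zeta>) < 1" "\<zeta> \<noteq> 0" using that R by (auto simp: norm_divide divide_less_eq)
    from sums_mult[OF geometric_sums[OF this(1)], of "1/\<zeta>"] this(2) show ?thesis
      by (simp add: field_simps power_divide)
  qed
  show "(\<lambda>z. \<integral>\<zeta>. f \<zeta> * (1 / (\<zeta> - z)) \<partial>\<mu>) holomorphic_on ball 0 R"
    "norm z < R \<Longrightarrow> integrable \<mu> (\<lambda>\<zeta>. f \<zeta> * (1 / (\<zeta> - z)))"
    by (rule holomorphic_power_series_integral[OF f R 1 2 3]; assumption)+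
qed

lemma holomorphic_log_integral:
  fixes f :: "complex \<Rightarrow> complex"
  assumes s: "sets \<mu> = sets borel" and f: "integrable \<mu> f" and R: "R > 0" and supp: "\<And>\<zeta>. norm \<zeta> < R \<Longrightarrow> f \<zeta> = 0"
  shows "(\<lambda>z. \<integral>\<zeta>. f \<zeta> * ln (1 - z / \<zeta>) \<partial>\<mu>) holomorphic_on ball 0 R"
    and "norm z < R \<Longrightarrow> integrable \<mu> (\<lambda>\<zeta>. f \<zeta> * ln (1 - z / \<zeta>))"
proof -
  note [measurable_cong] = s
  \<comment> \<open>For n = 0 the coefficient is 0, division by zero having value 0, in agreement
    with the missing constant term of the logarithmic series.\<close>
  have 1: "(\<lambda>\<zeta>. - (1 / (of_nat n * \<zeta> ^ n))) \<in> borel_measurable \<mu>" for n :: nat by measurable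
  have 2: "norm (- (1 / (of_nat n * \<zeta> ^ n))) \<le> 1 / R ^ n" if "f \<zeta> \<noteq> 0" for n \<zeta>
  proof (cases "n = 0")
    case False
    have "R \<le> norm \<zeta>" using supp[of \<zeta>] that by force
    then have "1 * R ^ n \<le> real n * norm \<zeta> ^ n" using R False by (intro mult_mono power_mono) auto
    then show ?thesis using R False by (simp add: norm_divide norm_power norm_mult frac_le)
  qed (use R in simp)
  have 3: "(\<lambda>n. - (1 / (of_nat n * \<zeta> ^ n)) * z ^ n) sums ln (1 - z / \<zeta>)" if "f \<zeta> \<noteq> 0" "norm z < R" for z \<zeta>
  proof -
    have "R \<le> norm \<zeta>" using supp[of \<zeta>] that by force
    then have "norm (- (z / \<zeta>)) < 1" "\<zeta> \<noteq> 0" using that R by (auto simp: norm_divide divide_less_eq)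
    from Ln_series'[OF this(1)] show ?thesis by (simp add: power_divide field_simps)
  qed
  show "(\<lambda>z. \<integral>\<zeta>. f \<zeta> * ln (1 - z / \<zeta>) \<partial>\<mu>) holomorphic_on ball 0 R"
    "norm z < R \<Longrightarrow> integrable \<mu> (\<lambda>\<zeta>. f \<zeta> * ln (1 - z / \<zeta>))"
    by (rule holomorphic_power_series_integral[OF f R 1 2 3]; assumption)+
qed

lemma ln_norm_diff: assumes "norm z < norm \<zeta>" shows "ln (norm (\<zeta> - z)) = ln (norm \<zeta>) + Re (ln (1 - z / \<zeta>))"
proof -
  have z: "\<zeta> \<noteq> 0" "\<zeta> \<noteq> z" using assms by auto
  have "norm (\<zeta> - z) = norm \<zeta> * norm (1 - z / \<zeta>)"
    using z by (simp add: norm_mult[symmetric] right_diff_distrib)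
  moreover have "1 - z / \<zeta> \<noteq> 0" using z by simp
  ultimately show ?thesis using z by (simp add: ln_mult Re_Ln)
qed

section \<open>The Riesz measure and the representation on a disc\<close>

locale riesz_fun = subharmonic_fun +
  fixes \<nu> :: "complex measure"
  assumes riesz: "riesz_measure v \<nu>"
begin

lemma sets_nu [simp, measurable_cong]: "sets \<nu> = sets borel"
  and nu_cball: "emeasure \<nu> (cball 0 R) < \<infinity>"
  and riesz_test: "test_function \<phi> \<Longrightarrow> (\<integral>z. \<phi> z \<partial>\<nu>) = (1 / (2*pi)) * (\<integral>z. rv z * laplacian \<phi> z \<partial>lborel)"
  using riesz unfolding riesz_measure_def by auto

lemma riesz_smooth2:
  assumes "\<phi> \<in> smooth2" "\<And>\<zeta>. norm \<zeta> > R \<Longrightarrow> \<phi> \<zeta> = 0"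
  shows "(\<integral>z. \<phi> z \<partial>\<nu>) = (1 / (2*pi)) * (\<integral>z. rv z * laplacian \<phi> z \<partial>lborel)"
proof (rule riesz_test)
  have "{z. \<phi> z \<noteq> 0} \<subseteq> cball 0 R" using assms(2) by force
  then have "bounded {z. \<phi> z \<noteq> 0}" using bounded_cball bounded_subset by blast
  then show "test_function \<phi>"
    unfolding test_function_def using smooth2_imp_smooth_R2[OF assms(1)] by (simp add: compact_closure)
qed

lemma nu_integrable:
  fixes f :: "complex \<Rightarrow> 'b :: {banach, second_countable_topology}"
  assumes [measurable]: "f \<in> borel_measurable borel" and "\<And>\<zeta>. norm \<zeta> > R \<Longrightarrow> f \<zeta> = 0" "\<And>\<zeta>. norm \<zeta> \<le> R \<Longrightarrow> norm (f \<zeta>) \<le> B"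
  shows "integrable \<nu> f"
  by (rule integrableI_bounded_set[where A = "cball 0 R" and B = B])
     (use assms nu_cball[of R] in auto)

lemma nu_integrable_continuous:
  assumes c: "continuous_on UNIV f" and [measurable]: "A \<in> sets borel" and A: "A \<subseteq> cball 0 R"
  shows "set_integrable \<nu> A (f :: complex \<Rightarrow> real)"
proof -
  have [measurable]: "f \<in> borel_measurable borel" using c by (rule borel_measurable_continuous_onI)
  have "compact (f ` cball 0 R)" by (intro compact_continuous_image continuous_on_subset[OF c]) auto
  then obtain B where B: "\<And>\<zeta>. \<zeta> \<in> cball 0 R \<Longrightarrow> norm (f \<zeta>) \<le> B" using compact_imp_bounded bounded_iff by (metis imageI)
  show ?thesis unfolding set_integrable_def
  proof (rule nu_integrable[where R = R and B = "max B 0"])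
    show "indicat_real A \<zeta> *\<^sub>R f \<zeta> = 0" if "norm \<zeta> > R" for \<zeta> using that A by (auto simp: indicator_def)
    show "norm (indicat_real A \<zeta> *\<^sub>R f \<zeta>) \<le> max B 0" if "norm \<zeta> \<le> R" for \<zeta>
      using B[of \<zeta>] that by (auto simp: indicator_def)
  qed measurable
qed

lemma smooth2_measurable: "f \<in> smooth2 \<Longrightarrow> f \<in> borel_measurable borel"
  by (intro borel_measurable_continuous_onI smooth2_continuous_on)

lemma smooth2_bounded_support:
  assumes "f \<in> smooth2" "\<And>\<zeta>. norm \<zeta> > R \<Longrightarrow> f \<zeta> = 0"
  obtains B where "\<And>\<zeta>. norm (f \<zeta>) \<le> B"
proof -
  have "compact (f ` cball 0 R)" by (intro compact_continuous_image smooth2_continuous_on assms) auto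
  then obtain B where B: "\<And>\<zeta>. \<zeta> \<in> cball 0 R \<Longrightarrow> norm (f \<zeta>) \<le> B" using compact_imp_bounded bounded_iff by (metis imageI)
  show thesis
  proof (rule that[of "max B 0"])
    show "norm (f \<zeta>) \<le> max B 0" for \<zeta> using B[of \<zeta>] assms(2)[of \<zeta>] by (cases "norm \<zeta> \<le> R") auto
  qed
qed

text \<open>The Riesz identity is tested with the smoothed logarithm times a cutoff. The bump part
  of the Laplacian reproduces the smoothed value at z; what comes from the cutoff lives at radii
  from R to 2R and depends on z as the real part of a holomorphic function.\<close>

lemma smoothed_representation_cutoff:
  assumes R: "R > 0"
  obtains h where "h holomorphic_on ball 0 R"
    "\<And>z \<rho>. 0 < \<rho> \<Longrightarrow> norm z + \<rho> \<le> R \<Longrightarrow> vsm \<rho> z = (\<integral>\<zeta>. slogd z \<rho> \<zeta> * cutoff R \<zeta> \<partial>\<nu>) - Re (h z)"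
proof -
  define f1 where "f1 = (\<lambda>\<zeta>. rv \<zeta> *\<^sub>R (if norm \<zeta> < R then 0 else cutoff_dbar R \<zeta>))"
  define f2 where "f2 = (\<lambda>\<zeta>. rv \<zeta> *\<^sub>R (if norm \<zeta> < R then 0 else of_real (laplacian (cutoff R) \<zeta>) :: complex))"
  have sm: "pd u (cutoff R) \<in> smooth2" "laplacian (cutoff R) \<in> smooth2" for u
    by (intro pd_smooth2 laplacian_smooth2 cutoff_smooth2)+
  note [measurable] = sm[THEN smooth2_measurable]
  obtain B1 Bi B2 where B: "\<And>\<zeta>. norm (pd 1 (cutoff R) \<zeta>) \<le> B1" "\<And>\<zeta>. norm (pd \<i> (cutoff R) \<zeta>) \<le> Bi"
    "\<And>\<zeta>. norm (laplacian (cutoff R) \<zeta>) \<le> B2"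
    using smooth2_bounded_support[OF sm(1)[of 1], of "2*R"] smooth2_bounded_support[OF sm(1)[of \<i>], of "2*R"]
      smooth2_bounded_support[OF sm(2), of "2*R"] pd_cutoff_eq_0[OF R] laplacian_cutoff_eq_0[OF R] by metis
  have [measurable]: "cutoff_dbar R \<in> borel_measurable borel"
    unfolding cutoff_dbar_def[abs_def] by (simp add: Complex_eq)
  have i1: "integrable lborel f1"
    unfolding f1_def
  proof (rule integrable_rv_mult[where R = "2 * R" and B = "2 * (B1 + Bi)"])
    show "norm (if norm \<zeta> < R then 0 else cutoff_dbar R \<zeta>) \<le> 2 * (B1 + Bi)" for \<zeta>
      using cmod_le[of "Complex (pd 1 (cutoff R) \<zeta>) (pd \<i> (cutoff R) \<zeta>)"] B(1,2)[of \<zeta>]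
      by (auto simp: cutoff_dbar_def norm_mult)
  qed (use R in \<open>auto simp: cutoff_dbar_def pd_cutoff_eq_0 Complex_eq\<close>)
  have i2: "integrable lborel f2"
    unfolding f2_def
  proof (rule integrable_rv_mult[where R = "2 * R" and B = "\<bar>B2\<bar>"])
    show "norm (if norm \<zeta> < R then 0 else of_real (laplacian (cutoff R) \<zeta>) :: complex) \<le> \<bar>B2\<bar>" for \<zeta>
      using B(3)[of \<zeta>] by auto
  qed (use R in \<open>auto simp: laplacian_cutoff_eq_0\<close>)
  have i3: "integrable lborel (\<lambda>\<zeta>. f2 \<zeta> * of_real (ln (norm \<zeta>)))"
  proof -
    have "integrable lborel (\<lambda>\<zeta>. rv \<zeta> *\<^sub>R ((if norm \<zeta> < R then 0 else of_real (laplacian (cutoff R) \<zeta>)) * of_real (ln (norm \<zeta>)) :: complex))"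
    proof (rule integrable_rv_mult[where R = "2 * R" and B = "\<bar>B2\<bar> * (\<bar>ln R\<bar> + \<bar>ln (2 * R)\<bar>)"])
      fix \<zeta> :: complex
      show "norm ((if norm \<zeta> < R then 0 else of_real (laplacian (cutoff R) \<zeta>)) * of_real (ln (norm \<zeta>)) :: complex) \<le> \<bar>B2\<bar> * (\<bar>ln R\<bar> + \<bar>ln (2 * R)\<bar>)"
      proof (cases "norm \<zeta> < R \<or> norm \<zeta> > 2 * R")
        case True
        then show ?thesis using R by (auto simp: laplacian_cutoff_eq_0)
      next
        case False
        then have "ln R \<le> ln (norm \<zeta>)" "ln (norm \<zeta>) \<le> ln (2 * R)" using R by (auto intro!: ln_mono)
        then have "\<bar>ln (norm \<zeta>)\<bar> \<le> \<bar>ln R\<bar> + \<bar>ln (2 * R)\<bar>" by linarith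
        moreover have "\<bar>laplacian (cutoff R) \<zeta>\<bar> \<le> \<bar>B2\<bar>" using B(3)[of \<zeta>] by simp
        ultimately have "\<bar>laplacian (cutoff R) \<zeta>\<bar> * \<bar>ln (norm \<zeta>)\<bar> \<le> \<bar>B2\<bar> * (\<bar>ln R\<bar> + \<bar>ln (2 * R)\<bar>)" by (intro mult_mono) auto
        then show ?thesis using False by (simp add: norm_mult)
      qed
    qed (use R in \<open>auto simp: laplacian_cutoff_eq_0\<close>)
    then show ?thesis by (simp add: f2_def)
  qed
  have s1: "f1 \<zeta> = 0" "f2 \<zeta> = 0" if "norm \<zeta> < R" for \<zeta> using that by (auto simp: f1_def f2_def)
  \<comment> \<open>The first term is the mixed gradient term. The other two come from the Laplacian
    of the cutoff, with log|\<zeta> - z| split as log|\<zeta>| + Re Ln(1 - z/\<zeta>).\<close>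
  define H where "H = (\<lambda>z. (\<integral>\<zeta>. f1 \<zeta> * (1 / (\<zeta> - z)) \<partial>lborel) + (\<integral>\<zeta>. f2 \<zeta> * of_real (ln (norm \<zeta>)) \<partial>lborel) + (\<integral>\<zeta>. f2 \<zeta> * ln (1 - z / \<zeta>) \<partial>lborel))"
  have H: "H holomorphic_on ball 0 R"
    unfolding H_def using s1
    by (intro holomorphic_intros holomorphic_Cauchy_integral holomorphic_log_integral i1 i2 R) auto
  show thesis
  proof (rule that[of "\<lambda>z. H z / (2 * pi)"])
    show "(\<lambda>z. H z / complex_of_real (2 * pi)) holomorphic_on ball 0 R"
      by (intro holomorphic_intros H) simp
    fix z :: complex and \<rho> :: real assume \<rho>: "0 < \<rho>" and z: "norm z + \<rho> \<le> R"
    have zR: "norm z < R" using \<rho> z by simp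
    have iC: "integrable lborel (\<lambda>\<zeta>. f1 \<zeta> * (1 / (\<zeta> - z)))" "integrable lborel (\<lambda>\<zeta>. f2 \<zeta> * ln (1 - z / \<zeta>))"
      using s1 zR by (intro holomorphic_Cauchy_integral holomorphic_log_integral i1 i2 R; auto)+
    have X: "rv \<zeta> * laplacian (\<lambda>\<zeta>. slogd z \<rho> \<zeta> * cutoff R \<zeta>) \<zeta>
      = (2 / \<rho>\<^sup>2) * (rv \<zeta> * bump ((norm (\<zeta> - z))\<^sup>2 / \<rho>\<^sup>2)) + Re (f1 \<zeta> * (1 / (\<zeta> - z)) + f2 \<zeta> * of_real (ln (norm \<zeta>)) + f2 \<zeta> * ln (1 - z / \<zeta>))" for \<zeta>
    proof (cases "norm \<zeta> < R")
      case True
      then show ?thesis unfolding laplacian_slogd_cutoff[OF R \<rho> z] by (simp add: s1 sqdist_def)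
    next
      case False
      then have "ln (norm (\<zeta> - z)) = ln (norm \<zeta>) + Re (ln (1 - z / \<zeta>))" using zR by (intro ln_norm_diff) simp
      then show ?thesis using False unfolding laplacian_slogd_cutoff[OF R \<rho> z]
        by (simp add: f1_def f2_def sqdist_def algebra_simps)
    qed
    have "(\<integral>\<zeta>. slogd z \<rho> \<zeta> * cutoff R \<zeta> \<partial>\<nu>) = (1 / (2*pi)) * (\<integral>\<zeta>. rv \<zeta> * laplacian (\<lambda>\<zeta>. slogd z \<rho> \<zeta> * cutoff R \<zeta>) \<zeta> \<partial>lborel)"
      by (rule riesz_smooth2[where R = "2 * R"]) (use R in \<open>auto intro!: smooth2.mult slogd_smooth2 cutoff_smooth2 simp: cutoff_eq_0\<close>)
    also have "(\<integral>\<zeta>. rv \<zeta> * laplacian (\<lambda>\<zeta>. slogd z \<rho> \<zeta> * cutoff R \<zeta>) \<zeta> \<partial>lborel)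
      = (2 / \<rho>\<^sup>2) * (\<integral>\<zeta>. rv \<zeta> * bump ((norm (\<zeta> - z))\<^sup>2 / \<rho>\<^sup>2) \<partial>lborel) + Re (H z)"
    proof -
      have iG: "integrable lborel (\<lambda>\<zeta>. f1 \<zeta> * (1 / (\<zeta> - z)) + f2 \<zeta> * of_real (ln (norm \<zeta>)) + f2 \<zeta> * ln (1 - z / \<zeta>))"
        by (intro Bochner_Integration.integrable_add iC i3)
      have "H z = (\<integral>\<zeta>. f1 \<zeta> * (1 / (\<zeta> - z)) + f2 \<zeta> * of_real (ln (norm \<zeta>)) + f2 \<zeta> * ln (1 - z / \<zeta>) \<partial>lborel)"
        unfolding H_def by (simp only: Bochner_Integration.integral_add Bochner_Integration.integrable_add iC i3)
      then have "Re (H z) = (\<integral>\<zeta>. Re (f1 \<zeta> * (1 / (\<zeta> - z)) + f2 \<zeta> * of_real (ln (norm \<zeta>)) + f2 \<zeta> * ln (1 - z / \<zeta>)) \<partial>lborel)"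
        by (simp only: integral_Re[OF iG])
      then show ?thesis
        unfolding X using integrable_rv_bump[OF \<rho>, of z] integrable_Re[OF iG]
        by (simp only: Bochner_Integration.integral_add integrable_mult_right integral_mult_right_zero)
    qed
    also have "(\<integral>\<zeta>. rv \<zeta> * bump ((norm (\<zeta> - z))\<^sup>2 / \<rho>\<^sup>2) \<partial>lborel) = pi * \<rho>\<^sup>2 * vsm \<rho> z"
      using \<rho> by (simp add: vsm_def)
    finally have "(\<integral>\<zeta>. slogd z \<rho> \<zeta> * cutoff R \<zeta> \<partial>\<nu>) = vsm \<rho> z + Re (H z) / (2 * pi)"
      using \<rho> by (simp add: field_simps)
    then show "vsm \<rho> z = (\<integral>\<zeta>. slogd z \<rho> \<zeta> * cutoff R \<zeta> \<partial>\<nu>) - Re (H z / complex_of_real (2 * pi))"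
      by (simp add: Re_divide_of_real del: of_real_mult)
  qed
qed

text \<open>The smooth cutoff is traded for the sharp disc, since its part at radii from R to 2R is
  again harmonic in z. Subtracting ln|\<zeta>| prepares the kernel log|1 - z/\<zeta>|; it starts
  only at \<open>r1\<close> because ln|\<zeta>| is unbounded near 0.\<close>

lemma smoothed_representation:
  assumes r1: "0 < r1" "r1 \<le> R"
  obtains h where "h holomorphic_on ball 0 R"
    "\<And>z \<rho>. 0 < \<rho> \<Longrightarrow> norm z + \<rho> \<le> R \<Longrightarrow>
      vsm \<rho> z = Re (h z) + (LINT \<zeta>:ball 0 R|\<nu>. slogd z \<rho> \<zeta> - (if norm \<zeta> < r1 then 0 else ln (norm \<zeta>)))"
    "\<And>z \<rho>. set_integrable \<nu> (ball 0 R) (\<lambda>\<zeta>. slogd z \<rho> \<zeta> - (if norm \<zeta> < r1 then 0 else ln (norm \<zeta>)))"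
proof -
  have R: "R > 0" using r1 by simp
  obtain H where H: "H holomorphic_on ball 0 R"
    "\<And>z \<rho>. 0 < \<rho> \<Longrightarrow> norm z + \<rho> \<le> R \<Longrightarrow> vsm \<rho> z = (\<integral>\<zeta>. slogd z \<rho> \<zeta> * cutoff R \<zeta> \<partial>\<nu>) - Re (H z)"
    using smoothed_representation_cutoff[OF R] by blast
  have [measurable]: "cutoff R \<in> borel_measurable borel" by (rule smooth2_measurable[OF cutoff_smooth2])
  define f where "f = (\<lambda>\<zeta>. if norm \<zeta> < R then 0 else complex_of_real (cutoff R \<zeta>))"
  define l where "l = (\<lambda>\<zeta>::complex. if norm \<zeta> < r1 then 0 else ln (norm \<zeta>))"
  have [measurable]: "f \<in> borel_measurable borel" unfolding f_def by measurable
  have iff: "integrable \<nu> f"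
    by (rule nu_integrable[where R = "2 * R" and B = 1]) (use cutoff_bounds R in \<open>auto simp: f_def cutoff_eq_0\<close>)
  have supp: "f \<zeta> = 0" if "norm \<zeta> < R" for \<zeta> using that by (simp add: f_def)
  have ifl: "integrable \<nu> (\<lambda>\<zeta>. Re (f \<zeta>) * ln (norm \<zeta>))"
  proof (rule nu_integrable[where R = "2 * R" and B = "\<bar>ln R\<bar> + \<bar>ln (2 * R)\<bar>"])
    fix \<zeta> :: complex assume \<zeta>: "norm \<zeta> \<le> 2 * R"
    show "norm (Re (f \<zeta>) * ln (norm \<zeta>)) \<le> \<bar>ln R\<bar> + \<bar>ln (2 * R)\<bar>"
    proof (cases "norm \<zeta> < R")
      case False
      then have "ln R \<le> ln (norm \<zeta>)" "ln (norm \<zeta>) \<le> ln (2 * R)" using R \<zeta> by (auto intro!: ln_mono)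
      then have "\<bar>ln (norm \<zeta>)\<bar> \<le> \<bar>ln R\<bar> + \<bar>ln (2 * R)\<bar>" by linarith
      moreover have "\<bar>cutoff R \<zeta>\<bar> \<le> 1" using cutoff_bounds[of R \<zeta>] by simp
      ultimately have "\<bar>cutoff R \<zeta>\<bar> * \<bar>ln (norm \<zeta>)\<bar> \<le> 1 * (\<bar>ln R\<bar> + \<bar>ln (2 * R)\<bar>)" by (intro mult_mono) auto
      then show ?thesis using False by (simp add: f_def abs_mult)
    qed (simp add: f_def)
  qed (use R in \<open>auto simp: f_def cutoff_eq_0\<close>)
  have il: "set_integrable \<nu> (ball 0 R) l"
    unfolding set_integrable_def
  proof (rule nu_integrable[where R = R and B = "\<bar>ln r1\<bar> + \<bar>ln R\<bar>"])
    show "(\<lambda>\<zeta>. indicat_real (ball 0 R) \<zeta> *\<^sub>R l \<zeta>) \<in> borel_measurable borel" unfolding l_def by measurable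
    fix \<zeta> :: complex assume \<zeta>: "norm \<zeta> \<le> R"
    show "norm (indicat_real (ball 0 R) \<zeta> *\<^sub>R l \<zeta>) \<le> \<bar>ln r1\<bar> + \<bar>ln R\<bar>"
    proof (cases "norm \<zeta> < r1")
      case False
      then have "ln r1 \<le> ln (norm \<zeta>)" "ln (norm \<zeta>) \<le> ln R" using r1 \<zeta> by (auto intro!: ln_mono)
      then show ?thesis using False by (auto simp: l_def indicator_def)
    qed (simp add: l_def)
  qed (auto simp: indicator_def)
  have isl: "set_integrable \<nu> (ball 0 R) (slogd z \<rho>)" for z \<rho>
    by (rule nu_integrable_continuous[where R = R]) (auto intro: smooth2_continuous_on slogd_smooth2)
  define I3 where "I3 = (\<lambda>z. \<integral>\<zeta>. f \<zeta> * ln (1 - z / \<zeta>) \<partial>\<nu>)"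
  have I3: "I3 holomorphic_on ball 0 R" unfolding I3_def
    by (rule holomorphic_log_integral[OF sets_nu iff R supp])
  define c where "c = (\<integral>\<zeta>. Re (f \<zeta>) * ln (norm \<zeta>) \<partial>\<nu>) + (LINT \<zeta>:ball 0 R|\<nu>. l \<zeta>)"
  show thesis
  proof (rule that[of "\<lambda>z. I3 z + of_real c - H z"])
    show "(\<lambda>z. I3 z + of_real c - H z) holomorphic_on ball 0 R" by (intro holomorphic_intros I3 H)
    show "set_integrable \<nu> (ball 0 R) (\<lambda>\<zeta>. slogd z \<rho> \<zeta> - (if norm \<zeta> < r1 then 0 else ln (norm \<zeta>)))" for z \<rho>
      using set_integral_diff(1)[OF isl il, of z \<rho>] unfolding l_def .
    fix z :: complex and \<rho> :: real assume \<rho>: "0 < \<rho>" and z: "norm z + \<rho> \<le> R"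
    have zR: "norm z < R" using \<rho> z by simp
    have iL: "integrable \<nu> (\<lambda>\<zeta>. f \<zeta> * ln (1 - z / \<zeta>))"
      by (rule holomorphic_log_integral(2)[OF sets_nu iff R supp zR])
    \<comment> \<open>Outside the disc the distance to z is at least \<open>\<rho>\<close>, so the
      exact logarithm applies and splits into a constant in z and a real part of Ln(1 -
      z/\<zeta>).\<close>
    have pt: "slogd z \<rho> \<zeta> * cutoff R \<zeta> = indicat_real (ball 0 R) \<zeta> *\<^sub>R slogd z \<rho> \<zeta> + Re (f \<zeta>) * ln (norm \<zeta>) + Re (f \<zeta> * ln (1 - z / \<zeta>))" for \<zeta>
    proof (cases "norm \<zeta> < R")
      case True
      then show ?thesis by (simp add: f_def cutoff_eq_1[OF R])
    next
      case False
      have d: "\<rho> \<le> norm (\<zeta> - z)" using False z norm_triangle_ineq2[of \<zeta> z] by simp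
      have "ln (norm (\<zeta> - z)) = ln (norm \<zeta>) + Re (ln (1 - z / \<zeta>))" using zR False by (intro ln_norm_diff) simp
      then show ?thesis using False by (simp add: f_def slogd_eq_ln[OF \<rho> d] algebra_simps)
    qed
    have "(\<integral>\<zeta>. slogd z \<rho> \<zeta> * cutoff R \<zeta> \<partial>\<nu>) = (LINT \<zeta>:ball 0 R|\<nu>. slogd z \<rho> \<zeta>) + (\<integral>\<zeta>. Re (f \<zeta>) * ln (norm \<zeta>) \<partial>\<nu>) + Re (I3 z)"
      unfolding pt I3_def set_lebesgue_integral_def integral_Re[OF iL, symmetric]
      using isl[of z \<rho>, unfolded set_integrable_def] ifl integrable_Re[OF iL]
      by (simp only: Bochner_Integration.integral_add Bochner_Integration.integrable_add)
    moreover have "(LINT \<zeta>:ball 0 R|\<nu>. slogd z \<rho> \<zeta> - l \<zeta>) = (LINT \<zeta>:ball 0 R|\<nu>. slogd z \<rho> \<zeta>) - (LINT \<zeta>:ball 0 R|\<nu>. l \<zeta>)"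
      by (rule set_integral_diff(2)[OF isl il])
    ultimately show "vsm \<rho> z = Re (I3 z + of_real c - H z) + (LINT \<zeta>:ball 0 R|\<nu>. slogd z \<rho> \<zeta> - (if norm \<zeta> < r1 then 0 else ln (norm \<zeta>)))"
      using H(2)[OF \<rho> z] by (simp add: c_def l_def)
  qed
qed

text \<open>The derivative of ln s / 2 - slog s is (1 - step s)/(2s), hence nonnegative: truncating
  at a larger radius raises the logarithm. For squared relative distance up to 1/4 the function
  \<open>slog\<close> is constant and only the summands ln \<open>\<rho>\<close> differ.\<close>

lemma slogd_diff:
  assumes "0 < \<rho>1" "\<rho>1 \<le> \<rho>2"
  shows slogd_mono: "slogd 0 \<rho>1 \<zeta> \<le> slogd 0 \<rho>2 \<zeta>"
    and slogd_diff_eq: "norm \<zeta> \<le> \<rho>1 / 2 \<Longrightarrow> slogd 0 \<rho>2 \<zeta> - slogd 0 \<rho>1 \<zeta> = ln (\<rho>2 / \<rho>1)"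
proof -
  define S1 S2 where "S1 = sqdist 0 \<rho>1 \<zeta>" and "S2 = sqdist 0 \<rho>2 \<zeta>"
  have S: "0 \<le> S2" "S2 \<le> S1" using assms by (auto simp: S1_def S2_def sqdist_def frac_le power_mono)
  have lnq: "ln (\<rho>2 / \<rho>1) = ln \<rho>2 - ln \<rho>1" using assms by (simp add: ln_div)
  have pos: "S2 > 0" if "S1 \<noteq> 0" using that assms by (auto simp: S1_def S2_def sqdist_def)
  have q: "ln S1 / 2 - ln S2 / 2 = ln \<rho>2 - ln \<rho>1" if "S1 \<noteq> 0"
    using that assms by (auto simp: S1_def S2_def sqdist_def ln_div ln_realpow diff_divide_distrib)
  have k: "slog' x = step x / (2 * x)" if "x > 0" for x
    using slog'_eq[of x] that by (simp add: field_simps)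
  have "slog S1 - slog S2 \<le> ln \<rho>2 - ln \<rho>1"
  proof (cases "S1 = 0")
    case True
    then show ?thesis using S assms by simp
  next
    case False
    have "ln S2 / 2 - slog S2 \<le> ln S1 / 2 - slog S1"
    proof (rule DERIV_nonneg_imp_nondecreasing[OF S(2), of "\<lambda>x. ln x / 2 - slog x"])
      fix x assume "S2 \<le> x" "x \<le> S1"
      then have x: "x > 0" using pos[OF False] by simp
      have "((\<lambda>x. ln x / 2 - slog x) has_real_derivative (1 / x / 2 - slog' x)) (at x)"
        using x by (auto intro!: derivative_eq_intros slog_deriv)
      moreover have "1 / x / 2 - slog' x \<ge> 0"
        using x step_le_1[of x] by (simp add: k divide_right_mono field_simps)
      ultimately show "\<exists>y. ((\<lambda>x. ln x / 2 - slog x) has_real_derivative y) (at x) \<and> 0 \<le> y" by blast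
    qed
    then show ?thesis using q[OF False] by linarith
  qed
  then show "slogd 0 \<rho>1 \<zeta> \<le> slogd 0 \<rho>2 \<zeta>" by (simp add: slogd_def S1_def[symmetric] S2_def[symmetric])
  show "slogd 0 \<rho>2 \<zeta> - slogd 0 \<rho>1 \<zeta> = ln (\<rho>2 / \<rho>1)" if "norm \<zeta> \<le> \<rho>1 / 2"
  proof -
    have "(norm \<zeta>)\<^sup>2 \<le> (\<rho>1 / 2)\<^sup>2" using that by (intro power_mono) auto
    then have S14: "S1 \<le> 1/4" using assms by (simp add: S1_def sqdist_def power_divide field_simps)
    have "slog S1 = slog S2"
    proof (cases "S1 = 0 \<or> S1 = S2")
      case True
      then show ?thesis using S by auto
    next
      case False
      have d: "(slog has_real_derivative 0) (at x)" if "S2 \<le> x" "x \<le> S1" for x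
        using slog_deriv[of x] that pos False S14 by (auto simp: k step_eq_0)
      have "slog S1 = slog S2"
        by (rule DERIV_isconst2[of S2 S1 slog]) (use S False d in \<open>auto intro!: smooth1_continuous_on slog_smooth\<close>)
      then show ?thesis .
    qed
    then show ?thesis by (simp add: slogd_def S1_def[symmetric] S2_def[symmetric] lnq)
  qed
qed

text \<open>The difference of two smoothed logarithms vanishes outside the larger disc and is
  therefore admissible as a test function without any cutoff.\<close>

lemma vsm_diff:
  assumes \<rho>: "0 < \<rho>1" "\<rho>1 \<le> \<rho>2"
  shows "vsm \<rho>2 0 - vsm \<rho>1 0 = (\<integral>\<zeta>. slogd 0 \<rho>2 \<zeta> - slogd 0 \<rho>1 \<zeta> \<partial>\<nu>)"
proof -
  have \<rho>2: "\<rho>2 > 0" using \<rho> by simp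
  have "(\<integral>\<zeta>. slogd 0 \<rho>2 \<zeta> - slogd 0 \<rho>1 \<zeta> \<partial>\<nu>) = (1 / (2*pi)) * (\<integral>\<zeta>. rv \<zeta> * laplacian (\<lambda>\<zeta>. slogd 0 \<rho>2 \<zeta> - slogd 0 \<rho>1 \<zeta>) \<zeta> \<partial>lborel)"
  proof (rule riesz_smooth2[where R = \<rho>2])
    show "slogd 0 \<rho>2 \<zeta> - slogd 0 \<rho>1 \<zeta> = 0" if "norm \<zeta> > \<rho>2" for \<zeta>
      using that \<rho> by (simp add: slogd_eq_ln)
  qed (rule smooth2_diff[OF slogd_smooth2 slogd_smooth2])
  also have "(\<lambda>\<zeta>. rv \<zeta> * laplacian (\<lambda>\<zeta>. slogd 0 \<rho>2 \<zeta> - slogd 0 \<rho>1 \<zeta>) \<zeta>)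
     = (\<lambda>\<zeta>. (2 / \<rho>2\<^sup>2) * (rv \<zeta> * bump ((norm (\<zeta> - 0))\<^sup>2 / \<rho>2\<^sup>2)) - (2 / \<rho>1\<^sup>2) * (rv \<zeta> * bump ((norm (\<zeta> - 0))\<^sup>2 / \<rho>1\<^sup>2)))"
    unfolding laplacian_diff[OF slogd_smooth2 slogd_smooth2] laplacian_slogd[OF \<rho>(1)] laplacian_slogd[OF \<rho>2] sqdist_def by (simp add: algebra_simps)
  also have "(\<integral>\<zeta>. (2 / \<rho>2\<^sup>2) * (rv \<zeta> * bump ((norm (\<zeta> - 0))\<^sup>2 / \<rho>2\<^sup>2)) - (2 / \<rho>1\<^sup>2) * (rv \<zeta> * bump ((norm (\<zeta> - 0))\<^sup>2 / \<rho>1\<^sup>2)) \<partial>lborel)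
     = (2 / \<rho>2\<^sup>2) * (pi * \<rho>2\<^sup>2 * vsm \<rho>2 0) - (2 / \<rho>1\<^sup>2) * (pi * \<rho>1\<^sup>2 * vsm \<rho>1 0)"
    using integrable_rv_bump[OF \<rho>(1), of 0] integrable_rv_bump[OF \<rho>2, of 0] \<rho> \<rho>2
    by (subst Bochner_Integration.integral_diff) (auto simp: vsm_def)
  also have "(1 / (2*pi)) * ((2 / \<rho>2\<^sup>2) * (pi * \<rho>2\<^sup>2 * vsm \<rho>2 0) - (2 / \<rho>1\<^sup>2) * (pi * \<rho>1\<^sup>2 * vsm \<rho>1 0)) = vsm \<rho>2 0 - vsm \<rho>1 0"
    using \<rho> \<rho>2 by (simp add: right_diff_distrib)
  finally show ?thesis ..
qed

lemma vsm_mono: assumes \<rho>: "0 < \<rho>1" "\<rho>1 \<le> \<rho>2" shows "vsm \<rho>1 0 \<le> vsm \<rho>2 0"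
proof -
  have "0 \<le> (\<integral>\<zeta>. slogd 0 \<rho>2 \<zeta> - slogd 0 \<rho>1 \<zeta> \<partial>\<nu>)"
    by (rule integral_nonneg_AE) (use slogd_mono[OF \<rho>] in auto)
  then show ?thesis using vsm_diff[OF \<rho>] by simp
qed

text \<open>The discrete form of Jensen's formula, with a smooth test function in place of \<open>log\<^sup>+\<close>.\<close>
lemma measure_cball_le_vsm:
  assumes \<rho>: "0 < \<rho>" shows "measure \<nu> (cball 0 (\<rho> / 2)) \<le> vsm (exp 1 * \<rho>) 0 - vsm \<rho> 0"
proof -
  have le: "\<rho> \<le> exp 1 * \<rho>" using \<rho> by simp
  let ?d = "\<lambda>\<zeta>. slogd 0 (exp 1 * \<rho>) \<zeta> - slogd 0 \<rho> \<zeta>"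
  have sm: "?d \<in> smooth2" by (rule smooth2_diff[OF slogd_smooth2 slogd_smooth2])
  have z: "?d \<zeta> = 0" if "norm \<zeta> > exp 1 * \<rho>" for \<zeta>
  proof -
    have "\<rho> \<le> norm \<zeta>" using that le by linarith
    then show ?thesis using that \<rho> by (simp add: slogd_eq_ln)
  qed
  obtain B where B: "\<And>\<zeta>. norm (?d \<zeta>) \<le> B" using smooth2_bounded_support[OF sm z] by blast
  have int: "integrable \<nu> ?d"
    by (rule nu_integrable[where R = "exp 1 * \<rho>" and B = B]) (use B z smooth2_measurable[OF sm] in auto)
  \<comment> \<open>With radii in the ratio e the difference is ln e = 1 on the inner disc, and it
    is nonnegative everywhere.\<close>
  have "(\<integral>\<zeta>. indicat_real (cball 0 (\<rho> / 2)) \<zeta> \<partial>\<nu>) \<le> (\<integral>\<zeta>. ?d \<zeta> \<partial>\<nu>)"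
  proof (rule integral_mono[OF _ int])
    show "integrable \<nu> (indicat_real (cball 0 (\<rho> / 2)))"
      using nu_cball[of "\<rho>/2"] by (intro integrable_real_indicator) auto
    show "indicat_real (cball 0 (\<rho> / 2)) \<zeta> \<le> ?d \<zeta>" for \<zeta>
      using slogd_mono[OF \<rho> le, of \<zeta>] slogd_diff_eq[OF \<rho> le, of \<zeta>] \<rho> by (auto simp: indicator_def)
  qed
  then show ?thesis using vsm_diff[OF \<rho> le] sets_eq_imp_space_eq[OF sets_nu] by simp
qed

end

subsection \<open>Logarithmic integrals on a half-line\<close>

text \<open>The truncated form of log|1 - t^2|. The factors 1 - t and 1 + t are truncated
  separately, because opposite points are replaced by zeros separately.\<close>

definition tlog2 :: "real \<Rightarrow> complex \<Rightarrow> real" where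
  "tlog2 \<rho> t = tlog \<rho> t + tlog \<rho> (- t)"

lemma tlog2_measurable [measurable]: "tlog2 \<rho> \<in> borel_measurable borel"
  unfolding tlog2_def by measurable

lemma tlog2_eq: "0 < \<rho> \<Longrightarrow> tlog2 \<rho> t = ln (max (norm (1 - t)) \<rho> * max (norm (1 + t)) \<rho>)"
  unfolding tlog2_def tlog_def by (subst ln_mult) auto

lemma norm_one_minus_sq: "norm (1 - t) * norm (1 + t) = norm (1 - (t::complex)\<^sup>2)"
  by (simp add: norm_mult[symmetric] power2_eq_square algebra_simps)

lemma tlog2_ge: assumes "0 < \<rho>" "t\<^sup>2 \<noteq> 1" shows "ln (norm (1 - t\<^sup>2)) \<le> tlog2 \<rho> t"
  unfolding tlog2_eq[OF assms(1)] norm_one_minus_sq[symmetric]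
  using assms norm_one_minus_sq[of t] by (intro ln_mono mult_mono) (auto simp: zero_less_mult_iff power2_eq_square square_eq_1_iff)

lemma tlog2_eq_ln:
  assumes "0 < \<rho>" "\<rho> \<le> norm (1 - t)" "\<rho> \<le> norm (1 + t)" shows "tlog2 \<rho> t = ln (norm (1 - t\<^sup>2))"
  using assms by (simp add: tlog2_eq max_absorb1 norm_one_minus_sq)

text \<open>Near a pole the product is at most 1/4 times 3, below 1; elsewhere the truncation is
  inactive and |1 - t^2| is at most 1 + |t|^2.\<close>

lemma tlog2_le:
  assumes \<rho>: "0 < \<rho>" "\<rho> \<le> 1/4" shows "tlog2 \<rho> t \<le> ln (1 + (norm t)\<^sup>2)"
proof -
  have key: "max (norm (1 - s)) \<rho> * max (norm (1 + s)) \<rho> \<le> 1 + (norm s)\<^sup>2" if "norm (1 - s) < \<rho>" for s :: complex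
  proof -
    have "norm (1 + s) \<le> 2 + norm (1 - s)" using norm_triangle_ineq4[of 2 "1 - s"] by (simp add: algebra_simps)
    then have "max (norm (1 + s)) \<rho> \<le> 3" using that \<rho> by simp
    then have "max (norm (1 - s)) \<rho> * max (norm (1 + s)) \<rho> \<le> (1/4) * 3" using that \<rho> by (intro mult_mono) auto
    also have "\<dots> \<le> 1 + (norm s)\<^sup>2" using zero_le_power2[of "norm s"] by linarith
    finally show ?thesis .
  qed
  have "max (norm (1 - t)) \<rho> * max (norm (1 + t)) \<rho> \<le> 1 + (norm t)\<^sup>2"
  proof (cases "norm (1 - t) < \<rho> \<or> norm (1 + t) < \<rho>")
    case True
    then show ?thesis using key[of t] key[of "- t"] by (auto simp: mult.commute)
  next
    case False
    have "norm (1 - t\<^sup>2) \<le> 1 + (norm t)\<^sup>2" using norm_triangle_ineq4[of 1 "t\<^sup>2"] by (simp add: norm_power)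
    then show ?thesis using False by (simp add: max_absorb1 norm_one_minus_sq)
  qed
  then show ?thesis unfolding tlog2_eq[OF \<rho>(1)] using \<rho> by (intro ln_mono mult_pos_pos) auto
qed

lemma ln_one_plus_ge: "0 \<le> x \<Longrightarrow> x / (1 + x) \<le> ln (1 + (x::real))"
  using ln_le_minus_one[of "1 / (1 + x)"] by (simp add: ln_div field_simps)

text \<open>The linear terms of the two opposite factors cancel, so the size near 0 is |t|^2, which
  makes integrals over whole rays converge. For |t| above 1/2 the right-hand logarithm is at least
  1/5, so the factor 10 absorbs twice |ln \<open>\<rho>\<close>|.\<close>

lemma abs_tlog2_le:
  assumes \<rho>: "0 < \<rho>" "\<rho> \<le> 1/4" shows "\<bar>tlog2 \<rho> t\<bar> \<le> (4 + 10 * \<bar>ln \<rho>\<bar>) * ln (1 + (norm t)\<^sup>2)"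
proof -
  define x where "x = (norm t)\<^sup>2"
  have x0: "x \<ge> 0" by (simp add: x_def)
  have lx: "x / (1 + x) \<le> ln (1 + x)" by (rule ln_one_plus_ge[OF x0])
  have l0: "0 \<le> ln (1 + x)" using x0 by simp
  have up: "tlog2 \<rho> t \<le> 1 * ln (1 + x)" unfolding x_def using tlog2_le[OF \<rho>, of t] by simp
  also have "\<dots> \<le> (4 + 10 * \<bar>ln \<rho>\<bar>) * ln (1 + x)" using l0 by (intro mult_right_mono) auto
  finally have 1: "tlog2 \<rho> t \<le> (4 + 10 * \<bar>ln \<rho>\<bar>) * ln (1 + x)" .
  have 2: "- tlog2 \<rho> t \<le> (4 + 10 * \<bar>ln \<rho>\<bar>) * ln (1 + x)"
  proof (cases "norm t \<le> 1/2")
    case True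
    have x4: "x \<le> 1/4" unfolding x_def using power_mono[OF True, of 2] by (simp add: power_divide)
    have "1/2 \<le> norm (1 - t)" "1/2 \<le> norm (1 + t)"
      using norm_triangle_ineq2[of 1 t] norm_triangle_ineq2[of 1 "- t"] True by auto
    then have "tlog2 \<rho> t = ln (norm (1 - t\<^sup>2))" using \<rho> by (intro tlog2_eq_ln) auto
    moreover have "1 - x \<le> norm (1 - t\<^sup>2)" using norm_triangle_ineq2[of 1 "t\<^sup>2"] by (simp add: x_def norm_power)
    then have "ln (1 - x) \<le> ln (norm (1 - t\<^sup>2))" using x4 by (intro ln_mono) auto
    moreover have "- x - 2 * x\<^sup>2 \<le> ln (1 - x)" using x0 x4 by (intro ln_one_minus_pos_lower_bound) auto
    moreover have "x\<^sup>2 \<le> (1/4) * x" using x0 x4 mult_right_mono[of x "1/4" x] by (simp add: power2_eq_square)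
    ultimately have "- tlog2 \<rho> t \<le> 2 * x" using x0 by linarith
    also have "\<dots> \<le> 4 * (x / (1 + x))" using x0 x4 mult_left_mono[of x "1/4" x] by (simp add: field_simps)
    also have "\<dots> \<le> 4 * ln (1 + x)" using lx by simp
    also have "\<dots> \<le> (4 + 10 * \<bar>ln \<rho>\<bar>) * ln (1 + x)" using l0 by (intro mult_right_mono) auto
    finally show ?thesis .
  next
    case False
    then have "(1/2)\<^sup>2 \<le> x" unfolding x_def by (intro power_mono) auto
    then have "1/5 \<le> x / (1 + x)" by (simp add: field_simps power_divide)
    then have l5: "1/5 \<le> ln (1 + x)" using lx by linarith
    have "- tlog2 \<rho> t \<le> 2 * \<bar>ln \<rho>\<bar>" unfolding tlog2_def using tlog_ge_ln[OF \<rho>(1), of t] tlog_ge_ln[OF \<rho>(1), of "- t"] by linarith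
    also have "\<dots> = (10 * \<bar>ln \<rho>\<bar>) * (1/5)" by simp
    also have "\<dots> \<le> (4 + 10 * \<bar>ln \<rho>\<bar>) * ln (1 + x)" using l5 by (intro mult_mono) auto
    finally show ?thesis .
  qed
  show ?thesis using 1 2 unfolding x_def[symmetric] by linarith
qed

lemma tlog2_nonneg: assumes "0 < \<rho>" "\<rho> \<le> 1" "norm t \<ge> 2" shows "0 \<le> tlog2 \<rho> t"
proof -
  have "1 \<le> norm (1 - t)" "1 \<le> norm (1 + t)"
    using norm_triangle_ineq2[of t 1] norm_triangle_ineq2[of t "-1"] assms by (auto simp: norm_minus_commute add.commute)
  then have "ln 1 \<le> tlog \<rho> t" "ln 1 \<le> tlog \<rho> (- t)" unfolding tlog_def using assms by (auto intro!: ln_mono)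
  then show ?thesis by (simp add: tlog2_def)
qed

lemma einterval_0_inf: "einterval 0 \<infinity> = {0<..}"
  by (auto simp: einterval_def zero_ereal_def)

lemma interval_integral_0_inf: "(LBINT x=0..\<infinity>. f x) = (LINT x:{0<..}|lborel. f x)"
  using interval_integral_to_infinity_eq[of lborel 0 f] by (simp add: zero_ereal_def)

lemma tendsto_at_right_0_ereal: "((F \<circ> real_of_ereal) \<longlongrightarrow> A) (at_right 0) \<longleftrightarrow> (F \<longlongrightarrow> A) (at_right (0::real))"
  by (simp add: zero_ereal_def ereal_tendsto_simps)

lemma tendsto_at_left_inf_ereal: "((F \<circ> real_of_ereal) \<longlongrightarrow> A) (at_left \<infinity>) \<longleftrightarrow> (F \<longlongrightarrow> A) at_top"
  by (simp add: ereal_tendsto_simps)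

lemma ln_one_plus_sq_le: assumes "y \<ge> 0" shows "ln (1 + y\<^sup>2) \<le> 4 * sqrt (y::real)"
proof -
  have "1 + y\<^sup>2 \<le> (1 + y)\<^sup>2" using assms by (simp add: power2_eq_square algebra_simps)
  also have "1 + y \<le> (1 + sqrt y)\<^sup>2" using assms by (simp add: power2_sum)
  then have "(1 + y)\<^sup>2 \<le> ((1 + sqrt y)\<^sup>2)\<^sup>2" using assms by (intro power_mono) auto
  finally have "1 + y\<^sup>2 \<le> (1 + sqrt y) ^ 4" by (simp add: power_mult[symmetric])
  then have "ln (1 + y\<^sup>2) \<le> ln ((1 + sqrt y) ^ 4)" by (intro ln_mono) (auto intro: add_pos_nonneg)
  also have "\<dots> = 4 * ln (1 + sqrt y)" using assms by (subst ln_realpow) (auto intro: add_pos_nonneg)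
  also have "\<dots> \<le> 4 * sqrt y" using assms by (intro mult_left_mono ln_add_one_self_le_self) auto
  finally show ?thesis .
qed

text \<open>An antiderivative is x ln(1 + (a/x)^2) + 2a arctan(x/a). Its first term vanishes at both
  ends and the arctangent supplies \<pi> a.\<close>

lemma
  assumes a: "a > 0"
  shows set_integrable_ln_one_plus_sq: "set_integrable lborel {0<..} (\<lambda>x. ln (1 + (a / x)\<^sup>2))"
    and integral_ln_one_plus_sq: "(LINT x:{0<..}|lborel. ln (1 + (a / x)\<^sup>2)) = pi * a"
proof -
  let ?f = "\<lambda>x. ln (1 + (a / x)\<^sup>2)"
  let ?F = "\<lambda>x. x * ln (1 + (a / x)\<^sup>2) + 2 * a * arctan (x / a)"
  have pos: "1 + (a / x)\<^sup>2 > 0" for x by (simp add: add_pos_nonneg)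
  have d: "DERIV ?F x :> ?f x" if "x > 0" for x
  proof -
    have "DERIV ?F x :> x * ((2 * (a / x) * (- a / x\<^sup>2)) / (1 + (a / x)\<^sup>2)) + ?f x + 2 * a * ((1 / a) / (1 + (x / a)\<^sup>2))"
    proof -
      have d1: "DERIV (\<lambda>x. a / x) x :> - a / x\<^sup>2"
        using that by (auto intro!: derivative_eq_intros simp: power2_eq_square)
      have d2: "DERIV (\<lambda>x. 1 + (a / x)\<^sup>2) x :> 2 * (a / x) * (- a / x\<^sup>2)"
        using DERIV_add[OF DERIV_const[of 1] DERIV_power[OF d1, of 2]] by (simp add: mult_ac)
      have d3: "DERIV (\<lambda>x. ln (1 + (a / x)\<^sup>2)) x :> (2 * (a / x) * (- a / x\<^sup>2)) / (1 + (a / x)\<^sup>2)"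
        using DERIV_chain2[OF DERIV_ln_divide[OF pos[of x]] d2] by (simp add: mult_ac)
      have d4: "DERIV (\<lambda>x. arctan (x / a)) x :> (1 / a) / (1 + (x / a)\<^sup>2)"
        using DERIV_chain2[OF DERIV_arctan DERIV_cdivide[OF DERIV_ident, of a x UNIV]] by (simp add: field_simps)
      show ?thesis
        using DERIV_add[OF DERIV_mult[OF DERIV_ident d3] DERIV_cmult[OF d4, of "2 * a"]] by (simp only: mult_1 mult.commute add.commute)
    qed
    moreover have "x * ((2 * (a / x) * (- a / x\<^sup>2)) / (1 + (a / x)\<^sup>2)) = - 2 * a\<^sup>2 / (x\<^sup>2 + a\<^sup>2)"
    proof -
      have "1 + (a / x)\<^sup>2 = (x\<^sup>2 + a\<^sup>2) / x\<^sup>2" using that by (simp add: field_simps)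
      then show ?thesis using that by (simp add: power2_eq_square)
    qed
    moreover have "2 * a * ((1 / a) / (1 + (x / a)\<^sup>2)) = 2 * a\<^sup>2 / (x\<^sup>2 + a\<^sup>2)"
    proof -
      have "1 + (x / a)\<^sup>2 = (x\<^sup>2 + a\<^sup>2) / a\<^sup>2" using a by (simp add: field_simps)
      then show ?thesis using a by (simp add: power2_eq_square)
    qed
    ultimately show ?thesis by simp
  qed
  have c: "isCont ?f x" if "x > 0" for x
    using that pos[of x] by (intro continuous_intros) auto
  have z: "((\<lambda>x. x * ln (1 + (a / x)\<^sup>2)) \<longlongrightarrow> 0) (at_right 0)"
  proof (rule tendsto_sandwich[of "\<lambda>_. 0" _ _ "\<lambda>x. 4 * sqrt (a * x)"])
    show "eventually (\<lambda>x. 0 \<le> x * ln (1 + (a / x)\<^sup>2)) (at_right 0)"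
      by (auto simp: eventually_at_filter)
    show "eventually (\<lambda>x. x * ln (1 + (a / x)\<^sup>2) \<le> 4 * sqrt (a * x)) (at_right 0)"
      unfolding eventually_at_filter
    proof (rule always_eventually, intro allI impI)
      fix x :: real assume "x \<in> {0<..}"
      then have x: "x > 0" by simp
      have "x * ln (1 + (a / x)\<^sup>2) \<le> x * (4 * sqrt (a / x))" using x a by (intro mult_left_mono ln_one_plus_sq_le) auto
      also have "\<dots> = 4 * sqrt (x\<^sup>2 * (a / x))" using x by (simp only: real_sqrt_mult) simp
      also have "x\<^sup>2 * (a / x) = a * x" using x by (simp add: power2_eq_square)
      finally show "x * ln (1 + (a / x)\<^sup>2) \<le> 4 * sqrt (a * x)" .
    qed
    have "((\<lambda>x. 4 * sqrt (a * x)) \<longlongrightarrow> 4 * sqrt (a * 0)) (at_right 0)" by (intro tendsto_intros)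
    then show "((\<lambda>x. 4 * sqrt (a * x)) \<longlongrightarrow> 0) (at_right 0)" by simp
  qed simp
  have i: "((\<lambda>x. x * ln (1 + (a / x)\<^sup>2)) \<longlongrightarrow> 0) at_top"
  proof (rule tendsto_sandwich[of "\<lambda>_. 0" _ _ "\<lambda>x. a\<^sup>2 / x"])
    show "eventually (\<lambda>x. 0 \<le> x * ln (1 + (a / x)\<^sup>2)) at_top"
      using eventually_ge_at_top[of 0] by eventually_elim simp
    show "eventually (\<lambda>x. x * ln (1 + (a / x)\<^sup>2) \<le> a\<^sup>2 / x) at_top"
      using eventually_gt_at_top[of 0]
    proof eventually_elim
      case (elim x)
      then have "x * ln (1 + (a / x)\<^sup>2) \<le> x * (a / x)\<^sup>2" by (intro mult_left_mono ln_add_one_self_le_self) auto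
      then show ?case using elim by (simp add: power2_eq_square)
    qed
    show "((\<lambda>x. a\<^sup>2 / x) \<longlongrightarrow> 0) at_top"
      by (rule real_tendsto_divide_at_top[OF tendsto_const filterlim_ident])
  qed simp
  have A: "((?F \<circ> real_of_ereal) \<longlongrightarrow> 0) (at_right 0)"
  proof -
    have "((\<lambda>x. x / a) \<longlongrightarrow> 0 / a) (at_right 0)" by (intro tendsto_intros) (use a in simp)
    then have "((\<lambda>x. arctan (x / a)) \<longlongrightarrow> 0) (at_right 0)" using tendsto_arctan by fastforce
    from tendsto_add[OF z tendsto_mult[OF tendsto_const[of "2 * a"] this]] show ?thesis
      unfolding tendsto_at_right_0_ereal by simp
  qed
  have B: "((?F \<circ> real_of_ereal) \<longlongrightarrow> pi * a) (at_left \<infinity>)"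
  proof -
    have "filterlim (\<lambda>x. x / a) at_top at_top"
      using a filterlim_tendsto_pos_mult_at_top[of "\<lambda>_. 1/a" "1/a" at_top "\<lambda>x. x"] by (simp add: filterlim_ident)
    then have "((\<lambda>x. arctan (x / a)) \<longlongrightarrow> pi / 2) at_top" by (rule filterlim_compose[OF tendsto_arctan_at_top])
    from tendsto_add[OF i tendsto_mult[OF tendsto_const[of "2 * a"] this]] show ?thesis
      unfolding tendsto_at_left_inf_ereal by (simp add: mult.commute)
  qed
  have nn: "AE x in lborel. (0::ereal) < ereal x \<longrightarrow> ereal x < \<infinity> \<longrightarrow> 0 \<le> ?f x" by simp
  note FTC = interval_integral_FTC_nonneg[of 0 \<infinity> ?F ?f, OF _ _ _ nn A B]
  show "set_integrable lborel {0<..} ?f"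
    using FTC(1) d c by (simp add: einterval_0_inf)
  show "(LINT x:{0<..}|lborel. ?f x) = pi * a"
    using FTC(2) d c by (simp add: interval_integral_0_inf)
qed

lemma norm_div_of_real: "x > 0 \<Longrightarrow> norm (z / complex_of_real x) = norm z / x"
  by (simp add: norm_divide)

lemma set_integrable_tlog2:
  assumes \<rho>: "0 < \<rho>" "\<rho> \<le> 1/4" shows "set_integrable lborel {0<..} (\<lambda>x. tlog2 \<rho> (z / of_real x))"
proof -
  \<comment> \<open>The added 1 keeps the parameter positive when z = 0.\<close>
  have "set_integrable lborel {0<..} (\<lambda>x. (4 + 10 * \<bar>ln \<rho>\<bar>) * ln (1 + ((norm z + 1) / x)\<^sup>2))"
    by (intro set_integrable_mult_right set_integrable_ln_one_plus_sq) (simp add: add_nonneg_pos)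
  then show ?thesis
  proof (rule set_integrable_bound)
    show "AE x in lborel. x \<in> {0<..} \<longrightarrow> norm (tlog2 \<rho> (z / of_real x)) \<le> norm ((4 + 10 * \<bar>ln \<rho>\<bar>) * ln (1 + ((norm z + 1) / x)\<^sup>2))"
    proof (rule AE_I2, rule impI)
      fix x :: real assume "x \<in> {0<..}"
      then have x: "x > 0" by simp
      have "\<bar>tlog2 \<rho> (z / of_real x)\<bar> \<le> (4 + 10 * \<bar>ln \<rho>\<bar>) * ln (1 + (norm z / x)\<^sup>2)"
        using abs_tlog2_le[OF \<rho>, of "z / of_real x"] x by (simp add: norm_divide)
      also have "\<dots> \<le> (4 + 10 * \<bar>ln \<rho>\<bar>) * ln (1 + ((norm z + 1) / x)\<^sup>2)"
        using x by (intro mult_left_mono ln_mono add_left_mono power_mono divide_right_mono) (auto intro: add_pos_nonneg)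
      also have "\<dots> \<le> norm ((4 + 10 * \<bar>ln \<rho>\<bar>) * ln (1 + ((norm z + 1) / x)\<^sup>2))" by simp
      finally show "norm (tlog2 \<rho> (z / of_real x)) \<le> norm ((4 + 10 * \<bar>ln \<rho>\<bar>) * ln (1 + ((norm z + 1) / x)\<^sup>2))" by simp
    qed
  qed (simp add: set_borel_measurable_def)
qed

lemma DERIV_Re_of_real:
  assumes "(G has_field_derivative D) (at (complex_of_real x))"
  shows "((\<lambda>x. Re (G (of_real x))) has_real_derivative Re D) (at x)"
  using bounded_linear.has_vector_derivative[OF bounded_linear_Re has_vector_derivative_real_field[OF assms]]
  by (simp add: has_real_derivative_iff_has_vector_derivative o_def)

lemma real_minus_notin_nonpos: "Im z \<noteq> 0 \<Longrightarrow> of_real x - z \<notin> \<real>\<^sub>\<le>\<^sub>0" "Im z \<noteq> 0 \<Longrightarrow> of_real x + z \<notin> \<real>\<^sub>\<le>\<^sub>0"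
  by (auto simp: complex_nonpos_Reals_iff)

lemma Ln_minus_pi: "Im z > 0 \<Longrightarrow> Ln (- z) = Ln z - \<i> * pi"
  using Ln_minus[of z] by (cases "z = 0") (auto split: if_splits)

text \<open>The quotient |Im z|/|z| is the distance from 1 to the line through 0 and z, on which all
  points z/x lie; up to that size the truncation is inactive.\<close>

lemma tlog2_eq_ln_real:
  assumes "Im z \<noteq> 0" "x > 0" "0 < \<rho>" "\<rho> \<le> \<bar>Im z\<bar> / norm z"
  shows "tlog2 \<rho> (z / of_real x) = ln (norm (1 - (z / of_real x)\<^sup>2))"
proof (rule tlog2_eq_ln)
  have z: "norm z > 0" using assms by auto
  have *: "\<bar>Im s\<bar> / norm s \<le> norm (1 - s / of_real x)" if "Im s \<noteq> 0" for s
  proof -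
    have "\<bar>Im s\<bar> * x \<le> norm s * norm (of_real x - s)"
    proof -
      have "Im (cnj s * (of_real x - s)) = - Im s * x" by (simp add: algebra_simps)
      then show ?thesis using abs_Im_le_cmod[of "cnj s * (of_real x - s)"] assms by (simp add: norm_mult abs_mult)
    qed
    moreover have "norm (1 - s / of_real x) = norm (of_real x - s) / x"
      using assms by (simp add: norm_div_of_real[symmetric] diff_divide_distrib)
    moreover have "norm s > 0" using that by auto
    ultimately have "\<bar>Im s\<bar> * x \<le> norm s * (norm (1 - s / of_real x) * x)" "norm s > 0" using assms by simp_all
    then show ?thesis using assms by (simp add: mult.assoc[symmetric] pos_divide_le_eq mult.commute)
  qed
  show "\<rho> \<le> norm (1 - z / of_real x)" using *[of z] assms by linarith
  show "\<rho> \<le> norm (1 + z / of_real x)" using *[of "- z"] assms by simp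
qed fact

text \<open>The integrand is the derivative of Re((x - z) Ln(x - z) + (x + z) Ln(x + z)) - 2 x ln x.
  This tends to 0 at infinity, and at 0 to Re(\<i> \<pi> z) = -\<pi> Im z, because Ln(-z) = Ln z -
  \<i> \<pi> in the upper half-plane.\<close>

lemma integral_ln_one_minus_sq_pos:
  assumes z: "Im z > 0"
  shows "set_integrable lborel {0<..} (\<lambda>x. ln (norm (1 - (z / of_real x)\<^sup>2)))"
    and "(LINT x:{0<..}|lborel. ln (norm (1 - (z / of_real x)\<^sup>2))) = pi * Im z"
proof -
  have z0: "z \<noteq> 0" "norm z > 0" using z by auto
  define \<rho> where "\<rho> = min (1/4) (Im z / norm z)"
  have \<rho>: "0 < \<rho>" "\<rho> \<le> 1/4" "\<rho> \<le> \<bar>Im z\<bar> / norm z" using z z0 unfolding \<rho>_def by (simp_all only: min.cobounded1) (auto simp: min_def)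
  let ?f = "\<lambda>x. ln (norm (1 - (z / complex_of_real x)\<^sup>2))"
  have eq: "tlog2 \<rho> (z / of_real x) = ?f x" if "x > 0" for x
    using that z \<rho> by (intro tlog2_eq_ln_real) auto
  show si: "set_integrable lborel {0<..} ?f"
    using set_integrable_tlog2[OF \<rho>(1,2), of z] by (rule set_integrable_cong[THEN iffD1, rotated -1]) (auto simp: eq)
  let ?G = "\<lambda>w. (w - z) * Ln (w - z) + (w + z) * Ln (w + z)"
  let ?F = "\<lambda>x. Re (?G (of_real x)) - 2 * (x * ln x)"
  have nz: "of_real x - z \<noteq> 0" "of_real x + z \<noteq> 0" for x :: real using z by (auto simp: complex_eq_iff)
  have feq: "?f x = Re (Ln (of_real x - z)) + Re (Ln (of_real x + z)) - 2 * ln x" if "x > 0" for x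
  proof -
    have "1 - (z / of_real x)\<^sup>2 = (of_real x - z) * (of_real x + z) / (of_real x)\<^sup>2"
      using that by (simp add: field_simps power2_eq_square)
    then have "norm (1 - (z / of_real x)\<^sup>2) = norm (of_real x - z) * norm (of_real x + z) / x\<^sup>2"
      by (simp add: norm_mult norm_divide norm_power)
    then show ?thesis using that nz by (simp add: ln_div ln_mult ln_realpow Re_Ln)
  qed
  have d: "(?F has_real_derivative ?f x) (at x)" if "x > 0" for x
  proof -
    have "(?G has_field_derivative (Ln (of_real x - z) + 1 + (Ln (of_real x + z) + 1))) (at (of_real x))"
      using nz[of x] real_minus_notin_nonpos[of z x] z by (auto intro!: derivative_eq_intros)
    note Gd = DERIV_Re_of_real[OF this]
    have dl: "((\<lambda>x. 2 * (x * ln x)) has_real_derivative 2 * (x * (1 / x) + 1 * ln x)) (at x)"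
      using that by (auto intro!: derivative_eq_intros)
    have "(?F has_real_derivative (Re (Ln (of_real x - z) + 1 + (Ln (of_real x + z) + 1)) - 2 * (x * (1 / x) + 1 * ln x))) (at x)"
      by (rule DERIV_diff[OF Gd dl])
    then show ?thesis using that by (simp add: feq)
  qed
  have c: "isCont ?f x" if "x > 0" for x
  proof -
    have "1 - (z / of_real x)\<^sup>2 \<noteq> 0"
      using nz[of x] that by (auto simp: field_simps power2_eq_square square_eq_iff)
    then show ?thesis using that by (intro continuous_intros) auto
  qed
  have xl: "((\<lambda>x::real. x * ln x) \<longlongrightarrow> 0) (at_right 0)"
  proof (rule Lim_null_comparison)
    show "eventually (\<lambda>x. norm (x * ln x) \<le> 2 * sqrt x) (at_right (0::real))"
      unfolding eventually_at_right_field
    proof (intro exI[of _ 1] conjI allI impI)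
      fix x :: real assume x: "0 < x" "x < 1"
      have "ln (1 / sqrt x) \<le> 1 / sqrt x - 1" using x by (intro ln_le_minus_one) auto
      then have "- ln x \<le> 2 / sqrt x" using x by (simp add: ln_div ln_sqrt)
      then have "x * (- ln x) \<le> x * (2 / sqrt x)" using x by (intro mult_left_mono) auto
      also have "x * (2 / sqrt x) = 2 * sqrt x" using x real_sqrt_mult_self[of x] by (simp add: field_simps)
      finally show "norm (x * ln x) \<le> 2 * sqrt x" using x by (simp add: abs_mult)
    qed simp
    have "((\<lambda>x. 2 * sqrt x) \<longlongrightarrow> 2 * sqrt 0) (at_right 0)" by (intro tendsto_intros)
    then show "((\<lambda>x. 2 * sqrt x) \<longlongrightarrow> 0) (at_right (0::real))" by simp
  qed
  have A: "((?F \<circ> real_of_ereal) \<longlongrightarrow> - pi * Im z) (at_right 0)"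
  proof -
    have "isCont ?G (of_real 0)"
      using real_minus_notin_nonpos[of z 0] z by (intro continuous_intros) auto
    then have "isCont (\<lambda>x. ?G (of_real x)) 0"
      by (intro isCont_o2[where g = ?G and f = of_real]) auto
    then have "((\<lambda>x. ?G (of_real x)) \<longlongrightarrow> ?G 0) (at 0)"
      unfolding isCont_def by simp
    then have "((\<lambda>x. ?G (of_real x)) \<longlongrightarrow> ?G 0) (at_right 0)"
      by (rule tendsto_mono[rotated]) (simp add: at_le)
    from tendsto_diff[OF tendsto_Re[OF this] tendsto_mult[OF tendsto_const xl]]
    have "(?F \<longlongrightarrow> Re (?G 0) - 2 * 0) (at_right 0)" .
    moreover have "Re (?G 0) = - pi * Im z" using z by (simp add: Ln_minus_pi algebra_simps)
    ultimately show ?thesis unfolding tendsto_at_right_0_ereal by simp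
  qed
  have B: "((?F \<circ> real_of_ereal) \<longlongrightarrow> 0) (at_left \<infinity>)"
    unfolding tendsto_at_left_inf_ereal
  proof (rule Lim_null_comparison)
    \<comment> \<open>With u = z/x the two logarithms are ln x - u and ln x + u up to errors
      O(|u|^2). The terms in ln x and those of order x u cancel, leaving O(|z|^2 / x).\<close>
    show "eventually (\<lambda>x. norm (?F x) \<le> 8 * (norm z)\<^sup>2 / x) at_top"
      using eventually_ge_at_top[of "2 * norm z"] eventually_gt_at_top[of 0]
    proof eventually_elim
      case (elim x)
      define u where "u = z / of_real x"
      have u: "norm u \<le> 1/2" using elim by (simp add: u_def norm_divide field_simps)
      have app: "norm (Ln (1 + w) - w) \<le> 2 * (norm u)\<^sup>2" if "norm w = norm u" for w
      proof -
        have "norm (Ln (1 + w) - w) \<le> norm w ^ 2 / (1 - norm w)" using u that by (intro Ln_approx_linear) auto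
        also have "\<dots> \<le> norm w ^ 2 / (1/2)" using u that by (intro divide_left_mono) auto
        finally show ?thesis using that by simp
      qed
      define e1 e2 where "e1 = Ln (1 + (- u)) - (- u)" and "e2 = Ln (1 + u) - u"
      have e: "norm e1 \<le> 2 * (norm u)\<^sup>2" "norm e2 \<le> 2 * (norm u)\<^sup>2" unfolding e1_def e2_def by (rule app, simp)+
      have L: "Ln (of_real x - z) = of_real (ln x) + (- u + e1)" "Ln (of_real x + z) = of_real (ln x) + (u + e2)"
      proof -
        have n1: "1 + (- u) \<noteq> 0" "1 + u \<noteq> 0" using nz[of x] elim by (auto simp: u_def field_simps)
        have "of_real x - z = of_real x * (1 + (- u))" "of_real x + z = of_real x * (1 + u)"
          using elim by (auto simp: u_def field_simps)
        then show "Ln (of_real x - z) = of_real (ln x) + (- u + e1)" "Ln (of_real x + z) = of_real (ln x) + (u + e2)"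
          using Ln_times_of_real[OF elim(2) n1(1)] Ln_times_of_real[OF elim(2) n1(2)] elim
          by (simp_all add: e1_def e2_def Ln_of_real)
      qed
      have "?G (of_real x) = of_real (2 * (x * ln x)) + (of_real x * (e1 + e2) + 2 * z * u + z * (e2 - e1))"
        unfolding L by (simp add: algebra_simps)
      then have "?F x = Re (of_real x * (e1 + e2) + 2 * z * u + z * (e2 - e1))" by simp
      then have "norm (?F x) \<le> norm (of_real x * (e1 + e2) + 2 * z * u + z * (e2 - e1))"
        using abs_Re_le_cmod[of "of_real x * (e1 + e2) + 2 * z * u + z * (e2 - e1)"] by simp
      also have "\<dots> \<le> norm (of_real x * (e1 + e2)) + norm (2 * z * u) + norm (z * (e2 - e1))"
        by (meson norm_triangle_le add_right_mono norm_triangle_ineq)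
      also have "\<dots> \<le> x * (4 * (norm u)\<^sup>2) + 2 * norm z * norm u + norm z * (4 * (norm u)\<^sup>2)"
      proof -
        have "norm (e1 + e2) \<le> 4 * (norm u)\<^sup>2" "norm (e2 - e1) \<le> 4 * (norm u)\<^sup>2"
          using e norm_triangle_ineq[of e1 e2] norm_triangle_ineq4[of e2 e1] by linarith+
        then have "x * norm (e1 + e2) \<le> x * (4 * (norm u)\<^sup>2)" "norm z * norm (e2 - e1) \<le> norm z * (4 * (norm u)\<^sup>2)"
          using elim by (auto intro!: mult_left_mono)
        then have "x * norm (e1 + e2) + norm z * norm (e2 - e1) \<le> x * (4 * (norm u)\<^sup>2) + norm z * (4 * (norm u)\<^sup>2)"
          by (rule add_mono)
        then show ?thesis using elim by (simp add: norm_mult)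
      qed
      also have "norm z * (4 * (norm u)\<^sup>2) \<le> 2 * norm z * norm u"
      proof -
        have "(norm z * norm u) * (4 * norm u) \<le> (norm z * norm u) * 2" using u by (intro mult_left_mono) auto
        then show ?thesis by (simp add: power2_eq_square mult_ac)
      qed
      also have "x * (4 * (norm u)\<^sup>2) + 2 * norm z * norm u + 2 * norm z * norm u = 8 * (norm z)\<^sup>2 / x"
        using elim by (simp add: u_def norm_divide power2_eq_square field_simps)
      finally show ?case by simp
    qed
    show "((\<lambda>x. 8 * (norm z)\<^sup>2 / x) \<longlongrightarrow> 0) at_top"
      by (rule real_tendsto_divide_at_top[OF tendsto_const filterlim_ident])
  qed
  have "(LBINT x=0..\<infinity>. ?f x) = 0 - (- pi * Im z)"
    by (rule interval_integral_FTC_integrable[where F = ?F, OF _ _ _ _ A B])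
       (use d c si in \<open>auto simp: einterval_0_inf has_real_derivative_iff_has_vector_derivative\<close>)
  then show "(LINT x:{0<..}|lborel. ?f x) = pi * Im z" by (simp add: interval_integral_0_inf)
qed

lemma integral_ln_one_minus_sq:
  assumes z: "Im z \<noteq> 0"
  shows "set_integrable lborel {0<..} (\<lambda>x. ln (norm (1 - (z / of_real x)\<^sup>2)))"
    and "(LINT x:{0<..}|lborel. ln (norm (1 - (z / of_real x)\<^sup>2))) = pi * \<bar>Im z\<bar>"
  using integral_ln_one_minus_sq_pos[of z] integral_ln_one_minus_sq_pos[of "- z"] z
  by (cases "Im z > 0"; simp)+

text \<open>The truncation is absorbed by moving \<open>z\<close> a distance \<open>2 \<rho> |z|\<close> away from the real axis.\<close>
lemma integral_tlog2_le:
  assumes \<rho>: "0 < \<rho>" "\<rho> \<le> 1/4" and z: "z \<noteq> 0"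
  shows "(LINT x:{0<..}|lborel. tlog2 \<rho> (z / of_real x)) \<le> pi * (\<bar>Im z\<bar> + 2 * \<rho> * norm z)"
proof -
  define d where "d = (if Im z \<ge> 0 then 2 * \<rho> * norm z else - (2 * \<rho> * norm z))"
  define z' where "z' = z + \<i> * of_real d"
  have Im': "Im z' = Im z + d" by (simp add: z'_def)
  have pos: "2 * \<rho> * norm z > 0" using \<rho> z by simp
  then have d: "\<bar>Im z + d\<bar> = \<bar>Im z\<bar> + 2 * \<rho> * norm z" unfolding d_def by (simp split: if_split)
  have I0: "Im z' \<noteq> 0" using Im' d pos by auto
  have key: "tlog \<rho> (s / of_real x) \<le> ln (norm (1 - s' / of_real x))"
    if x: "x > 0" and s: "Re s' = Re s" "\<bar>Im s'\<bar> = \<bar>Im s\<bar> + 2 * \<rho> * norm z" "norm s = norm z" for s s' x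
  proof -
    have n: "norm (1 - t / of_real x) = norm (of_real x - t) / x" for t :: complex
      using x by (simp add: norm_div_of_real[symmetric] diff_divide_distrib)
    have "(Im s)\<^sup>2 \<le> (Im s')\<^sup>2" using s pos by (intro abs_le_square_iff[THEN iffD1]) auto
    then have "norm (of_real x - s) \<le> norm (of_real x - s')"
      unfolding cmod_def using s by (intro real_sqrt_le_mono add_mono) (auto simp: power2_commute)
    then have 1: "norm (1 - s / of_real x) \<le> norm (1 - s' / of_real x)" unfolding n using x by (intro divide_right_mono) auto
    \<comment> \<open>If the truncation is active then x is at most 2|z|, so the displacement 2
      \<open>\<rho>\<close> |z| is at least \<open>\<rho>\<close> x.\<close>
    have 2: "\<rho> \<le> norm (1 - s' / of_real x)" if "norm (1 - s / of_real x) < \<rho>"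
    proof -
      have "norm (of_real x - s) < \<rho> * x" using that x unfolding n by (simp add: field_simps)
      then have "x - norm s < \<rho> * x" using norm_triangle_ineq2[of "of_real x" s] x by simp
      then have "x * (1 - \<rho>) \<le> norm z" using s by (simp add: algebra_simps)
      moreover have "x * (1/2) \<le> x * (1 - \<rho>)" using x \<rho> by (intro mult_left_mono) auto
      ultimately have "2 * \<rho> * (x / 2) \<le> 2 * \<rho> * norm z" using \<rho> by (intro mult_left_mono) auto
      also have "\<dots> \<le> \<bar>Im s'\<bar>" using s by simp
      also have "\<dots> \<le> norm (of_real x - s')" using abs_Im_le_cmod[of "of_real x - s'"] by simp
      finally show ?thesis unfolding n using x by (simp add: field_simps)
    qed
    have "max (norm (1 - s / of_real x)) \<rho> \<le> norm (1 - s' / of_real x)"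
      using 1 2 by (cases "norm (1 - s / of_real x) < \<rho>") auto
    moreover have "0 < max (norm (1 - s / of_real x)) \<rho>" using \<rho> by simp
    ultimately show ?thesis unfolding tlog_def by (intro ln_mono)
  qed
  have "(LINT x:{0<..}|lborel. tlog2 \<rho> (z / of_real x)) \<le> (LINT x:{0<..}|lborel. ln (norm (1 - (z' / of_real x)\<^sup>2)))"
  proof (rule set_integral_mono[OF set_integrable_tlog2[OF \<rho>] integral_ln_one_minus_sq(1)[OF I0]])
    fix x :: real assume "x \<in> {0<..}"
    then have x: "x > 0" by simp
    have nz: "norm (1 - z' / of_real x) > 0" "norm (1 - (- z') / of_real x) > 0"
      using I0 x by (auto simp: field_simps complex_eq_iff)
    have "tlog \<rho> (z / of_real x) \<le> ln (norm (1 - z' / of_real x))"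
      by (rule key[OF x]) (auto simp: z'_def d)
    moreover have "tlog \<rho> ((- z) / of_real x) \<le> ln (norm (1 - (- z') / of_real x))"
    proof (rule key[OF x])
      show "\<bar>Im (- z')\<bar> = \<bar>Im (- z)\<bar> + 2 * \<rho> * norm z" using d by (simp add: z'_def)
    qed (auto simp: z'_def)
    moreover have "ln (norm (1 - z' / of_real x)) + ln (norm (1 - (- z') / of_real x)) = ln (norm (1 - (z' / of_real x)\<^sup>2))"
      using nz ln_mult[of "norm (1 - z' / of_real x)" "norm (1 - (- z') / of_real x)"] norm_one_minus_sq[of "z' / of_real x"] by simp
    ultimately show "tlog2 \<rho> (z / of_real x) \<le> ln (norm (1 - (z' / of_real x)\<^sup>2))"
      by (simp add: tlog2_def)
  qed
  also have "\<dots> = pi * \<bar>Im z'\<bar>" by (rule integral_ln_one_minus_sq(2)[OF I0])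
  finally show ?thesis unfolding Im' d .
qed

lemma emeasure_lborel_Ioi: "emeasure lborel {0::real<..} = top"
proof (rule ccontr)
  assume "emeasure lborel {0::real<..} \<noteq> top"
  then obtain r where r: "emeasure lborel {0::real<..} = ennreal r" "r \<ge> 0" by (cases "emeasure lborel {0::real<..}") auto
  have "emeasure lborel {0<..<r + 1} \<le> emeasure lborel {0::real<..}" by (intro emeasure_mono) auto
  then show False using r by simp
qed

section \<open>Integrals of radial functions against mass of linear growth\<close>

text \<open>Layer-cake argument: the superlevel sets of a decreasing function of |w| lie in discs,
  whose mass is at most \<open>B\<close> times the length of the corresponding interval. In effect
  the mass is replaced by density \<open>B\<close> on the half-line.\<close>

lemma nn_integral_decreasing_le:
  fixes f :: "real \<Rightarrow> real" and \<mu> :: "complex measure"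
  assumes \<mu>: "sets \<mu> = sets borel" "sigma_finite_measure \<mu>" and B: "B \<ge> 0"
    and growth: "\<And>t. t \<ge> 0 \<Longrightarrow> emeasure \<mu> (cball 0 t) \<le> ennreal (B * t)"
    and [measurable]: "f \<in> borel_measurable borel"
    and dec: "\<And>s t. 0 < s \<Longrightarrow> s \<le> t \<Longrightarrow> f t \<le> f s"
  shows "(\<integral>\<^sup>+w. ennreal (f (norm w)) \<partial>\<mu>) \<le> ennreal B * (\<integral>\<^sup>+t. ennreal (f t) * indicator {0<..} t \<partial>lborel)"
proof -
  note [measurable_cong] = \<mu>(1)
  interpret M: sigma_finite_measure \<mu> by fact
  interpret P: pair_sigma_finite \<mu> "lborel :: real measure" ..
  have sp: "space \<mu> = UNIV" using sets_eq_imp_space_eq[OF \<mu>(1)] by simp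
  have cake: "(\<integral>\<^sup>+l. indicator {0..<y} l \<partial>lborel) = ennreal y" for y :: real
    by (cases "y \<ge> 0") (auto simp: ennreal_neg)
  have le: "emeasure \<mu> {w. l < f (norm w)} \<le> ennreal B * emeasure lborel {t. 0 < t \<and> l < f t}" for l
  proof -
    let ?E = "{t. 0 < t \<and> l < f t}"
    have sub: "{w. l < f (norm w)} \<subseteq> insert 0 {w. norm w \<in> ?E}" by auto
    have m0: "emeasure \<mu> {0} = 0" using growth[of 0] by simp
    have down: "s \<in> ?E" if "t \<in> ?E" "0 < s" "s \<le> t" for s t using that dec[of s t] by auto
    have grow: "emeasure \<mu> {w. l < f (norm w)} \<le> ennreal (B * T)" if "\<forall>t\<in>?E. t \<le> T" "T \<ge> 0" for T
    proof -
      have "emeasure \<mu> {w. l < f (norm w)} \<le> emeasure \<mu> (cball 0 T)"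
        using sub that by (intro emeasure_mono) (force simp: \<mu>(1))+
      also have "\<dots> \<le> ennreal (B * T)" by (rule growth) fact
      finally show ?thesis .
    qed
    show ?thesis
    \<comment> \<open>A superlevel set is an initial interval. If it is unbounded its length is
      infinite, and the claim is immediate unless B = 0, where \<open>\<mu>\<close> vanishes
      altogether.\<close>
    proof (cases "\<exists>T\<ge>0. \<forall>t\<in>?E. t \<le> T")
      case True
      show ?thesis
      proof (cases "?E = {}")
        case empty: True
        then have "emeasure \<mu> {w. l < f (norm w)} \<le> ennreal (B * 0)" by (intro grow) auto
        then show ?thesis by simp
      next
        case False
        have bdd: "bdd_above ?E" using True by (auto intro: bdd_aboveI)
        define T where "T = Sup ?E"
        have T: "t \<le> T" if "t \<in> ?E" for t unfolding T_def using that bdd by (rule cSup_upper)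
        have T0: "T \<ge> 0" using False T by fastforce
        have "{0<..<T} \<subseteq> ?E"
        proof
          fix s assume s: "s \<in> {0<..<T}"
          then obtain t where "t \<in> ?E" "s < t" unfolding T_def using less_cSup_iff[OF False bdd] by auto
          then show "s \<in> ?E" using down[of t s] s by auto
        qed
        then have "emeasure lborel {0<..<T} \<le> emeasure lborel ?E" by (intro emeasure_mono) auto
        then have "ennreal T \<le> emeasure lborel ?E" using T0 by simp
        then have "ennreal B * ennreal T \<le> ennreal B * emeasure lborel ?E" by (intro mult_left_mono) auto
        moreover have "emeasure \<mu> {w. l < f (norm w)} \<le> ennreal (B * T)" using T T0 by (intro grow) auto
        ultimately show ?thesis using B T0 by (simp add: ennreal_mult)
      qed
    next
      case False
      have all: "?E = {0<..}"
      proof (intro equalityI subsetI)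
        fix s :: real assume s: "s \<in> {0<..}"
        then have "\<not> (\<forall>t\<in>?E. t \<le> s)" using False by (metis greaterThan_iff less_imp_le)
        then obtain t where "t \<in> ?E" "\<not> t \<le> s" by blast
        then show "s \<in> ?E" using down[of t s] s by auto
      qed auto
      show ?thesis
      proof (cases "B = 0")
        case True
        have "emeasure \<mu> (\<Union>n::nat. cball 0 (real n)) = 0"
          using growth[of "real _"] True by (intro emeasure_UN_eq_0) (auto simp: \<mu>(1))
        moreover have "(\<Union>n::nat. cball 0 (real n)) = (UNIV :: complex set)"
          by (auto simp: real_arch_simple)
        ultimately have "emeasure \<mu> UNIV = 0" by simp
        then have "emeasure \<mu> {w. l < f (norm w)} = 0"
          by (metis \<mu>(1) emeasure_mono le_zero_eq sets.top sp subset_UNIV)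
        then show ?thesis by simp
      next
        case False
        then have "ennreal B * emeasure lborel {0::real<..} = \<infinity>" using B by (simp add: ennreal_mult_eq_top_iff emeasure_lborel_Ioi)
        then show ?thesis unfolding all by simp
      qed
    qed
  qed
  have "(\<integral>\<^sup>+w. ennreal (f (norm w)) \<partial>\<mu>) = (\<integral>\<^sup>+w. (\<integral>\<^sup>+l. indicator {0..<f (norm w)} l \<partial>lborel) \<partial>\<mu>)"
    by (simp add: cake)
  also have "\<dots> = (\<integral>\<^sup>+w. (\<integral>\<^sup>+l. indicator {0..} l * indicator {(w, l). l < f (norm w)} (w, l) \<partial>lborel) \<partial>\<mu>)"
    by (intro nn_integral_cong) (auto simp: indicator_def)
  also have "\<dots> = (\<integral>\<^sup>+l. (\<integral>\<^sup>+w. indicator {0..} l * indicator {(w, l). l < f (norm w)} (w, l) \<partial>\<mu>) \<partial>lborel)"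
    by (rule P.Fubini'[symmetric]) measurable
  also have "\<dots> = (\<integral>\<^sup>+l. indicator {0..} l * emeasure \<mu> {w. l < f (norm w)} \<partial>lborel)"
  proof (rule nn_integral_cong)
    fix l :: real
    have "(\<integral>\<^sup>+w. indicator {0..} l * indicator {(w, l). l < f (norm w)} (w, l) \<partial>\<mu>)
       = (\<integral>\<^sup>+w. indicator {0..} l * indicator {w. l < f (norm w)} w \<partial>\<mu>)"
      by (intro nn_integral_cong) (auto simp: indicator_def)
    also have "\<dots> = indicator {0..} l * emeasure \<mu> {w. l < f (norm w)}"
      by (subst nn_integral_cmult) (auto simp: \<mu>(1))
    finally show "(\<integral>\<^sup>+w. indicator {0..} l * indicator {(w, l). l < f (norm w)} (w, l) \<partial>\<mu>) = indicator {0..} l * emeasure \<mu> {w. l < f (norm w)}" .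
  qed
  also have "\<dots> \<le> (\<integral>\<^sup>+l. indicator {0..} l * (ennreal B * (\<integral>\<^sup>+t. indicator {t. 0 < t \<and> l < f t} t \<partial>lborel)) \<partial>lborel)"
    by (intro nn_integral_mono mult_left_mono) (use le in auto)
  also have "\<dots> = (\<integral>\<^sup>+l. ennreal B * (\<integral>\<^sup>+t. indicator {0..} l * indicator {0<..} t * indicator {(l, t). l < f t} (l, t) \<partial>lborel) \<partial>lborel)"
  proof (rule nn_integral_cong)
    fix l :: real
    have "(\<integral>\<^sup>+t. indicator {0..} l * indicator {0<..} t * indicator {(l, t). l < f t} (l, t) \<partial>lborel)
       = (\<integral>\<^sup>+t. indicator {0..} l * indicator {t. 0 < t \<and> l < f t} t \<partial>lborel)"
      by (intro nn_integral_cong) (auto simp: indicator_def)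
    also have "\<dots> = indicator {0..} l * (\<integral>\<^sup>+t. indicator {t. 0 < t \<and> l < f t} t \<partial>lborel)"
      by (rule nn_integral_cmult) measurable
    finally show "indicator {0..} l * (ennreal B * (\<integral>\<^sup>+t. indicator {t. 0 < t \<and> l < f t} t \<partial>lborel))
       = ennreal B * (\<integral>\<^sup>+t. indicator {0..} l * indicator {0<..} t * indicator {(l, t). l < f t} (l, t) \<partial>lborel)"
      by (simp only: mult_ac)
  qed
  also have "\<dots> = ennreal B * (\<integral>\<^sup>+l. (\<integral>\<^sup>+t. indicator {0..} l * indicator {0<..} t * indicator {(l, t). l < f t} (l, t) \<partial>lborel) \<partial>lborel)"
    by (rule nn_integral_cmult) measurable
  also have "(\<integral>\<^sup>+l. (\<integral>\<^sup>+t. indicator {0..} l * indicator {0<..} t * indicator {(l, t). l < f t} (l, t) \<partial>lborel) \<partial>lborel)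
     = (\<integral>\<^sup>+t. (\<integral>\<^sup>+l. indicator {0..} l * indicator {0<..} t * indicator {(l, t). l < f t} (l, t) \<partial>lborel) \<partial>(lborel::real measure))"
    by (rule lborel_pair.Fubini'[symmetric]) measurable
  also have "\<dots> = (\<integral>\<^sup>+t. ennreal (f t) * indicator {0<..} t \<partial>lborel)"
  proof (rule nn_integral_cong)
    fix t :: real
    have "(\<integral>\<^sup>+l. indicator {0..} l * indicator {0<..} t * indicator {(l, t). l < f t} (l, t) \<partial>lborel)
       = (\<integral>\<^sup>+l. indicator {0..<f t} l * indicator {0<..} t \<partial>lborel)"
      by (intro nn_integral_cong) (auto simp: indicator_def)
    also have "\<dots> = ennreal (f t) * indicator {0<..} t" by (subst nn_integral_multc) (auto simp: cake simp del: nn_integral_indicator)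
    finally show "(\<integral>\<^sup>+l. indicator {0..} l * indicator {0<..} t * indicator {(l, t). l < f t} (l, t) \<partial>lborel) = ennreal (f t) * indicator {0<..} t" .
  qed
  finally show ?thesis .
qed

subsection \<open>Sweeping a point mass onto the coordinate axes\<close>

text \<open>In the variable \<open>X = x\<^sup>2\<close> this is the Poisson kernel of a half-plane at the point \<open>r\<^sup>2 e\<^sup>\<plusminus>\<^sup>i\<^sup>\<eta>\<close>;
  the positive and the negative half-axis of \<open>X\<close> are the real and the imaginary axis of the original variable,
  and the latter corresponds to the parameter \<open>\<pi> - \<eta>\<close>.\<close>
definition poisson :: "real \<Rightarrow> real \<Rightarrow> real \<Rightarrow> real" where
  "poisson \<eta> r x = 2 * r\<^sup>2 * sin \<eta> * x / (pi * (x ^ 4 - 2 * x\<^sup>2 * r\<^sup>2 * cos \<eta> + r ^ 4))"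

text \<open>The angular parameter of harmonic measure: its derivative is \<pi> times the Poisson
  kernel, so in this variable the kernel becomes uniform on the angles from \<eta> - \<pi>/2 to
  \<pi>/2.\<close>

definition pangle :: "real \<Rightarrow> real \<Rightarrow> real \<Rightarrow> real" where
  "pangle \<eta> r x = arctan ((x\<^sup>2 / r\<^sup>2 - cos \<eta>) / sin \<eta>)"

lemma poisson_measurable [measurable]:
  "(\<lambda>(w, x). poisson \<eta> (norm w) x) \<in> borel_measurable (borel \<Otimes>\<^sub>M borel)" "poisson \<eta> r \<in> borel_measurable borel"
  unfolding poisson_def[abs_def] by measurable

lemma poisson_denom: "x ^ 4 - 2 * x\<^sup>2 * r\<^sup>2 * cos \<eta> + r ^ 4 = (x\<^sup>2 - r\<^sup>2 * cos \<eta>)\<^sup>2 + (r\<^sup>2 * sin \<eta>)\<^sup>2" for x r \<eta> :: real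
proof -
  have "(r\<^sup>2 * sin \<eta>)\<^sup>2 = r ^ 4 * (1 - (cos \<eta>)\<^sup>2)" by (simp add: power_mult_distrib sin_squared_eq power_mult[symmetric])
  then show ?thesis by (simp add: power2_diff power_mult_distrib power_mult[symmetric] algebra_simps)
qed

context
  fixes \<eta> r :: real
  assumes \<eta>: "0 < \<eta>" "\<eta> < pi" and r: "r > 0"
begin

lemma sin_eta: "sin \<eta> > 0" using \<eta> by (rule sin_gt_zero)

lemma poisson_denom_pos: "x ^ 4 - 2 * x\<^sup>2 * r\<^sup>2 * cos \<eta> + r ^ 4 > 0"
  unfolding poisson_denom using sin_eta r by (intro add_nonneg_pos) auto

lemma poisson_nonneg: "x \<ge> 0 \<Longrightarrow> 0 \<le> poisson \<eta> r x"
  unfolding poisson_def using poisson_denom_pos[of x] sin_eta by (intro divide_nonneg_nonneg) auto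

lemma poisson_isCont: "isCont (poisson \<eta> r) x"
  unfolding poisson_def[abs_def] using poisson_denom_pos[of x] by (intro continuous_intros) auto

lemma pangle_deriv: "(pangle \<eta> r has_real_derivative pi * poisson \<eta> r x) (at x)"
proof -
  define y where "y = (x\<^sup>2 / r\<^sup>2 - cos \<eta>) / sin \<eta>"
  have "((\<lambda>x. (x\<^sup>2 / r\<^sup>2 - cos \<eta>) / sin \<eta>) has_real_derivative (2 * x / r\<^sup>2) / sin \<eta>) (at x)"
  proof -
    have q: "((\<lambda>x. x\<^sup>2) has_real_derivative 2 * x) (at x)" by (auto intro!: derivative_eq_intros)
    show ?thesis
      using DERIV_cdivide[OF DERIV_diff[OF DERIV_cdivide[OF q, of "r\<^sup>2"] DERIV_const[of "cos \<eta>"]], of "sin \<eta>"] by simp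
  qed
  from DERIV_chain2[OF DERIV_arctan this]
  have "(pangle \<eta> r has_real_derivative inverse (1 + y\<^sup>2) * ((2 * x / r\<^sup>2) / sin \<eta>)) (at x)"
    by (simp add: pangle_def[abs_def] y_def)
  moreover have "1 + y\<^sup>2 = (x ^ 4 - 2 * x\<^sup>2 * r\<^sup>2 * cos \<eta> + r ^ 4) / (r\<^sup>2 * sin \<eta>)\<^sup>2"
  proof -
    have "y = (x\<^sup>2 - r\<^sup>2 * cos \<eta>) / (r\<^sup>2 * sin \<eta>)" using r sin_eta by (simp add: y_def field_simps)
    then show ?thesis unfolding poisson_denom using r sin_eta by (simp add: power_divide add_divide_distrib)
  qed
  moreover have "inverse ((x ^ 4 - 2 * x\<^sup>2 * r\<^sup>2 * cos \<eta> + r ^ 4) / (r\<^sup>2 * sin \<eta>)\<^sup>2) * ((2 * x / r\<^sup>2) / sin \<eta>) = pi * poisson \<eta> r x"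
    unfolding poisson_def using r sin_eta by (simp add: power2_eq_square)
  ultimately show ?thesis by simp
qed

lemma pangle_bounds: "- (pi/2) < pangle \<eta> r x" "pangle \<eta> r x < pi/2"
  unfolding pangle_def by (rule arctan_lbound, rule arctan_ubound)

lemma pangle_0: "(pangle \<eta> r \<longlongrightarrow> \<eta> - pi/2) (at_right 0)"
proof -
  have "pangle \<eta> r 0 = arctan (tan (\<eta> - pi/2))"
    by (simp add: pangle_def tan_def sin_diff cos_diff)
  also have "\<dots> = \<eta> - pi/2" using \<eta> by (intro arctan_tan) auto
  finally have "pangle \<eta> r 0 = \<eta> - pi/2" .
  moreover have "isCont (pangle \<eta> r) 0" by (rule DERIV_isCont[OF pangle_deriv])
  ultimately have "(pangle \<eta> r \<longlongrightarrow> \<eta> - pi/2) (at 0)" by (simp add: isCont_def)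
  then show ?thesis by (rule tendsto_mono[rotated]) (simp add: at_le)
qed

lemma pangle_inf: "(pangle \<eta> r \<longlongrightarrow> pi/2) at_top"
proof -
  have "filterlim (\<lambda>x::real. x\<^sup>2) at_top at_top" by (rule filterlim_pow_at_top) (auto intro: filterlim_ident)
  from filterlim_tendsto_pos_mult_at_top[OF tendsto_const[of "1 / r\<^sup>2"] _ this]
  have "filterlim (\<lambda>x. x\<^sup>2 / r\<^sup>2) at_top at_top" using r by simp
  from filterlim_tendsto_add_at_top[OF tendsto_const[of "- cos \<eta>"] this]
  have "filterlim (\<lambda>x. x\<^sup>2 / r\<^sup>2 - cos \<eta>) at_top at_top" by simp
  from filterlim_tendsto_pos_mult_at_top[OF tendsto_const[of "1 / sin \<eta>"] _ this]
  have "filterlim (\<lambda>x. (x\<^sup>2 / r\<^sup>2 - cos \<eta>) / sin \<eta>) at_top at_top" using sin_eta by simp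
  from filterlim_compose[OF tendsto_arctan_at_top this] show ?thesis by (simp add: pangle_def[abs_def])
qed

lemma set_integrable_poisson: "set_integrable lborel {0<..} (poisson \<eta> r)"
proof -
  have "set_integrable lborel (einterval 0 \<infinity>) (poisson \<eta> r)"
  proof (rule interval_integral_FTC_nonneg(1)[where F = "\<lambda>x. pangle \<eta> r x / pi" and A = "(\<eta> - pi/2) / pi" and B = "(pi/2) / pi"])
    show "((\<lambda>x. pangle \<eta> r x / pi) has_real_derivative poisson \<eta> r x) (at x)" for x
      using DERIV_cdivide[OF pangle_deriv[of x], of pi] by simp
    show "(((\<lambda>x. pangle \<eta> r x / pi) \<circ> real_of_ereal) \<longlongrightarrow> (\<eta> - pi/2) / pi) (at_right 0)"
      unfolding tendsto_at_right_0_ereal by (intro tendsto_divide pangle_0 tendsto_const) simp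
    show "(((\<lambda>x. pangle \<eta> r x / pi) \<circ> real_of_ereal) \<longlongrightarrow> (pi/2) / pi) (at_left \<infinity>)"
      unfolding tendsto_at_left_inf_ereal by (intro tendsto_divide pangle_inf tendsto_const) simp
    show "AE x in lborel. 0 < ereal x \<longrightarrow> ereal x < \<infinity> \<longrightarrow> 0 \<le> poisson \<eta> r x"
      using poisson_nonneg by auto
  qed (simp_all add: poisson_isCont)
  then show ?thesis by (simp add: einterval_0_inf)
qed

text \<open>The lower end \<eta> - \<pi>/2 is the value of the angle at x = 0. The remaining angles
  down to -\<pi>/2 will be supplied by the other axis.\<close>

lemma poisson_substitution:
  assumes f: "continuous_on UNIV f"
  shows "set_integrable lborel {0<..} (\<lambda>x. poisson \<eta> r x * f (pangle \<eta> r x))"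
    and "(LINT x:{0<..}|lborel. poisson \<eta> r x * f (pangle \<eta> r x)) = (LBINT \<phi>=(\<eta> - pi/2)..(pi/2). f \<phi>) / pi"
proof -
  have [measurable]: "f \<in> borel_measurable borel" using f by (rule borel_measurable_continuous_onI)
  have [measurable]: "pangle \<eta> r \<in> borel_measurable borel" unfolding pangle_def[abs_def] by measurable
  have "compact (f ` {- (pi/2)..pi/2})" by (intro compact_continuous_image continuous_on_subset[OF f]) auto
  then obtain K where K: "\<And>\<phi>. \<phi> \<in> {- (pi/2)..pi/2} \<Longrightarrow> norm (f \<phi>) \<le> K" using compact_imp_bounded bounded_iff by (metis imageI)
  show si: "set_integrable lborel {0<..} (\<lambda>x. poisson \<eta> r x * f (pangle \<eta> r x))"
  proof (rule set_integrable_bound)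
    show "set_integrable lborel {0<..} (\<lambda>x. poisson \<eta> r x * K)"
      by (intro set_integrable_mult_left) (rule set_integrable_poisson)
    show "AE x in lborel. x \<in> {0<..} \<longrightarrow> norm (poisson \<eta> r x * f (pangle \<eta> r x)) \<le> norm (poisson \<eta> r x * K)"
    proof (rule AE_I2, rule impI)
      fix x :: real
      have "\<bar>f (pangle \<eta> r x)\<bar> \<le> \<bar>K\<bar>" using K[of "pangle \<eta> r x"] pangle_bounds[of x] by auto
      then show "norm (poisson \<eta> r x * f (pangle \<eta> r x)) \<le> norm (poisson \<eta> r x * K)"
        by (simp add: abs_mult mult_left_mono)
    qed
  qed (simp add: set_borel_measurable_def)
  define F where "F = (\<lambda>\<phi>. integral {- pi..\<phi>} f)"
  have F: "(F has_real_derivative f \<phi>) (at \<phi>)" if "- pi < \<phi>" "\<phi> < pi" for \<phi>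
  proof -
    have "(F has_real_derivative f \<phi>) (at \<phi> within {- pi..pi})"
      unfolding F_def using that by (intro integral_has_real_derivative continuous_on_subset[OF f]) auto
    moreover have "at \<phi> within {- pi..pi} = at \<phi>" using that by (intro at_within_interior) auto
    ultimately show ?thesis by simp
  qed
  have Fc: "isCont F \<phi>" if "- pi < \<phi>" "\<phi> < pi" for \<phi> using F[OF that] by (rule DERIV_isCont)
  have ep: "- pi < \<eta> - pi/2" "\<eta> - pi/2 < pi" "- pi < pi/2" "pi/2 < pi" "\<eta> - pi/2 \<le> pi/2" using \<eta> pi_gt_zero by auto
  have b: "- pi < pangle \<eta> r x" "pangle \<eta> r x < pi" for x using pangle_bounds[of x] pi_gt_zero by linarith+
  have "(LBINT x=0..\<infinity>. poisson \<eta> r x * f (pangle \<eta> r x)) = F (pi/2) / pi - F (\<eta> - pi/2) / pi"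
  proof (rule interval_integral_FTC_integrable[where F = "\<lambda>x. F (pangle \<eta> r x) / pi"])
    fix x :: real
    show "((\<lambda>x. F (pangle \<eta> r x) / pi) has_vector_derivative poisson \<eta> r x * f (pangle \<eta> r x)) (at x)"
      unfolding has_real_derivative_iff_has_vector_derivative[symmetric]
      using DERIV_cdivide[OF DERIV_chain2[OF F[OF b] pangle_deriv[of x]], of pi] by (simp add: mult.commute)
    have "isCont f (pangle \<eta> r x)" using f by (simp add: continuous_on_eq_continuous_at)
    then show "isCont (\<lambda>x. poisson \<eta> r x * f (pangle \<eta> r x)) x"
      by (intro continuous_mult poisson_isCont isCont_o2[OF DERIV_isCont[OF pangle_deriv]])
  next
    show "(((\<lambda>x. F (pangle \<eta> r x) / pi) \<circ> real_of_ereal) \<longlongrightarrow> F (\<eta> - pi/2) / pi) (at_right 0)"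
      unfolding tendsto_at_right_0_ereal
      by (intro tendsto_divide isCont_tendsto_compose[OF Fc] pangle_0 tendsto_const ep) simp
    show "(((\<lambda>x. F (pangle \<eta> r x) / pi) \<circ> real_of_ereal) \<longlongrightarrow> F (pi/2) / pi) (at_left \<infinity>)"
      unfolding tendsto_at_left_inf_ereal
      by (intro tendsto_divide isCont_tendsto_compose[OF Fc] pangle_inf tendsto_const ep) simp
  qed (use si in \<open>simp_all add: einterval_0_inf\<close>)
  moreover have "(LBINT \<phi>=(\<eta> - pi/2)..(pi/2). f \<phi>) = F (pi/2) - F (\<eta> - pi/2)"
  proof (rule interval_integral_FTC_finite)
    fix \<phi> assume "min (\<eta> - pi/2) (pi/2) \<le> \<phi>" "\<phi> \<le> max (\<eta> - pi/2) (pi/2)"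
    then have "- pi < \<phi>" "\<phi> < pi" using ep by auto
    then show "(F has_vector_derivative f \<phi>) (at \<phi> within {min (\<eta> - pi/2) (pi/2)..max (\<eta> - pi/2) (pi/2)})"
      using F has_vector_derivative_at_within has_real_derivative_iff_has_vector_derivative by blast
  qed (rule continuous_on_subset[OF f], simp)
  ultimately show "(LINT x:{0<..}|lborel. poisson \<eta> r x * f (pangle \<eta> r x)) = (LBINT \<phi>=(\<eta> - pi/2)..(pi/2). f \<phi>) / pi"
    by (simp add: interval_integral_0_inf diff_divide_distrib)
qed

lemma integral_poisson: "(LINT x:{0<..}|lborel. poisson \<eta> r x) = (pi - \<eta>) / pi"
  using poisson_substitution(2)[of "\<lambda>_. 1"] by simp

text \<open>A bound uniform in x for fixed \<eta> and r; it makes the product of the kernel with a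
  truncated logarithm integrable.\<close>

lemma poisson_bounded: "x > 0 \<Longrightarrow> poisson \<eta> r x \<le> 2 * sin \<eta> / (pi * (1 - \<bar>cos \<eta>\<bar>) * r)"
proof -
  assume x: "x > 0"
  have c1: "\<bar>cos \<eta>\<bar> < 1"
  proof -
    have "(cos \<eta>)\<^sup>2 < 1" using sin_eta by (simp add: cos_squared_eq)
    then show ?thesis by (simp add: abs_square_less_1)
  qed
  have xr: "2 * x\<^sup>2 * r\<^sup>2 \<le> x ^ 4 + r ^ 4"
    using sum_squares_bound[of "x\<^sup>2" "r\<^sup>2"] by (simp add: power_mult[symmetric])
  have "2 * x\<^sup>2 * r\<^sup>2 * cos \<eta> \<le> 2 * x\<^sup>2 * r\<^sup>2 * \<bar>cos \<eta>\<bar>" by (intro mult_left_mono) auto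
  also have "\<dots> \<le> (x ^ 4 + r ^ 4) * \<bar>cos \<eta>\<bar>" using xr by (intro mult_right_mono) auto
  finally have D: "(1 - \<bar>cos \<eta>\<bar>) * (x ^ 4 + r ^ 4) \<le> x ^ 4 - 2 * x\<^sup>2 * r\<^sup>2 * cos \<eta> + r ^ 4" by (simp add: algebra_simps)
  have x3: "x * r ^ 3 \<le> x ^ 4 + r ^ 4"
  proof (cases "x \<le> r")
    case True
    then have "x * r ^ 3 \<le> r * r ^ 3" using r by (intro mult_right_mono) auto
    also have "r * r ^ 3 = r ^ 4" by (simp add: power_Suc[symmetric] del: power_Suc)
    finally show ?thesis using x by (simp add: add_increasing)
  next
    case False
    then have "x * r ^ 3 \<le> x * x ^ 3" using r x by (intro mult_left_mono power_mono) auto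
    also have "x * x ^ 3 = x ^ 4" by (simp add: power_Suc[symmetric] del: power_Suc)
    finally show ?thesis using r by (simp add: add_increasing2)
  qed
  have "poisson \<eta> r x \<le> 2 * r\<^sup>2 * sin \<eta> * x / (pi * ((1 - \<bar>cos \<eta>\<bar>) * (x ^ 4 + r ^ 4)))"
    unfolding poisson_def using D x r c1 sin_eta by (intro divide_left_mono mult_left_mono mult_pos_pos poisson_denom_pos) (auto intro: add_pos_pos)
  also have "\<dots> = (2 * sin \<eta> / (pi * (1 - \<bar>cos \<eta>\<bar>) * r)) * (x * r ^ 3 / (x ^ 4 + r ^ 4))"
    using r c1 by (simp add: power2_eq_square power3_eq_cube mult.assoc mult.commute mult.left_commute)
  also have "\<dots> \<le> (2 * sin \<eta> / (pi * (1 - \<bar>cos \<eta>\<bar>) * r)) * 1"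
  proof (rule mult_left_mono)
    have "x ^ 4 + r ^ 4 > 0" using x r by (intro add_pos_pos) auto
    then show "x * r ^ 3 / (x ^ 4 + r ^ 4) \<le> 1" using x3 by simp
  qed (use r c1 sin_eta in auto)
  finally show ?thesis by simp
qed

lemma set_integrable_poisson_tlog2:
  assumes \<rho>: "0 < \<rho>" "\<rho> \<le> 1/4"
  shows "set_integrable lborel {0<..} (\<lambda>x. poisson \<eta> r x * tlog2 \<rho> (z / of_real x))"
proof (rule set_integrable_bound)
  show "set_integrable lborel {0<..} (\<lambda>x. (2 * sin \<eta> / (pi * (1 - \<bar>cos \<eta>\<bar>) * r)) * tlog2 \<rho> (z / of_real x))"
    by (intro set_integrable_mult_right set_integrable_tlog2 \<rho>)
  show "AE x in lborel. x \<in> {0<..} \<longrightarrow> norm (poisson \<eta> r x * tlog2 \<rho> (z / of_real x))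
      \<le> norm ((2 * sin \<eta> / (pi * (1 - \<bar>cos \<eta>\<bar>) * r)) * tlog2 \<rho> (z / of_real x))"
  proof (rule AE_I2, rule impI)
    fix x :: real assume "x \<in> {0<..}"
    then have "\<bar>poisson \<eta> r x\<bar> \<le> \<bar>2 * sin \<eta> / (pi * (1 - \<bar>cos \<eta>\<bar>) * r)\<bar>"
      using poisson_bounded[of x] poisson_nonneg[of x] unfolding greaterThan_iff by linarith
    from mult_right_mono[OF this abs_ge_zero[of "tlog2 \<rho> (z / of_real x)"]]
    show "norm (poisson \<eta> r x * tlog2 \<rho> (z / of_real x)) \<le> norm ((2 * sin \<eta> / (pi * (1 - \<bar>cos \<eta>\<bar>) * r)) * tlog2 \<rho> (z / of_real x))"
      by (simp only: real_norm_def abs_mult)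
  qed
qed (simp add: set_borel_measurable_def)

end

section \<open>The potential of a swept point mass\<close>

text \<open>In the angular variable x^2/r^2 = cos(\<phi> - \<eta>)/cos \<phi>, so log|x^2/r^2 -
  \<zeta>| is this numerator minus ln cos \<phi>. The numerator is continuous up to \<phi> =
  \<pi>/2, and in a difference of two such logarithms the singular ln cos \<phi> drops out.\<close>

definition lnum :: "real \<Rightarrow> complex \<Rightarrow> real \<Rightarrow> real" where
  "lnum \<eta> \<zeta> \<phi> = ln (norm (of_real (cos (\<phi> - \<eta>)) - \<zeta> * of_real (cos \<phi>)))"

lemma lnum_nonzero:
  assumes "0 < \<eta>" "\<eta> < pi" "Im \<zeta> \<noteq> 0" shows "of_real (cos (\<phi> - \<eta>)) - \<zeta> * of_real (cos \<phi>) \<noteq> 0"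
proof
  assume *: "of_real (cos (\<phi> - \<eta>)) - \<zeta> * of_real (cos \<phi>) = 0"
  have "Im (of_real (cos (\<phi> - \<eta>)) - \<zeta> * of_real (cos \<phi>)) = - Im \<zeta> * cos \<phi>" by simp
  then have c: "cos \<phi> = 0" using * assms by simp
  then have "cos (\<phi> - \<eta>) = 0" using * by simp
  then have "sin \<phi> * sin \<eta> = 0" using c by (simp add: cos_diff)
  moreover have "sin \<eta> > 0" using assms by (intro sin_gt_zero)
  ultimately have "sin \<phi> = 0" by simp
  with c sin_cos_squared_add[of \<phi>] show False by simp
qed

lemma continuous_on_lnum:
  assumes "0 < \<eta>" "\<eta> < pi" "Im \<zeta> \<noteq> 0" shows "continuous_on S (lnum \<eta> \<zeta>)"
  unfolding lnum_def[abs_def] using lnum_nonzero[OF assms] by (intro continuous_intros) auto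

lemma lnum_pangle:
  assumes \<eta>: "0 < \<eta>" "\<eta> < pi" and r: "r > 0" and \<zeta>: "Im \<zeta> \<noteq> 0"
  shows "lnum \<eta> \<zeta> (pangle \<eta> r x) = ln (cos (pangle \<eta> r x)) + ln (norm (of_real (x\<^sup>2 / r\<^sup>2) - \<zeta>))" "cos (pangle \<eta> r x) > 0"
proof -
  let ?\<phi> = "pangle \<eta> r x"
  have s: "sin \<eta> > 0" using \<eta> by (rule sin_gt_zero)
  show c: "cos ?\<phi> > 0" by (auto simp: pangle_def cos_arctan intro: add_pos_nonneg)
  have "sin ?\<phi> = cos ?\<phi> * ((x\<^sup>2 / r\<^sup>2 - cos \<eta>) / sin \<eta>)"
    by (simp add: pangle_def cos_arctan sin_arctan)
  then have "cos (?\<phi> - \<eta>) = cos ?\<phi> * (x\<^sup>2 / r\<^sup>2)" using s by (simp add: cos_diff field_simps)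
  then have "of_real (cos (?\<phi> - \<eta>)) - \<zeta> * of_real (cos ?\<phi>) = of_real (cos ?\<phi>) * (of_real (x\<^sup>2 / r\<^sup>2) - \<zeta>)"
    by (simp add: algebra_simps)
  then have "norm (of_real (cos (?\<phi> - \<eta>)) - \<zeta> * of_real (cos ?\<phi>)) = cos ?\<phi> * norm (of_real (x\<^sup>2 / r\<^sup>2) - \<zeta>)"
    using c by (simp add: norm_mult)
  moreover have "of_real (x\<^sup>2 / r\<^sup>2) - \<zeta> \<noteq> 0" using \<zeta> by (auto simp: complex_eq_iff)
  ultimately show "lnum \<eta> \<zeta> ?\<phi> = ln (cos ?\<phi>) + ln (norm (of_real (x\<^sup>2 / r\<^sup>2) - \<zeta>))"
    using c by (simp add: lnum_def ln_mult)
qed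

text \<open>The reference point \<i> \<tau> removes the singular denominator. Its own factor |1 -
  \<i> \<tau> r^2/x^2| is at least 1, so dropping its logarithm only helps, and truncating the other
  one only increases it.\<close>

lemma poisson_tlog2_ge_half:
  assumes \<eta>: "0 < \<eta>" "\<eta> < pi" and r: "r > 0" and \<zeta>: "Im (z\<^sup>2) \<noteq> 0" and \<tau>: "\<tau> \<noteq> 0" and \<rho>: "0 < \<rho>" "\<rho> \<le> 1/4"
  shows "(LBINT \<phi>=(\<eta> - pi/2)..(pi/2). lnum \<eta> (z\<^sup>2 / of_real (r\<^sup>2)) \<phi> - lnum \<eta> (\<i> * of_real \<tau>) \<phi>) / pi
    \<le> (LINT x:{0<..}|lborel. poisson \<eta> r x * tlog2 \<rho> (z / of_real x))"
proof -
  define \<zeta> where "\<zeta> = z\<^sup>2 / of_real (r\<^sup>2)"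
  have I: "Im \<zeta> \<noteq> 0" "Im (\<i> * of_real \<tau>) \<noteq> 0" using assms by (auto simp: \<zeta>_def Im_divide_of_real)
  have c: "continuous_on UNIV (\<lambda>\<phi>. lnum \<eta> \<zeta> \<phi> - lnum \<eta> (\<i> * of_real \<tau>) \<phi>)"
    by (intro continuous_intros continuous_on_lnum \<eta> I)
  show ?thesis
    unfolding \<zeta>_def[symmetric] poisson_substitution(2)[OF \<eta> r c, symmetric]
  proof (rule set_integral_mono[OF poisson_substitution(1)[OF \<eta> r c] set_integrable_poisson_tlog2[OF \<eta> r \<rho>]])
    fix x :: real assume "x \<in> {0<..}"
    then have x: "x > 0" by simp
    have n: "norm (of_real (x\<^sup>2 / r\<^sup>2) - \<zeta>') = (x\<^sup>2 / r\<^sup>2) * norm (1 - \<zeta>' * of_real (r\<^sup>2 / x\<^sup>2))" for \<zeta>' :: complex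
    proof -
      have "of_real (x\<^sup>2 / r\<^sup>2) - \<zeta>' = of_real (x\<^sup>2 / r\<^sup>2) * (1 - \<zeta>' * of_real (r\<^sup>2 / x\<^sup>2))"
        using x r by (simp add: field_simps)
      then show ?thesis by (simp only: norm_mult norm_of_real) simp
    qed
    have nz: "1 - \<zeta>' * of_real (r\<^sup>2 / x\<^sup>2) \<noteq> 0" if "Im \<zeta>' \<noteq> 0" for \<zeta>'
      using that x r by (auto simp: complex_eq_iff)
    have "lnum \<eta> \<zeta> (pangle \<eta> r x) - lnum \<eta> (\<i> * of_real \<tau>) (pangle \<eta> r x)
        = ln (norm (1 - \<zeta> * of_real (r\<^sup>2 / x\<^sup>2))) - ln (norm (1 - (\<i> * of_real \<tau>) * of_real (r\<^sup>2 / x\<^sup>2)))"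
    proof -
      have "ln (norm (of_real (x\<^sup>2 / r\<^sup>2) - \<zeta>')) = ln (x\<^sup>2 / r\<^sup>2) + ln (norm (1 - \<zeta>' * of_real (r\<^sup>2 / x\<^sup>2)))" if "Im \<zeta>' \<noteq> 0" for \<zeta>' :: complex
        unfolding n using nz[OF that] x r by (subst ln_mult) auto
      from this[OF I(1)] this[OF I(2)] show ?thesis
        unfolding lnum_pangle(1)[OF \<eta> r I(1)] lnum_pangle(1)[OF \<eta> r I(2)] by simp
    qed
    also have "\<dots> \<le> ln (norm (1 - \<zeta> * of_real (r\<^sup>2 / x\<^sup>2)))"
    proof -
      have "1 \<le> norm (1 - (\<i> * of_real \<tau>) * of_real (r\<^sup>2 / x\<^sup>2))"
        using abs_Re_le_cmod[of "1 - (\<i> * of_real \<tau>) * of_real (r\<^sup>2 / x\<^sup>2)"] by simp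
      then have "ln 1 \<le> ln (norm (1 - (\<i> * of_real \<tau>) * of_real (r\<^sup>2 / x\<^sup>2)))" by (intro ln_mono) auto
      then show ?thesis by simp
    qed
    also have "\<zeta> * of_real (r\<^sup>2 / x\<^sup>2) = (z / of_real x)\<^sup>2" using r by (simp add: \<zeta>_def power_divide)
    also have "ln (norm (1 - (z / of_real x)\<^sup>2)) \<le> tlog2 \<rho> (z / of_real x)"
    proof (rule tlog2_ge[OF \<rho>(1)])
      have "1 - (z / of_real x)\<^sup>2 \<noteq> 0" using nz[OF I(1)] unfolding \<open>\<zeta> * of_real (r\<^sup>2 / x\<^sup>2) = (z / of_real x)\<^sup>2\<close> .
      then show "(z / of_real x)\<^sup>2 \<noteq> 1" by (metis diff_self)
    qed
    finally show "poisson \<eta> r x * (lnum \<eta> \<zeta> (pangle \<eta> r x) - lnum \<eta> (\<i> * of_real \<tau>) (pangle \<eta> r x))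
        \<le> poisson \<eta> r x * tlog2 \<rho> (z / of_real x)"
      using poisson_nonneg[OF \<eta> r, of x] x by (intro mult_left_mono) auto
  qed
qed

text \<open>The mean value property, by Cauchy's formula: Ln(1 + c u) is holomorphic on the disc and
  vanishes at 0.\<close>

lemma integral_Ln_circle:
  assumes c: "norm c < 1"
  shows "((\<lambda>x. Ln (1 + c * exp (2 * of_real pi * \<i> * of_real x))) has_integral 0) {0..1::real}"
proof -
  have nz: "1 + c * w \<notin> \<real>\<^sub>\<le>\<^sub>0" if "norm w \<le> 1" for w
  proof -
    have "norm c * norm w \<le> norm c * 1" using that by (intro mult_left_mono) auto
    then have "norm (c * w) < 1" using c unfolding norm_mult by linarith
    then have "Re (1 + c * w) > 0" using abs_Re_le_cmod[of "c * w"] by simp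
    then show ?thesis by (auto simp: complex_nonpos_Reals_iff)
  qed
  have "((\<lambda>u. Ln (1 + c * u) / (u - 0)) has_contour_integral (2 * of_real pi * \<i>) * Ln (1 + c * 0)) (circlepath 0 1)"
  proof (rule Cauchy_integral_circlepath)
    show "continuous_on (cball 0 1) (\<lambda>u. Ln (1 + c * u))" by (intro continuous_intros) (use nz in auto)
    show "(\<lambda>u. Ln (1 + c * u)) holomorphic_on ball 0 1" by (intro holomorphic_intros) (use nz in auto)
  qed simp
  then have "((\<lambda>x. Ln (1 + c * circlepath 0 1 x) / circlepath 0 1 x * vector_derivative (circlepath 0 1) (at x within {0..1})) has_integral 0) {0..1}"
    by (simp add: has_contour_integral_def)
  then have "((\<lambda>x. (2 * of_real pi * \<i>) * Ln (1 + c * exp (2 * of_real pi * \<i> * of_real x))) has_integral 0) {0..1}"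
    by (rule has_integral_eq[rotated]) (simp add: vector_derivative_circlepath01, simp add: circlepath)
  from has_integral_mult_right[OF this, of "1 / (2 * of_real pi * \<i>)"] show ?thesis by simp
qed

text \<open>The angle 2 \<phi> runs once round the circle. The parametrisation starts at angle
  -\<pi>, and the resulting sign is moved into \<open>c\<close>.\<close>

lemma integral_ln_circle:
  assumes c: "norm c < 1"
  shows "(LBINT \<phi>=-(pi/2)..pi/2. ln (norm (1 + c * cis (2 * \<phi>)))) = 0"
proof -
  let ?g = "\<lambda>x::real. pi * x - pi/2"
  let ?f = "\<lambda>\<phi>. ln (norm (1 + c * cis (2 * \<phi>)))"
  have nz: "1 + c * cis t \<noteq> 0" for t
  proof
    assume "1 + c * cis t = 0"
    then have "c * cis t = - 1" by (simp add: add_eq_0_iff)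
    then have "norm (c * cis t) = 1" by simp
    then show False using c by (simp add: norm_mult)
  qed
  have cont: "continuous_on S ?f" for S using nz by (intro continuous_intros) auto
  have "(LBINT \<phi>=ereal (?g 0)..ereal (?g 1). ?f \<phi>) = (LBINT x=ereal 0..ereal 1. pi *\<^sub>R ?f (?g x))"
    by (rule interval_integral_substitution_finite[symmetric]) (auto intro!: derivative_eq_intros cont)
  also have "\<dots> = integral {0..1} (\<lambda>x. pi *\<^sub>R ?f (?g x))"
    using nz by (intro interval_integral_eq_integral borel_integrable_compact continuous_intros) (auto simp: set_integrable_def[symmetric] intro!: borel_integrable_atLeastAtMost' continuous_intros)
  also have "(\<lambda>x. pi *\<^sub>R ?f (?g x)) = (\<lambda>x. pi *\<^sub>R Re (Ln (1 + (- c) * exp (2 * of_real pi * \<i> * of_real x))))"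
  proof (rule ext)
    fix x :: real
    have "cis (2 * ?g x) = - exp (2 * of_real pi * \<i> * of_real x)"
    proof -
      have "cis (2 * ?g x) = cis (2 * pi * x) * cis (- pi)" by (simp add: cis_mult algebra_simps)
      also have "cis (2 * pi * x) = exp (2 * of_real pi * \<i> * of_real x)" by (simp add: cis_conv_exp mult_ac)
      finally show ?thesis by (simp add: complex_eq_iff)
    qed
    then show "pi *\<^sub>R ?f (?g x) = pi *\<^sub>R Re (Ln (1 + (- c) * exp (2 * of_real pi * \<i> * of_real x)))"
      using nz[of "2 * ?g x"] by (simp add: Re_Ln)
  qed
  also have "integral {0..1} (\<lambda>x. pi *\<^sub>R Re (Ln (1 + (- c) * exp (2 * of_real pi * \<i> * of_real x)))) = 0"
  proof -
    have "((\<lambda>x. Ln (1 + (- c) * exp (2 * of_real pi * \<i> * of_real x))) has_integral 0) {0..1}"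
      using c by (intro integral_Ln_circle) simp
    from integral_unique[OF has_integral_cmul[OF has_integral_Re[OF this], of pi]] show ?thesis by simp
  qed
  finally show ?thesis by simp
qed

text \<open>With A = exp(-\<i> \<eta>) - \<zeta> and B = exp(\<i> \<eta>) - \<zeta> the numerator is
  (exp(\<i> \<phi>) A + exp(-\<i> \<phi>) B)/2. Factoring out the larger of the two leaves a factor
  1 + c exp(2 \<i> \<phi>), up to reflection of \<phi>, whose logarithm has mean 0. They differ in
  modulus because \<zeta> is not real.\<close>

lemma integral_lnum:
  assumes \<eta>: "0 < \<eta>" "\<eta> < pi" and \<zeta>: "Im \<zeta> \<noteq> 0"
  shows "(LBINT \<phi>=-(pi/2)..pi/2. lnum \<eta> \<zeta> \<phi>) = pi * (ln (max (norm (cis (- \<eta>) - \<zeta>)) (norm (cis \<eta> - \<zeta>))) - ln 2)"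
proof -
  define A B where "A = cis (- \<eta>) - \<zeta>" and "B = cis \<eta> - \<zeta>"
  have s: "sin \<eta> > 0" using \<eta> by (rule sin_gt_zero)
  have eq: "of_real (cos (\<phi> - \<eta>)) - \<zeta> * of_real (cos \<phi>) = (cis \<phi> * A + cis (- \<phi>) * B) / 2" for \<phi>
    by (simp add: A_def B_def complex_eq_iff cos_diff algebra_simps)
  have ne: "norm A \<noteq> norm B"
  proof
    assume "norm A = norm B"
    moreover have "(norm A)\<^sup>2 - (norm B)\<^sup>2 = 4 * Im \<zeta> * sin \<eta>"
      unfolding A_def B_def cmod_power2 by (simp add: power2_eq_square algebra_simps)
    ultimately have "4 * Im \<zeta> * sin \<eta> = 0" by simp
    then show False using s \<zeta> by simp
  qed
  have main: "(LBINT \<phi>=-(pi/2)..pi/2. G \<phi>) = pi * (ln (norm P) - ln 2)"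
    if PQ: "norm Q < norm P" and n: "\<And>\<phi>. G \<phi> = ln (norm P * norm (1 + Q / P * cis (2 * \<phi>)) / 2)" for P Q G
  proof -
    have P: "norm P > 0" using PQ norm_ge_zero[of Q] by linarith
    have c: "norm (Q / P) < 1" using PQ P by (simp add: norm_divide)
    have nz: "1 + Q / P * cis t \<noteq> 0" for t
    proof
      assume "1 + Q / P * cis t = 0"
      then have "norm (Q / P * cis t) = 1" by (metis add_eq_0_iff norm_minus_cancel norm_one)
      then show False using c by (simp only: norm_mult norm_cis mult_1_right)
    qed
    have l: "G \<phi> = ln (norm (1 + Q / P * cis (2 * \<phi>))) + (ln (norm P) - ln 2)" for \<phi>
      using nz[of "2 * \<phi>"] P by (simp add: n ln_mult ln_div)
    have "continuous_on {- (pi/2)..pi/2} (\<lambda>\<phi>. ln (norm (1 + Q / P * cis (2 * \<phi>))))"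
      using nz by (intro continuous_intros) auto
    then have "interval_lebesgue_integrable lborel (ereal (- (pi/2))) (ereal (pi/2)) (\<lambda>\<phi>. ln (norm (1 + Q / P * cis (2 * \<phi>))))"
      by (intro interval_integrable_continuous_on) auto
    from interval_lebesgue_integral_add(2)[OF this interval_integral_const(1), of "ln (norm P) - ln 2"]
    show ?thesis unfolding l using integral_ln_circle[OF c] by simp
  qed
  have fac: "norm (cis \<phi> * S + cis (- \<phi>) * P) = norm P * norm (1 + S / P * cis (2 * \<phi>))" if "P \<noteq> 0" for P S \<phi>
  proof -
    have "cis \<phi> = cis (- \<phi>) * cis (2 * \<phi>)" by (simp add: cis_mult)
    then have "cis \<phi> * S + cis (- \<phi>) * P = cis (- \<phi>) * P * (1 + S / P * cis (2 * \<phi>))"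
      using that by (simp add: field_simps)
    then show ?thesis by (simp only: norm_mult norm_cis mult_1)
  qed
  show ?thesis
  proof (cases "norm B < norm A")
    case True
    then have A0: "A \<noteq> 0" by auto
    have "(LBINT \<phi>=-(pi/2)..pi/2. lnum \<eta> \<zeta> \<phi>) = (LBINT \<phi>=-(pi/2)..pi/2. lnum \<eta> \<zeta> (- \<phi>))"
      by (subst interval_integral_reflect) simp
    also have "\<dots> = pi * (ln (norm A) - ln 2)"
    proof (rule main[OF True])
      fix \<phi>
      show "lnum \<eta> \<zeta> (- \<phi>) = ln (norm A * norm (1 + B / A * cis (2 * \<phi>)) / 2)"
        using fac[OF A0, of \<phi> B] unfolding lnum_def eq by (simp add: norm_divide add.commute)
    qed
    finally show ?thesis using True by (simp add: A_def B_def max_def)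
  next
    case False
    then have AB: "norm A < norm B" using ne by simp
    then have B0: "B \<noteq> 0" by auto
    have "(LBINT \<phi>=-(pi/2)..pi/2. lnum \<eta> \<zeta> \<phi>) = pi * (ln (norm B) - ln 2)"
    proof (rule main[OF AB])
      fix \<phi>
      show "lnum \<eta> \<zeta> \<phi> = ln (norm B * norm (1 + A / B * cis (2 * \<phi>)) / 2)"
        using fac[OF B0, of \<phi> A] unfolding lnum_def eq by (simp add: norm_divide)
    qed
    then show ?thesis using AB by (simp add: A_def B_def max_def)
  qed
qed

text \<open>The potential at z of a mass at distance r after sweeping. The second term is the
  imaginary axis: multiplying by -\<i> carries it to the real one and turns the angle \<eta> into
  \<pi> - \<eta>.\<close>

definition swept :: "real \<Rightarrow> real \<Rightarrow> real \<Rightarrow> complex \<Rightarrow> real" where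
  "swept \<eta> \<rho> r z = (LINT x:{0<..}|lborel. poisson \<eta> r x * tlog2 \<rho> (z / of_real x))
    + (LINT x:{0<..}|lborel. poisson (pi - \<eta>) r x * tlog2 \<rho> (- \<i> * z / of_real x))"

text \<open>The angular intervals of the two axes join to the full interval from -\<pi>/2 to
  \<pi>/2, on which the integral is explicit. The reference point contributes at most \<tau>, which
  is arbitrary.\<close>

lemma swept_ge_nonreal:
  assumes \<eta>: "0 < \<eta>" "\<eta> < pi" and r: "r > 0" and \<zeta>: "Im (z\<^sup>2) \<noteq> 0" and \<rho>: "0 < \<rho>" "\<rho> \<le> 1/4"
  shows "ln (max (norm (cis (- \<eta>) - z\<^sup>2 / of_real (r\<^sup>2))) (norm (cis \<eta> - z\<^sup>2 / of_real (r\<^sup>2)))) \<le> swept \<eta> \<rho> r z"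
proof (rule field_le_epsilon)
  fix \<tau> :: real assume \<tau>: "\<tau> > 0"
  define \<zeta> where "\<zeta> = z\<^sup>2 / of_real (r\<^sup>2)"
  define \<beta> where "\<beta> = \<i> * complex_of_real \<tau>"
  have I: "Im \<zeta> \<noteq> 0" "Im \<beta> \<noteq> 0" using assms \<tau> by (auto simp: \<zeta>_def \<beta>_def Im_divide_of_real)
  have \<eta>': "0 < pi - \<eta>" "pi - \<eta> < pi" using \<eta> by auto
  define f where "f = (\<lambda>\<phi>. lnum \<eta> \<zeta> \<phi> - lnum \<eta> \<beta> \<phi>)"
  have cont: "continuous_on S f" for S unfolding f_def by (intro continuous_intros continuous_on_lnum \<eta> I)
  \<comment> \<open>Changing the sign of the squared variable and passing to the supplementary angle
    amounts to reflecting \<phi>; thus the imaginary axis covers the angles from -\<pi>/2 to \<eta>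
    - \<pi>/2.\<close>
  have neg: "lnum (pi - \<eta>) (- s) \<phi> = lnum \<eta> s (- \<phi>)" for s \<phi>
  proof -
    have "cos (\<phi> - (pi - \<eta>)) = - cos (- \<phi> - \<eta>)"
      by (simp add: cos_diff cos_add sin_diff algebra_simps)
    then have "of_real (cos (\<phi> - (pi - \<eta>))) - (- s) * of_real (cos \<phi>) = - (of_real (cos (- \<phi> - \<eta>)) - s * of_real (cos (- \<phi>)))" by simp
    then show ?thesis unfolding lnum_def by (simp only: norm_minus_cancel)
  qed
  have h1: "(LBINT \<phi>=(\<eta> - pi/2)..(pi/2). f \<phi>) / pi \<le> (LINT x:{0<..}|lborel. poisson \<eta> r x * tlog2 \<rho> (z / of_real x))"
    unfolding f_def \<zeta>_def \<beta>_def using \<tau> by (intro poisson_tlog2_ge_half assms) auto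
  have "(LBINT \<phi>=((pi - \<eta>) - pi/2)..(pi/2). lnum (pi - \<eta>) ((- \<i> * z)\<^sup>2 / of_real (r\<^sup>2)) \<phi> - lnum (pi - \<eta>) (\<i> * of_real (- \<tau>)) \<phi>) / pi
     \<le> (LINT x:{0<..}|lborel. poisson (pi - \<eta>) r x * tlog2 \<rho> (- \<i> * z / of_real x))"
    using \<tau> \<zeta> by (intro poisson_tlog2_ge_half \<eta>' r \<rho>) (auto simp: power_mult_distrib)
  also have "(- \<i> * z)\<^sup>2 / of_real (r\<^sup>2) = - \<zeta>" by (simp add: \<zeta>_def power_mult_distrib)
  also have "\<i> * of_real (- \<tau>) = - \<beta>" by (simp add: \<beta>_def)
  also have "(LBINT \<phi>=((pi - \<eta>) - pi/2)..(pi/2). lnum (pi - \<eta>) (- \<zeta>) \<phi> - lnum (pi - \<eta>) (- \<beta>) \<phi>)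
     = (LBINT \<phi>=-(pi/2)..(\<eta> - pi/2). f \<phi>)"
    unfolding neg by (subst interval_integral_reflect) (simp add: f_def)
  finally have h2: "(LBINT \<phi>=-(pi/2)..(\<eta> - pi/2). f \<phi>) / pi \<le> (LINT x:{0<..}|lborel. poisson (pi - \<eta>) r x * tlog2 \<rho> (- \<i> * z / of_real x))" .
  have "(LBINT \<phi>=-(pi/2)..(\<eta> - pi/2). f \<phi>) + (LBINT \<phi>=(\<eta> - pi/2)..(pi/2). f \<phi>) = (LBINT \<phi>=-(pi/2)..(pi/2). f \<phi>)"
  proof (rule interval_integral_sum)
    have "interval_lebesgue_integrable lborel (ereal (- (pi/2))) (ereal (pi/2)) f"
      by (intro interval_integrable_continuous_on cont) simp
    moreover have "min (ereal (- (pi/2))) (min (ereal (\<eta> - pi/2)) (ereal (pi/2))) = ereal (- (pi/2))"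
      "max (ereal (- (pi/2))) (max (ereal (\<eta> - pi/2)) (ereal (pi/2))) = ereal (pi/2)"
      using \<eta> by (simp_all add: min_def max_def)
    ultimately show "interval_lebesgue_integrable lborel (min (ereal (- (pi/2))) (min (ereal (\<eta> - pi/2)) (ereal (pi/2))))
      (max (ereal (- (pi/2))) (max (ereal (\<eta> - pi/2)) (ereal (pi/2)))) f" by simp
  qed
  then have "(LBINT \<phi>=-(pi/2)..(pi/2). f \<phi>) / pi = (LBINT \<phi>=-(pi/2)..(\<eta> - pi/2). f \<phi>) / pi + (LBINT \<phi>=(\<eta> - pi/2)..(pi/2). f \<phi>) / pi"
    by (metis add_divide_distrib)
  then have "(LBINT \<phi>=-(pi/2)..(pi/2). f \<phi>) / pi \<le> swept \<eta> \<rho> r z"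
    using h1 h2 unfolding swept_def by linarith
  moreover have "(LBINT \<phi>=-(pi/2)..(pi/2). f \<phi>) = (LBINT \<phi>=-(pi/2)..(pi/2). lnum \<eta> \<zeta> \<phi>) - (LBINT \<phi>=-(pi/2)..(pi/2). lnum \<eta> \<beta> \<phi>)"
    unfolding f_def
    by (intro interval_lebesgue_integral_diff(2) interval_integrable_continuous_on continuous_on_lnum \<eta> I) auto
  ultimately have "ln (max (norm (cis (- \<eta>) - \<zeta>)) (norm (cis \<eta> - \<zeta>))) - ln (max (norm (cis (- \<eta>) - \<beta>)) (norm (cis \<eta> - \<beta>))) \<le> swept \<eta> \<rho> r z"
    unfolding integral_lnum[OF \<eta> I(1)] integral_lnum[OF \<eta> I(2)] by (simp add: right_diff_distrib[symmetric])
  moreover have "ln (max (norm (cis (- \<eta>) - \<beta>)) (norm (cis \<eta> - \<beta>))) \<le> \<tau>"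
  proof -
    have "norm (cis t - \<beta>) \<le> 1 + \<tau>" for t using norm_triangle_ineq4[of "cis t" \<beta>] \<tau> by (simp add: \<beta>_def norm_mult)
    moreover have "0 < max (norm (cis (- \<eta>) - \<beta>)) (norm (cis \<eta> - \<beta>))"
    proof -
      have "sin \<eta> > 0" using \<eta> by (rule sin_gt_zero)
      then have "cis (- \<eta>) - \<beta> \<noteq> 0" using \<tau> by (auto simp: \<beta>_def complex_eq_iff)
      then show ?thesis by (simp add: less_max_iff_disj)
    qed
    ultimately have "ln (max (norm (cis (- \<eta>) - \<beta>)) (norm (cis \<eta> - \<beta>))) \<le> ln (1 + \<tau>)" by (intro ln_mono) auto
    also have "\<dots> \<le> \<tau>" using \<tau> by (intro ln_add_one_self_le_self) auto
    finally show ?thesis .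
  qed
  ultimately show "ln (max (norm (cis (- \<eta>) - z\<^sup>2 / of_real (r\<^sup>2))) (norm (cis \<eta> - z\<^sup>2 / of_real (r\<^sup>2)))) \<le> swept \<eta> \<rho> r z + \<tau>"
    unfolding \<zeta>_def by linarith
qed

lemma norm_cis_minus_1_le: "norm (cis \<delta> - 1) \<le> \<bar>\<delta>\<bar>"
proof -
  have "(norm (cis \<delta> - 1))\<^sup>2 = (cos \<delta> - 1)\<^sup>2 + (sin \<delta>)\<^sup>2" by (simp add: cmod_power2)
  also have "\<dots> = 2 * (1 - cos \<delta>)" by (simp add: power2_diff sin_squared_eq)
  also have "\<dots> = (2 * sin (\<delta> / 2))\<^sup>2" using cos_double_sin[of "\<delta>/2"] by (simp add: power_mult_distrib)
  also have "\<dots> \<le> \<bar>\<delta>\<bar>\<^sup>2"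
    using abs_sin_x_le_abs_x[of "\<delta>/2"] by (intro power2_le_iff_abs_le[THEN iffD2]) auto
  finally show ?thesis by (rule power2_le_imp_le) simp
qed

text \<open>A rotation by \<delta> moves t by at most |\<delta>| |t|, and |t| is at most
  2/\<open>\<rho>\<close> times the truncated modulus, so the relative change is at most
  2|\<delta>|/\<open>\<rho>\<close>.\<close>

lemma tlog_rotate:
  assumes \<rho>: "0 < \<rho>" "\<rho> \<le> 1" shows "tlog \<rho> (cis \<delta> * t) \<le> tlog \<rho> t + 2 * \<bar>\<delta>\<bar> / \<rho>"
proof -
  define M where "M = max (norm (1 - t)) \<rho>"
  have M: "M > 0" "\<rho> \<le> M" "norm (1 - t) \<le> M" using \<rho> by (auto simp: M_def)
  have "norm ((1 - cis \<delta>) * t) = norm (cis \<delta> - 1) * norm t" by (simp add: norm_mult norm_minus_commute)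
  also have "\<dots> \<le> \<bar>\<delta>\<bar> * norm t" by (intro mult_right_mono norm_cis_minus_1_le) auto
  also have "\<dots> \<le> \<bar>\<delta>\<bar> * (2 * M / \<rho>)"
  proof (rule mult_left_mono)
    show "norm t \<le> 2 * M / \<rho>"
    proof (cases "norm t \<le> 2")
      case True
      then have "norm t * \<rho> \<le> 2 * M" using M \<rho> by (intro mult_mono) auto
      then show ?thesis using \<rho> by (simp add: field_simps)
    next
      case False
      then have "norm t \<le> 2 * M" using norm_triangle_ineq2[of t 1] M by (simp add: norm_minus_commute)
      also have "\<dots> \<le> 2 * M / \<rho>" using M \<rho> by (simp add: field_simps mult_left_le)
      finally show ?thesis .
    qed
  qed simp
  finally have "norm (1 - cis \<delta> * t) \<le> M + \<bar>\<delta>\<bar> * (2 * M / \<rho>)"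
    using norm_triangle_ineq[of "1 - t" "(1 - cis \<delta>) * t"] M by (simp add: algebra_simps)
  then have "max (norm (1 - cis \<delta> * t)) \<rho> \<le> M * (1 + 2 * \<bar>\<delta>\<bar> / \<rho>)"
    using M \<rho> by (auto simp: algebra_simps intro: add_increasing2)
  also have "\<dots> \<le> M * exp (2 * \<bar>\<delta>\<bar> / \<rho>)" using M by (intro mult_left_mono exp_ge_add_one_self) auto
  finally have "tlog \<rho> (cis \<delta> * t) \<le> ln (M * exp (2 * \<bar>\<delta>\<bar> / \<rho>))" unfolding tlog_def using \<rho> by (intro ln_mono) auto
  also have "\<dots> = tlog \<rho> t + 2 * \<bar>\<delta>\<bar> / \<rho>" using M by (simp add: ln_mult tlog_def M_def)
  finally show ?thesis .
qed

text \<open>A small rotation of z makes z^2 nonreal. The swept potential changes by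
  O(\<delta>/\<open>\<rho>\<close>) and the left side is continuous, so \<delta> may tend to
  0.\<close>

lemma swept_ge:
  assumes \<eta>: "0 < \<eta>" "\<eta> < pi" and r: "r > 0" and z: "z \<noteq> 0" and \<rho>: "0 < \<rho>" "\<rho> \<le> 1/4"
  shows "ln (max (norm (cis (- \<eta>) - z\<^sup>2 / of_real (r\<^sup>2))) (norm (cis \<eta> - z\<^sup>2 / of_real (r\<^sup>2)))) \<le> swept \<eta> \<rho> r z"
proof (cases "Im (z\<^sup>2) = 0")
  case False
  then show ?thesis by (intro swept_ge_nonreal \<eta> r \<rho>)
next
  case True
  define \<zeta> where "\<zeta> = z\<^sup>2 / of_real (r\<^sup>2)"
  have \<eta>': "0 < pi - \<eta>" "pi - \<eta> < pi" using \<eta> by auto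
  have "z\<^sup>2 \<noteq> 0" using z by simp
  then have X: "Re (z\<^sup>2) \<noteq> 0" using True by (simp add: complex_eq_iff)
  let ?m = "\<lambda>\<delta>. max (norm (cis (- \<eta>) - \<zeta> * cis (2 * \<delta>))) (norm (cis \<eta> - \<zeta> * cis (2 * \<delta>)))"
  have bound: "ln (?m \<delta>) \<le> swept \<eta> \<rho> r z + 4 * \<delta> / \<rho>" if \<delta>: "0 < \<delta>" "\<delta> < 1" for \<delta>
  proof -
    define z' where "z' = cis \<delta> * z"
    have "z'\<^sup>2 = cis (2 * \<delta>) * z\<^sup>2" by (simp add: z'_def power_mult_distrib power2_eq_square cis_mult)
    moreover have "sin (2 * \<delta>) > 0" using \<delta> pi_gt3 by (intro sin_gt_zero) auto
    ultimately have "Im (z'\<^sup>2) \<noteq> 0" using X True by simp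
    from swept_ge_nonreal[OF \<eta> r this \<rho>]
    have "ln (?m \<delta>) \<le> swept \<eta> \<rho> r z'" using \<open>z'\<^sup>2 = cis (2 * \<delta>) * z\<^sup>2\<close> by (simp add: \<zeta>_def mult.commute)
    also have "\<dots> \<le> swept \<eta> \<rho> r z + 4 * \<delta> / \<rho>"
    proof -
      have t2: "tlog2 \<rho> (cis \<delta> * t) \<le> tlog2 \<rho> t + 4 * \<delta> / \<rho>" for t
        using tlog_rotate[of \<rho> \<delta> t] tlog_rotate[of \<rho> \<delta> "- t"] \<rho> \<delta> by (simp add: tlog2_def)
      have half: "(LINT x:{0<..}|lborel. poisson \<alpha> r x * tlog2 \<rho> ((cis \<delta> * s) / of_real x))
          \<le> (LINT x:{0<..}|lborel. poisson \<alpha> r x * tlog2 \<rho> (s / of_real x)) + (4 * \<delta> / \<rho>) * ((pi - \<alpha>) / pi)"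
        if \<alpha>: "0 < \<alpha>" "\<alpha> < pi" for \<alpha> s
      proof -
        have i1: "set_integrable lborel {0<..} (\<lambda>x. poisson \<alpha> r x * tlog2 \<rho> (s / of_real x))"
          by (rule set_integrable_poisson_tlog2[OF \<alpha> r \<rho>])
        have i2: "set_integrable lborel {0<..} (\<lambda>x. (4 * \<delta> / \<rho>) * poisson \<alpha> r x)"
          by (intro set_integrable_mult_right set_integrable_poisson[OF \<alpha> r])
        have "(LINT x:{0<..}|lborel. poisson \<alpha> r x * tlog2 \<rho> ((cis \<delta> * s) / of_real x))
           \<le> (LINT x:{0<..}|lborel. poisson \<alpha> r x * tlog2 \<rho> (s / of_real x) + (4 * \<delta> / \<rho>) * poisson \<alpha> r x)"
        proof (rule set_integral_mono[OF set_integrable_poisson_tlog2[OF \<alpha> r \<rho>] set_integral_add(1)[OF i1 i2]])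
          fix x :: real assume "x \<in> {0<..}"
          then have "poisson \<alpha> r x * tlog2 \<rho> (cis \<delta> * (s / of_real x)) \<le> poisson \<alpha> r x * (tlog2 \<rho> (s / of_real x) + 4 * \<delta> / \<rho>)"
            using poisson_nonneg[OF \<alpha> r, of x] by (intro mult_left_mono t2) auto
          then show "poisson \<alpha> r x * tlog2 \<rho> ((cis \<delta> * s) / of_real x) \<le> poisson \<alpha> r x * tlog2 \<rho> (s / of_real x) + (4 * \<delta> / \<rho>) * poisson \<alpha> r x"
            by (simp add: algebra_simps)
        qed
        also have "\<dots> = (LINT x:{0<..}|lborel. poisson \<alpha> r x * tlog2 \<rho> (s / of_real x)) + (4 * \<delta> / \<rho>) * ((pi - \<alpha>) / pi)"
          using set_integral_add(2)[OF i1 i2] by (simp add: integral_poisson[OF \<alpha> r])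
        finally show ?thesis .
      qed
      have "- \<i> * z' = cis \<delta> * (- \<i> * z)" by (simp add: z'_def)
      then have "swept \<eta> \<rho> r z' \<le> swept \<eta> \<rho> r z + (4 * \<delta> / \<rho>) * ((pi - \<eta>) / pi) + (4 * \<delta> / \<rho>) * ((pi - (pi - \<eta>)) / pi)"
        using half[OF \<eta>, of z] half[OF \<eta>', of "- \<i> * z"] unfolding swept_def by (simp only: z'_def)
      moreover have "(4 * \<delta> / \<rho>) * ((pi - \<eta>) / pi) + (4 * \<delta> / \<rho>) * ((pi - (pi - \<eta>)) / pi) = 4 * \<delta> / \<rho>"
        using \<rho> pi_gt_zero by (simp add: field_simps)
      ultimately show ?thesis by linarith
    qed
    finally show ?thesis .
  qed
  have s: "sin \<eta> > 0" using \<eta> by (rule sin_gt_zero)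
  have mpos: "?m 0 > 0"
  proof -
    have "cis (- \<eta>) - \<zeta> \<noteq> cis \<eta> - \<zeta>" using s by (auto simp: complex_eq_iff)
    then have "cis (- \<eta>) - \<zeta> \<noteq> 0 \<or> cis \<eta> - \<zeta> \<noteq> 0" by metis
    then show ?thesis by (auto simp: less_max_iff_disj)
  qed
  have "isCont (\<lambda>\<delta>. cis (2 * \<delta>)) 0" unfolding cis_conv_exp by (intro continuous_intros)
  note cc = this
  have "isCont (\<lambda>\<delta>. ln (?m \<delta>)) 0" using mpos by (intro continuous_intros cc) auto
  then have "((\<lambda>\<delta>. ln (?m \<delta>)) \<longlongrightarrow> ln (?m 0)) (at_right 0)"
    unfolding isCont_def by (rule tendsto_mono[rotated]) (simp add: at_le)
  moreover have "((\<lambda>\<delta>. swept \<eta> \<rho> r z + 4 * \<delta> / \<rho>) \<longlongrightarrow> swept \<eta> \<rho> r z + 4 * 0 / \<rho>) (at_right 0)"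
    using \<rho> by (intro tendsto_intros) auto
  moreover have "eventually (\<lambda>\<delta>. ln (?m \<delta>) \<le> swept \<eta> \<rho> r z + 4 * \<delta> / \<rho>) (at_right 0)"
    unfolding eventually_at_right_field using bound by (intro exI[of _ 1]) auto
  ultimately have "ln (?m 0) \<le> swept \<eta> \<rho> r z + 4 * 0 / \<rho>"
    by (intro tendsto_le[of "at_right 0"]) auto
  then show ?thesis by (simp add: \<zeta>_def)
qed

section \<open>Comparing a mass in the narrow angles with its swept image\<close>

text \<open>For Re \<zeta> nonnegative a point of the unit arc between the angles -\<eta> and \<eta>
  is no farther from \<zeta> than the farther of the two ends. For Re \<zeta> negative it may be
  farther by a relative amount of order (1 - cos \<eta>) |\<zeta>|/(1 + |\<zeta>|^2), which is the
  correction term.\<close>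

lemma tlog2_le_swept:
  assumes \<eta>: "0 < \<eta>" "\<eta> \<le> 1/2" and w: "w \<noteq> 0" "\<bar>Im w\<bar> \<le> sin (\<eta> / 2) * norm w" and z: "z \<noteq> 0"
    and \<rho>: "0 < \<rho>" "\<rho> \<le> 1/4" "3 * \<rho> \<le> sin \<eta>"
  shows "tlog2 \<rho> (z / w) \<le> swept \<eta> \<rho> (norm w) z + (1 - cos \<eta>) * ((norm z)\<^sup>2 * (norm w)\<^sup>2 / ((norm w) ^ 4 + (norm z) ^ 4))"
proof -
  define r where "r = norm w"
  have r: "r > 0" using w by (simp add: r_def)
  define \<zeta> \<omega> where "\<zeta> = z\<^sup>2 / of_real (r\<^sup>2)" and "\<omega> = w\<^sup>2 / of_real (r\<^sup>2)"
  define T where "T = max (norm (cis (- \<eta>) - \<zeta>)) (norm (cis \<eta> - \<zeta>))"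
  define X Y where "X = Re \<zeta>" and "Y = Im \<zeta>"
  define a b where "a = Re \<omega>" and "b = Im \<omega>"
  define N where "N = X\<^sup>2 + Y\<^sup>2"
  have \<eta>pi: "\<eta> < pi" "\<eta> < pi/2" using \<eta> pi_gt3 by auto
  have s: "sin \<eta> > 0" using \<eta> \<eta>pi by (intro sin_gt_zero) auto
  have c: "cos \<eta> \<ge> 0" "cos \<eta> \<le> 1" using \<eta> \<eta>pi by (auto intro!: cos_ge_zero)
  have s2: "sin (\<eta>/2) \<ge> 0" using \<eta> \<eta>pi by (intro sin_ge_zero) auto
  have om: "norm \<omega> = 1" using r by (simp add: \<omega>_def norm_divide norm_power r_def)
  then have ab: "a\<^sup>2 + b\<^sup>2 = 1" using cmod_power2[of \<omega>] by (simp add: a_def b_def)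
  \<comment> \<open>Squaring doubles the angle: |Im w| up to sin(\<eta>/2) |w| puts the unit vector
    \<omega> on the arc between the angles -\<eta> and \<eta>.\<close>
  have a: "cos \<eta> \<le> a"
  proof -
    have "(Im w)\<^sup>2 \<le> (sin (\<eta>/2) * r)\<^sup>2" using w(2) s2 by (intro power2_le_iff_abs_le[THEN iffD2]) (auto simp: r_def)
    moreover have "r\<^sup>2 = (Re w)\<^sup>2 + (Im w)\<^sup>2" by (simp add: r_def cmod_power2)
    moreover have c2: "cos \<eta> = 1 - 2 * (sin (\<eta>/2))\<^sup>2" using cos_double_sin[of "\<eta>/2"] by simp
    moreover have "r\<^sup>2 * cos \<eta> = r\<^sup>2 - 2 * (sin (\<eta>/2) * r)\<^sup>2" unfolding c2 by (simp add: power_mult_distrib right_diff_distrib)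
    ultimately have "r\<^sup>2 * cos \<eta> \<le> (Re w)\<^sup>2 - (Im w)\<^sup>2" by linarith
    also have "\<dots> = r\<^sup>2 * a" using r by (simp add: a_def \<omega>_def Re_divide_of_real) (simp add: power2_eq_square)
    finally show ?thesis using r by simp
  qed
  have b: "\<bar>b\<bar> \<le> sin \<eta>"
  proof -
    have "(cos \<eta>)\<^sup>2 \<le> a\<^sup>2" using a c by (intro power_mono) auto
    then have "b\<^sup>2 \<le> (sin \<eta>)\<^sup>2" using ab by (simp add: sin_squared_eq)
    then show ?thesis using s by (simp add: abs_le_square_iff[symmetric])
  qed
  have a1: "a \<le> 1" using om abs_Re_le_cmod[of \<omega>] by (simp add: a_def)
  have N0: "N \<ge> 0" by (simp add: N_def)
  have Nz: "norm \<zeta> = sqrt N" "(norm \<zeta>)\<^sup>2 = N" by (simp_all add: N_def X_def Y_def cmod_def)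
  have A: "(norm (cis (- \<eta>) - \<zeta>))\<^sup>2 = 1 + N - 2 * X * cos \<eta> + 2 * Y * sin \<eta>" "(norm (cis \<eta> - \<zeta>))\<^sup>2 = 1 + N - 2 * X * cos \<eta> - 2 * Y * sin \<eta>"
    unfolding cmod_power2 using sin_cos_squared_add3[of \<eta>] by (simp_all add: N_def X_def Y_def power2_eq_square algebra_simps)
  \<comment> \<open>The two ends of the arc are 2 sin \<eta> apart, so one of them is at least sin
    \<eta> away from \<zeta>. Near a pole the truncated product is at most 3 \<open>\<rho>\<close>,
    hence below this value.\<close>
  have Tpos: "sin \<eta> \<le> T"
  proof -
    have "cis \<eta> - cis (- \<eta>) = of_real (2 * sin \<eta>) * \<i>" by (simp add: complex_eq_iff)
    then have "norm (cis \<eta> - cis (- \<eta>)) = 2 * sin \<eta>" using s by (simp only: norm_mult norm_of_real) simp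
    moreover have "norm (cis \<eta> - cis (- \<eta>)) \<le> norm (cis \<eta> - \<zeta>) + norm (cis (- \<eta>) - \<zeta>)"
      using norm_triangle_ineq4[of "cis \<eta> - \<zeta>" "cis (- \<eta>) - \<zeta>"] by simp
    ultimately show ?thesis unfolding T_def by linarith
  qed
  have T0: "T > 0" using Tpos s by linarith
  have T2: "1 + N - 2 * X * cos \<eta> + 2 * \<bar>Y\<bar> * sin \<eta> \<le> T\<^sup>2"
  proof -
    have "(norm (cis (- \<eta>) - \<zeta>))\<^sup>2 \<le> T\<^sup>2" "(norm (cis \<eta> - \<zeta>))\<^sup>2 \<le> T\<^sup>2" by (intro power_mono; simp add: T_def)+
    then show ?thesis unfolding A by (cases "Y \<ge> 0") auto
  qed
  have om2: "(norm (\<omega> - \<zeta>))\<^sup>2 = 1 + N - 2 * (a * X + b * Y)"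
    unfolding cmod_power2 using ab by (simp add: N_def X_def Y_def a_def b_def power2_eq_square algebra_simps)
  have bY: "- (\<bar>Y\<bar> * sin \<eta>) \<le> b * Y"
  proof -
    have "\<bar>b * Y\<bar> \<le> sin \<eta> * \<bar>Y\<bar>" unfolding abs_mult using b by (intro mult_right_mono) auto
    then show ?thesis by (simp add: mult.commute)
  qed
  \<comment> \<open>The excess of the squared distance, relative to 1 + |\<zeta>|^2; for Re \<zeta>
    negative the latter is at most T^2.\<close>
  define E where "E = 2 * (1 - cos \<eta>) * (norm \<zeta> / (1 + N))"
  have E0: "E \<ge> 0" using c N0 by (simp add: E_def)
  have le: "(norm (\<omega> - \<zeta>))\<^sup>2 \<le> T\<^sup>2 * (1 + E)"
  proof (cases "X \<ge> 0")
    case True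
    then have "cos \<eta> * X \<le> a * X" using a by (intro mult_right_mono) auto
    then have "(norm (\<omega> - \<zeta>))\<^sup>2 \<le> T\<^sup>2" using T2 bY unfolding om2 by (simp add: algebra_simps)
    also have "\<dots> \<le> T\<^sup>2 * (1 + E)" using E0 by (simp add: mult_le_cancel_left1)
    finally show ?thesis .
  next
    case False
    have "1 * X \<le> a * X" using a1 False by (intro mult_right_mono_neg) auto
    moreover have "X \<ge> - norm \<zeta>" using abs_Re_le_cmod[of \<zeta>] by (simp add: X_def)
    then have "- norm \<zeta> * (1 - cos \<eta>) \<le> X * (1 - cos \<eta>)" using c by (intro mult_right_mono) auto
    ultimately have 1: "(norm (\<omega> - \<zeta>))\<^sup>2 \<le> T\<^sup>2 + 2 * norm \<zeta> * (1 - cos \<eta>)" using T2 bY unfolding om2 by (simp add: algebra_simps)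
    have "X * cos \<eta> \<le> 0" using False c by (intro mult_nonpos_nonneg) auto
    moreover have "\<bar>Y\<bar> * sin \<eta> \<ge> 0" using s by simp
    ultimately have "1 + N \<le> T\<^sup>2" using T2 by linarith
    then have "(1 + N) * E \<le> T\<^sup>2 * E" using E0 by (intro mult_right_mono)
    moreover have "(1 + N) * E = 2 * norm \<zeta> * (1 - cos \<eta>)" using N0 by (simp add: E_def)
    ultimately show ?thesis using 1 by (simp add: distrib_left)
  qed
  have "norm (\<omega> - \<zeta>) \<le> T * exp (E / 2)"
  proof (rule power2_le_imp_le)
    have "T\<^sup>2 * (1 + E) \<le> T\<^sup>2 * exp E" by (intro mult_left_mono exp_ge_add_one_self) auto
    also have "\<dots> = (T * exp (E/2))\<^sup>2" by (simp add: power_mult_distrib exp_double[symmetric])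
    finally show "(norm (\<omega> - \<zeta>))\<^sup>2 \<le> (T * exp (E / 2))\<^sup>2" using le by linarith
  qed (use T0 in simp)
  moreover have "norm (1 - (z / w)\<^sup>2) = norm (\<omega> - \<zeta>)"
  proof -
    have "\<omega> - \<zeta> = \<omega> * (1 - (z / w)\<^sup>2)" using w r by (simp add: \<omega>_def \<zeta>_def field_simps)
    then show ?thesis using om by (simp add: norm_mult)
  qed
  ultimately have le1: "norm (1 - z / w) * norm (1 + z / w) \<le> T * exp (E / 2)" by (simp add: norm_one_minus_sq)
  have TE: "T * 1 \<le> T * exp (E / 2)" using T0 E0 by (intro mult_left_mono) auto
  have small: "max (norm (1 - t)) \<rho> * max (norm (1 + t)) \<rho> \<le> sin \<eta>" if "norm (1 - t) < \<rho>" for t :: complex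
  proof -
    have "norm (1 + t) \<le> 2 + norm (1 - t)" using norm_triangle_ineq4[of 2 "1 - t"] by (simp add: algebra_simps)
    then have "max (norm (1 - t)) \<rho> * max (norm (1 + t)) \<rho> \<le> \<rho> * 3" using that \<rho> by (intro mult_mono) auto
    then show ?thesis using \<rho> by simp
  qed
  have "max (norm (1 - z / w)) \<rho> * max (norm (1 + z / w)) \<rho> \<le> T * exp (E / 2)"
  proof (cases "norm (1 - z / w) < \<rho> \<or> norm (1 + z / w) < \<rho>")
    case True
    then have "max (norm (1 - z / w)) \<rho> * max (norm (1 + z / w)) \<rho> \<le> sin \<eta>"
      using small[of "z / w"] small[of "- (z / w)"] by (auto simp: mult.commute)
    then show ?thesis using Tpos TE by linarith
  next
    case False
    then show ?thesis using le1 by (simp add: max_absorb1)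
  qed
  then have "tlog2 \<rho> (z / w) \<le> ln (T * exp (E / 2))" unfolding tlog2_eq[OF \<rho>(1)] using \<rho> by (intro ln_mono mult_pos_pos) auto
  also have "\<dots> = ln T + E / 2" using T0 by (simp add: ln_mult)
  also have "ln T \<le> swept \<eta> \<rho> r z" unfolding T_def \<zeta>_def using \<eta> \<eta>pi r z \<rho> by (intro swept_ge) auto
  also have "E / 2 = (1 - cos \<eta>) * ((norm z)\<^sup>2 * r\<^sup>2 / (r ^ 4 + (norm z) ^ 4))"
  proof -
    have n1: "norm \<zeta> = (norm z)\<^sup>2 / r\<^sup>2" by (simp add: \<zeta>_def norm_divide norm_power)
    have "1 + N = (r ^ 4 + (norm z) ^ 4) / r ^ 4"
      unfolding Nz(2)[symmetric] n1 using r by (simp add: power_divide power_mult[symmetric] add_divide_distrib)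
    then have "norm \<zeta> / (1 + N) = (norm z)\<^sup>2 * r\<^sup>2 / (r ^ 4 + (norm z) ^ 4)"
      unfolding n1 using r by (simp add: power2_eq_square power4_eq_xxxx)
    moreover have "2 * x * y / 2 = x * y" for x y :: real by simp
    ultimately show ?thesis unfolding E_def by metis
  qed
  finally show ?thesis by (simp add: r_def)
qed

lemma sin_ge_half: assumes "0 \<le> y" "y \<le> 1" shows "y / 2 \<le> sin (y::real)"
proof -
  have "sin 0 - 0 / 2 \<le> sin y - y / 2"
  proof (rule DERIV_nonneg_imp_nondecreasing[OF assms(1), of "\<lambda>y. sin y - y / 2"])
    fix x :: real assume x: "0 \<le> x" "x \<le> y"
    have "2 * (sin (x/2))\<^sup>2 \<le> 2 * (x / 2)\<^sup>2"
      using abs_sin_x_le_abs_x[of "x/2"] by (intro mult_left_mono abs_le_square_iff[THEN iffD1]) auto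
    moreover have "x\<^sup>2 \<le> 1" using x assms by (simp add: power_le_one)
    ultimately have "cos x - 1/2 \<ge> 0" using cos_double_sin[of "x/2"] by (simp add: power_divide)
    moreover have "((\<lambda>y. sin y - y / 2) has_real_derivative cos x - 1/2) (at x)" by (auto intro!: derivative_eq_intros)
    ultimately show "\<exists>d. ((\<lambda>y. sin y - y / 2) has_real_derivative d) (at x) \<and> 0 \<le> d" by blast
  qed
  then show ?thesis by simp
qed

section \<open>Size of the kernels and of their integrals over the mass\<close>

text \<open>With h = 2(1 - cos \<eta>), of order \<eta>^2, the denominator on the near axis is (x^2
  - r^2)^2 + h x^2 r^2, whence height sin \<eta> / h, about 1/\<eta>. On the far axis the mixed term
  is nonnegative and only the factor sin \<eta> remains. Both decay in r fast enough to be
  integrated.\<close>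

lemma poisson_le:
  assumes \<eta>: "0 < \<eta>" "\<eta> \<le> 1/2" and x: "x > 0" and r: "r > 0"
  shows poisson_le_main: "poisson \<eta> r x \<le> (12 / (pi * \<eta> * x)) * (1 / (1 + (r / x)\<^sup>2))"
    and poisson_le_cross: "poisson (pi - \<eta>) r x \<le> (4 * \<eta> / (pi * x)) * (1 / (1 + (r / x)\<^sup>2))"
proof -
  have \<eta>pi: "\<eta> < pi" "\<eta> < pi/2" using \<eta> pi_gt3 by auto
  have s: "sin \<eta> > 0" using \<eta> \<eta>pi by (intro sin_gt_zero) auto
  have c: "cos \<eta> \<ge> 0" "cos \<eta> \<le> 1" using \<eta> \<eta>pi by (auto intro!: cos_ge_zero)
  define S where "S = sin (\<eta> / 2)"
  have S: "\<eta> / 4 \<le> S" "S \<le> \<eta> / 2" using sin_ge_half[of "\<eta>/2"] sin_x_le_x[of "\<eta>/2"] \<eta> by (auto simp: S_def)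
  have S0: "S > 0" using S \<eta> by linarith
  define h where "h = 4 * S\<^sup>2"
  have h: "cos \<eta> = 1 - h / 2" using cos_double_sin[of "\<eta>/2"] by (simp add: h_def S_def)
  have h0: "h > 0" using S0 by (simp add: h_def)
  have "h \<le> 4 * (1/4)\<^sup>2" unfolding h_def using S S0 \<eta> by (intro mult_left_mono power_mono) auto
  then have h4: "h \<le> 1/4" by (simp add: power2_eq_square)
  have fr: "(1 / (1 + (r / x)\<^sup>2)) = x\<^sup>2 / (x\<^sup>2 + r\<^sup>2)" using x by (simp add: power_divide field_simps)
  have xr: "x\<^sup>2 + r\<^sup>2 > 0" using x by (simp add: add_pos_nonneg)
  define D where "D = x ^ 4 - 2 * x\<^sup>2 * r\<^sup>2 * cos \<eta> + r ^ 4"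
  have D: "D = (x\<^sup>2 - r\<^sup>2)\<^sup>2 + h * x\<^sup>2 * r\<^sup>2"
    unfolding D_def h by (simp add: power2_diff power_mult[symmetric] algebra_simps)
  \<comment> \<open>When 2x^2 is at least r^2 the term h x^2 r^2 suffices; otherwise (x^2 - r^2)^2
    is at least r^4/4 and h at most 1/4.\<close>
  have key: "h * r\<^sup>2 * (x\<^sup>2 + r\<^sup>2) \<le> 3 * D"
  proof -
    have "0 \<le> 3 * (x\<^sup>2 - r\<^sup>2)\<^sup>2 + h * (r\<^sup>2 * (2 * x\<^sup>2 - r\<^sup>2))"
    proof (cases "2 * x\<^sup>2 \<ge> r\<^sup>2")
      case True
      then show ?thesis using h0 by (intro add_nonneg_nonneg mult_nonneg_nonneg) auto
    next
      case False
      have "(r\<^sup>2 / 2)\<^sup>2 \<le> (r\<^sup>2 - x\<^sup>2)\<^sup>2" using False by (intro power_mono) auto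
      then have 1: "r ^ 4 / 4 \<le> (x\<^sup>2 - r\<^sup>2)\<^sup>2" by (simp add: power_divide power_mult[symmetric] power2_commute)
      have "h * (r\<^sup>2 * (2 * x\<^sup>2 - r\<^sup>2)) \<ge> h * (r\<^sup>2 * (- r\<^sup>2))"
        using h0 by (intro mult_left_mono) auto
      then have 2: "h * (r\<^sup>2 * (2 * x\<^sup>2 - r\<^sup>2)) \<ge> - (h * r ^ 4)" by (simp add: power4_eq_xxxx power2_eq_square)
      have "h * r ^ 4 \<le> (1/4) * r ^ 4" using h4 by (intro mult_right_mono) auto
      then show ?thesis using 1 2 zero_le_power[of r 4] r by linarith
    qed
    then show ?thesis unfolding D by (simp add: algebra_simps)
  qed
  have Dpos: "D > 0" unfolding D_def by (rule poisson_denom_pos) (use \<eta> \<eta>pi r in auto)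
  have "r\<^sup>2 = (h * r\<^sup>2 * (x\<^sup>2 + r\<^sup>2)) / (h * (x\<^sup>2 + r\<^sup>2))" using h0 xr by simp
  also have "\<dots> \<le> 3 * D / (h * (x\<^sup>2 + r\<^sup>2))" using key h0 xr by (intro divide_right_mono) auto
  finally have "r\<^sup>2 \<le> 3 / (h * (x\<^sup>2 + r\<^sup>2)) * D" by simp
  then have "r\<^sup>2 / D \<le> 3 / (h * (x\<^sup>2 + r\<^sup>2))" by (rule mult_imp_div_pos_le[OF Dpos])
  then have "(2 * sin \<eta> * x / pi) * (r\<^sup>2 / D) \<le> (2 * sin \<eta> * x / pi) * (3 / (h * (x\<^sup>2 + r\<^sup>2)))"
    using s x by (intro mult_left_mono) auto
  moreover have "poisson \<eta> r x = (2 * sin \<eta> * x / pi) * (r\<^sup>2 / D)" by (simp add: poisson_def D_def)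
  moreover have "(2 * sin \<eta> * x / pi) * (3 / (h * (x\<^sup>2 + r\<^sup>2))) = (6 * sin \<eta> / h) * (x / (pi * (x\<^sup>2 + r\<^sup>2)))" using h0 xr by (simp add: field_simps)
  moreover have "(6 * sin \<eta> / h) * (x / (pi * (x\<^sup>2 + r\<^sup>2))) \<le> (12 / \<eta>) * (x / (pi * (x\<^sup>2 + r\<^sup>2)))"
  proof (rule mult_right_mono)
    have "sin \<eta> = 2 * S * cos (\<eta>/2)" using sin_double[of "\<eta>/2"] by (simp add: S_def)
    also have "\<dots> \<le> 2 * S * 1" using S0 by (intro mult_left_mono) auto
    finally have "6 * sin \<eta> / h \<le> 6 * (2 * S) / h" using h0 by (intro divide_right_mono) auto
    also have "\<dots> = 3 / S" using S0 by (simp add: h_def power2_eq_square)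
    also have "\<dots> \<le> 3 / (\<eta> / 4)" using S \<eta> by (intro divide_left_mono) auto
    finally show "6 * sin \<eta> / h \<le> 12 / \<eta>" by simp
  qed (use x xr in simp)
  moreover have "(12 / \<eta>) * (x / (pi * (x\<^sup>2 + r\<^sup>2))) = (12 / (pi * \<eta> * x)) * (1 / (1 + (r / x)\<^sup>2))"
    unfolding fr using x \<eta> by (simp add: power2_eq_square)
  ultimately show "poisson \<eta> r x \<le> (12 / (pi * \<eta> * x)) * (1 / (1 + (r / x)\<^sup>2))" by linarith
  define D' where "D' = x ^ 4 - 2 * x\<^sup>2 * r\<^sup>2 * cos (pi - \<eta>) + r ^ 4"
  have "(x\<^sup>2 + r\<^sup>2)\<^sup>2 \<le> 2 * (x ^ 4 + r ^ 4)"
    using sum_squares_bound[of "x\<^sup>2" "r\<^sup>2"] by (simp add: power2_sum power_mult[symmetric])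
  also have "x ^ 4 + r ^ 4 \<le> D'" using c by (simp add: D'_def)
  finally have D': "(x\<^sup>2 + r\<^sup>2)\<^sup>2 \<le> 2 * D'" by simp
  then have D'0: "D' > 0" using zero_less_power[OF xr, of 2] by linarith
  have "r\<^sup>2 * (x\<^sup>2 + r\<^sup>2) \<le> (x\<^sup>2 + r\<^sup>2) * (x\<^sup>2 + r\<^sup>2)" using xr by (intro mult_right_mono) auto
  then have "r\<^sup>2 * (x\<^sup>2 + r\<^sup>2) \<le> 2 * D'" using D' by (simp add: power2_eq_square)
  then have "r\<^sup>2 * (x\<^sup>2 + r\<^sup>2) / (x\<^sup>2 + r\<^sup>2) \<le> 2 * D' / (x\<^sup>2 + r\<^sup>2)" using xr by (intro divide_right_mono) auto
  then have "r\<^sup>2 \<le> 2 / (x\<^sup>2 + r\<^sup>2) * D'" using xr x by simp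
  then have "r\<^sup>2 / D' \<le> 2 / (x\<^sup>2 + r\<^sup>2)" by (rule mult_imp_div_pos_le[OF D'0])
  then have "(2 * sin \<eta> * x / pi) * (r\<^sup>2 / D') \<le> (2 * sin \<eta> * x / pi) * (2 / (x\<^sup>2 + r\<^sup>2))"
    using s x by (intro mult_left_mono) auto
  also have "\<dots> \<le> (2 * \<eta> * x / pi) * (2 / (x\<^sup>2 + r\<^sup>2))"
    using sin_x_le_x[of \<eta>] \<eta> x xr by (intro mult_right_mono divide_right_mono) auto
  also have "\<dots> = (4 * \<eta> / (pi * x)) * (1 / (1 + (r / x)\<^sup>2))"
    unfolding fr using x by (simp add: power2_eq_square)
  also have "(2 * sin \<eta> * x / pi) * (r\<^sup>2 / D') = poisson (pi - \<eta>) r x" by (simp add: poisson_def D'_def)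
  finally show "poisson (pi - \<eta>) r x \<le> (4 * \<eta> / (pi * x)) * (1 / (1 + (r / x)\<^sup>2))" .
qed

lemma nn_integral_arctan_le:
  assumes x: "x > 0" and K: "K \<ge> 0"
  shows "(\<integral>\<^sup>+t. ennreal (K * (1 / (1 + (t / x)\<^sup>2))) * indicator {0<..} t \<partial>lborel) \<le> ennreal (K * (pi / 2) * x)"
proof -
  have pos: "1 + (t / x)\<^sup>2 > 0" for t by (simp add: add_pos_nonneg)
  have "(\<integral>\<^sup>+t. ennreal (K * (1 / (1 + (t / x)\<^sup>2))) * indicator {0<..} t \<partial>lborel)
     \<le> (\<integral>\<^sup>+t. ennreal (K * (1 / (1 + (t / x)\<^sup>2))) * indicator {0..} t \<partial>lborel)"
    by (intro nn_integral_mono) (auto simp: indicator_def)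
  also have "\<dots> = ennreal (K * (pi/2) * x - K * arctan (0 / x) * x)"
  proof (rule nn_integral_FTC_atLeast)
    show "((\<lambda>t. K * arctan (t / x) * x) has_real_derivative K * (1 / (1 + (t / x)\<^sup>2))) (at t)" for t
      using DERIV_cmult_right[OF DERIV_cmult[OF DERIV_chain2[OF DERIV_arctan DERIV_cdivide[OF DERIV_ident, of x t]], of K], of x] x
      by (simp add: inverse_eq_divide)
    have "filterlim (\<lambda>t. t / x) at_top at_top"
      using x filterlim_tendsto_pos_mult_at_top[of "\<lambda>_. 1/x" "1/x" at_top "\<lambda>t. t"] by (simp add: filterlim_ident)
    then have "((\<lambda>t. arctan (t / x)) \<longlongrightarrow> pi / 2) at_top" by (rule filterlim_compose[OF tendsto_arctan_at_top])
    then show "((\<lambda>t. K * arctan (t / x) * x) \<longlongrightarrow> K * (pi / 2) * x) at_top" by (intro tendsto_intros)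
    show "0 \<le> K * (1 / (1 + (t / x)\<^sup>2))" for t using K pos[of t] by (intro mult_nonneg_nonneg) auto
  qed measurable
  finally show ?thesis by simp
qed

text \<open>Linear growth acts like density \<open>B\<close> on the half-line, where K/(1 + (t/x)^2)
  integrates to K (\<pi>/2) x.\<close>

lemma integral_growth_le:
  fixes \<mu> :: "complex measure"
  assumes \<mu>: "sets \<mu> = sets borel" "finite_measure \<mu>" and B: "B \<ge> 0"
    and growth: "\<And>t. t \<ge> 0 \<Longrightarrow> emeasure \<mu> (cball 0 t) \<le> ennreal (B * t)"
    and x: "x > 0" and K: "K \<ge> 0" and f: "AE w in \<mu>. 0 \<le> f w \<and> f w \<le> K * (1 / (1 + (norm w / x)\<^sup>2))"
    and [measurable]: "f \<in> borel_measurable borel"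
  shows "(\<integral>\<^sup>+w. ennreal (f w) \<partial>\<mu>) \<le> ennreal (B * K * (pi/2) * x)"
    and "integrable \<mu> f" "(\<integral>w. f w \<partial>\<mu>) \<le> B * K * (pi/2) * x"
proof -
  note [measurable_cong] = \<mu>(1)
  interpret finite_measure \<mu> by fact
  have "(\<integral>\<^sup>+w. ennreal (f w) \<partial>\<mu>) \<le> (\<integral>\<^sup>+w. ennreal (K * (1 / (1 + (norm w / x)\<^sup>2))) \<partial>\<mu>)"
    by (rule nn_integral_mono_AE) (use f in \<open>auto intro: ennreal_leI\<close>)
  also have "\<dots> \<le> ennreal B * (\<integral>\<^sup>+t. ennreal (K * (1 / (1 + (t / x)\<^sup>2))) * indicator {0<..} t \<partial>lborel)"
  proof (rule nn_integral_decreasing_le[OF \<mu>(1) _ B growth])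
    show "sigma_finite_measure \<mu>" by unfold_locales
    fix s t :: real assume "0 < s" "s \<le> t"
    then show "K * (1 / (1 + (t / x)\<^sup>2)) \<le> K * (1 / (1 + (s / x)\<^sup>2))"
      using K x by (intro mult_left_mono divide_left_mono add_left_mono power_mono divide_right_mono mult_pos_pos) (auto intro: add_pos_nonneg)
  qed measurable
  also have "\<dots> \<le> ennreal B * ennreal (K * (pi / 2) * x)" by (intro mult_left_mono nn_integral_arctan_le x K) simp
  also have "\<dots> = ennreal (B * K * (pi/2) * x)" using B K x by (simp add: ennreal_mult[symmetric] mult.assoc)
  finally show nn: "(\<integral>\<^sup>+w. ennreal (f w) \<partial>\<mu>) \<le> ennreal (B * K * (pi/2) * x)" .
  show int: "integrable \<mu> f"
    by (rule integrableI_nonneg) (use f nn in \<open>auto intro: le_less_trans\<close>)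
  have "ennreal (\<integral>w. f w \<partial>\<mu>) \<le> ennreal (B * K * (pi/2) * x)"
    using nn nn_integral_eq_integral[OF int] f by auto
  then show "(\<integral>w. f w \<partial>\<mu>) \<le> B * K * (pi/2) * x" using B K x by (subst (asm) ennreal_le_iff) auto
qed

subsection \<open>Sweeping a measure\<close>

text \<open>The uniform bound \<open>C\<close> on the swept density dominates the double integral by
  a multiple of the integral of |F|, which permits the exchange.\<close>

lemma sweep_Fubini:
  fixes \<mu> :: "complex measure" and k :: "complex \<Rightarrow> real \<Rightarrow> real" and F :: "real \<Rightarrow> real"
  assumes \<mu>: "sets \<mu> = sets borel" "finite_measure \<mu>"
    and k: "(\<lambda>(w, x). k w x) \<in> borel_measurable (borel \<Otimes>\<^sub>M borel)" and k0: "\<And>w x. x > 0 \<Longrightarrow> 0 \<le> k w x"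
    and kint: "\<And>x. x > 0 \<Longrightarrow> integrable \<mu> (\<lambda>w. k w x)" and kC: "\<And>x. x > 0 \<Longrightarrow> (\<integral>w. k w x \<partial>\<mu>) \<le> C"
    and F[measurable]: "F \<in> borel_measurable borel" and Fint: "set_integrable lborel {0<..} F"
  shows "integrable \<mu> (\<lambda>w. LINT x:{0<..}|lborel. k w x * F x)"
    and "(\<integral>w. (LINT x:{0<..}|lborel. k w x * F x) \<partial>\<mu>) = (LINT x:{0<..}|lborel. (\<integral>w. k w x \<partial>\<mu>) * F x)"
proof -
  note [measurable_cong] = \<mu>(1)
  interpret finite_measure \<mu> by fact
  interpret pair_sigma_finite lborel \<mu> by unfold_locales
  have [measurable]: "(\<lambda>p. k (snd p) (fst p)) \<in> borel_measurable (lborel \<Otimes>\<^sub>M \<mu>)"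
  proof -
    have "(\<lambda>p. (\<lambda>(w, x). k w x) (snd p, fst p)) \<in> borel_measurable (lborel \<Otimes>\<^sub>M \<mu>)"
      by (rule measurable_compose[OF _ k]) measurable
    then show ?thesis by simp
  qed
  define f where "f = (\<lambda>x w. indicator {0<..} x *\<^sub>R (k w x * F x))"
  have fm[measurable]: "(\<lambda>p. f (fst p) (snd p)) \<in> borel_measurable (lborel \<Otimes>\<^sub>M \<mu>)" unfolding f_def by measurable
  have fm'[measurable]: "case_prod f \<in> borel_measurable (lborel \<Otimes>\<^sub>M \<mu>)" using fm by (simp add: case_prod_unfold)
  have nf: "(\<integral>w. norm (f x w) \<partial>\<mu>) = indicator {0<..} x * (\<bar>F x\<bar> * (\<integral>w. k w x \<partial>\<mu>))" for x
  proof (cases "x > 0")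
    case True
    then have "norm (f x w) = \<bar>F x\<bar> * k w x" for w using k0[OF True, of w] by (simp add: f_def abs_mult)
    then show ?thesis using True by simp
  qed (simp add: f_def)
  have nf': "(\<integral>w. \<bar>f x w\<bar> \<partial>\<mu>) = indicator {0<..} x * (\<bar>F x\<bar> * (\<integral>w. k w x \<partial>\<mu>))" for x using nf by simp
  have int: "integrable (lborel \<Otimes>\<^sub>M \<mu>) (case_prod f)"
  proof (rule Fubini_integrable)
    have "integrable lborel (\<lambda>x. C * norm (indicator {0<..} x *\<^sub>R F x))"
      using Fint unfolding set_integrable_def by (intro integrable_mult_right integrable_norm)
    then show "integrable lborel (\<lambda>x. \<integral>w. norm (case_prod f (x, w)) \<partial>\<mu>)"
    proof (rule Bochner_Integration.integrable_bound)
      show "AE x in lborel. norm (\<integral>w. norm (case_prod f (x, w)) \<partial>\<mu>) \<le> norm (C * norm (indicator {0<..} x *\<^sub>R F x))"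
      proof (rule AE_I2)
        fix x :: real
        show "norm (\<integral>w. norm (case_prod f (x, w)) \<partial>\<mu>) \<le> norm (C * norm (indicator {0<..} x *\<^sub>R F x))"
        proof (cases "x > 0")
          case True
          have "0 \<le> (\<integral>w. k w x \<partial>\<mu>)" using k0[OF True] by simp
          then have "\<bar>F x\<bar> * (\<integral>w. k w x \<partial>\<mu>) \<le> \<bar>F x\<bar> * \<bar>C\<bar>" "0 \<le> \<bar>F x\<bar> * (\<integral>w. k w x \<partial>\<mu>)" using kC[OF True] by (auto intro!: mult_left_mono)
          then show ?thesis using True by (simp add: nf' abs_mult mult.commute)
        qed (simp add: nf')
      qed
    qed measurable
    show "AE x in lborel. integrable \<mu> (\<lambda>w. case_prod f (x, w))"
    proof (rule AE_I2)
      fix x :: real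
      show "integrable \<mu> (\<lambda>w. case_prod f (x, w))"
        using kint[of x] by (cases "x > 0") (auto simp: f_def)
    qed
  qed measurable
  show "integrable \<mu> (\<lambda>w. LINT x:{0<..}|lborel. k w x * F x)"
    using integrable_snd[OF int] by (simp add: f_def set_lebesgue_integral_def)
  have "(\<integral>w. k w x * F x \<partial>\<mu>) = (\<integral>w. k w x \<partial>\<mu>) * F x" for x by simp
  then have "(\<integral>w. f x w \<partial>\<mu>) = indicator {0<..} x *\<^sub>R ((\<integral>w. k w x \<partial>\<mu>) * F x)" for x
    by (simp add: f_def)
  then show "(\<integral>w. (LINT x:{0<..}|lborel. k w x * F x) \<partial>\<mu>) = (LINT x:{0<..}|lborel. (\<integral>w. k w x \<partial>\<mu>) * F x)"
    using Fubini_integral[OF int] by (simp add: f_def set_lebesgue_integral_def)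
qed

definition sweep :: "complex measure \<Rightarrow> real \<Rightarrow> real \<Rightarrow> real" where
  "sweep \<mu> \<eta> x = (\<integral>w. poisson \<eta> (norm w) x \<partial>\<mu>)"

lemma poisson_norm_nonneg: "0 < \<eta> \<Longrightarrow> \<eta> < pi \<Longrightarrow> 0 \<le> x \<Longrightarrow> 0 \<le> poisson \<eta> (norm w) x"
  by (cases "w = 0") (auto simp: poisson_def[of _ 0] intro: poisson_nonneg)

lemma sweep_measurable [measurable]:
  assumes "sets \<mu> = sets borel" "finite_measure \<mu>" shows "sweep \<mu> \<eta> \<in> borel_measurable borel"
proof -
  note [measurable_cong] = assms(1)
  interpret finite_measure \<mu> by fact
  have "(\<lambda>p. (\<lambda>(w, x). poisson \<eta> (norm w) x) (snd p, fst p)) \<in> borel_measurable (borel \<Otimes>\<^sub>M \<mu>)"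
    by (rule measurable_compose[OF _ poisson_measurable(1)]) measurable
  then have [measurable]: "(\<lambda>(x, w). poisson \<eta> (norm w) x) \<in> borel_measurable (borel \<Otimes>\<^sub>M \<mu>)" by (simp add: case_prod_unfold)
  show ?thesis unfolding sweep_def[abs_def] by (rule borel_measurable_lebesgue_integral) measurable
qed

context
  fixes \<mu> :: "complex measure" and B \<eta> r1 :: real
  assumes \<mu>: "sets \<mu> = sets borel" "finite_measure \<mu>" and B: "B \<ge> 0"
    and growth: "\<And>t. t \<ge> 0 \<Longrightarrow> emeasure \<mu> (cball 0 t) \<le> ennreal (B * t)"
    and r1: "r1 > 0" and away: "AE w in \<mu>. r1 \<le> norm w"
    and \<eta>: "0 < \<eta>" "\<eta> \<le> 1/2"
begin

text \<open>The kernel scales like 1/x and the mass it sees like x, so the swept density is bounded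
  independently of x: B (12/(\<pi> \<eta> x)) (\<pi>/2) x = 6 B/\<eta>.\<close>

lemma sweep_main:
  assumes x: "x > 0"
  shows sweep_main_int: "integrable \<mu> (\<lambda>w. poisson \<eta> (norm w) x)"
    and sweep_main_le: "sweep \<mu> \<eta> x \<le> 6 * B / \<eta>"
proof -
  have \<eta>pi: "\<eta> < pi" using \<eta> pi_gt3 by auto
  have ae: "AE w in \<mu>. 0 \<le> poisson \<eta> (norm w) x \<and> poisson \<eta> (norm w) x \<le> (12 / (pi * \<eta> * x)) * (1 / (1 + (norm w / x)\<^sup>2))"
    using away
  proof (rule eventually_mono)
    fix w :: complex assume "r1 \<le> norm w"
    then have "norm w > 0" using r1 by linarith
    then show "0 \<le> poisson \<eta> (norm w) x \<and> poisson \<eta> (norm w) x \<le> (12 / (pi * \<eta> * x)) * (1 / (1 + (norm w / x)\<^sup>2))"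
      using poisson_le_main[OF \<eta> x, of "norm w"] poisson_norm_nonneg[OF \<eta>(1) \<eta>pi, of x w] x by auto
  qed
  have K: "12 / (pi * \<eta> * x) \<ge> 0" using \<eta> x by auto
  note * = integral_growth_le[OF \<mu> B growth x K ae]
  show "integrable \<mu> (\<lambda>w. poisson \<eta> (norm w) x)" by (rule *(2)) measurable
  have "sweep \<mu> \<eta> x \<le> B * (12 / (pi * \<eta> * x)) * (pi/2) * x" unfolding sweep_def by (rule *(3)) measurable
  also have "\<dots> = 6 * B / \<eta>" using x \<eta> by simp
  finally show "sweep \<mu> \<eta> x \<le> 6 * B / \<eta>" .
qed

lemma sweep_cross:
  assumes x: "x > 0"
  shows sweep_cross_int: "integrable \<mu> (\<lambda>w. poisson (pi - \<eta>) (norm w) x)"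
    and sweep_cross_le: "sweep \<mu> (pi - \<eta>) x \<le> 2 * B * \<eta>"
proof -
  have \<eta>pi: "0 < pi - \<eta>" "pi - \<eta> < pi" using \<eta> pi_gt3 by auto
  have ae: "AE w in \<mu>. 0 \<le> poisson (pi - \<eta>) (norm w) x \<and> poisson (pi - \<eta>) (norm w) x \<le> (4 * \<eta> / (pi * x)) * (1 / (1 + (norm w / x)\<^sup>2))"
    using away
  proof (rule eventually_mono)
    fix w :: complex assume "r1 \<le> norm w"
    then have "norm w > 0" using r1 by linarith
    then show "0 \<le> poisson (pi - \<eta>) (norm w) x \<and> poisson (pi - \<eta>) (norm w) x \<le> (4 * \<eta> / (pi * x)) * (1 / (1 + (norm w / x)\<^sup>2))"
      using poisson_le_cross[OF \<eta> x, of "norm w"] poisson_norm_nonneg[OF \<eta>pi, of x w] x by auto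
  qed
  have K: "4 * \<eta> / (pi * x) \<ge> 0" using \<eta> x by auto
  note * = integral_growth_le[OF \<mu> B growth x K ae]
  show "integrable \<mu> (\<lambda>w. poisson (pi - \<eta>) (norm w) x)" by (rule *(2)) measurable
  have "sweep \<mu> (pi - \<eta>) x \<le> B * (4 * \<eta> / (pi * x)) * (pi/2) * x" unfolding sweep_def by (rule *(3)) measurable
  also have "\<dots> = 2 * B * \<eta>" using x \<eta> by simp
  finally show "sweep \<mu> (pi - \<eta>) x \<le> 2 * B * \<eta>" .
qed

lemma sweep_nonneg: "0 < \<alpha> \<Longrightarrow> \<alpha> < pi \<Longrightarrow> x \<ge> 0 \<Longrightarrow> 0 \<le> sweep \<mu> \<alpha> x"
  unfolding sweep_def using poisson_norm_nonneg[of \<alpha> x] by (intro integral_nonneg_AE AE_I2) auto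

text \<open>The bound for a single mass is integrated over \<open>\<mu>\<close> and the order of
  integration exchanged. Its correction is dominated by 2/(1 + (|w|/|z|)^2), whose integral is at
  most B \<pi> |z|.\<close>

lemma integral_tlog2_le_sweep:
  assumes narrow: "AE w in \<mu>. \<bar>Im w\<bar> \<le> sin (\<eta> / 2) * norm w" and z: "z \<noteq> 0"
    and \<rho>: "0 < \<rho>" "\<rho> \<le> 1/4" "3 * \<rho> \<le> sin \<eta>"
  shows "(\<integral>w. tlog2 \<rho> (z / w) \<partial>\<mu>) \<le> (LINT x:{0<..}|lborel. sweep \<mu> \<eta> x * tlog2 \<rho> (z / of_real x))
     + (LINT x:{0<..}|lborel. sweep \<mu> (pi - \<eta>) x * tlog2 \<rho> (- \<i> * z / of_real x)) + (1 - cos \<eta>) * (B * pi * norm z)"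
proof -
  note [measurable_cong] = \<mu>(1)
  interpret finite_measure \<mu> by (rule \<mu>)
  have \<eta>pi: "0 < \<eta>" "\<eta> < pi" "0 < pi - \<eta>" "pi - \<eta> < pi" using \<eta> pi_gt3 by auto
  let ?e = "\<lambda>w. (norm z)\<^sup>2 * (norm w)\<^sup>2 / ((norm w) ^ 4 + (norm z) ^ 4)"
  have m1: "(\<lambda>(w, x). poisson \<alpha> (norm w) x) \<in> borel_measurable (borel \<Otimes>\<^sub>M borel)" for \<alpha> by measurable
  have mF: "(\<lambda>x. tlog2 \<rho> (y / of_real x)) \<in> borel_measurable borel" for y by measurable
  note A = sweep_Fubini[OF \<mu> m1 poisson_norm_nonneg[OF \<eta>pi(1,2) less_imp_le] sweep_main_int sweep_main_le[unfolded sweep_def] mF[of z] set_integrable_tlog2[OF \<rho>(1,2), of z]]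
  note A' = sweep_Fubini[OF \<mu> m1 poisson_norm_nonneg[OF \<eta>pi(3,4) less_imp_le] sweep_cross_int sweep_cross_le[unfolded sweep_def] mF[of "- \<i> * z"] set_integrable_tlog2[OF \<rho>(1,2), of "- \<i> * z"]]
  have ae: "AE w in \<mu>. 0 \<le> ?e w \<and> ?e w \<le> 2 * (1 / (1 + (norm w / norm z)\<^sup>2))"
  proof (rule AE_I2)
    fix w :: complex
    have zp: "norm z > 0" using z by simp
    have n: "norm w ^ 4 + norm z ^ 4 > 0" using zp by (simp add: add_nonneg_pos)
    have m: "(norm z)\<^sup>2 + (norm w)\<^sup>2 > 0" using zp by (simp add: add_pos_nonneg)
    have "2 * (norm z)\<^sup>2 * (norm w)\<^sup>2 \<le> norm z ^ 4 + norm w ^ 4"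
      using sum_squares_bound[of "(norm z)\<^sup>2" "(norm w)\<^sup>2"] by (simp add: power_mult[symmetric])
    moreover have "(norm w)\<^sup>2 * ((norm z)\<^sup>2 + (norm w)\<^sup>2) = (norm z)\<^sup>2 * (norm w)\<^sup>2 + norm w ^ 4"
      by (simp add: power2_eq_square power4_eq_xxxx algebra_simps)
    moreover have "u + Q \<le> 2 * (Q + P)" if "2 * u \<le> P + Q" "0 \<le> P" "0 \<le> Q" for u P Q :: real
      using that unfolding distrib_left by linarith
    ultimately have "(norm w)\<^sup>2 * ((norm z)\<^sup>2 + (norm w)\<^sup>2) \<le> 2 * (norm w ^ 4 + norm z ^ 4)"
      using zero_le_power[OF norm_ge_zero[of w], of 4] zero_le_power[OF norm_ge_zero[of z], of 4] by (metis mult.assoc)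
    then have "(norm w)\<^sup>2 \<le> 2 * (norm w ^ 4 + norm z ^ 4) / ((norm z)\<^sup>2 + (norm w)\<^sup>2)"
      by (subst pos_le_divide_eq[OF m])
    then have "(norm w)\<^sup>2 / (norm w ^ 4 + norm z ^ 4) \<le> 2 / ((norm z)\<^sup>2 + (norm w)\<^sup>2)"
      by (intro mult_imp_div_pos_le[OF n]) simp
    then have "(norm z)\<^sup>2 * ((norm w)\<^sup>2 / (norm w ^ 4 + norm z ^ 4)) \<le> (norm z)\<^sup>2 * (2 / ((norm z)\<^sup>2 + (norm w)\<^sup>2))"
      by (intro mult_left_mono) auto
    also have "\<dots> = 2 * (1 / (1 + (norm w / norm z)\<^sup>2))" using zp by (simp add: power_divide field_simps)
    finally show "0 \<le> ?e w \<and> ?e w \<le> 2 * (1 / (1 + (norm w / norm z)\<^sup>2))" using n by simp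
  qed
  have zp: "norm z > 0" using z by simp
  have em: "?e \<in> borel_measurable borel" by measurable
  note C = integral_growth_le(2,3)[OF \<mu> B growth zp _ ae em, simplified]
  have sw: "(\<lambda>w. swept \<eta> \<rho> (norm w) z) = (\<lambda>w. (LINT x:{0<..}|lborel. poisson \<eta> (norm w) x * tlog2 \<rho> (z / of_real x))
    + (LINT x:{0<..}|lborel. poisson (pi - \<eta>) (norm w) x * tlog2 \<rho> (- \<i> * z / of_real x)))" by (simp only: swept_def)
  have int1: "integrable \<mu> (\<lambda>w. swept \<eta> \<rho> (norm w) z)" unfolding sw by (rule Bochner_Integration.integrable_add[OF A(1) A'(1)])
  have "integrable \<mu> (\<lambda>w. tlog2 \<rho> (z / w))"
  proof (rule integrable_const_bound)
    show "AE w in \<mu>. norm (tlog2 \<rho> (z / w)) \<le> (4 + 10 * \<bar>ln \<rho>\<bar>) * ln (1 + (norm z / r1)\<^sup>2)"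
      using away
    proof (rule eventually_mono)
      fix w :: complex assume w: "r1 \<le> norm w"
      have "(norm (z / w))\<^sup>2 \<le> (norm z / r1)\<^sup>2" unfolding norm_divide using w r1 by (intro power_mono divide_left_mono mult_pos_pos) auto
      then have "ln (1 + (norm (z / w))\<^sup>2) \<le> ln (1 + (norm z / r1)\<^sup>2)" by (intro ln_mono) (auto intro: add_pos_nonneg)
      then have "(4 + 10 * \<bar>ln \<rho>\<bar>) * ln (1 + (norm (z / w))\<^sup>2) \<le> (4 + 10 * \<bar>ln \<rho>\<bar>) * ln (1 + (norm z / r1)\<^sup>2)" by (intro mult_left_mono) auto
      then show "norm (tlog2 \<rho> (z / w)) \<le> (4 + 10 * \<bar>ln \<rho>\<bar>) * ln (1 + (norm z / r1)\<^sup>2)"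
        using abs_tlog2_le[OF \<rho>(1,2), of "z / w"] by simp
    qed
  qed measurable
  then have "(\<integral>w. tlog2 \<rho> (z / w) \<partial>\<mu>) \<le> (\<integral>w. swept \<eta> \<rho> (norm w) z + (1 - cos \<eta>) * ?e w \<partial>\<mu>)"
  proof (rule integral_mono_AE)
    show "integrable \<mu> (\<lambda>w. swept \<eta> \<rho> (norm w) z + (1 - cos \<eta>) * ?e w)"
      by (rule Bochner_Integration.integrable_add[OF int1 integrable_mult_right[OF C(1)]])
    show "AE w in \<mu>. tlog2 \<rho> (z / w) \<le> swept \<eta> \<rho> (norm w) z + (1 - cos \<eta>) * ?e w"
      using away narrow
    proof eventually_elim
      case (elim w)
      then have "w \<noteq> 0" using r1 by auto
      then show ?case using elim tlog2_le_swept[OF \<eta> _ _ z \<rho>] by blast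
    qed
  qed
  also have "\<dots> = (\<integral>w. swept \<eta> \<rho> (norm w) z \<partial>\<mu>) + (1 - cos \<eta>) * (\<integral>w. ?e w \<partial>\<mu>)"
    unfolding Bochner_Integration.integral_add[OF int1 integrable_mult_right[OF C(1)]] by (simp only: integral_mult_right_zero)
  also have "(\<integral>w. swept \<eta> \<rho> (norm w) z \<partial>\<mu>) = (LINT x:{0<..}|lborel. sweep \<mu> \<eta> x * tlog2 \<rho> (z / of_real x))
     + (LINT x:{0<..}|lborel. sweep \<mu> (pi - \<eta>) x * tlog2 \<rho> (- \<i> * z / of_real x))"
    unfolding sw using A A' by (simp add: sweep_def)
  also have "(1 - cos \<eta>) * (\<integral>w. ?e w \<partial>\<mu>) \<le> (1 - cos \<eta>) * (B * pi * norm z)" using C(2) by (intro mult_left_mono) (auto simp: mult_ac)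
  finally show ?thesis by simp
qed

end

subsection \<open>Quantization over dyadic annuli\<close>

text \<open>Cells of side comparable to \<open>2\<^sup>k / (k + 1)\<^sup>2\<close> in the \<open>k\<close>-th dyadic annulus make the total error sublinear.\<close>
definition qcoef :: "real \<Rightarrow> nat \<Rightarrow> real" where
  "qcoef D k = 8 * (D * 2 ^ k) / (real k + 1)\<^sup>2 + 50 * (real k + 1) ^ 4"

text \<open>The sum runs over all annuli and not only those inside a given disc, so that the error
  bound does not depend on the disc.\<close>

definition qerr :: "real \<Rightarrow> real \<Rightarrow> real \<Rightarrow> real" where
  "qerr D \<rho> t = (\<Sum>k. qcoef D k / \<rho> * min 1 (t / 2 ^ k))"

lemma qcoef_nonneg: "D \<ge> 0 \<Longrightarrow> 0 \<le> qcoef D k" unfolding qcoef_def by simp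

lemma summable_qcoef: "summable (\<lambda>k. qcoef D k / 2 ^ k)"
proof -
  have "summable (\<lambda>k. 50 * ((real k + 1) ^ 4 / 2 ^ k))"
  \<comment> \<open>From n = 10 on the ratio of consecutive polynomials is at most (11/10)^4, below
    3/2; halving gives 3/4.\<close>
  proof (intro summable_mult summable_ratio_test[of "3/4" 10])
    fix n :: nat assume n: "10 \<le> n"
    have "(real (Suc n) + 1) ^ 4 \<le> ((11/10) * (real n + 1)) ^ 4" using n by (intro power_mono) auto
    also have "\<dots> = (14641/10000) * (real n + 1) ^ 4" by (simp only: power_mult_distrib) (simp add: power4_eq_xxxx)
    also have "\<dots> \<le> (3/2) * (real n + 1) ^ 4" by (intro mult_right_mono) auto
    finally have "(real (Suc n) + 1) ^ 4 / 2 ^ Suc n \<le> (3/2) * (real n + 1) ^ 4 / 2 ^ Suc n" by (intro divide_right_mono) auto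
    then show "norm ((real (Suc n) + 1) ^ 4 / 2 ^ Suc n) \<le> 3/4 * norm ((real n + 1) ^ 4 / 2 ^ n)" by simp
  qed simp
  moreover have "summable (\<lambda>k. 8 * D * (1 / (real k + 1)\<^sup>2))"
    using inverse_power_summable[of 2, where 'a=real] summable_Suc_iff[of "\<lambda>k. inverse (real k ^ 2)"]
    by (intro summable_mult) (auto simp: inverse_eq_divide add.commute)
  ultimately have "summable (\<lambda>k. 8 * D * (1 / (real k + 1)\<^sup>2) + 50 * ((real k + 1) ^ 4 / 2 ^ k))" by (intro summable_add)
  then show ?thesis by (simp add: qcoef_def add_divide_distrib)
qed

lemma summable_qerr:
  assumes "D \<ge> 0" "\<rho> > 0" "t \<ge> 0" shows "summable (\<lambda>k. qcoef D k / \<rho> * min 1 (t / 2 ^ k))"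
proof (rule summable_comparison_test'[where N=0])
  show "summable (\<lambda>k. (t / \<rho>) * (qcoef D k / 2 ^ k))" by (intro summable_mult summable_qcoef)
  fix k :: nat
  have q: "0 \<le> qcoef D k / \<rho>" using assms qcoef_nonneg[OF assms(1), of k] by simp
  have "qcoef D k / \<rho> * min 1 (t / 2 ^ k) \<le> qcoef D k / \<rho> * (t / 2 ^ k)" by (rule mult_left_mono[OF min.cobounded2 q])
  moreover have "0 \<le> qcoef D k / \<rho> * min 1 (t / 2 ^ k)" using assms by (intro mult_nonneg_nonneg[OF q]) auto
  ultimately  show "norm (qcoef D k / \<rho> * min 1 (t / 2 ^ k)) \<le> (t / \<rho>) * (qcoef D k / 2 ^ k)" by (simp add: mult.commute)
qed

text \<open>Tannery's theorem: after division by t each term tends to 0, since its numerator is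
  bounded in t, and all terms are dominated by the summable sequence qcoef/2^k.\<close>

lemma qerr_sublinear:
  assumes D: "D \<ge> 0" and \<rho>: "\<rho> > 0" shows "((\<lambda>t. qerr D \<rho> t / t) \<longlongrightarrow> 0) at_top"
proof -
  let ?a = "\<lambda>k t. qcoef D k / \<rho> * min 1 (t / 2 ^ k) / t"
  have bounds: "0 \<le> ?a k t" "?a k t \<le> qcoef D k / \<rho> / t" "?a k t \<le> (1 / \<rho>) * (qcoef D k / 2 ^ k)" if t: "t > 0" for k t
  proof -
    have q: "0 \<le> qcoef D k / \<rho>" using D \<rho> qcoef_nonneg[of D k] by simp
    show "0 \<le> ?a k t" using t by (intro divide_nonneg_pos mult_nonneg_nonneg[OF q]) auto
    have "qcoef D k / \<rho> * min 1 (t / 2 ^ k) \<le> qcoef D k / \<rho> * 1" using q by (intro mult_left_mono) auto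
    then show "?a k t \<le> qcoef D k / \<rho> / t" using t by (intro divide_right_mono) auto
    have "qcoef D k / \<rho> * min 1 (t / 2 ^ k) \<le> qcoef D k / \<rho> * (t / 2 ^ k)" using q by (intro mult_left_mono) auto
    then have "?a k t \<le> qcoef D k / \<rho> * (t / 2 ^ k) / t" using t by (intro divide_right_mono) auto
    also have "\<dots> = (1 / \<rho>) * (qcoef D k / 2 ^ k)" using t by simp
    finally show "?a k t \<le> (1 / \<rho>) * (qcoef D k / 2 ^ k)" .
  qed
  have "((\<lambda>t. suminf (\<lambda>k. ?a k t)) \<longlongrightarrow> suminf (\<lambda>k. 0)) at_top"
  proof (rule tannerys_theorem[THEN conjunct2, THEN conjunct2])
    fix k :: nat
    show "(?a k \<longlongrightarrow> 0) at_top"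
    proof (rule tendsto_sandwich[where f="\<lambda>_. 0" and h="\<lambda>t. qcoef D k / \<rho> / t"])
      show "eventually (\<lambda>t. 0 \<le> ?a k t) at_top" "eventually (\<lambda>t. ?a k t \<le> qcoef D k / \<rho> / t) at_top"
        by (rule eventually_mono[OF eventually_gt_at_top[of 0]], erule bounds)+
      show "((\<lambda>t. qcoef D k / \<rho> / t) \<longlongrightarrow> 0) at_top" by (rule real_tendsto_divide_at_top[OF tendsto_const filterlim_ident])
    qed simp
  next
    show "eventually (\<lambda>(k, t). norm (?a k t) \<le> (1 / \<rho>) * (qcoef D k / 2 ^ k)) (at_top \<times>\<^sub>F at_top)"
      unfolding eventually_prod_filter
    proof (intro exI conjI allI impI)
      show "eventually (\<lambda>_. True) (at_top :: nat filter)" by simp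
      show "eventually (\<lambda>t::real. t > 0) at_top" by (rule eventually_gt_at_top)
      show "case (k, t) of (k, t) \<Rightarrow> norm (?a k t) \<le> (1 / \<rho>) * (qcoef D k / 2 ^ k)" if "t > 0" for k t
        using bounds(1)[OF that, of k] bounds(3)[OF that, of k] by simp
    qed
    show "summable (\<lambda>k. (1 / \<rho>) * (qcoef D k / 2 ^ k))" by (intro summable_mult summable_qcoef)
  qed simp
  moreover have "eventually (\<lambda>t. suminf (\<lambda>k. ?a k t) = qerr D \<rho> t / t) at_top"
    using eventually_gt_at_top[of 0]
  proof (rule eventually_mono)
    fix t :: real assume "0 < t"
    then show "suminf (\<lambda>k. ?a k t) = qerr D \<rho> t / t"
      unfolding qerr_def using D \<rho> by (intro suminf_divide summable_qerr) auto
  qed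
  ultimately show ?thesis by (simp add: tendsto_cong)
qed

text \<open>The entire functions of the single annuli are multiplied, by induction on the outer
  radius. The finite error sum is then enlarged to the full series, which makes the estimate uniform
  in \<open>K\<close>.\<close>

lemma quantization:
  fixes p :: "'a \<Rightarrow> complex"
  assumes pm[measurable]: "p \<in> borel_measurable \<mu>" and D: "D \<ge> 0"
    and mass: "\<And>k. k0 \<le> k \<Longrightarrow> emeasure \<mu> {x \<in> space \<mu>. 2 ^ k \<le> norm (p x) \<and> norm (p x) < 2 ^ Suc k} \<le> ennreal (D * 2 ^ k)"
    and K: "k0 \<le> K"
  obtains q where "q holomorphic_on UNIV" "q 0 = 1"
    "\<And>z \<rho>. 0 < \<rho> \<Longrightarrow> \<rho> \<le> 1 \<Longrightarrow> norm (q z) \<le>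
      exp ((LINT x:{x \<in> space \<mu>. 2 ^ k0 \<le> norm (p x) \<and> norm (p x) < 2 ^ K}|\<mu>. tlog \<rho> (z / p x)) + qerr D \<rho> (norm z))"
proof -
  define S where "S = (\<lambda>K. {x \<in> space \<mu>. 2 ^ k0 \<le> norm (p x) \<and> norm (p x) < 2 ^ K})"
  have Sm[measurable]: "S K \<in> sets \<mu>" for K unfolding S_def by measurable
  have si: "set_integrable \<mu> A (\<lambda>x. tlog \<rho> (z / p x))"
    if A: "A \<in> sets \<mu>" "emeasure \<mu> A < \<infinity>" "\<And>x. x \<in> A \<Longrightarrow> 2 ^ k0 \<le> norm (p x)" and \<rho>: "0 < \<rho>" "\<rho> \<le> 1" for A z \<rho>
    unfolding set_integrable_def
  proof (rule integrableI_bounded_set_indicator[OF A(1) _ A(2)])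
    show "AE x in \<mu>. x \<in> A \<longrightarrow> norm (tlog \<rho> (z / p x)) \<le> norm z / 2 ^ k0 + \<bar>ln \<rho>\<bar>"
    proof (intro AE_I2 impI)
      fix x assume "x \<in> A"
      then have "2 ^ k0 \<le> norm (p x)" by (rule A)
      moreover have p0: "0 < (2::real) ^ k0" by simp
      ultimately have "norm (p x) > 0" by linarith
      with \<open>2 ^ k0 \<le> norm (p x)\<close> p0 have "norm z / norm (p x) \<le> norm z / 2 ^ k0" by (intro divide_left_mono mult_pos_pos) auto
      then show "norm (tlog \<rho> (z / p x)) \<le> norm z / 2 ^ k0 + \<bar>ln \<rho>\<bar>"
        using abs_tlog_le[OF \<rho>, of "z / p x"] by (simp add: norm_divide)
    qed
  qed measurable
  have "\<exists>q. q holomorphic_on UNIV \<and> q 0 = 1 \<and> emeasure \<mu> (S K) < \<infinity> \<and> (\<forall>z \<rho>. 0 < \<rho> \<longrightarrow> \<rho> \<le> 1 \<longrightarrow> norm (q z) \<le>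
      exp ((LINT x:S K|\<mu>. tlog \<rho> (z / p x)) + (\<Sum>k\<in>{k0..<K}. qcoef D k / \<rho> * min 1 (norm z / 2 ^ k))))"
    using K
  proof (induction K rule: dec_induct)
    case base
    have "S k0 = {}" by (auto simp: S_def)
    then show ?case by (intro exI[of _ "\<lambda>_. 1"]) (auto simp: set_lebesgue_integral_def)
  next
    case (step n)
    then obtain q where q: "q holomorphic_on UNIV" "q 0 = 1" "emeasure \<mu> (S n) < \<infinity>"
      "\<And>z \<rho>. 0 < \<rho> \<Longrightarrow> \<rho> \<le> 1 \<Longrightarrow> norm (q z) \<le>
      exp ((LINT x:S n|\<mu>. tlog \<rho> (z / p x)) + (\<Sum>k\<in>{k0..<n}. qcoef D k / \<rho> * min 1 (norm z / 2 ^ k)))" by blast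
    define A where "A = {x \<in> space \<mu>. 2 ^ n \<le> norm (p x) \<and> norm (p x) < 2 * 2 ^ n}"
    have Am[measurable]: "A \<in> sets \<mu>" unfolding A_def by measurable
    have mA: "emeasure \<mu> A \<le> ennreal (D * 2 ^ n)" using mass[OF step(1)] by (simp add: A_def)
    then have fA: "emeasure \<mu> A < \<infinity>" by (rule le_less_trans) simp
    have mA': "measure \<mu> A \<le> D * 2 ^ n" unfolding measure_def using mA D by (intro enn2real_leI) auto
    \<comment> \<open>The annulus is subdivided with parameter (n + 1)^2, which turns its error into
      \<open>qcoef D n\<close>.\<close>
    have n0: "(Suc n)\<^sup>2 \<ge> 1" by simp
    have r0: "(0::real) < 2 ^ n" by simp
    obtain q' where q': "q' holomorphic_on UNIV" "q' 0 = 1"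
      "\<And>z \<rho>. 0 < \<rho> \<Longrightarrow> \<rho> \<le> 1 \<Longrightarrow> norm (q' z) \<le>
      exp ((LINT x:A|\<mu>. tlog \<rho> (z / p x)) + (8 * measure \<mu> A / real ((Suc n)\<^sup>2) + 50 * real ((Suc n)\<^sup>2) ^ 2) / \<rho> * min 1 (norm z / 2 ^ n))"
      using annulus_quantization[OF r0 n0 pm fA[unfolded A_def] A_def] by blast
    have 2: "(2::real) ^ k0 \<le> 2 ^ n" using step(1) by (intro power_increasing) auto
    have "S (Suc n) = S n \<union> A"
    proof (intro set_eqI)
      fix x
      have 1: "norm (p x) < 2 * 2 ^ n" if "norm (p x) < 2 ^ n" using that r0 by linarith
      have 3: "2 ^ k0 \<le> norm (p x)" if "\<not> norm (p x) < 2 ^ n" using that 2 by linarith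
      show "x \<in> S (Suc n) \<longleftrightarrow> x \<in> S n \<union> A" unfolding S_def A_def using 1 3 by (cases "norm (p x) < 2 ^ n") auto
    qed
    moreover have "S n \<inter> A = {}" unfolding S_def A_def by auto
    ultimately have SA: "S (Suc n) = S n \<union> A" "S n \<inter> A = {}" by auto
    have "emeasure \<mu> (S (Suc n)) \<le> emeasure \<mu> (S n) + emeasure \<mu> A" unfolding SA by (rule emeasure_subadditive) auto
    also have "\<dots> < \<infinity>" using q(3) fA by simp
    finally have fS: "emeasure \<mu> (S (Suc n)) < \<infinity>" .
    have "norm (q z * q' z) \<le> exp ((LINT x:S (Suc n)|\<mu>. tlog \<rho> (z / p x)) + (\<Sum>k\<in>{k0..<Suc n}. qcoef D k / \<rho> * min 1 (norm z / 2 ^ k)))"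
      if \<rho>: "0 < \<rho>" "\<rho> \<le> 1" for z \<rho>
    proof -
      have "(8 * measure \<mu> A / real ((Suc n)\<^sup>2) + 50 * real ((Suc n)\<^sup>2) ^ 2) \<le> qcoef D n"
      proof -
        have "8 * measure \<mu> A / real ((Suc n)\<^sup>2) \<le> 8 * (D * 2 ^ n) / real ((Suc n)\<^sup>2)"
          using mA' by (intro divide_right_mono mult_left_mono) auto
        moreover have "real ((Suc n)\<^sup>2) = (real n + 1)\<^sup>2" "real ((Suc n)\<^sup>2) ^ 2 = (real n + 1) ^ 4"
          by (simp_all add: power_mult[symmetric] add.commute)
        ultimately show ?thesis unfolding qcoef_def by (simp only: add_right_mono)
      qed
      then have "(8 * measure \<mu> A / real ((Suc n)\<^sup>2) + 50 * real ((Suc n)\<^sup>2) ^ 2) / \<rho> * min 1 (norm z / 2 ^ n) \<le> qcoef D n / \<rho> * min 1 (norm z / 2 ^ n)"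
        using \<rho> by (intro mult_right_mono divide_right_mono) auto
      then have "norm (q' z) \<le> exp ((LINT x:A|\<mu>. tlog \<rho> (z / p x)) + qcoef D n / \<rho> * min 1 (norm z / 2 ^ n))"
        using q'(3)[OF \<rho>, of z] by (rule_tac order_trans) auto
      then have "norm (q z * q' z) \<le> exp ((LINT x:S n|\<mu>. tlog \<rho> (z / p x)) + (\<Sum>k\<in>{k0..<n}. qcoef D k / \<rho> * min 1 (norm z / 2 ^ k)))
        * exp ((LINT x:A|\<mu>. tlog \<rho> (z / p x)) + qcoef D n / \<rho> * min 1 (norm z / 2 ^ n))"
        unfolding norm_mult using q(4)[OF \<rho>, of z] by (intro mult_mono) auto
      also have "\<dots> = exp ((LINT x:S (Suc n)|\<mu>. tlog \<rho> (z / p x)) + (\<Sum>k\<in>{k0..<Suc n}. qcoef D k / \<rho> * min 1 (norm z / 2 ^ k)))"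
      proof -
        have "(LINT x:S (Suc n)|\<mu>. tlog \<rho> (z / p x)) = (LINT x:S n|\<mu>. tlog \<rho> (z / p x)) + (LINT x:A|\<mu>. tlog \<rho> (z / p x))"
        proof -
          have "2 ^ k0 \<le> norm (p x)" if "x \<in> S n \<union> A" for x using that unfolding SA(1)[symmetric] by (simp add: S_def)
          then show ?thesis unfolding SA(1) by (intro set_integral_Un SA(2) si Sm Am q(3) fA \<rho>) auto
        qed
        moreover have "{k0..<Suc n} = insert n {k0..<n}" using step(1) by auto
        ultimately show ?thesis by (simp add: exp_add[symmetric])
      qed
      finally show ?thesis .
    qed
    then show ?case using q(1,2) q'(1,2) fS by (intro exI[of _ "\<lambda>z. q z * q' z"]) (auto intro: holomorphic_intros)
  qed
  then obtain q where q: "q holomorphic_on UNIV" "q 0 = 1" 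
      "\<And>z \<rho>. 0 < \<rho> \<Longrightarrow> \<rho> \<le> 1 \<Longrightarrow> norm (q z) \<le>
      exp ((LINT x:S K|\<mu>. tlog \<rho> (z / p x)) + (\<Sum>k\<in>{k0..<K}. qcoef D k / \<rho> * min 1 (norm z / 2 ^ k)))" by blast
  show thesis
  proof (rule that[OF q(1,2)])
    fix z :: complex and \<rho> :: real assume \<rho>: "0 < \<rho>" "\<rho> \<le> 1"
    have "(\<Sum>k\<in>{k0..<K}. qcoef D k / \<rho> * min 1 (norm z / 2 ^ k)) \<le> qerr D \<rho> (norm z)"
      unfolding qerr_def using D \<rho> qcoef_nonneg[OF D] by (intro sum_le_suminf summable_qerr) (auto intro!: mult_nonneg_nonneg)
    then show "norm (q z) \<le> exp ((LINT x:{x \<in> space \<mu>. 2 ^ k0 \<le> norm (p x) \<and> norm (p x) < 2 ^ K}|\<mu>. tlog \<rho> (z / p x)) + qerr D \<rho> (norm z))"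
      using q(3)[OF \<rho>, of z] unfolding S_def by (rule_tac order_trans) auto
  qed
qed

text \<open>The density is treated as a mass on the positive ray. Multiplying q(z) by q(-z) adds the
  opposite zeros, which yields the paired kernel and doubles the error.\<close>

lemma ray_quantization:
  fixes f :: "real \<Rightarrow> real"
  assumes fm[measurable]: "f \<in> borel_measurable borel" and f: "\<And>x. x > 0 \<Longrightarrow> 0 \<le> f x" "\<And>x. x > 0 \<Longrightarrow> f x \<le> c"
    and K: "k0 \<le> K"
  obtains q where "q holomorphic_on UNIV" "q 0 = 1"
    "\<And>z \<rho>. 0 < \<rho> \<Longrightarrow> \<rho> \<le> 1 \<Longrightarrow> norm (q z) \<le>
      exp ((LINT x:{2 ^ k0..<2 ^ K}|lborel. f x * tlog2 \<rho> (z / of_real x)) + 2 * qerr c \<rho> (norm z))"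
proof -
  have c: "c \<ge> 0" using f(1)[of 1] f(2)[of 1] by simp
  define d where "d = (\<lambda>x. indicator {0<..} x * f x)"
  have dm[measurable]: "d \<in> borel_measurable borel" unfolding d_def by measurable
  have d: "0 \<le> d x" "d x \<le> c" for x using f[of x] c by (auto simp: d_def indicator_def)
  define \<mu> where "\<mu> = density lborel (\<lambda>x. ennreal (d x))"
  have mass: "emeasure \<mu> {x \<in> space \<mu>. 2 ^ k \<le> norm (complex_of_real x) \<and> norm (complex_of_real x) < 2 ^ Suc k} \<le> ennreal (c * 2 ^ k)" for k
  proof -
    have "emeasure \<mu> {x \<in> space \<mu>. 2 ^ k \<le> norm (complex_of_real x) \<and> norm (complex_of_real x) < 2 ^ Suc k}
       = (\<integral>\<^sup>+x. ennreal (d x) * indicator {x. 2 ^ k \<le> \<bar>x\<bar> \<and> \<bar>x\<bar> < 2 ^ Suc k} x \<partial>lborel)"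
      unfolding \<mu>_def by (subst emeasure_density) auto
    also have "\<dots> \<le> (\<integral>\<^sup>+x. ennreal c * indicator {2 ^ k..<2 ^ Suc k} (x::real) \<partial>lborel)"
    proof (intro nn_integral_mono)
      fix x :: real
      have "d x = 0" if "\<not> x > 0" using that by (simp add: d_def)
      then show "ennreal (d x) * indicator {x. 2 ^ k \<le> \<bar>x\<bar> \<and> \<bar>x\<bar> < 2 ^ Suc k} x \<le> ennreal c * indicator {2 ^ k..<2 ^ Suc k} x"
        using ennreal_leI[OF d(2), of x] by (cases "x > 0") (simp_all add: indicator_def)
    qed
    also have "\<dots> = ennreal (c * 2 ^ k)"
      using c by (subst nn_integral_cmult_indicator) (auto simp: ennreal_mult)
    finally show ?thesis .
  qed
  obtain q where q: "q holomorphic_on UNIV" "q 0 = 1"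
    "\<And>z \<rho>. 0 < \<rho> \<Longrightarrow> \<rho> \<le> 1 \<Longrightarrow> norm (q z) \<le>
      exp ((LINT x:{x \<in> space \<mu>. 2 ^ k0 \<le> norm (complex_of_real x) \<and> norm (complex_of_real x) < 2 ^ K}|\<mu>. tlog \<rho> (z / of_real x)) + qerr c \<rho> (norm z))"
    using quantization[of complex_of_real \<mu> c k0 K, OF _ c mass K] unfolding \<mu>_def by (auto simp del: norm_of_real)
  have eq: "(LINT x:{x \<in> space \<mu>. 2 ^ k0 \<le> norm (complex_of_real x) \<and> norm (complex_of_real x) < 2 ^ K}|\<mu>. tlog \<rho> (z / of_real x))
    = (LINT x:{2 ^ k0..<2 ^ K}|lborel. f x * tlog \<rho> (z / of_real x))" for z \<rho>
  proof -
    have "(LINT x:{x \<in> space \<mu>. 2 ^ k0 \<le> norm (complex_of_real x) \<and> norm (complex_of_real x) < 2 ^ K}|\<mu>. tlog \<rho> (z / of_real x))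
      = (\<integral>x. d x *\<^sub>R (indicator {x. 2 ^ k0 \<le> \<bar>x\<bar> \<and> \<bar>x\<bar> < 2 ^ K} x *\<^sub>R tlog \<rho> (z / of_real x)) \<partial>lborel)"
      unfolding set_lebesgue_integral_def \<mu>_def using d by (subst integral_density) auto
    also have "\<dots> = (LINT x:{2 ^ k0..<2 ^ K}|lborel. f x * tlog \<rho> (z / of_real x))"
      unfolding set_lebesgue_integral_def
    proof (rule Bochner_Integration.integral_cong)
      fix x :: real
      have "(0::real) < 2 ^ k0" by simp
      then have p: "2 ^ k0 \<le> x \<Longrightarrow> x > 0" by (rule less_le_trans)
      show "d x *\<^sub>R (indicator {x. 2 ^ k0 \<le> \<bar>x\<bar> \<and> \<bar>x\<bar> < 2 ^ K} x *\<^sub>R tlog \<rho> (z / of_real x)) = indicator {2 ^ k0..<2 ^ K} x *\<^sub>R (f x * tlog \<rho> (z / of_real x))"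
        using p by (cases "x > 0") (force simp: d_def indicator_def)+
    qed simp
    finally show ?thesis .
  qed
  have si: "set_integrable lborel {2 ^ k0..<2 ^ K} (\<lambda>x. f x * tlog \<rho> (z / of_real x))" if \<rho>: "0 < \<rho>" "\<rho> \<le> 1" for z \<rho>
    unfolding set_integrable_def
  proof (rule integrableI_bounded_set_indicator)
    show "AE x in lborel. x \<in> {2 ^ k0..<2 ^ K} \<longrightarrow> norm (f x * tlog \<rho> (z / of_real x)) \<le> c * (norm z / 2 ^ k0 + \<bar>ln \<rho>\<bar>)"
    proof (intro AE_I2 impI)
      fix x :: real assume x: "x \<in> {2 ^ k0..<2 ^ K}"
      have p: "(0::real) < 2 ^ k0" by simp
      moreover have "2 ^ k0 \<le> x" using x by simp
      ultimately have x0: "x > 0" by (rule less_le_trans)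
      have "norm z / x \<le> norm z / 2 ^ k0" using x by (intro divide_left_mono mult_pos_pos[OF x0 p]) auto
      then have "\<bar>tlog \<rho> (z / of_real x)\<bar> \<le> norm z / 2 ^ k0 + \<bar>ln \<rho>\<bar>"
        using abs_tlog_le[OF \<rho>, of "z / of_real x"] x0 by (simp add: norm_divide)
      then show "norm (f x * tlog \<rho> (z / of_real x)) \<le> c * (norm z / 2 ^ k0 + \<bar>ln \<rho>\<bar>)"
        using f[OF x0] by (simp add: abs_mult) (intro mult_mono, auto)
    qed
    show "emeasure lborel {2 ^ k0..<2 ^ K::real} < \<infinity>" using emeasure_bounded_finite[of "{2 ^ k0..<2 ^ K::real}"] by simp
  qed measurable
  show thesis
  proof (rule that[of "\<lambda>z. q z * q (- z)"])
    have "(q \<circ> uminus) holomorphic_on UNIV" using q(1) by (intro holomorphic_on_compose holomorphic_intros) (auto intro: holomorphic_on_subset)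
    then show "(\<lambda>z. q z * q (- z)) holomorphic_on UNIV" using q(1) by (intro holomorphic_intros) (auto simp: o_def)
    fix z :: complex and \<rho> :: real assume \<rho>: "0 < \<rho>" "\<rho> \<le> 1"
    have "norm (q z * q (- z)) \<le> exp ((LINT x:{2 ^ k0..<2 ^ K}|lborel. f x * tlog \<rho> (z / of_real x)) + qerr c \<rho> (norm z))
       * exp ((LINT x:{2 ^ k0..<2 ^ K}|lborel. f x * tlog \<rho> (- z / of_real x)) + qerr c \<rho> (norm z))"
      unfolding norm_mult using q(3)[OF \<rho>, of z] q(3)[OF \<rho>, of "- z"] unfolding eq by (intro mult_mono) auto
    also have "\<dots> = exp ((LINT x:{2 ^ k0..<2 ^ K}|lborel. f x * tlog2 \<rho> (z / of_real x)) + 2 * qerr c \<rho> (norm z))"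
      using set_integral_add(2)[OF si[OF \<rho>, of z] si[OF \<rho>, of "- z"]] by (simp add: tlog2_def distrib_left exp_add[symmetric])
    finally show "norm (q z * q (- z)) \<le> exp ((LINT x:{2 ^ k0..<2 ^ K}|lborel. f x * tlog2 \<rho> (z / of_real x)) + 2 * qerr c \<rho> (norm z))" .
  qed (simp add: q)
qed

subsection \<open>The multiplier on a large disc and its limit\<close>

lemma sigma_finite_if_finite_cballs:
  fixes \<mu> :: "'a :: real_normed_vector measure"
  assumes "sets \<mu> = sets borel" "\<And>R. emeasure \<mu> (cball 0 R) < \<infinity>" shows "sigma_finite_measure \<mu>"
proof
  have sp: "space \<mu> = UNIV" using sets_eq_imp_space_eq[OF assms(1)] by simp
  show "\<exists>A. countable A \<and> A \<subseteq> sets \<mu> \<and> \<Union>A = space \<mu> \<and> (\<forall>a\<in>A. emeasure \<mu> a \<noteq> \<infinity>)"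
  proof (intro exI conjI ballI)
    show "\<Union>(range (\<lambda>n. cball (0::'a) (real n))) = space \<mu>" unfolding sp using real_arch_simple by auto
    show "emeasure \<mu> a \<noteq> \<infinity>" if "a \<in> range (\<lambda>n. cball 0 (real n))" for a using that assms(2) by (auto simp: less_top)
  qed (auto simp: assms(1))
qed

lemma inverse_square_tail:
  fixes R :: real
  assumes R: "R > 0"
  shows set_integrable_inverse_square_tail: "set_integrable lborel {R..} (\<lambda>x. 1 / x\<^sup>2)"
    and integral_inverse_square_tail: "(LINT x:{R..}|lborel. 1 / x\<^sup>2) = 1 / R"
proof -
  have nn: "(\<integral>\<^sup>+x. ennreal (1 / x\<^sup>2) * indicator {R..} x \<partial>lborel) = ennreal (0 - - (1 / R))"
  proof (rule nn_integral_FTC_atLeast)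
    show "((\<lambda>x. - (1 / x)) has_real_derivative 1 / x\<^sup>2) (at x)" if "R \<le> x" for x
      using that R by (auto intro!: derivative_eq_intros simp: power2_eq_square)
    have "((\<lambda>x::real. 1 / x) \<longlongrightarrow> 0) at_top" by (rule real_tendsto_divide_at_top[OF tendsto_const filterlim_ident])
    then show "((\<lambda>x::real. - (1 / x)) \<longlongrightarrow> 0) at_top" using tendsto_minus by fastforce
  qed auto
  have eq: "(\<lambda>x::real. ennreal (1 / x\<^sup>2) * indicator {R..} x) = (\<lambda>x. ennreal (indicator {R..} x *\<^sub>R (1 / x\<^sup>2)))"
    by (auto simp: indicator_def)
  have "has_bochner_integral lborel (\<lambda>x. indicator {R..} x *\<^sub>R (1 / x\<^sup>2)) (1 / R)"
    by (rule has_bochner_integral_nn_integral) (use nn R in \<open>auto simp: eq\<close>)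
  then show "set_integrable lborel {R..} (\<lambda>x. 1 / x\<^sup>2)" "(LINT x:{R..}|lborel. 1 / x\<^sup>2) = 1 / R"
    unfolding set_integrable_def set_lebesgue_integral_def by (auto simp: has_bochner_integral_iff)
qed

text \<open>A Taylor polynomial, whose exact value at 0 preserves the normalisation there. It makes
  the exponential factor entire at the price of an additive 1.\<close>

lemma entire_approximation:
  assumes h: "h holomorphic_on ball 0 R" and R: "R > 0"
  obtains p where "p holomorphic_on UNIV" "p 0 = h 0" "\<And>z. norm z \<le> R / 2 \<Longrightarrow> norm (p z - h z) \<le> 1"
proof -
  define a where "a = (\<lambda>n. (deriv ^^ n) h 0 / fact n)"
  have sums: "(\<lambda>n. a n * z ^ n) sums h z" if "norm z < R" for z
    using holomorphic_power_series[OF h, of z] that by (simp add: a_def)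
  have "summable (\<lambda>n. a n * (of_real (3 * R / 4)) ^ n)" using sums[of "of_real (3 * R / 4)"] R by (auto simp: sums_iff)
  from powser_insidea[OF this, of "of_real (R / 2)"] R have "summable (\<lambda>n. norm (a n * of_real (R / 2) ^ n))" by simp
  then have "uniform_limit (cball 0 (R/2)) (\<lambda>n z. \<Sum>i<n. a i * z ^ i) (\<lambda>z. suminf (\<lambda>i. a i * z ^ i)) sequentially"
  proof (rule Weierstrass_m_test[rotated])
    fix n and z :: complex assume "z \<in> cball 0 (R/2)"
    then show "norm (a n * z ^ n) \<le> norm (a n * of_real (R / 2) ^ n)"
      unfolding norm_mult norm_power using R by (intro mult_left_mono power_mono) auto
  qed
  note ul = this
  obtain N where N: "\<forall>n\<ge>N. \<forall>z\<in>cball 0 (R/2). dist (\<Sum>i<n. a i * z ^ i) (suminf (\<lambda>i. a i * z ^ i)) < 1"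
    using uniform_limitD[OF ul, of 1] unfolding eventually_sequentially by force
  show thesis
  \<comment> \<open>\<open>Suc N\<close> terms guarantee that the constant term is present.\<close>
  proof (rule that[of "\<lambda>z. \<Sum>i<Suc N. a i * z ^ i"])
    show "(\<lambda>z. \<Sum>i<Suc N. a i * z ^ i) holomorphic_on UNIV" by (intro holomorphic_intros)
    show "(\<Sum>i<Suc N. a i * 0 ^ i) = h 0" by (subst sum.lessThan_Suc_shift) (simp add: a_def)
    fix z :: complex assume z: "norm z \<le> R / 2"
    then have "suminf (\<lambda>i. a i * z ^ i) = h z" using sums[of z] R by (simp add: sums_iff)
    then show "norm ((\<Sum>i<Suc N. a i * z ^ i) - h z) \<le> 1" using N[rule_format, of "Suc N" z] z by (simp add: dist_norm del: sum.lessThan_Suc)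
  qed
qed

lemma ray_split:
  fixes f :: "real \<Rightarrow> real"
  assumes [measurable]: "f \<in> borel_measurable borel" and f: "\<And>x. x > 0 \<Longrightarrow> 0 \<le> f x" "\<And>x. x > 0 \<Longrightarrow> f x \<le> c"
    and \<rho>: "0 < \<rho>" "\<rho> \<le> 1/4" and r: "0 < r1" "r1 \<le> R" "2 * r1 \<le> norm z"
  shows "(LINT x:{r1..<R}|lborel. (c - f x) * tlog2 \<rho> (z / of_real x)) + (LINT x:{0<..}|lborel. f x * tlog2 \<rho> (z / of_real x))
    \<le> c * (LINT x:{0<..}|lborel. tlog2 \<rho> (z / of_real x)) + c * ((4 + 10 * \<bar>ln \<rho>\<bar>) * ((norm z)\<^sup>2 / R))"
proof -
  let ?F = "\<lambda>x. tlog2 \<rho> (z / complex_of_real x)" and ?C = "4 + 10 * \<bar>ln \<rho>\<bar>"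
  have c: "c \<ge> 0" using f(1)[of 1] f(2)[of 1] by simp
  have F: "set_integrable lborel {0<..} ?F" by (rule set_integrable_tlog2[OF \<rho>])
  have cF: "set_integrable lborel {0<..} (\<lambda>x. c * ?F x)" using F by (rule set_integrable_mult_right)
  have fF: "set_integrable lborel {0<..} (\<lambda>x. f x * ?F x)"
  proof (rule set_integrable_bound[OF cF])
    show "AE x in lborel. x \<in> {0<..} \<longrightarrow> norm (f x * ?F x) \<le> norm (c * ?F x)"
      using f c by (intro AE_I2 impI) (auto simp: abs_mult intro!: mult_right_mono)
  qed (auto simp: set_borel_measurable_def)
  let ?G = "\<lambda>x. (c - f x) * ?F x"
  have G: "set_integrable lborel {0<..} ?G" using set_integral_diff(1)[OF cF fF] by (simp add: left_diff_distrib)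
  have GI: "(LINT x:{0<..}|lborel. ?G x) = c * (LINT x:{0<..}|lborel. ?F x) - (LINT x:{0<..}|lborel. f x * ?F x)"
    using set_integral_diff(2)[OF cF fF] by (simp add: left_diff_distrib)
  have sub: "set_integrable lborel A ?G" if "A \<subseteq> {0<..}" "A \<in> sets lborel" for A
    using set_integrable_subset[OF G that(2,1)] .
  have Un: "{0<..} = ({0<..<r1} \<union> {r1..<R}) \<union> {R..}" using r by auto
  have "(LINT x:{0<..}|lborel. ?G x) = (LINT x:{0<..<r1}|lborel. ?G x) + (LINT x:{r1..<R}|lborel. ?G x) + (LINT x:{R..}|lborel. ?G x)"
  proof -
    have "(LINT x:{0<..<r1} \<union> {r1..<R}|lborel. ?G x) = (LINT x:{0<..<r1}|lborel. ?G x) + (LINT x:{r1..<R}|lborel. ?G x)"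
      by (rule set_integral_Un) (use r in \<open>auto intro!: sub\<close>)
    moreover have "(LINT x:({0<..<r1} \<union> {r1..<R}) \<union> {R..}|lborel. ?G x) = (LINT x:{0<..<r1} \<union> {r1..<R}|lborel. ?G x) + (LINT x:{R..}|lborel. ?G x)"
      by (rule set_integral_Un) (use r in \<open>auto intro!: sub\<close>)
    ultimately show ?thesis unfolding Un by simp
  qed
  moreover have "0 \<le> (LINT x:{0<..<r1}|lborel. ?G x)"
    unfolding set_lebesgue_integral_def
  proof (intro integral_nonneg_AE AE_I2)
    fix x :: real
    show "0 \<le> indicator {0<..<r1} x *\<^sub>R ?G x"
    proof (cases "x \<in> {0<..<r1}")
      case True
      then have "2 * x \<le> norm z" using r by auto
      then have "2 \<le> norm (z / of_real x)" using True by (simp add: norm_divide pos_le_divide_eq)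
      then have "0 \<le> ?F x" using \<rho> by (intro tlog2_nonneg) auto
      then show ?thesis using True f[of x] by simp
    qed simp
  qed
  moreover have "- (c * (?C * ((norm z)\<^sup>2 / R))) \<le> (LINT x:{R..}|lborel. ?G x)"
  proof -
    have R: "R > 0" using r by linarith
    have "- (c * (?C * ((norm z)\<^sup>2 / R))) = (LINT x:{R..}|lborel. (- (c * (?C * (norm z)\<^sup>2))) * (1 / x\<^sup>2))"
      by (simp only: set_integral_mult_right integral_inverse_square_tail[OF R]) simp
    also have "\<dots> \<le> (LINT x:{R..}|lborel. ?G x)"
    proof (rule set_integral_mono)
      show "set_integrable lborel {R..} (\<lambda>x. (- (c * (?C * (norm z)\<^sup>2))) * (1 / x\<^sup>2))"
        by (rule set_integrable_mult_right[OF set_integrable_inverse_square_tail[OF R]])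
      show "set_integrable lborel {R..} ?G" using R by (intro sub) auto
      fix x assume "x \<in> {R..}"
      then have x: "x > 0" using R by auto
      have "\<bar>?F x\<bar> \<le> ?C * ln (1 + (norm (z / of_real x))\<^sup>2)" by (rule abs_tlog2_le[OF \<rho>])
      also have "\<dots> \<le> ?C * (norm (z / of_real x))\<^sup>2" by (intro mult_left_mono ln_add_one_self_le_self) auto
      also have "\<dots> = ?C * (norm z)\<^sup>2 * (1 / x\<^sup>2)" using x by (simp add: norm_divide power_divide)
      finally have "\<bar>c - f x\<bar> * \<bar>?F x\<bar> \<le> c * (?C * (norm z)\<^sup>2 * (1 / x\<^sup>2))" using f[OF x] by (intro mult_mono) auto
      then have "\<bar>?G x\<bar> \<le> c * (?C * (norm z)\<^sup>2 * (1 / x\<^sup>2))" by (simp only: abs_mult)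
      moreover have "- (c * (?C * (norm z)\<^sup>2)) * (1 / x\<^sup>2) = - (c * (?C * (norm z)\<^sup>2 * (1 / x\<^sup>2)))" by simp
      ultimately show "- (c * (?C * (norm z)\<^sup>2)) * (1 / x\<^sup>2) \<le> ?G x" by linarith
    qed
    finally show ?thesis .
  qed
  ultimately show ?thesis using GI by linarith
qed

section \<open>The mass outside the narrow angles\<close>

context riesz_fun
begin

text \<open>A majorant at |z| = a of the paired potential of the mass in \<open>E\<close>, from |1 -
  (z/w)^2| at most 1 + |z/w|^2; it depends on z only through its modulus.\<close>

definition outer_part :: "complex set \<Rightarrow> real \<Rightarrow> ennreal" where
  "outer_part E a = (\<integral>\<^sup>+w. ennreal (ln (1 + (a / norm w)\<^sup>2)) * indicator E w \<partial>\<nu>)"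

text \<open>Mass below \<open>r0\<close> is estimated by the largest value of the integrand, mass
  beyond by the half-line comparison with density \<delta>, where the logarithm integrates to \<pi>
  a.\<close>

lemma outer_part_le:
  assumes E[measurable]: "E \<in> sets borel" and r1: "0 < r1" "r1 \<le> r0" and away: "\<And>w. w \<in> E \<Longrightarrow> r1 \<le> norm w" and \<delta>: "\<delta> \<ge> 0" and a: "a > 0"
    and growth: "\<And>t. t \<ge> r0 \<Longrightarrow> emeasure \<nu> (E \<inter> cball 0 t) \<le> ennreal (\<delta> * t)"
  shows "outer_part E a \<le> ennreal (measure \<nu> (cball 0 r0) * ln (1 + (a / r1)\<^sup>2) + \<delta> * pi * a)"
proof -
  let ?f = "\<lambda>t. ln (1 + (a / t)\<^sup>2)"
  have dec: "?f t \<le> ?f s" if "0 < s" "s \<le> t" for s t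
    using that a by (intro ln_mono add_left_mono power_mono divide_left_mono) (auto intro: add_pos_nonneg)
  define \<mu> where "\<mu> = density \<nu> (indicator (E - ball 0 r0))"
  have s\<mu>: "sets \<mu> = sets borel" by (simp add: \<mu>_def)
  have em: "emeasure \<mu> (cball 0 t) = emeasure \<nu> ((E - ball 0 r0) \<inter> cball 0 t)" for t
    unfolding \<mu>_def by (subst emeasure_density) (auto intro!: arg_cong[where f="emeasure \<nu>"] simp: indicator_inter_arith[symmetric])
  have gr: "emeasure \<mu> (cball 0 t) \<le> ennreal (\<delta> * t)" if "t \<ge> 0" for t
  proof (cases "t \<ge> r0")
    case True
    have "emeasure \<nu> ((E - ball 0 r0) \<inter> cball 0 t) \<le> emeasure \<nu> (E \<inter> cball 0 t)" by (intro emeasure_mono) auto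
    then show ?thesis unfolding em using growth[OF True] by (rule order_trans)
  next
    case False
    then have "(E - ball 0 r0) \<inter> cball 0 t = {}" by auto
    then show ?thesis unfolding em by simp
  qed
  have sf: "sigma_finite_measure \<mu>"
  proof (rule sigma_finite_if_finite_cballs[OF s\<mu>])
    fix R
    have "emeasure \<nu> ((E - ball 0 r0) \<inter> cball 0 R) \<le> emeasure \<nu> (cball 0 R)" by (intro emeasure_mono) auto
    then show "emeasure \<mu> (cball 0 R) < \<infinity>" unfolding em using nu_cball[of R] by (rule le_less_trans)
  qed
  have "outer_part E a \<le> (\<integral>\<^sup>+w. ennreal (?f r1) * indicator (cball 0 r0) w + ennreal (?f (norm w)) * indicator (E - ball 0 r0) w \<partial>\<nu>)"
    unfolding outer_part_def
  proof (rule nn_integral_mono)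
    fix w
    show "ennreal (?f (norm w)) * indicator E w \<le> ennreal (?f r1) * indicator (cball 0 r0) w + ennreal (?f (norm w)) * indicator (E - ball 0 r0) w"
    proof (cases "w \<in> E")
      case True
      then have "ennreal (?f (norm w)) \<le> ennreal (?f r1)" by (intro ennreal_leI dec r1 away)
      then show ?thesis using True by (cases "norm w < r0") (auto simp: indicator_def)
    qed simp
  qed
  also have "\<dots> = ennreal (?f r1) * emeasure \<nu> (cball 0 r0) + (\<integral>\<^sup>+w. ennreal (?f (norm w)) * indicator (E - ball 0 r0) w \<partial>\<nu>)"
    by (subst nn_integral_add) (auto simp: nn_integral_cmult_indicator)
  also have "(\<integral>\<^sup>+w. ennreal (?f (norm w)) * indicator (E - ball 0 r0) w \<partial>\<nu>) = (\<integral>\<^sup>+w. ennreal (?f (norm w)) \<partial>\<mu>)"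
    unfolding \<mu>_def by (subst nn_integral_density) (auto simp: mult.commute)
  also have "\<dots> \<le> ennreal \<delta> * (\<integral>\<^sup>+t. ennreal (?f t) * indicator {0<..} t \<partial>lborel)"
    by (rule nn_integral_decreasing_le[OF s\<mu> sf \<delta> gr _ dec]) auto
  also have "(\<integral>\<^sup>+t. ennreal (?f t) * indicator {0<..} t \<partial>lborel) = ennreal (pi * a)"
  proof -
    have "(\<integral>\<^sup>+t. ennreal (?f t) * indicator {0<..} t \<partial>lborel) = (\<integral>\<^sup>+t. ennreal (indicator {0<..} t *\<^sub>R ?f t) \<partial>lborel)"
      by (intro nn_integral_cong) (auto simp: indicator_def)
    also have "\<dots> = ennreal (LINT t:{0<..}|lborel. ?f t)"
      unfolding set_lebesgue_integral_def using set_integrable_ln_one_plus_sq[OF a]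
      by (intro nn_integral_eq_integral) (auto simp: set_integrable_def)
    finally show ?thesis using integral_ln_one_plus_sq[OF a] by simp
  qed
  also have "emeasure \<nu> (cball 0 r0) = ennreal (measure \<nu> (cball 0 r0))" using nu_cball[of r0] by (intro emeasure_eq_ennreal_measure) auto
  also have "ennreal (?f r1) * ennreal (measure \<nu> (cball 0 r0)) + ennreal \<delta> * ennreal (pi * a) = ennreal (measure \<nu> (cball 0 r0) * ?f r1 + \<delta> * pi * a)"
    using \<delta> a by (simp add: ennreal_mult[symmetric] ennreal_plus[symmetric] mult_ac del: ennreal_plus)
  finally show ?thesis using add_left_mono by (simp add: mult_ac)
qed

text \<open>The mass in \<open>E\<close> has arbitrarily small linear density far out, and the
  finite remainder contributes only O(ln a); hence no linear growth.\<close>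

lemma outer_part_sublinear:
  assumes E: "E \<in> sets borel" and r1: "0 < r1" and away: "\<And>w. w \<in> E \<Longrightarrow> r1 \<le> norm w"
    and small: "\<And>\<delta>. \<delta> > 0 \<Longrightarrow> eventually (\<lambda>t. emeasure \<nu> (E \<inter> cball 0 t) \<le> ennreal (\<delta> * t)) at_top"
  shows "a > 0 \<Longrightarrow> outer_part E a < \<infinity>"
    and "\<delta> > 0 \<Longrightarrow> eventually (\<lambda>a. enn2real (outer_part E a) \<le> \<delta> * a) at_top"
proof -
  have bound: "\<exists>r0\<ge>r1. \<forall>a>0. outer_part E a \<le> ennreal (measure \<nu> (cball 0 r0) * ln (1 + (a / r1)\<^sup>2) + \<delta> * pi * a)" if \<delta>: "\<delta> > 0" for \<delta>
  proof -
    obtain r where r: "\<And>t. t \<ge> r \<Longrightarrow> emeasure \<nu> (E \<inter> cball 0 t) \<le> ennreal (\<delta> * t)"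
      using small[OF \<delta>] unfolding eventually_at_top_linorder by blast
    show ?thesis
    proof (intro exI[of _ "max r r1"] conjI allI impI)
      fix a :: real assume "a > 0"
      then show "outer_part E a \<le> ennreal (measure \<nu> (cball 0 (max r r1)) * ln (1 + (a / r1)\<^sup>2) + \<delta> * pi * a)"
        using \<delta> r by (intro outer_part_le[OF E r1 _ away]) auto
    qed simp
  qed
  show "a > 0 \<Longrightarrow> outer_part E a < \<infinity>" using bound[of 1] by (auto intro: le_less_trans)
  assume \<delta>: "\<delta> > 0"
  then have "\<delta> / (2 * pi) > 0" by simp
  from bound[OF this] obtain r0 where r0: "\<And>a. a > 0 \<Longrightarrow> outer_part E a \<le> ennreal (measure \<nu> (cball 0 r0) * ln (1 + (a / r1)\<^sup>2) + \<delta> / (2 * pi) * pi * a)" by blast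
  define m where "m = measure \<nu> (cball 0 r0)"
  \<comment> \<open>From here on 4 m sqrt(a/r1) is at most \<delta> a/2; the density \<delta>/(2
    \<pi>) of the far mass provides the other half.\<close>
  define A where "A = max 1 ((8 * m / \<delta>)\<^sup>2 / r1)"
  have m: "m \<ge> 0" by (simp add: m_def)
  show "eventually (\<lambda>a. enn2real (outer_part E a) \<le> \<delta> * a) at_top"
    using eventually_ge_at_top[of A]
  proof (rule eventually_mono)
    fix a assume a: "A \<le> a"
    then have a0: "a > 0" by (simp add: A_def)
    have "(8 * m / \<delta>)\<^sup>2 \<le> a * r1" using a r1 by (simp add: A_def pos_divide_le_eq)
    then have "8 * m / \<delta> \<le> sqrt (a * r1)" by (rule real_le_rsqrt)
    then have 1: "m * 8 \<le> \<delta> * sqrt (a * r1)" using \<delta> by (simp add: pos_divide_le_eq mult.commute)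
    have "ln (1 + (a / r1)\<^sup>2) \<le> 4 * sqrt (a / r1)" using a0 r1 by (intro ln_one_plus_sq_le) auto
    then have "m * ln (1 + (a / r1)\<^sup>2) \<le> m * (4 * sqrt (a / r1))" using m by (rule mult_left_mono)
    also have "\<dots> = (m * 8) * (sqrt (a / r1) / 2)" by simp
    also have "\<dots> \<le> (\<delta> * sqrt (a * r1)) * (sqrt (a / r1) / 2)" using 1 a0 r1 by (intro mult_right_mono) auto
    also have "\<dots> = \<delta> / 2 * sqrt ((a * r1) * (a / r1))" unfolding real_sqrt_mult[of "a * r1" "a / r1"] by simp
    also have "(a * r1) * (a / r1) = a\<^sup>2" using r1 by (simp add: power2_eq_square)
    finally have "m * ln (1 + (a / r1)\<^sup>2) \<le> \<delta> / 2 * a" using a0 by simp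
    then have le: "m * ln (1 + (a / r1)\<^sup>2) + \<delta> / (2 * pi) * pi * a \<le> \<delta> * a" by simp
    have "outer_part E a \<le> ennreal (\<delta> * a)" using r0[OF a0] ennreal_leI[OF le] unfolding m_def by (rule order_trans)
    then show "enn2real (outer_part E a) \<le> \<delta> * a" using \<delta> a0 by (intro enn2real_leI) auto
  qed
qed

end

section \<open>The multiplier on a fixed disc\<close>

context riesz_fun
begin

text \<open>The terms are, in order: the polynomial approximation, the mass near 0, the mass off the
  angles, the correction in sweeping, the constant densities on the real and imaginary axes, and the
  discretization. None involves the radius of the disc.\<close>

definition stage_bound :: "complex set \<Rightarrow> real \<Rightarrow> real \<Rightarrow> real \<Rightarrow> real \<Rightarrow> nat \<Rightarrow> complex \<Rightarrow> real" where
  "stage_bound M \<eta> B D \<rho> k0 z =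
     1 + measure \<nu> (ball 0 (2 ^ k0)) * ln (norm z + 2 ^ k0) + enn2real (outer_part (- M - ball 0 (2 ^ k0)) (norm z))
     + (1 - cos \<eta>) * (B * pi * norm z)
     + (6 * B / \<eta>) * (pi * (\<bar>Im z\<bar> + 2 * \<rho> * norm z)) + (2 * B * \<eta>) * (pi * (\<bar>Re z\<bar> + 2 * \<rho> * norm z))
     + (qerr D \<rho> (norm z) + 2 * qerr (6 * B / \<eta>) \<rho> (norm z) + 2 * qerr (2 * B * \<eta>) \<rho> (norm z))"

lemma space_nu [simp]: "space \<nu> = UNIV"
  using sets_eq_imp_space_eq[OF sets_nu] by simp

text \<open>The radius \<open>\<rho> * norm z / 2\<close> is small enough that \<zeta> within it of
  z has modulus at least |z|/2. There the smoothed logarithm minus ln|\<zeta>| is at most ln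
  \<open>\<rho>\<close>, so the kernel truncated at \<open>\<rho>\<close> dominates
  everywhere.\<close>

lemma vsm_le_representation:
  assumes r1: "1 \<le> r1" "r1 \<le> R" and rep: "\<And>z \<rho>. 0 < \<rho> \<Longrightarrow> norm z + \<rho> \<le> R \<Longrightarrow>
      vsm \<rho> z = Re (h z) + (LINT \<zeta>:ball 0 R|\<nu>. slogd z \<rho> \<zeta> - (if norm \<zeta> < r1 then 0 else ln (norm \<zeta>)))"
    and int: "\<And>z \<rho>. set_integrable \<nu> (ball 0 R) (\<lambda>\<zeta>. slogd z \<rho> \<zeta> - (if norm \<zeta> < r1 then 0 else ln (norm \<zeta>)))"
    and tint: "set_integrable \<nu> {w. r1 \<le> norm w \<and> norm w < R} (\<lambda>w. tlog \<rho> (z / w))"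
    and \<rho>: "0 < \<rho>" "\<rho> \<le> 1/4" and z: "2 * r1 \<le> norm z" "norm z \<le> R / 2"
  shows "vsm (\<rho> * norm z / 2) z \<le> Re (h z) + measure \<nu> (ball 0 r1) * ln (norm z + r1)
    + (LINT w:{w. r1 \<le> norm w \<and> norm w < R}|\<nu>. tlog \<rho> (z / w))"
proof -
  define \<sigma> where "\<sigma> = \<rho> * norm z / 2"
  define A where "A = {w::complex. r1 \<le> norm w \<and> norm w < R}"
  have z0: "norm z > 0" using z r1 by linarith
  have \<sigma>: "0 < \<sigma>" using \<rho> z0 by (simp add: \<sigma>_def)
  have "\<rho> * norm z \<le> (1/4) * norm z" using \<rho> z0 by (intro mult_right_mono) auto
  then have \<sigma>z: "\<sigma> \<le> norm z / 8" by (simp add: \<sigma>_def)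
  have "norm z + \<sigma> \<le> R" using \<sigma>z z z0 by linarith
  note v = rep[OF \<sigma> this]
  have fb: "emeasure \<nu> (ball 0 r1) < \<infinity>"
    by (rule le_less_trans[OF emeasure_mono nu_cball[of r1]]) auto
  let ?G = "\<lambda>\<zeta>. slogd z \<sigma> \<zeta> - (if norm \<zeta> < r1 then 0 else ln (norm \<zeta>))"
  have "(\<integral>\<zeta>. indicator (ball 0 R) \<zeta> *\<^sub>R ?G \<zeta> \<partial>\<nu>)
     \<le> (\<integral>\<zeta>. indicator (ball 0 r1) \<zeta> * ln (norm z + r1) + indicator A \<zeta> *\<^sub>R tlog \<rho> (z / \<zeta>) \<partial>\<nu>)"
  proof (rule integral_mono)
    show "integrable \<nu> (\<lambda>\<zeta>. indicator (ball 0 R) \<zeta> *\<^sub>R ?G \<zeta>)" using int unfolding set_integrable_def .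
    show "integrable \<nu> (\<lambda>\<zeta>. indicator (ball 0 r1) \<zeta> * ln (norm z + r1) + indicator A \<zeta> *\<^sub>R tlog \<rho> (z / \<zeta>))"
      using tint fb unfolding set_integrable_def A_def by (intro Bochner_Integration.integrable_add integrable_mult_left) auto
    fix \<zeta> :: complex
    consider "norm \<zeta> < r1" | "r1 \<le> norm \<zeta>" "norm \<zeta> < R" | "R \<le> norm \<zeta>" by linarith
    then show "indicator (ball 0 R) \<zeta> *\<^sub>R ?G \<zeta> \<le> indicator (ball 0 r1) \<zeta> * ln (norm z + r1) + indicator A \<zeta> *\<^sub>R tlog \<rho> (z / \<zeta>)"
    proof cases
      case 1
      have "slogd z \<sigma> \<zeta> \<le> ln (max (norm (\<zeta> - z)) \<sigma>)" using \<sigma> by (rule slogd_le)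
      also have "\<dots> \<le> ln (norm z + r1)"
        using 1 \<sigma> \<sigma>z z0 r1 norm_triangle_ineq4[of \<zeta> z] by (intro ln_mono) auto
      finally show ?thesis using 1 r1 by (simp add: A_def)
    next
      case 2
      have \<zeta>0: "norm \<zeta> > 0" using 2 r1 by linarith
      have nn: "norm (1 - z / \<zeta>) = norm (\<zeta> - z) / norm \<zeta>"
      proof -
        have "1 - z / \<zeta> = (\<zeta> - z) / \<zeta>" using \<zeta>0 by (simp add: diff_divide_distrib)
        then show ?thesis by (simp add: norm_divide)
      qed
      have "slogd z \<sigma> \<zeta> - ln (norm \<zeta>) \<le> tlog \<rho> (z / \<zeta>)"
      proof (cases "\<sigma> \<le> norm (\<zeta> - z)")
        case True
        then have "slogd z \<sigma> \<zeta> - ln (norm \<zeta>) = ln (norm (\<zeta> - z) / norm \<zeta>)"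
        proof -
          have "norm (\<zeta> - z) > 0" using True \<sigma> by linarith
          then show ?thesis using \<zeta>0 slogd_eq_ln[OF \<sigma> True] by (simp only: ln_div) simp
        qed
        also have "\<dots> \<le> tlog \<rho> (z / \<zeta>)" unfolding tlog_def nn using True \<sigma> \<zeta>0 by (intro ln_mono divide_pos_pos) auto
        finally show ?thesis .
      next
        case False
        then have "slogd z \<sigma> \<zeta> \<le> ln \<sigma>" using slogd_le[OF \<sigma>, of z \<zeta>] by (simp add: max_absorb2)
        moreover have "norm z \<le> norm \<zeta> + norm (\<zeta> - z)" using norm_triangle_ineq4[of \<zeta> "\<zeta> - z"] by simp
        then have "norm z / 2 \<le> norm \<zeta>" using False \<sigma>z z0 by linarith
        then have "\<rho> * (norm z / 2) \<le> \<rho> * norm \<zeta>" using \<rho> by (intro mult_left_mono) auto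
        then have "ln \<sigma> \<le> ln (\<rho> * norm \<zeta>)" using \<sigma> by (intro ln_mono) (auto simp: \<sigma>_def)
        moreover have "ln (\<rho> * norm \<zeta>) = ln \<rho> + ln (norm \<zeta>)" using \<rho> \<zeta>0 by (simp add: ln_mult)
        ultimately show ?thesis using tlog_ge_ln[OF \<rho>(1), of "z / \<zeta>"] by linarith
      qed
      then show ?thesis using 2 by (simp add: A_def)
    next
      case 3
      then show ?thesis using r1 by (simp add: A_def)
    qed
  qed
  also have "\<dots> = measure \<nu> (ball 0 r1) * ln (norm z + r1) + (LINT w:A|\<nu>. tlog \<rho> (z / w))"
    unfolding set_lebesgue_integral_def
    using tint fb unfolding set_integrable_def A_def by (subst Bochner_Integration.integral_add) (auto intro!: integrable_mult_left)
  finally show ?thesis using v by (simp add: \<sigma>_def A_def set_lebesgue_integral_def)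
qed

text \<open>Unlike \<open>v\<close>, its smoothing is bounded below on discs. This turns a bound on
  |g| exp(vsm) over a circle into one on |g|.\<close>

lemma vsm_bounded_below:
  assumes "\<sigma> > 0" obtains C where "\<And>z. norm z \<le> T \<Longrightarrow> - C \<le> vsm \<sigma> z"
proof -
  obtain b where b: "b > 0" "\<And>s. bump s \<le> b" using bump_bounded by blast
  define I where "I = (\<integral>\<zeta>. \<bar>indicator (cball 0 (T + \<sigma>)) \<zeta> *\<^sub>R rv \<zeta>\<bar> * b \<partial>lborel)"
  have int: "integrable lborel (\<lambda>\<zeta>. \<bar>indicator (cball 0 (T + \<sigma>)) \<zeta> *\<^sub>R rv \<zeta>\<bar> * b)"
    using rv_integrable[of "T + \<sigma>"] unfolding set_integrable_def by (intro integrable_mult_left integrable_abs)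
  have "- (I / (pi * \<sigma>\<^sup>2)) \<le> vsm \<sigma> z" if z: "norm z \<le> T" for z
  proof -
    have "- I \<le> (\<integral>\<zeta>. rv \<zeta> * bump ((norm (\<zeta> - z))\<^sup>2 / \<sigma>\<^sup>2) \<partial>lborel)"
      unfolding I_def Bochner_Integration.integral_minus[symmetric]
    proof (rule integral_mono)
      show "integrable lborel (\<lambda>\<zeta>. - (\<bar>indicator (cball 0 (T + \<sigma>)) \<zeta> *\<^sub>R rv \<zeta>\<bar> * b))" using int by (rule Bochner_Integration.integrable_minus)
      show "integrable lborel (\<lambda>\<zeta>. rv \<zeta> * bump ((norm (\<zeta> - z))\<^sup>2 / \<sigma>\<^sup>2))" by (rule integrable_rv_bump[OF assms])
      fix \<zeta> :: complex
      show "- (\<bar>indicator (cball 0 (T + \<sigma>)) \<zeta> *\<^sub>R rv \<zeta>\<bar> * b) \<le> rv \<zeta> * bump ((norm (\<zeta> - z))\<^sup>2 / \<sigma>\<^sup>2)"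
      proof (cases "norm (\<zeta> - z) > \<sigma>")
        case True
        then show ?thesis using bump_sqdist_eq_0[OF assms True] b by simp
      next
        case False
        then have "norm \<zeta> \<le> T + \<sigma>" using z norm_triangle_ineq2[of \<zeta> z] by linarith
        moreover have "\<bar>rv \<zeta> * bump ((norm (\<zeta> - z))\<^sup>2 / \<sigma>\<^sup>2)\<bar> \<le> \<bar>rv \<zeta>\<bar> * b"
          unfolding abs_mult using b bump_nonneg by (intro mult_left_mono abs_ge_zero) auto
        ultimately show ?thesis by simp
      qed
    qed
    then have "- I / (pi * \<sigma>\<^sup>2) \<le> vsm \<sigma> z" unfolding vsm_def using assms by (intro divide_right_mono) auto
    then show ?thesis by simp
  qed
  then show thesis using that by blast
qed

lemma stage_bound_le_circle:
  assumes B: "B \<ge> 0" and \<eta>: "0 < \<eta>" and \<rho>: "0 < \<rho>"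
  obtains C where "\<And>z. norm z = T \<Longrightarrow> stage_bound M \<eta> B D \<rho> k0 z \<le> C"
proof -
  have "stage_bound M \<eta> B D \<rho> k0 z \<le> stage_bound M \<eta> B D \<rho> k0 (of_real T)
      + (6 * B / \<eta>) * (pi * T) + (2 * B * \<eta>) * (pi * T)" if z: "norm z = T" for z
  proof -
    have T: "T \<ge> 0" using z norm_ge_zero[of z] by linarith
    have "\<bar>Im z\<bar> \<le> T" "\<bar>Re z\<bar> \<le> T" using z abs_Im_le_cmod[of z] abs_Re_le_cmod[of z] by auto
    then have "(6 * B / \<eta>) * (pi * (\<bar>Im z\<bar> + 2 * \<rho> * T)) \<le> (6 * B / \<eta>) * (pi * (0 + 2 * \<rho> * T)) + (6 * B / \<eta>) * (pi * T)"
      "(2 * B * \<eta>) * (pi * (\<bar>Re z\<bar> + 2 * \<rho> * T)) \<le> (2 * B * \<eta>) * (pi * (T + 2 * \<rho> * T)) + (2 * B * \<eta>) * (pi * T)"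
      using B \<eta> T unfolding distrib_left[symmetric] by (intro mult_left_mono; simp)+
    then show ?thesis unfolding stage_bound_def using z T by simp
  qed
  then show thesis using that by blast
qed

context
  fixes M :: "complex set" and \<eta> B D \<rho> :: real and k0 :: nat
  assumes M[measurable]: "M \<in> sets borel" and \<eta>: "0 < \<eta>" "\<eta> \<le> 1/2" and B: "B \<ge> 0"
    and narrow: "\<And>w. w \<in> M \<Longrightarrow> \<bar>Im w\<bar> \<le> sin (\<eta> / 2) * norm w"
    and growth: "\<And>t. 2 ^ k0 \<le> t \<Longrightarrow> emeasure \<nu> (M \<inter> cball 0 t - ball 0 (2 ^ k0)) \<le> ennreal (B * t)"
    and D: "D \<ge> 0" and mass: "\<And>k. k0 \<le> k \<Longrightarrow> emeasure \<nu> {w. 2 ^ k \<le> norm w \<and> norm w < 2 ^ Suc k} \<le> ennreal (D * 2 ^ k)"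
    and \<rho>: "0 < \<rho>" "\<rho> \<le> 1/4" "3 * \<rho> \<le> sin \<eta>"
    and fin: "\<And>a. a > 0 \<Longrightarrow> outer_part (- M - ball 0 (2 ^ k0)) a < \<infinity>"
begin

text \<open>Reflected zeros make the kernel even, sweeping bounds the mass in the angles by its
  densities on the axes, and added zeros raise these densities to constants. The only trace of the
  disc in the bound is the tail |z|^2/2^K of the constant densities.\<close>

lemma stage:
  assumes K: "k0 \<le> K"
  obtains g where "g holomorphic_on UNIV"
    "norm (g 0) = exp ((LINT \<zeta>:ball 0 (2 ^ k0)|\<nu>. slogd 0 (2 ^ k0) \<zeta>) - vsm (2 ^ k0) 0)"
    "\<And>z. 2 * 2 ^ k0 \<le> norm z \<Longrightarrow> norm z \<le> 2 ^ K / 2 \<Longrightarrow> norm (g z) * exp (vsm (\<rho> * norm z / 2) z)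
      \<le> exp (stage_bound M \<eta> B D \<rho> k0 z + (6 * B / \<eta> + 2 * B * \<eta>) * ((4 + 10 * \<bar>ln \<rho>\<bar>) * ((norm z)\<^sup>2 / 2 ^ K)))"
proof -
  define r1 R :: real where "r1 = 2 ^ k0" and "R = 2 ^ K"
  define A where "A = {w::complex. r1 \<le> norm w \<and> norm w < R}"
  define c c' where "c = 6 * B / \<eta>" and "c' = 2 * B * \<eta>"
  have r1: "1 \<le> r1" "r1 \<le> R" "0 < r1" using K by (auto simp: r1_def R_def intro: power_increasing)
  have R0: "R > 0" by (simp add: R_def)
  have Am[measurable]: "A \<in> sets borel" unfolding A_def by measurable
  have fA: "emeasure \<nu> A < \<infinity>" by (rule le_less_trans[OF emeasure_mono nu_cball[of R]]) (auto simp: A_def)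
  have \<eta>pi: "0 < \<eta>" "\<eta> < pi" "0 < pi - \<eta>" "pi - \<eta> < pi" using \<eta> pi_gt3 by auto
  obtain h where h: "h holomorphic_on ball 0 R"
    "\<And>z \<rho>. 0 < \<rho> \<Longrightarrow> norm z + \<rho> \<le> R \<Longrightarrow>
      vsm \<rho> z = Re (h z) + (LINT \<zeta>:ball 0 R|\<nu>. slogd z \<rho> \<zeta> - (if norm \<zeta> < r1 then 0 else ln (norm \<zeta>)))"
    "\<And>z \<rho>. set_integrable \<nu> (ball 0 R) (\<lambda>\<zeta>. slogd z \<rho> \<zeta> - (if norm \<zeta> < r1 then 0 else ln (norm \<zeta>)))"
    using smoothed_representation[OF r1(3,2)] by blast
  obtain p where p: "p holomorphic_on UNIV" "p 0 = h 0" "\<And>z. norm z \<le> R / 2 \<Longrightarrow> norm (p z - h z) \<le> 1"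
    using entire_approximation[OF h(1) R0] by blast
  have mass': "emeasure \<nu> {x \<in> space \<nu>. 2 ^ k \<le> norm (- x) \<and> norm (- x) < 2 ^ Suc k} \<le> ennreal (D * 2 ^ k)" if "k0 \<le> k" for k
    using mass[OF that] by simp
  have mm: "(\<lambda>w::complex. - w) \<in> borel_measurable \<nu>" by measurable
  obtain q1 where q1: "q1 holomorphic_on UNIV" "q1 0 = 1"
    "\<And>z \<rho>. 0 < \<rho> \<Longrightarrow> \<rho> \<le> 1 \<Longrightarrow> norm (q1 z) \<le>
      exp ((LINT w:{w \<in> space \<nu>. 2 ^ k0 \<le> norm (- w) \<and> norm (- w) < 2 ^ K}|\<nu>. tlog \<rho> (z / - w)) + qerr D \<rho> (norm z))"
    using quantization[OF mm D mass' K] by blast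
  have setA: "{w \<in> space \<nu>. 2 ^ k0 \<le> norm (- w) \<and> norm (- w) < 2 ^ K} = A" by (auto simp: A_def r1_def R_def)
  note q13 = q1(3)[unfolded setA]
  \<comment> \<open>The mass to be swept: restricted to the annulus it is finite and stays away from
    0.\<close>
  define \<mu> where "\<mu> = density \<nu> (\<lambda>w. ennreal (indicator (M \<inter> A) w))"
  have s\<mu>: "sets \<mu> = sets borel" by (simp add: \<mu>_def)
  have e\<mu>: "emeasure \<mu> X = emeasure \<nu> (M \<inter> A \<inter> X)" if [measurable]: "X \<in> sets borel" for X
    unfolding \<mu>_def by (subst emeasure_density) (auto intro!: arg_cong[where f="emeasure \<nu>"] simp: ennreal_indicator indicator_inter_arith[symmetric])
  have f\<mu>: "finite_measure \<mu>"
  proof (rule finite_measureI)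
    have "emeasure \<nu> (M \<inter> A \<inter> UNIV) \<le> emeasure \<nu> A" by (intro emeasure_mono) auto
    then have "emeasure \<mu> UNIV < \<infinity>" using fA e\<mu>[of UNIV] by (simp add: le_less_trans)
    moreover have "space \<mu> = UNIV" by (simp add: \<mu>_def)
    ultimately show "emeasure \<mu> (space \<mu>) \<noteq> \<infinity>" by simp
  qed
  have gr: "emeasure \<mu> (cball 0 t) \<le> ennreal (B * t)" if "t \<ge> 0" for t
  proof (cases "r1 \<le> t")
    case True
    have "emeasure \<nu> (M \<inter> A \<inter> cball 0 t) \<le> emeasure \<nu> (M \<inter> cball 0 t - ball 0 r1)" by (intro emeasure_mono) (auto simp: A_def)
    also have "\<dots> \<le> ennreal (B * t)" using growth[of t] True by (simp add: r1_def)
    finally show ?thesis by (simp add: e\<mu>)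
  next
    case False
    then have "M \<inter> A \<inter> cball 0 t = {}" by (auto simp: A_def)
    then show ?thesis by (simp add: e\<mu>)
  qed
  have ae: "AE w in \<mu>. w \<in> M \<inter> A"
    unfolding \<mu>_def by (subst AE_density) (auto simp: indicator_def)
  have away: "AE w in \<mu>. r1 \<le> norm w" using ae by (rule eventually_mono) (simp add: A_def)
  have nar: "AE w in \<mu>. \<bar>Im w\<bar> \<le> sin (\<eta> / 2) * norm w" using ae by (rule eventually_mono) (use narrow in blast)
  note sw = s\<mu> f\<mu> B gr r1(3) away \<eta>
  have [measurable]: "sweep \<mu> \<alpha> \<in> borel_measurable borel" for \<alpha> by (rule sweep_measurable[OF s\<mu> f\<mu>])
  have s1: "0 \<le> sweep \<mu> \<eta> x" "sweep \<mu> \<eta> x \<le> c" if "x > 0" for x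
    using sweep_main_le[OF sw that] sweep_nonneg[OF sw \<eta>pi(1,2), of x] that by (auto simp: c_def)
  have s2: "0 \<le> sweep \<mu> (pi - \<eta>) x" "sweep \<mu> (pi - \<eta>) x \<le> c'" if "x > 0" for x
    using sweep_cross_le[OF sw that] sweep_nonneg[OF sw \<eta>pi(3,4), of x] that by (auto simp: c'_def)
  \<comment> \<open>The swept density is at most \<open>c\<close>, so the complement to
    \<open>c\<close> is nonnegative and can be realised by zeros.\<close>
  obtain q2 where q2: "q2 holomorphic_on UNIV" "q2 0 = 1"
    "\<And>z \<rho>. 0 < \<rho> \<Longrightarrow> \<rho> \<le> 1 \<Longrightarrow> norm (q2 z) \<le>
      exp ((LINT x:{2 ^ k0..<2 ^ K}|lborel. (c - sweep \<mu> \<eta> x) * tlog2 \<rho> (z / of_real x)) + 2 * qerr c \<rho> (norm z))"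
    using ray_quantization[of "\<lambda>x. c - sweep \<mu> \<eta> x" c k0 K] s1 K by auto
  obtain q3 where q3: "q3 holomorphic_on UNIV" "q3 0 = 1"
    "\<And>z \<rho>. 0 < \<rho> \<Longrightarrow> \<rho> \<le> 1 \<Longrightarrow> norm (q3 z) \<le>
      exp ((LINT x:{2 ^ k0..<2 ^ K}|lborel. (c' - sweep \<mu> (pi - \<eta>) x) * tlog2 \<rho> (z / of_real x)) + 2 * qerr c' \<rho> (norm z))"
    using ray_quantization[of "\<lambda>x. c' - sweep \<mu> (pi - \<eta>) x" c' k0 K] s2 K by auto
  \<comment> \<open>The exponential removes the harmonic part, \<open>q1\<close> approximates the
    masses at -w, and \<open>q2\<close> and \<open>q3\<close> supply the missing densities; the
    argument -\<i> z places the zeros of \<open>q3\<close> on the imaginary axis.\<close>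
  define g where "g = (\<lambda>z. exp (- p z) * q1 z * q2 z * q3 (- \<i> * z))"
  have tint: "set_integrable \<nu> A (\<lambda>w. tlog \<rho> (y / w))" for y
    unfolding set_integrable_def
  proof (rule integrableI_bounded_set_indicator[OF _ _ fA])
    show "AE w in \<nu>. w \<in> A \<longrightarrow> norm (tlog \<rho> (y / w)) \<le> norm y / r1 + \<bar>ln \<rho>\<bar>"
    proof (intro AE_I2 impI)
      fix w assume "w \<in> A"
      then have "r1 \<le> norm w" by (simp add: A_def)
      then have "norm y / norm w \<le> norm y / r1" using r1 by (intro divide_left_mono mult_pos_pos) auto
      then show "norm (tlog \<rho> (y / w)) \<le> norm y / r1 + \<bar>ln \<rho>\<bar>"
        using abs_tlog_le[of \<rho> "y / w"] \<rho> by (simp add: norm_divide)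
    qed
  qed measurable
  show thesis
  proof (rule that[of g])
    have "(\<lambda>z. q3 (- \<i> * z)) holomorphic_on UNIV"
      using holomorphic_on_compose[of "\<lambda>z. - \<i> * z" UNIV q3] q3(1) by (auto simp: o_def intro!: holomorphic_intros intro: holomorphic_on_subset)
    then show "g holomorphic_on UNIV" unfolding g_def using p(1) q1(1) q2(1) by (intro holomorphic_intros)
    \<comment> \<open>From radius r1 outwards the smoothed logarithm about 0 is exactly ln|\<zeta>|
      and cancels, so the value of |g(0)| does not depend on \<open>K\<close>.\<close>
    have "(LINT \<zeta>:ball 0 R|\<nu>. slogd 0 r1 \<zeta> - (if norm \<zeta> < r1 then 0 else ln (norm \<zeta>))) = (LINT \<zeta>:ball 0 r1|\<nu>. slogd 0 r1 \<zeta>)"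
      unfolding set_lebesgue_integral_def
    proof (rule Bochner_Integration.integral_cong)
      fix \<zeta> :: complex
      show "indicator (ball 0 R) \<zeta> *\<^sub>R (slogd 0 r1 \<zeta> - (if norm \<zeta> < r1 then 0 else ln (norm \<zeta>))) = indicator (ball 0 r1) \<zeta> *\<^sub>R slogd 0 r1 \<zeta>"
        using slogd_eq_ln[OF r1(3), of \<zeta> 0] r1 by (cases "norm \<zeta> < r1") auto
    qed simp
    then have "vsm r1 0 = Re (h 0) + (LINT \<zeta>:ball 0 r1|\<nu>. slogd 0 r1 \<zeta>)" using h(2)[of r1 0] r1 by simp
    then show "norm (g 0) = exp ((LINT \<zeta>:ball 0 (2 ^ k0)|\<nu>. slogd 0 (2 ^ k0) \<zeta>) - vsm (2 ^ k0) 0)"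
      by (simp add: g_def q1 q2 q3 p r1_def)
    fix z :: complex assume z: "2 * 2 ^ k0 \<le> norm z" "norm z \<le> 2 ^ K / 2"
    have z': "2 * r1 \<le> norm z" "norm z \<le> R / 2" using z by (auto simp: r1_def R_def)
    have z0: "norm z > 0" using z' r1 by linarith
    then have zn: "z \<noteq> 0" "- \<i> * z \<noteq> 0" by auto
    have niz: "norm (- \<i> * z) = norm z" "\<bar>Im (- \<i> * z)\<bar> = \<bar>Re z\<bar>" by (simp_all add: norm_mult)
    define I1 E1 where "I1 = (LINT w:A|\<nu>. tlog \<rho> (z / w))" and "E1 = (LINT w:A|\<nu>. tlog \<rho> (z / - w))"
    define I2 where "I2 = (LINT x:{r1..<R}|lborel. (c - sweep \<mu> \<eta> x) * tlog2 \<rho> (z / of_real x))"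
    define I3 where "I3 = (LINT x:{r1..<R}|lborel. (c' - sweep \<mu> (pi - \<eta>) x) * tlog2 \<rho> (- \<i> * z / of_real x))"
    define J2 where "J2 = (LINT x:{0<..}|lborel. sweep \<mu> \<eta> x * tlog2 \<rho> (z / of_real x))"
    define J3 where "J3 = (LINT x:{0<..}|lborel. sweep \<mu> (pi - \<eta>) x * tlog2 \<rho> (- \<i> * z / of_real x))"
    define T where "T = (4 + 10 * \<bar>ln \<rho>\<bar>) * ((norm z)\<^sup>2 / R)"
    define outer where "outer = enn2real (outer_part (- M - ball 0 r1) (norm z))"
    have v: "vsm (\<rho> * norm z / 2) z \<le> Re (h z) + measure \<nu> (ball 0 r1) * ln (norm z + r1) + I1"
      unfolding I1_def A_def by (rule vsm_le_representation[OF r1(1,2) h(2,3) tint[unfolded A_def] \<rho>(1,2) z'])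
    have t2: "set_integrable \<nu> A (\<lambda>w. tlog2 \<rho> (z / w))" and t2I: "I1 + E1 = (LINT w:A|\<nu>. tlog2 \<rho> (z / w))"
      using set_integral_add[OF tint[of z] tint[of "- z"]] by (simp_all add: I1_def E1_def tlog2_def)
    have "(LINT w:A|\<nu>. tlog2 \<rho> (z / w)) = (LINT w:(M \<inter> A) \<union> (A - M)|\<nu>. tlog2 \<rho> (z / w))" by (rule arg_cong[where f="\<lambda>S. set_lebesgue_integral \<nu> S _"]) auto
    also have "\<dots> = (LINT w:M \<inter> A|\<nu>. tlog2 \<rho> (z / w)) + (LINT w:A - M|\<nu>. tlog2 \<rho> (z / w))"
      by (rule set_integral_Un) (auto intro!: set_integrable_subset[OF t2])
    also have "(LINT w:M \<inter> A|\<nu>. tlog2 \<rho> (z / w)) = (\<integral>w. tlog2 \<rho> (z / w) \<partial>\<mu>)"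
      unfolding \<mu>_def set_lebesgue_integral_def by (subst integral_density) auto
    also have "\<dots> \<le> J2 + J3 + (1 - cos \<eta>) * (B * pi * norm z)"
      unfolding J2_def J3_def by (rule integral_tlog2_le_sweep[OF sw nar zn(1) \<rho>])
    also have "(LINT w:A - M|\<nu>. tlog2 \<rho> (z / w)) \<le> outer"
    proof -
      let ?l = "\<lambda>w. indicator (- M - ball 0 r1) w * ln (1 + (norm z / norm w)\<^sup>2)"
      have l0: "0 \<le> ?l w" for w by (auto simp: indicator_def)
      have nn: "(\<integral>\<^sup>+w. ennreal (?l w) \<partial>\<nu>) = outer_part (- M - ball 0 r1) (norm z)"
        unfolding outer_part_def by (intro nn_integral_cong) (auto simp: indicator_def)
      have li: "integrable \<nu> ?l"
        by (rule integrableI_nonneg) (use l0 fin[OF z0] in \<open>auto simp: nn[unfolded r1_def] r1_def\<close>)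
      have "(LINT w:A - M|\<nu>. tlog2 \<rho> (z / w)) \<le> (\<integral>w. ?l w \<partial>\<nu>)"
        unfolding set_lebesgue_integral_def
      proof (rule integral_mono[OF _ li])
        show "integrable \<nu> (\<lambda>w. indicator (A - M) w *\<^sub>R tlog2 \<rho> (z / w))"
          using set_integrable_subset[OF t2, of "A - M"] unfolding set_integrable_def by auto
        fix w
        show "indicator (A - M) w *\<^sub>R tlog2 \<rho> (z / w) \<le> ?l w"
          using l0[of w] tlog2_le[OF \<rho>(1,2), of "z / w"] by (auto simp: indicator_def A_def norm_divide)
      qed
      also have "(\<integral>w. ?l w \<partial>\<nu>) = outer"
        unfolding outer_def nn[symmetric] using l0 by (intro integral_eq_nn_integral) auto
      finally show ?thesis .
    qed
    finally have main: "I1 + E1 \<le> J2 + J3 + (1 - cos \<eta>) * (B * pi * norm z) + outer" unfolding t2I by simp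
    have c0: "c \<ge> 0" "c' \<ge> 0" using B \<eta> by (auto simp: c_def c'_def)
    have "I2 + J2 \<le> c * (LINT x:{0<..}|lborel. tlog2 \<rho> (z / of_real x)) + c * T"
      unfolding I2_def J2_def T_def by (rule ray_split) (use s1 \<rho> r1 z' in auto)
    also have "\<dots> \<le> c * (pi * (\<bar>Im z\<bar> + 2 * \<rho> * norm z)) + c * T"
      using c0 \<rho> zn by (intro add_right_mono mult_left_mono integral_tlog2_le) auto
    finally have ray1: "I2 + J2 \<le> c * (pi * (\<bar>Im z\<bar> + 2 * \<rho> * norm z)) + c * T" .
    have "I3 + J3 \<le> c' * (LINT x:{0<..}|lborel. tlog2 \<rho> (- \<i> * z / of_real x)) + c' * ((4 + 10 * \<bar>ln \<rho>\<bar>) * ((norm (- \<i> * z))\<^sup>2 / R))"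
      unfolding I3_def J3_def by (rule ray_split) (use s2 \<rho> r1 z' in \<open>auto simp: norm_mult\<close>)
    also have "\<dots> \<le> c' * (pi * (\<bar>Im (- \<i> * z)\<bar> + 2 * \<rho> * norm (- \<i> * z))) + c' * ((4 + 10 * \<bar>ln \<rho>\<bar>) * ((norm (- \<i> * z))\<^sup>2 / R))"
      using c0 \<rho> zn by (intro add_right_mono mult_left_mono integral_tlog2_le) auto
    finally have ray2: "I3 + J3 \<le> c' * (pi * (\<bar>Re z\<bar> + 2 * \<rho> * norm z)) + c' * T" unfolding niz T_def .
    have rh: "- Re (p z) \<le> 1 - Re (h z)" using p(3)[OF z'(2)] abs_Re_le_cmod[of "p z - h z"] by simp
    have \<rho>1: "\<rho> \<le> 1" using \<rho> by simp
    define e1 e2 e3 where "e1 = qerr D \<rho> (norm z)" and "e2 = qerr c \<rho> (norm z)" and "e3 = qerr c' \<rho> (norm z)"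
    have b1: "norm (q1 z) \<le> exp (E1 + e1)" using q13[OF \<rho>(1) \<rho>1, of z] unfolding E1_def e1_def .
    have b2: "norm (q2 z) \<le> exp (I2 + 2 * e2)" using q2(3)[OF \<rho>(1) \<rho>1, of z] unfolding I2_def e2_def r1_def R_def .
    have b3: "norm (q3 (- \<i> * z)) \<le> exp (I3 + 2 * e3)" using q3(3)[OF \<rho>(1) \<rho>1, of "- \<i> * z"] unfolding I3_def e3_def r1_def R_def niz(1) .
    have "norm (g z) = exp (- Re (p z)) * norm (q1 z) * norm (q2 z) * norm (q3 (- \<i> * z))" by (simp only: g_def norm_mult norm_exp_eq_Re) simp
    also have "\<dots> \<le> exp (- Re (p z)) * exp (E1 + e1) * exp (I2 + 2 * e2) * exp (I3 + 2 * e3)"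
      using b1 b2 b3 by (intro mult_mono) auto
    finally have "norm (g z) * exp (vsm (\<rho> * norm z / 2) z)
        \<le> exp (- Re (p z)) * exp (E1 + e1) * exp (I2 + 2 * e2) * exp (I3 + 2 * e3) * exp (vsm (\<rho> * norm z / 2) z)" by (intro mult_right_mono) auto
    also have "\<dots> = exp (- Re (p z) + (E1 + e1) + (I2 + 2 * e2) + (I3 + 2 * e3) + vsm (\<rho> * norm z / 2) z)" by (simp only: exp_add)
    also have "\<dots> \<le> exp (stage_bound M \<eta> B D \<rho> k0 z + (c + c') * T)"
    proof -
      have "stage_bound M \<eta> B D \<rho> k0 z = 1 + measure \<nu> (ball 0 r1) * ln (norm z + r1) + outer
         + (1 - cos \<eta>) * (B * pi * norm z) + c * (pi * (\<bar>Im z\<bar> + 2 * \<rho> * norm z)) + c' * (pi * (\<bar>Re z\<bar> + 2 * \<rho> * norm z)) + (e1 + 2 * e2 + 2 * e3)"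
        by (simp only: stage_bound_def r1_def outer_def c_def c'_def e1_def e2_def e3_def)
      moreover have "(c + c') * T = c * T + c' * T" by (rule distrib_right)
      ultimately have "- Re (p z) + (E1 + e1) + (I2 + 2 * e2) + (I3 + 2 * e3) + vsm (\<rho> * norm z / 2) z \<le> stage_bound M \<eta> B D \<rho> k0 z + (c + c') * T"
        using v main ray1 ray2 rh by linarith
      then show ?thesis by simp
    qed
    finally show "norm (g z) * exp (vsm (\<rho> * norm z / 2) z)
      \<le> exp (stage_bound M \<eta> B D \<rho> k0 z + (6 * B / \<eta> + 2 * B * \<eta>) * ((4 + 10 * \<bar>ln \<rho>\<bar>) * ((norm z)\<^sup>2 / 2 ^ K)))"
      unfolding c_def c'_def T_def R_def .
  qed
qed

section \<open>Letting the disc grow\<close>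

text \<open>The stage functions are uniformly bounded on compact sets, so a subsequence converges to
  an entire g. The tail term tends to 0 at each z, and g(0) is nonzero because all stages have the
  same positive modulus at 0.\<close>

lemma multiplier:
  obtains g where "g holomorphic_on UNIV" "g 0 \<noteq> 0"
    "\<And>z. 2 * 2 ^ k0 \<le> norm z \<Longrightarrow> v z + log_abs g z \<le> ereal (stage_bound M \<eta> B D \<rho> k0 z)"
proof -
  define L where "L = exp ((LINT \<zeta>:ball 0 (2 ^ k0)|\<nu>. slogd 0 (2 ^ k0) \<zeta>) - vsm (2 ^ k0) 0)"
  define c where "c = (6 * B / \<eta> + 2 * B * \<eta>) * (4 + 10 * \<bar>ln \<rho>\<bar>)"
  have c: "c \<ge> 0" using B \<eta> by (simp add: c_def)
  have "\<exists>g. g holomorphic_on UNIV \<and> norm (g 0) = L \<and> (\<forall>z. 2 * 2 ^ k0 \<le> norm z \<longrightarrow> norm z \<le> 2 ^ (k0 + n) / 2 \<longrightarrow>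
      norm (g z) * exp (vsm (\<rho> * norm z / 2) z) \<le> exp (stage_bound M \<eta> B D \<rho> k0 z + c * ((norm z)\<^sup>2 / 2 ^ (k0 + n))))" for n
    using stage[of "k0 + n"] unfolding L_def c_def mult.assoc by (metis le_add1)
  then obtain F where F: "\<And>n. F n holomorphic_on UNIV" "\<And>n. norm (F n 0) = L"
    "\<And>n z. 2 * 2 ^ k0 \<le> norm z \<Longrightarrow> norm z \<le> 2 ^ (k0 + n) / 2 \<Longrightarrow>
      norm (F n z) * exp (vsm (\<rho> * norm z / 2) z) \<le> exp (stage_bound M \<eta> B D \<rho> k0 z + c * ((norm z)\<^sup>2 / 2 ^ (k0 + n)))"
    by metis
  have large: "\<exists>n0. \<forall>n\<ge>n0. T \<le> 2 ^ (k0 + n) / 2" for T :: real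
  proof -
    obtain n0 where n0: "2 * T < 2 ^ n0" using real_arch_pow[of 2 "2 * T"] by auto
    have "2 * T \<le> 2 ^ (k0 + n)" if "n \<ge> n0" for n
    proof -
      have "(2::real) ^ n0 \<le> 2 ^ (k0 + n)" using that by (intro power_increasing) auto
      then show ?thesis using n0 by linarith
    qed
    then show ?thesis by (intro exI[of _ n0]) (auto simp: mult.commute)
  qed
  have bounded: "\<exists>b. \<forall>h\<in>range F. \<forall>z\<in>C. norm (h z) \<le> b" if C: "compact C" for C
  proof -
    obtain T0 where T0: "\<And>z. z \<in> C \<Longrightarrow> norm z \<le> T0" using compact_imp_bounded[OF C] bounded_iff by blast
    define T where "T = max T0 (2 * 2 ^ k0)"
    have T: "T \<ge> 2 * 2 ^ k0" "T \<ge> T0" "T > 0" by (auto simp: T_def less_max_iff_disj)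
    obtain n0 where n0: "\<And>n. n \<ge> n0 \<Longrightarrow> T \<le> 2 ^ (k0 + n) / 2" using large by blast
    have "\<rho> * T / 2 > 0" using \<rho> T by simp
    then obtain V where V: "\<And>z. norm z \<le> T \<Longrightarrow> - V \<le> vsm (\<rho> * T / 2) z" using vsm_bounded_below by blast
    obtain S where S: "\<And>z. norm z = T \<Longrightarrow> stage_bound M \<eta> B D \<rho> k0 z \<le> S" using stage_bound_le_circle[OF B \<eta>(1) \<rho>(1)] by blast
    \<comment> \<open>The stage estimate holds only away from 0, so it is used on the circle |z| = T
      and carried inside by the maximum principle.\<close>
    have big: "norm (F n z) \<le> exp (S + c * T\<^sup>2 + V)" if n: "n \<ge> n0" and z: "norm z \<le> T" for n z
    proof (rule maximum_modulus_frontier[of "F n" "cball 0 T"])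
      show "F n holomorphic_on interior (cball 0 T)" using F(1) by (rule holomorphic_on_subset) simp
      show "continuous_on (closure (cball 0 T)) (F n)" using holomorphic_on_imp_continuous_on[OF F(1)] by (rule continuous_on_subset) simp
      fix y assume "y \<in> frontier (cball (0::complex) T)"
      then have y: "norm y = T" using T by (simp add: frontier_cball)
      have "norm (F n y) * exp (vsm (\<rho> * norm y / 2) y) \<le> exp (stage_bound M \<eta> B D \<rho> k0 y + c * ((norm y)\<^sup>2 / 2 ^ (k0 + n)))"
        using F(3)[of y n] n0[OF n] T y by simp
      also have "c * ((norm y)\<^sup>2 / 2 ^ (k0 + n)) \<le> c * T\<^sup>2"
      proof (rule mult_left_mono[OF _ c])
        have "T\<^sup>2 / 2 ^ (k0 + n) \<le> T\<^sup>2 / 1" by (intro divide_left_mono) auto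
        then show "(norm y)\<^sup>2 / 2 ^ (k0 + n) \<le> T\<^sup>2" using y by simp
      qed
      then have "exp (stage_bound M \<eta> B D \<rho> k0 y + c * ((norm y)\<^sup>2 / 2 ^ (k0 + n))) \<le> exp (S + c * T\<^sup>2)"
        using S[OF y] by simp
      finally have "norm (F n y) * exp (vsm (\<rho> * T / 2) y) \<le> exp (S + c * T\<^sup>2)" using y by simp
      moreover have "norm (F n y) * exp (- V) \<le> norm (F n y) * exp (vsm (\<rho> * T / 2) y)" using V[of y] y by (intro mult_left_mono) auto
      ultimately have "norm (F n y) * exp (- V) * exp V \<le> exp (S + c * T\<^sup>2) * exp V" by (intro mult_right_mono) auto
      then show "norm (F n y) \<le> exp (S + c * T\<^sup>2 + V)" by (simp add: mult.assoc exp_add[symmetric])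
    qed (use z in auto)
    \<comment> \<open>The finitely many early stages, whose discs are still too small for the
      estimate, are bounded one by one.\<close>
    have "\<exists>b. \<forall>z\<in>cball 0 T. norm (F n z) \<le> b" for n
    proof -
      have "compact (F n ` cball 0 T)" using holomorphic_on_imp_continuous_on[OF F(1)] by (intro compact_continuous_image) (auto intro: continuous_on_subset)
      then show ?thesis using compact_imp_bounded bounded_iff by (metis imageI)
    qed
    then obtain b where b: "\<And>n z. z \<in> cball 0 T \<Longrightarrow> norm (F n z) \<le> b n" by metis
    have "norm (F n z) \<le> exp (S + c * T\<^sup>2 + V) + (\<Sum>n<n0. \<bar>b n\<bar>)" if "z \<in> C" for n z
    proof (cases "n \<ge> n0")
      case True
      have "0 \<le> (\<Sum>n<n0. \<bar>b n\<bar>)" by (intro sum_nonneg) auto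
      then show ?thesis using big[OF True, of z] T0[OF that] T by linarith
    next
      case False
      then have "\<bar>b n\<bar> \<le> (\<Sum>n<n0. \<bar>b n\<bar>)" by (intro member_le_sum) auto
      moreover have "norm (F n z) \<le> b n" using b T0[OF that] T by simp
      ultimately show ?thesis using exp_gt_zero[of "S + c * T\<^sup>2 + V"] by linarith
    qed
    then show ?thesis by blast
  qed
  obtain g r where g: "g holomorphic_on UNIV" "strict_mono (r :: nat \<Rightarrow> nat)" "\<And>z. ((\<lambda>n. F (r n) z) \<longlonglongrightarrow> g z)"
    using Montel[of UNIV "range F" F] F(1) bounded by (smt (verit, best) UNIV_I imageE open_UNIV order_refl)
  show thesis
  proof (rule that[OF g(1)])
    have "(\<lambda>n. norm (F (r n) 0)) \<longlonglongrightarrow> norm (g 0)" by (rule tendsto_norm[OF g(3)])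
    then have "norm (g 0) = L" unfolding F(2) by (simp add: LIMSEQ_const_iff)
    then show "g 0 \<noteq> 0" by (auto simp: L_def)
    fix z :: complex assume z: "2 * 2 ^ k0 \<le> norm z"
    obtain n0 where n0: "\<And>n. n \<ge> n0 \<Longrightarrow> norm z \<le> 2 ^ (k0 + n) / 2" using large by blast
    define W where "W = vsm (\<rho> * norm z / 2) z"
    have lim0: "(\<lambda>n. (norm z)\<^sup>2 / 2 ^ (k0 + r n)) \<longlonglongrightarrow> 0"
    proof -
      have "(\<lambda>n. ((norm z)\<^sup>2 / 2 ^ k0) * (1/2) ^ n) \<longlonglongrightarrow> ((norm z)\<^sup>2 / 2 ^ k0) * 0"
        by (intro tendsto_mult tendsto_const LIMSEQ_power_zero) simp
      from LIMSEQ_subseq_LIMSEQ[OF this g(2)] show ?thesis by (simp add: o_def power_add power_divide mult.commute)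
    qed
    have "norm (g z) * exp W \<le> exp (stage_bound M \<eta> B D \<rho> k0 z + c * 0)"
    proof (rule LIMSEQ_le)
      show "(\<lambda>n. norm (F (r n) z) * exp W) \<longlonglongrightarrow> norm (g z) * exp W" by (intro tendsto_mult tendsto_norm g(3) tendsto_const)
      show "(\<lambda>n. exp (stage_bound M \<eta> B D \<rho> k0 z + c * ((norm z)\<^sup>2 / 2 ^ (k0 + r n)))) \<longlonglongrightarrow> exp (stage_bound M \<eta> B D \<rho> k0 z + c * 0)"
        by (intro tendsto_exp tendsto_add tendsto_mult lim0 tendsto_const)
      show "\<exists>N. \<forall>n\<ge>N. norm (F (r n) z) * exp W \<le> exp (stage_bound M \<eta> B D \<rho> k0 z + c * ((norm z)\<^sup>2 / 2 ^ (k0 + r n)))"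
      proof (intro exI[of _ n0] allI impI)
        fix n assume "n \<ge> n0"
        then have "r n \<ge> n0" using seq_suble[OF g(2), of n] by linarith
        then show "norm (F (r n) z) * exp W \<le> exp (stage_bound M \<eta> B D \<rho> k0 z + c * ((norm z)\<^sup>2 / 2 ^ (k0 + r n)))"
          unfolding W_def using n0 z by (intro F(3)) auto
      qed
    qed
    then have le: "norm (g z) * exp W \<le> exp (stage_bound M \<eta> B D \<rho> k0 z)" by simp
    have vW: "v z \<le> ereal W" unfolding W_def
    proof (rule v_le_vsm)
      have "(0::real) < 2 * 2 ^ k0" by simp
      then have "norm z > 0" using z by linarith
      then show "\<rho> * norm z / 2 > 0" using \<rho> by simp
    qed
    show "v z + log_abs g z \<le> ereal (stage_bound M \<eta> B D \<rho> k0 z)"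
    proof (cases "g z = 0")
      case True
      then show ?thesis using not_PInf[of z] by (cases "v z") (auto simp: log_abs_def)
    next
      case False
      then have n: "norm (g z) > 0" by simp
      have "ln (norm (g z) * exp W) \<le> ln (exp (stage_bound M \<eta> B D \<rho> k0 z))" using le n by (intro ln_mono mult_pos_pos) auto
      then have "ln (norm (g z)) + W \<le> stage_bound M \<eta> B D \<rho> k0 z" using n False by (simp add: ln_mult)
      moreover have "v z + log_abs g z \<le> ereal W + ereal (ln (norm (g z)))" using vW False by (intro add_mono) (auto simp: log_abs_def)
      ultimately show ?thesis by (simp add: order_trans add.commute)
    qed
  qed
qed

end

end

subsection \<open>Growth conditions\<close>

lemma eventually_emeasure_le_of_Limsup:
  fixes m :: "real \<Rightarrow> ennreal"
  assumes "Limsup at_top (\<lambda>r. enn2ereal (m r) / ereal r) \<le> ereal c" "c < c'"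
  shows "eventually (\<lambda>r. m r \<le> ennreal (c' * r)) at_top"
proof -
  have "Limsup at_top (\<lambda>r. enn2ereal (m r) / ereal r) < ereal c'" using assms by (auto intro: le_less_trans)
  then have "eventually (\<lambda>r. enn2ereal (m r) / ereal r < ereal c') at_top" by (rule Limsup_lessD)
  then show ?thesis using eventually_gt_at_top[of 0]
  proof eventually_elim
    case (elim r)
    then have "enn2ereal (m r) / ereal r \<le> ereal c'" by simp
    then have "enn2ereal (m r) \<le> ereal r * ereal c'" using elim by (subst (asm) ereal_divide_le_pos) auto
    then have "e2ennreal (enn2ereal (m r)) \<le> e2ennreal (ereal (r * c'))" by (intro e2ennreal_mono) simp
    then show ?case by (simp add: mult.commute)
  qed
qed

lemma eventually_add_le_linear:
  fixes C \<delta> \<delta>' :: real assumes "\<delta> < \<delta>'" shows "eventually (\<lambda>t. C + \<delta> * t \<le> \<delta>' * t) at_top"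
  using eventually_ge_at_top[of "C / (\<delta>' - \<delta>)"]
proof (rule eventually_mono)
  fix t assume "C / (\<delta>' - \<delta>) \<le> t"
  then have "C \<le> t * (\<delta>' - \<delta>)" using assms by (simp add: pos_divide_le_eq)
  then show "C + \<delta> * t \<le> \<delta>' * t" by (simp add: algebra_simps)
qed

lemma U_angle_narrow:
  assumes \<beta>: "0 < \<beta>" "\<beta> \<le> pi / 4" and w: "w \<in> U_angle \<beta>" shows "\<bar>Im w\<bar> \<le> sin \<beta> * norm w"
proof -
  have *: "\<bar>Im u\<bar> \<le> sin \<beta> * norm u" if u: "\<bar>Arg u\<bar> \<le> \<beta>" for u
  proof -
    have "Im u = norm u * sin (Arg u)" using arg_cong[OF rcis_cmod_Arg[of u], of Im] by simp
    moreover have "\<bar>sin (Arg u)\<bar> \<le> sin \<beta>"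
    proof -
      have "sin \<bar>Arg u\<bar> \<le> sin \<beta>" using \<beta> u pi_gt_zero by (intro sin_monotone_2pi_le) auto
      moreover have "sin \<bar>Arg u\<bar> \<ge> 0" using \<beta> u pi_gt_zero by (intro sin_ge_zero) auto
      moreover have "\<bar>sin (Arg u)\<bar> = \<bar>sin \<bar>Arg u\<bar>\<bar>" by (cases "Arg u \<ge> 0") auto
      ultimately show ?thesis by simp
    qed
    ultimately show ?thesis using mult_right_mono[of "\<bar>sin (Arg u)\<bar>" "sin \<beta>" "norm u"] by (simp add: abs_mult mult.commute)
  qed
  have "sin \<beta> \<ge> 0" using \<beta> pi_gt_zero by (intro sin_ge_zero) auto
  then show ?thesis using w *[of w] *[of "- w"] unfolding U_angle_def by auto
qed

text \<open>After a possible change of sign the real part is nonnegative, so the argument is at most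
  \<pi>/2 in absolute value, where the sine is monotone. The description by |Im w| also shows that
  the set is Borel.\<close>

lemma U_angle_eq:
  assumes \<beta>: "0 < \<beta>" "\<beta> \<le> pi / 4" shows "U_angle \<beta> = {w. \<bar>Im w\<bar> \<le> sin \<beta> * norm w}"
proof (intro set_eqI iffI CollectI)
  fix w assume "w \<in> {w. \<bar>Im w\<bar> \<le> sin \<beta> * norm w}"
  then have w: "\<bar>Im w\<bar> \<le> sin \<beta> * norm w" by simp
  have *: "\<bar>Arg u\<bar> \<le> \<beta>" if u: "\<bar>Im u\<bar> \<le> sin \<beta> * norm u" "u \<noteq> 0" "Re u \<ge> 0" for u
  proof -
    have a: "\<bar>Arg u\<bar> \<le> pi / 2" using u Re_Ln_pos_le[of u] by (simp add: Arg_eq_Im_Ln)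
    have "Im u = norm u * sin (Arg u)" using arg_cong[OF rcis_cmod_Arg[of u], of Im] by simp
    then have "norm u * \<bar>sin (Arg u)\<bar> \<le> norm u * sin \<beta>" using u by (simp add: abs_mult mult.commute)
    then have "\<bar>sin (Arg u)\<bar> \<le> sin \<beta>" using u by simp
    moreover have "sin \<bar>Arg u\<bar> \<le> \<bar>sin (Arg u)\<bar>" by (cases "Arg u \<ge> 0") auto
    ultimately show ?thesis using sin_mono_le_eq[of "\<bar>Arg u\<bar>" \<beta>] a \<beta> pi_gt_zero by auto
  qed
  show "w \<in> U_angle \<beta>"
  proof (cases "w = 0")
    case False
    then show ?thesis using *[of w] *[of "- w"] w unfolding U_angle_def by (cases "Re w \<ge> 0") auto
  qed (simp add: U_angle_def)
qed (rule U_angle_narrow[OF \<beta>])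

context riesz_fun
begin

text \<open>Three sublinear groups receive \<delta>/3 each: the constant with the logarithm of the
  mass near 0, the mass off the angles, and the discretization. The other terms are homogeneous in
  r.\<close>

lemma eventually_stage_bound_le:
  assumes B: "B \<ge> 0" and \<eta>: "0 < \<eta>" and D: "D \<ge> 0" and \<rho>: "0 < \<rho>" and M: "M \<in> sets borel" and \<delta>: "\<delta> > 0"
    and small: "\<And>\<delta>. \<delta> > 0 \<Longrightarrow> eventually (\<lambda>t. emeasure \<nu> (cball 0 t - M) \<le> ennreal (\<delta> * t)) at_top"
  shows "eventually (\<lambda>r. stage_bound M \<eta> B D \<rho> k0 (of_real r * cis \<theta>) \<le> r * ((1 - cos \<eta>) * (B * pi)
     + (6 * B / \<eta>) * (pi * (\<bar>sin \<theta>\<bar> + 2 * \<rho>)) + (2 * B * \<eta>) * (pi * (\<bar>cos \<theta>\<bar> + 2 * \<rho>)) + \<delta>)) at_top"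
proof -
  define m where "m = measure \<nu> (ball 0 (2 ^ k0))"
  define E where "E = - M - ball 0 (2 ^ k0)"
  have Em: "E \<in> sets borel" using M by (auto simp: E_def)
  have sm: "eventually (\<lambda>t. emeasure \<nu> (E \<inter> cball 0 t) \<le> ennreal (\<delta> * t)) at_top" if "\<delta> > 0" for \<delta>
    using small[OF that]
  proof (rule eventually_mono)
    fix t assume t: "emeasure \<nu> (cball 0 t - M) \<le> ennreal (\<delta> * t)"
    have "emeasure \<nu> (E \<inter> cball 0 t) \<le> emeasure \<nu> (cball 0 t - M)" using M by (intro emeasure_mono) (auto simp: E_def)
    then show "emeasure \<nu> (E \<inter> cball 0 t) \<le> ennreal (\<delta> * t)" using t by (rule order_trans)
  qed
  have o: "eventually (\<lambda>a. enn2real (outer_part E a) \<le> \<delta> / 3 * a) at_top"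
    by (rule outer_part_sublinear(2)[OF Em, of "2 ^ k0"]) (use sm \<delta> in \<open>auto simp: E_def\<close>)
  have pos: "6 * B / \<eta> \<ge> 0" "2 * B * \<eta> \<ge> 0" using B \<eta> by auto
  have "((\<lambda>r. qerr D \<rho> r / r + 2 * (qerr (6 * B / \<eta>) \<rho> r / r) + 2 * (qerr (2 * B * \<eta>) \<rho> r / r)) \<longlongrightarrow> 0 + 2 * 0 + 2 * 0) at_top"
    by (intro tendsto_add tendsto_mult tendsto_const qerr_sublinear D pos \<rho>)
  then have q: "eventually (\<lambda>r. qerr D \<rho> r / r + 2 * (qerr (6 * B / \<eta>) \<rho> r / r) + 2 * (qerr (2 * B * \<eta>) \<rho> r / r) < \<delta> / 3) at_top"
    using \<delta> by (intro order_tendstoD) auto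
  have "((\<lambda>r. (1 + m * ln 2) / r + m * (ln r / r)) \<longlongrightarrow> 0 + m * 0) at_top"
    by (intro tendsto_add tendsto_mult tendsto_const ln_x_over_x_tendsto_0 real_tendsto_divide_at_top[OF tendsto_const filterlim_ident])
  then have l: "eventually (\<lambda>r. (1 + m * ln 2) / r + m * (ln r / r) < \<delta> / 3) at_top"
    using \<delta> by (intro order_tendstoD) auto
  show ?thesis
    using o q l eventually_ge_at_top[of "2 ^ k0"] eventually_gt_at_top[of 0]
  proof eventually_elim
    case (elim r)
    have r: "r > 0" by fact
    have n: "norm (of_real r * cis \<theta>) = r" "Im (of_real r * cis \<theta>) = r * sin \<theta>" "Re (of_real r * cis \<theta>) = r * cos \<theta>"
      using r by (simp_all add: norm_mult)
    have "ln (r + 2 ^ k0) \<le> ln (2 * r)" using elim(4) r by (intro ln_mono add_pos_pos) auto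
    also have "\<dots> = ln 2 + ln r" using r by (simp add: ln_mult)
    finally have "m * ln (r + 2 ^ k0) \<le> m * (ln 2 + ln r)" by (intro mult_left_mono) (auto simp: m_def)
    moreover have "1 + m * (ln 2 + ln r) = r * ((1 + m * ln 2) / r + m * (ln r / r))"
    proof -
      have "r * ((1 + m * ln 2) / r) = 1 + m * ln 2" "r * (m * (ln r / r)) = m * ln r" using r by simp_all
      then show ?thesis by (simp only: distrib_left[of r]) (simp add: distrib_left)
    qed
    moreover have "r * ((1 + m * ln 2) / r + m * (ln r / r)) \<le> r * (\<delta> / 3)" using elim(3) r by (intro mult_left_mono) auto
    ultimately have 1: "1 + m * ln (r + 2 ^ k0) \<le> r * (\<delta> / 3)" by linarith
    have "qerr D \<rho> r + 2 * qerr (6 * B / \<eta>) \<rho> r + 2 * qerr (2 * B * \<eta>) \<rho> r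
        = r * (qerr D \<rho> r / r + 2 * (qerr (6 * B / \<eta>) \<rho> r / r) + 2 * (qerr (2 * B * \<eta>) \<rho> r / r))" using r by (simp add: distrib_left)
    also have "\<dots> \<le> r * (\<delta> / 3)" using elim(2) r by (intro mult_left_mono) auto
    finally have 2: "qerr D \<rho> r + 2 * qerr (6 * B / \<eta>) \<rho> r + 2 * qerr (2 * B * \<eta>) \<rho> r \<le> r * (\<delta> / 3)" .
    have 3: "\<bar>r * x\<bar> + 2 * \<rho> * r = r * (\<bar>x\<bar> + 2 * \<rho>)" for x using r by (simp add: abs_mult algebra_simps)
    have "stage_bound M \<eta> B D \<rho> k0 (of_real r * cis \<theta>) = (1 + m * ln (r + 2 ^ k0)) + enn2real (outer_part E r)
      + (1 - cos \<eta>) * (B * pi * r) + (6 * B / \<eta>) * (pi * (r * (\<bar>sin \<theta>\<bar> + 2 * \<rho>))) + (2 * B * \<eta>) * (pi * (r * (\<bar>cos \<theta>\<bar> + 2 * \<rho>)))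
      + (qerr D \<rho> r + 2 * qerr (6 * B / \<eta>) \<rho> r + 2 * qerr (2 * B * \<eta>) \<rho> r)"
      unfolding stage_bound_def n m_def E_def 3 by simp
    also have "\<dots> \<le> r * (\<delta> / 3) + \<delta> / 3 * r
      + (1 - cos \<eta>) * (B * pi * r) + (6 * B / \<eta>) * (pi * (r * (\<bar>sin \<theta>\<bar> + 2 * \<rho>))) + (2 * B * \<eta>) * (pi * (r * (\<bar>cos \<theta>\<bar> + 2 * \<rho>)))
      + r * (\<delta> / 3)" using 1 2 elim(1) by linarith
    also have "\<dots> = r * ((1 - cos \<eta>) * (B * pi)
     + (6 * B / \<eta>) * (pi * (\<bar>sin \<theta>\<bar> + 2 * \<rho>)) + (2 * B * \<eta>) * (pi * (\<bar>cos \<theta>\<bar> + 2 * \<rho>)) + \<delta>)"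
      by (simp add: distrib_left mult_ac)
    finally show ?case .
  qed
qed

text \<open>The growth hypotheses hold only eventually; they fix the starting scale 2^k0. From there
  on a disc has mass at most (B + 1) times its radius, so an annulus has at most 2(B + 1) times its
  inner radius.\<close>

lemma exists_multiplier:
  assumes M[measurable]: "M \<in> sets borel" and \<eta>: "0 < \<eta>" "\<eta> \<le> 1/2" and B: "B \<ge> 0"
    and narrow: "\<And>w. w \<in> M \<Longrightarrow> \<bar>Im w\<bar> \<le> sin (\<eta> / 2) * norm w"
    and growth: "eventually (\<lambda>t. emeasure \<nu> (M \<inter> cball 0 t) \<le> ennreal (B * t)) at_top"
    and small: "\<And>\<delta>. \<delta> > 0 \<Longrightarrow> eventually (\<lambda>t. emeasure \<nu> (cball 0 t - M) \<le> ennreal (\<delta> * t)) at_top"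
    and \<rho>: "0 < \<rho>" "\<rho> \<le> 1/4" "3 * \<rho> \<le> sin \<eta>"
  obtains g where "g holomorphic_on UNIV" "g 0 \<noteq> 0"
    "\<And>\<theta>. Limsup at_top (\<lambda>r. (v (of_real r * cis \<theta>) + log_abs g (of_real r * cis \<theta>)) / ereal r)
       \<le> ereal ((1 - cos \<eta>) * (B * pi) + (6 * B / \<eta>) * (pi * (\<bar>sin \<theta>\<bar> + 2 * \<rho>)) + (2 * B * \<eta>) * (pi * (\<bar>cos \<theta>\<bar> + 2 * \<rho>)))"
proof -
  have "eventually (\<lambda>t. emeasure \<nu> (M \<inter> cball 0 t) \<le> ennreal (B * t) \<and> emeasure \<nu> (cball 0 t) \<le> ennreal ((B + 1) * t)) at_top"
    using growth small[OF zero_less_one] eventually_ge_at_top[of 0]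
  proof eventually_elim
    case (elim t)
    have "emeasure \<nu> (cball 0 t) \<le> emeasure \<nu> (M \<inter> cball 0 t) + emeasure \<nu> (cball 0 t - M)"
      by (rule order_trans[OF emeasure_mono emeasure_subadditive]) auto
    also have "\<dots> \<le> ennreal (B * t) + ennreal (1 * t)" using elim by (intro add_mono)
    also have "\<dots> = ennreal ((B + 1) * t)" using elim B by (simp add: ennreal_plus[symmetric] distrib_right del: ennreal_plus)
    finally show ?case using elim by simp
  qed
  then obtain t0 where t0: "\<And>t. t \<ge> t0 \<Longrightarrow> emeasure \<nu> (M \<inter> cball 0 t) \<le> ennreal (B * t)" "\<And>t. t \<ge> t0 \<Longrightarrow> emeasure \<nu> (cball 0 t) \<le> ennreal ((B + 1) * t)"
    unfolding eventually_at_top_linorder by blast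
  obtain k0 where k0: "t0 < 2 ^ k0" using real_arch_pow[of 2 t0] by auto
  have gr: "emeasure \<nu> (M \<inter> cball 0 t - ball 0 (2 ^ k0)) \<le> ennreal (B * t)" if "2 ^ k0 \<le> t" for t
  proof -
    have "emeasure \<nu> (M \<inter> cball 0 t - ball 0 (2 ^ k0)) \<le> emeasure \<nu> (M \<inter> cball 0 t)" by (intro emeasure_mono) auto
    also have "\<dots> \<le> ennreal (B * t)" using that k0 by (intro t0) linarith
    finally show ?thesis .
  qed
  have D: "2 * (B + 1) \<ge> 0" using B by simp
  have mass: "emeasure \<nu> {w. 2 ^ k \<le> norm w \<and> norm w < 2 ^ Suc k} \<le> ennreal (2 * (B + 1) * 2 ^ k)" if "k0 \<le> k" for k
  proof -
    have "(2::real) ^ k0 \<le> 2 ^ Suc k" using that by (intro power_increasing) auto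
    have "emeasure \<nu> {w. 2 ^ k \<le> norm w \<and> norm w < 2 ^ Suc k} \<le> emeasure \<nu> (cball 0 (2 ^ Suc k))" by (intro emeasure_mono) auto
    also have "\<dots> \<le> ennreal ((B + 1) * 2 ^ Suc k)" using \<open>(2::real) ^ k0 \<le> 2 ^ Suc k\<close> k0 by (intro t0) linarith
    also have "(B + 1) * 2 ^ Suc k = 2 * (B + 1) * 2 ^ k" by (simp add: algebra_simps)
    finally show ?thesis .
  qed
  have fin: "outer_part (- M - ball 0 (2 ^ k0)) a < \<infinity>" if "a > 0" for a
  proof (rule outer_part_sublinear(1)[of _ "2 ^ k0", OF _ _ _ _ that])
    fix \<delta> :: real assume "\<delta> > 0"
    from small[OF this] show "eventually (\<lambda>t. emeasure \<nu> ((- M - ball 0 (2 ^ k0)) \<inter> cball 0 t) \<le> ennreal (\<delta> * t)) at_top"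
    proof (rule eventually_mono)
      fix t assume t: "emeasure \<nu> (cball 0 t - M) \<le> ennreal (\<delta> * t)"
      have "emeasure \<nu> ((- M - ball 0 (2 ^ k0)) \<inter> cball 0 t) \<le> emeasure \<nu> (cball 0 t - M)" by (intro emeasure_mono) auto
      then show "emeasure \<nu> ((- M - ball 0 (2 ^ k0)) \<inter> cball 0 t) \<le> ennreal (\<delta> * t)" using t by (rule order_trans)
    qed
  qed auto
  obtain g where g: "g holomorphic_on UNIV" "g 0 \<noteq> 0"
    "\<And>z. 2 * 2 ^ k0 \<le> norm z \<Longrightarrow> v z + log_abs g z \<le> ereal (stage_bound M \<eta> B (2 * (B + 1)) \<rho> k0 z)"
    using multiplier[OF M \<eta> B narrow gr D mass \<rho> fin] by blast
  show thesis
  proof (rule that[OF g(1,2)])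
    fix \<theta>
    define C where "C = (1 - cos \<eta>) * (B * pi) + (6 * B / \<eta>) * (pi * (\<bar>sin \<theta>\<bar> + 2 * \<rho>)) + (2 * B * \<eta>) * (pi * (\<bar>cos \<theta>\<bar> + 2 * \<rho>))"
    show "Limsup at_top (\<lambda>r. (v (of_real r * cis \<theta>) + log_abs g (of_real r * cis \<theta>)) / ereal r) \<le> ereal C"
    proof (rule ereal_le_epsilon2)
      fix \<delta> :: real assume \<delta>: "0 < \<delta>"
      have ev: "eventually (\<lambda>r. stage_bound M \<eta> B (2 * (B + 1)) \<rho> k0 (of_real r * cis \<theta>) \<le> r * (C + \<delta>)) at_top"
        unfolding C_def by (rule eventually_stage_bound_le[OF B \<eta>(1) D \<rho>(1) M \<delta> small])
      have "eventually (\<lambda>r. (v (of_real r * cis \<theta>) + log_abs g (of_real r * cis \<theta>)) / ereal r \<le> ereal (C + \<delta>)) at_top"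
        using ev eventually_ge_at_top[of "2 * 2 ^ k0"] eventually_gt_at_top[of 0]
      proof eventually_elim
        case (elim r)
        let ?z = "of_real r * cis \<theta>"
        have "norm ?z = r" using elim by (simp add: norm_mult)
        then have "v ?z + log_abs g ?z \<le> ereal (stage_bound M \<eta> B (2 * (B + 1)) \<rho> k0 ?z)" using elim by (intro g) simp
        also have "\<dots> \<le> ereal (r * (C + \<delta>))" using elim(1) by simp
        finally have "v ?z + log_abs g ?z \<le> ereal r * ereal (C + \<delta>)" by simp
        then show ?case using elim by (subst ereal_divide_le_pos) auto
      qed
      then show "Limsup at_top (\<lambda>r. (v (of_real r * cis \<theta>) + log_abs g (of_real r * cis \<theta>)) / ereal r) \<le> ereal C + ereal \<delta>"
        by (intro Limsup_bounded) simp
    qed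
  qed
qed

text \<open>The mass of the disc of radius t is at most the increase of the smoothed means from
  radius 2t to 2et. The larger mean is at most about 2 e b t, and e below 3 gives the factor
  6.\<close>

lemma growth_of_circle_means:
  assumes L: "Limsup at_top (\<lambda>r. circle_integral v 0 r / ereal (2 * pi * r)) \<le> ereal b" and b: "b \<ge> 0" and \<delta>: "\<delta> > 0"
  shows "eventually (\<lambda>t. emeasure \<nu> (cball 0 t) \<le> ennreal ((6 * b + \<delta>) * t)) at_top"
proof -
  \<comment> \<open>The slack \<delta>/12 becomes \<delta>/2 after the factor 6; the other half
    absorbs the constant \<open>vsm 1 0\<close>.\<close>
  define c where "c = b + \<delta> / 12"
  have c: "c \<ge> 0" "b < c" using b \<delta> by (auto simp: c_def)
  have "Limsup at_top (\<lambda>r. circle_integral v 0 r / ereal (2 * pi * r)) < ereal c" using L c by (auto intro: le_less_trans)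
  then have "eventually (\<lambda>r. circle_integral v 0 r / ereal (2 * pi * r) < ereal c) at_top" by (rule Limsup_lessD)
  then obtain r0 where r0: "\<And>r. r \<ge> r0 \<Longrightarrow> circle_integral v 0 r / ereal (2 * pi * r) < ereal c" unfolding eventually_at_top_linorder by blast
  have circ: "circle_integral v 0 r \<le> ereal (2 * pi * (c * r))" if "r \<ge> r0" "r > 0" for r
  proof -
    have "circle_integral v 0 r / ereal (2 * pi * r) \<le> ereal c" using r0[OF that(1)] by simp
    then have "circle_integral v 0 r \<le> ereal (2 * pi * r) * ereal c" using that by (subst (asm) ereal_divide_le_pos) auto
    then show ?thesis by (simp add: mult_ac)
  qed
  have "eventually (\<lambda>t. - vsm 1 0 + (6 * b + \<delta> / 2) * t \<le> (6 * b + \<delta>) * t) at_top"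
    using \<delta> by (intro eventually_add_le_linear) simp
  then show ?thesis using eventually_ge_at_top[of r0] eventually_ge_at_top[of 1]
  proof eventually_elim
    case (elim t)
    have e: "exp 1 * (2 * t) \<le> 3 * (2 * t)" using exp_le elim by (intro mult_right_mono) auto
    have e1: "1 * (2 * t) \<le> exp 1 * (2 * t)" using elim by (intro mult_right_mono) auto
    have m1: "measure \<nu> (cball 0 (2 * t / 2)) \<le> vsm (exp 1 * (2 * t)) 0 - vsm (2 * t) 0" using elim by (intro measure_cball_le_vsm) simp
    have m2: "vsm (exp 1 * (2 * t)) 0 \<le> c * (exp 1 * (2 * t))"
    proof (rule vsm_le_circle_bound)
      fix r assume r: "exp 1 * (2 * t) / 2 \<le> r" "r \<le> exp 1 * (2 * t)"
      then have "r \<ge> t" using e1 by linarith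
      then have "circle_integral v 0 r \<le> ereal (2 * pi * (c * r))" using elim by (intro circ) auto
      also have "2 * pi * (c * r) \<le> 2 * pi * (c * (exp 1 * (2 * t)))" using r c by (intro mult_left_mono) auto
      finally show "circle_integral v 0 r \<le> ereal (2 * pi * (c * (exp 1 * (2 * t))))" by simp
    qed (use elim in simp)
    have m3: "vsm 1 0 \<le> vsm (2 * t) 0" using elim by (intro vsm_mono) auto
    have m4: "c * (exp 1 * (2 * t)) \<le> c * (3 * (2 * t))" using e c by (intro mult_left_mono) auto
    have m5: "c * (3 * (2 * t)) = (6 * b + \<delta> / 2) * t" by (simp add: c_def algebra_simps)
    have "x \<le> e - w" if "x \<le> p - u" "p \<le> q" "w \<le> u" "q \<le> q'" "q' = e" for x p u q w q' e :: real using that by linarith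
    from this[OF m1 m2 m3 m4 m5] have "measure \<nu> (cball 0 t) \<le> (6 * b + \<delta> / 2) * t - vsm 1 0" by simp
    then have "measure \<nu> (cball 0 t) \<le> (6 * b + \<delta>) * t" using elim(1) by linarith
    moreover have "emeasure \<nu> (cball 0 t) = ennreal (measure \<nu> (cball 0 t))" using nu_cball[of t] by (intro emeasure_eq_ennreal_measure) auto
    ultimately show ?case by (simp add: ennreal_leI)
  qed
qed

text \<open>Off the angles the two Blaschke integrals make 1/|w| integrable. The mass up to radius t
  is then at most a constant plus t times a tail of a convergent integral.\<close>

lemma small_of_Blaschke:
  assumes r0: "r0 > 0" and s: "s > 0"
    and up: "(\<integral>\<^sup>+ z. ennreal (Im (1 / cnj z)) * indicator ({z. Im z > 0} - ball 0 r0) z \<partial>\<nu>) < \<infinity>"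
    and low: "(\<integral>\<^sup>+ z. ennreal \<bar>Im (1 / z)\<bar> * indicator ({z. Im z < 0} - ball 0 r0) z \<partial>\<nu>) < \<infinity>"
    and \<delta>: "\<delta> > 0"
  shows "eventually (\<lambda>t. emeasure \<nu> (cball 0 t - {w. \<bar>Im w\<bar> \<le> s * norm w}) \<le> ennreal (\<delta> * t)) at_top"
proof -
  define E where "E = {w. s * norm w < \<bar>Im w\<bar>}"
  have Em[measurable]: "E \<in> sets borel" unfolding E_def by measurable
  define f where "f = (\<lambda>w. indicator (E - ball 0 r0) w * (1 / norm w))"
  have f0: "0 \<le> f w" for w by (simp add: f_def)
  have fm[measurable]: "f \<in> borel_measurable borel" unfolding f_def by measurable
  have [measurable]: "cnj \<in> borel_measurable borel" by (intro borel_measurable_continuous_onI continuous_intros)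
  \<comment> \<open>|Im w| above s |w| gives 1/|w| at most (1/s) |Im w|/|w|^2, which is 1/s times
    the Blaschke integrand of the half-plane containing w.\<close>
  have point: "ennreal (f w) \<le> ennreal (1 / s) * (ennreal (Im (1 / cnj w)) * indicator ({z. Im z > 0} - ball 0 r0) w
      + ennreal \<bar>Im (1 / w)\<bar> * indicator ({z. Im z < 0} - ball 0 r0) w)" for w
  proof (cases "w \<in> E - ball 0 r0")
    case True
    then have w: "norm w > 0" "s * norm w < \<bar>Im w\<bar>" "\<not> norm w < r0" using r0 by (auto simp: E_def)
    have "s * (1 / norm w) = s * norm w / (norm w)\<^sup>2" using w by (simp add: power2_eq_square)
    also have "\<dots> \<le> \<bar>Im w\<bar> / (norm w)\<^sup>2" using w by (intro divide_right_mono) auto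
    finally have "(1 / s) * (s * (1 / norm w)) \<le> (1 / s) * (\<bar>Im w\<bar> / (norm w)\<^sup>2)" using s by (intro mult_left_mono) auto
    then have le: "1 / norm w \<le> (1 / s) * (\<bar>Im w\<bar> / (norm w)\<^sup>2)" using s by simp
    have im: "Im (1 / cnj w) = Im w / (norm w)\<^sup>2" "Im (1 / w) = - (Im w / (norm w)\<^sup>2)" by (simp_all add: Im_divide cmod_power2)
    have "s * norm w > 0" using s w by simp
    then have "Im w \<noteq> 0" using w by auto
    then consider "Im w > 0" | "Im w < 0" by linarith
    then have "ennreal (\<bar>Im w\<bar> / (norm w)\<^sup>2) = ennreal (Im (1 / cnj w)) * indicator ({z. Im z > 0} - ball 0 r0) w
      + ennreal \<bar>Im (1 / w)\<bar> * indicator ({z. Im z < 0} - ball 0 r0) w"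
      unfolding im by cases (use w in auto)
    moreover have "ennreal (f w) \<le> ennreal (1 / s) * ennreal (\<bar>Im w\<bar> / (norm w)\<^sup>2)"
      using True le s by (subst ennreal_mult[symmetric]) (auto simp: f_def intro!: ennreal_leI)
    ultimately show ?thesis by simp
  qed (simp add: f_def)
  have "(\<integral>\<^sup>+w. ennreal (f w) \<partial>\<nu>) \<le> (\<integral>\<^sup>+w. ennreal (1 / s) * (ennreal (Im (1 / cnj w)) * indicator ({z. Im z > 0} - ball 0 r0) w
      + ennreal \<bar>Im (1 / w)\<bar> * indicator ({z. Im z < 0} - ball 0 r0) w) \<partial>\<nu>)" by (intro nn_integral_mono point)
  also have "\<dots> = ennreal (1 / s) * ((\<integral>\<^sup>+ z. ennreal (Im (1 / cnj z)) * indicator ({z. Im z > 0} - ball 0 r0) z \<partial>\<nu>)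
      + (\<integral>\<^sup>+ z. ennreal \<bar>Im (1 / z)\<bar> * indicator ({z. Im z < 0} - ball 0 r0) z \<partial>\<nu>))"
    by (simp add: nn_integral_cmult nn_integral_add)
  also have "\<dots> < \<infinity>" using up low by (simp add: ennreal_mult_less_top)
  finally have fint: "integrable \<nu> f" by (intro integrableI_nonneg) (use f0 in auto)
  \<comment> \<open>Tails of an integrable function: dominated convergence provides a radius beyond
    which the integral is below \<delta>/2.\<close>
  define F where "F = (\<lambda>n w. indicator (- ball 0 (real n)) w * f w)"
  have Fi: "integrable \<nu> (F n)" for n
    unfolding F_def by (rule Bochner_Integration.integrable_bound[OF fint]) (auto simp: indicator_def)
  have "(\<lambda>n. \<integral>w. F n w \<partial>\<nu>) \<longlonglongrightarrow> (\<integral>w. 0 \<partial>\<nu>)"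
  proof (rule integral_dominated_convergence[where w = f])
    show "AE w in \<nu>. (\<lambda>n. F n w) \<longlonglongrightarrow> 0"
    proof (rule AE_I2)
      fix w :: complex
      obtain N where N: "norm w < real N" using reals_Archimedean2 by blast
      have "eventually (\<lambda>n. F n w = 0) sequentially"
        using eventually_ge_at_top[of N] by (rule eventually_mono) (use N in \<open>auto simp: F_def\<close>)
      then show "(\<lambda>n. F n w) \<longlonglongrightarrow> 0" by (rule tendsto_eventually)
    qed
    show "AE w in \<nu>. norm (F n w) \<le> f w" for n using f0 by (auto simp: F_def indicator_def)
  qed (use fint in \<open>auto simp: F_def\<close>)
  then have "eventually (\<lambda>n. (\<integral>w. F n w \<partial>\<nu>) < \<delta> / 2) sequentially" using \<delta> by (intro order_tendstoD) auto
  then obtain n where n: "(\<integral>w. F n w \<partial>\<nu>) < \<delta> / 2" "r0 \<le> real n"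
    using eventually_conj[OF _ eventually_ge_at_top[of "nat \<lceil>r0\<rceil>"]] eventually_happens'[OF sequentially_bot] by (smt (verit) nat_ceiling_le_eq)
  have "eventually (\<lambda>t. measure \<nu> (cball 0 n) + \<delta> / 2 * t \<le> \<delta> * t) at_top" using \<delta> by (intro eventually_add_le_linear) simp
  then show ?thesis using eventually_gt_at_top[of 0]
  proof eventually_elim
    case (elim t)
    have "emeasure \<nu> (cball 0 t - {w. \<bar>Im w\<bar> \<le> s * norm w}) \<le> emeasure \<nu> (cball 0 n \<union> (E \<inter> cball 0 t - ball 0 n))"
      by (intro emeasure_mono) (auto simp: E_def)
    also have "\<dots> \<le> emeasure \<nu> (cball 0 n) + emeasure \<nu> (E \<inter> cball 0 t - ball 0 n)" by (intro emeasure_subadditive) auto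
    also have "emeasure \<nu> (E \<inter> cball 0 t - ball 0 n) = (\<integral>\<^sup>+w. indicator (E \<inter> cball 0 t - ball 0 n) w \<partial>\<nu>)" by simp
    also have "\<dots> \<le> (\<integral>\<^sup>+w. ennreal (t * F n w) \<partial>\<nu>)"
    proof (rule nn_integral_mono)
      fix w :: complex
      show "indicator (E \<inter> cball 0 t - ball 0 n) w \<le> ennreal (t * F n w)"
      proof (cases "w \<in> E \<inter> cball 0 t - ball 0 n")
        case True
        then have w: "norm w \<le> t" "real n \<le> norm w" "w \<in> E" by auto
        then have "norm w > 0" using r0 n(2) by linarith
        then have "1 \<le> t * F n w" using w n(2) by (simp add: F_def f_def pos_le_divide_eq)
        then show ?thesis using True ennreal_leI[of 1 "t * F n w"] by simp
      qed simp
    qed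
    also have "\<dots> = ennreal (\<integral>w. t * F n w \<partial>\<nu>)"
      using Fi[of n] elim f0 by (intro nn_integral_eq_integral) (auto simp: F_def)
    also have "(\<integral>w. t * F n w \<partial>\<nu>) = t * (\<integral>w. F n w \<partial>\<nu>)" by simp
    also have "ennreal \<dots> \<le> ennreal (t * (\<delta> / 2))" using n(1) elim by (intro ennreal_leI mult_left_mono) auto
    also have "emeasure \<nu> (cball 0 n) = ennreal (measure \<nu> (cball 0 n))" using nu_cball[of n] by (intro emeasure_eq_ennreal_measure) auto
    also have "ennreal (measure \<nu> (cball 0 n)) + ennreal (t * (\<delta> / 2)) = ennreal (measure \<nu> (cball 0 n) + \<delta> / 2 * t)"
      using elim \<delta> by (simp add: ennreal_plus[symmetric] mult.commute del: ennreal_plus)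
    also have "\<dots> \<le> ennreal (\<delta> * t)" using elim by (intro ennreal_leI)
    finally show ?case by (simp add: add_left_mono)
  qed
qed

end

section \<open>The constant 1000 and the final assembly\<close>

text \<open>The parameters are \<eta> = \<epsilon>/2, B = 7b and \<open>\<rho>\<close> =
  \<epsilon>^2/100. The leading terms are at most 336 b |sin|/\<epsilon> and 28 b \<epsilon> |cos|;
  everything else is a small multiple of b \<epsilon>.\<close>

lemma indicator_constant_le:
  fixes b \<epsilon> :: real
  assumes b: "b \<ge> 0" and \<epsilon>: "0 < \<epsilon>" "\<epsilon> \<le> 1"
  shows "(1 - cos (\<epsilon> / 2)) * (7 * b * pi) + (6 * (7 * b) / (\<epsilon> / 2)) * (pi * (\<bar>sin \<theta>\<bar> + 2 * (\<epsilon>\<^sup>2 / 100)))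
     + (2 * (7 * b) * (\<epsilon> / 2)) * (pi * (\<bar>cos \<theta>\<bar> + 2 * (\<epsilon>\<^sup>2 / 100)))
    \<le> 1000 * b * (\<epsilon> * \<bar>cos \<theta>\<bar> + \<bar>sin \<theta>\<bar> / \<epsilon>)"
proof -
  define s c where "s = \<bar>sin \<theta>\<bar>" and "c = \<bar>cos \<theta>\<bar>"
  have sc0: "s \<ge> 0" "c \<ge> 0" by (auto simp: s_def c_def)
  have sc: "1 \<le> s + c"
  proof -
    have "s\<^sup>2 + c\<^sup>2 = 1" by (simp add: s_def c_def)
    moreover have "(s + c)\<^sup>2 \<ge> s\<^sup>2 + c\<^sup>2" using sc0 by (simp add: power2_sum)
    ultimately show ?thesis using sc0 by (intro power2_le_imp_le[of 1]) auto
  qed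
  define P Q where "P = b * \<epsilon> * c" and "Q = b * (s / \<epsilon>)"
  have PQ0: "P \<ge> 0" "Q \<ge> 0" using b \<epsilon> sc0 by (auto simp: P_def Q_def)
  have "\<epsilon> \<le> 1 / \<epsilon>" using \<epsilon> mult_mono[of \<epsilon> 1 \<epsilon> 1] by (simp add: pos_le_divide_eq)
  then have "b * (s * \<epsilon>) \<le> b * (s * (1 / \<epsilon>))" using b sc0 by (intro mult_left_mono) auto
  moreover have "b * \<epsilon> * 1 \<le> b * \<epsilon> * (s + c)" using b \<epsilon> sc by (intro mult_left_mono) auto
  \<comment> \<open>Since |sin| + |cos| is at least 1 and \<epsilon> at most 1/\<epsilon>, errors of
    order b \<epsilon> are absorbed in every direction \<theta>.\<close>
  ultimately have be: "b * \<epsilon> \<le> P + Q" by (simp add: P_def Q_def algebra_simps)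
  have e2: "\<epsilon>\<^sup>2 \<le> \<epsilon>" using \<epsilon> mult_left_mono[of \<epsilon> 1 \<epsilon>] by (simp add: power2_eq_square)
  have be2: "b * \<epsilon>\<^sup>2 \<le> b * \<epsilon>" using e2 b by (rule mult_left_mono)
  have "\<epsilon> * \<epsilon>\<^sup>2 \<le> \<epsilon> * 1" using e2 \<epsilon> by (intro mult_left_mono) auto
  then have be3: "b * (\<epsilon> * \<epsilon>\<^sup>2) \<le> b * \<epsilon>" using b by (intro mult_left_mono) auto
  have pi4: "pi \<le> 4" using pi_less_4 by simp
  have bp: "b * \<epsilon> \<ge> 0" using b \<epsilon> by simp
  have "(1 - cos (\<epsilon> / 2)) \<le> \<epsilon>\<^sup>2 / 8"
  proof -
    have "cos (\<epsilon>/2) = 1 - 2 * (sin (\<epsilon>/4))\<^sup>2" using cos_double_sin[of "\<epsilon>/4"] by simp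
    moreover have "(sin (\<epsilon>/4))\<^sup>2 \<le> (\<epsilon>/4)\<^sup>2" using abs_sin_x_le_abs_x[of "\<epsilon>/4"] by (intro abs_le_square_iff[THEN iffD1])
    ultimately show ?thesis by (simp add: power_divide)
  qed
  then have "(1 - cos (\<epsilon> / 2)) * (7 * b * pi) \<le> (\<epsilon>\<^sup>2 / 8) * (7 * b * 4)" using b pi4 by (intro mult_mono) auto
  also have "\<dots> = (7/2) * (b * \<epsilon>\<^sup>2)" by simp
  finally have 1: "(1 - cos (\<epsilon> / 2)) * (7 * b * pi) \<le> (7/2) * (P + Q)" using be2 be unfolding distrib_left by linarith
  have "(6 * (7 * b) / (\<epsilon> / 2)) * (pi * (s + 2 * (\<epsilon>\<^sup>2 / 100))) = pi * (84 * Q + (84/50) * (b * \<epsilon>))"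
    using \<epsilon> by (simp add: Q_def power2_eq_square field_simps)
  also have "\<dots> \<le> 4 * (84 * Q + (84/50) * (b * \<epsilon>))" using PQ0 bp pi4 by (intro mult_right_mono) auto
  finally have 2: "(6 * (7 * b) / (\<epsilon> / 2)) * (pi * (s + 2 * (\<epsilon>\<^sup>2 / 100))) \<le> 336 * Q + 8 * (P + Q)" using be bp PQ0 unfolding distrib_left by linarith
  have "(2 * (7 * b) * (\<epsilon> / 2)) * (pi * (c + 2 * (\<epsilon>\<^sup>2 / 100))) = pi * (7 * P + (7/50) * (b * (\<epsilon> * \<epsilon>\<^sup>2)))"
    by (simp add: P_def algebra_simps)
  also have "\<dots> \<le> 4 * (7 * P + (7/50) * (b * (\<epsilon> * \<epsilon>\<^sup>2)))" using PQ0 b \<epsilon> pi4 by (intro mult_right_mono) auto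
  finally have 3: "(2 * (7 * b) * (\<epsilon> / 2)) * (pi * (c + 2 * (\<epsilon>\<^sup>2 / 100))) \<le> 28 * P + (P + Q)" using be3 be PQ0 unfolding distrib_left by linarith
  have "1000 * b * (\<epsilon> * c + s / \<epsilon>) = 1000 * P + 1000 * Q" by (simp add: P_def Q_def algebra_simps)
  moreover have "x + y + u \<le> 1000 * P + 1000 * Q" if "x \<le> (7/2) * (P + Q)" "y \<le> 336 * Q + 8 * (P + Q)" "u \<le> 28 * P + (P + Q)" for x y u
    using that PQ0 unfolding distrib_left by linarith
  ultimately show ?thesis unfolding s_def[symmetric] c_def[symmetric] using 1 2 3 by metis
qed

text \<open>Both alternatives reduce to the same two facts: the total mass has linear density at
  most 6b up to an arbitrary slack, and the mass outside a narrow pair of angles is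
  sublinear.\<close>

theorem theorem11:
  fixes v :: "complex \<Rightarrow> ereal" and \<nu> :: "complex measure" and b :: real
  assumes sh: "subharmonic v"
    and nontriv: "\<exists>z. v z \<noteq> - \<infinity>"
    and riesz: "riesz_measure v \<nu>"
    and b: "b \<ge> 0"
    and cases:
      "(Limsup at_top (\<lambda>r. circle_integral v 0 r / ereal (2 * pi * r)) \<le> ereal b \<and>
        (\<exists>r0>0. (\<integral>\<^sup>+ z. ennreal (Im (1 / cnj z)) * indicator ({z. Im z > 0} - ball 0 r0) z \<partial>\<nu>) < \<infinity> \<and>
                 (\<integral>\<^sup>+ z. ennreal \<bar>Im (1 / z)\<bar> * indicator ({z. Im z < 0} - ball 0 r0) z \<partial>\<nu>) < \<infinity>))
     \<or> ((\<forall>\<beta>. 0 < \<beta> \<and> \<beta> \<le> pi / 4 \<longrightarrow>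
           Limsup at_top (\<lambda>r. enn2ereal (emeasure \<nu> (cball 0 r - U_angle \<beta>)) / ereal r) = 0) \<and>
         Limsup at_top (\<lambda>r. enn2ereal (emeasure \<nu> (cball 0 r)) / ereal r) \<le> ereal (exp 1 * b))"
  shows "\<forall>\<epsilon>. 0 < \<epsilon> \<and> \<epsilon> \<le> 1 \<longrightarrow>
           (\<exists>g. g holomorphic_on UNIV \<and> (\<exists>z. g z \<noteq> 0) \<and>
              (\<forall>\<theta>\<in>{0..2*pi}.
                 Limsup at_top (\<lambda>r. (v (of_real r * cis \<theta>) + log_abs g (of_real r * cis \<theta>)) / ereal r)
                   \<le> ereal (1000 * b * (\<epsilon> * \<bar>cos \<theta>\<bar> + \<bar>sin \<theta>\<bar> / \<epsilon>))))"
proof (intro allI impI, elim conjE)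
  fix \<epsilon> :: real assume \<epsilon>: "0 < \<epsilon>" "\<epsilon> \<le> 1"
  interpret riesz_fun v \<nu> by unfold_locales fact+
  have total: "eventually (\<lambda>t. emeasure \<nu> (cball 0 t) \<le> ennreal ((6 * b + \<delta>) * t)) at_top" if \<delta>: "\<delta> > 0" for \<delta>
    using cases
  proof
    assume "Limsup at_top (\<lambda>r. circle_integral v 0 r / ereal (2 * pi * r)) \<le> ereal b \<and>
        (\<exists>r0>0. (\<integral>\<^sup>+ z. ennreal (Im (1 / cnj z)) * indicator ({z. Im z > 0} - ball 0 r0) z \<partial>\<nu>) < \<infinity> \<and>
                 (\<integral>\<^sup>+ z. ennreal \<bar>Im (1 / z)\<bar> * indicator ({z. Im z < 0} - ball 0 r0) z \<partial>\<nu>) < \<infinity>)"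
    then show ?thesis using b \<delta> by (intro growth_of_circle_means) auto
  next
    assume A: "(\<forall>\<beta>. 0 < \<beta> \<and> \<beta> \<le> pi / 4 \<longrightarrow>
           Limsup at_top (\<lambda>r. enn2ereal (emeasure \<nu> (cball 0 r - U_angle \<beta>)) / ereal r) = 0) \<and>
         Limsup at_top (\<lambda>r. enn2ereal (emeasure \<nu> (cball 0 r)) / ereal r) \<le> ereal (exp 1 * b)"
    have "exp 1 * b \<le> 3 * b" using exp_le b by (intro mult_right_mono) auto
    then have "exp 1 * b < 6 * b + \<delta>" using b \<delta> by linarith
    then show ?thesis using A by (intro eventually_emeasure_le_of_Limsup) auto
  qed
  \<comment> \<open>This is sin(\<eta>/2) for \<eta> = \<epsilon>/2, the width that sweeping
    requires.\<close>
  define s where "s = sin (\<epsilon> / 4)"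
  have s: "s > 0" unfolding s_def using \<epsilon> pi_gt3 by (intro sin_gt_zero) auto
  define N where "N = {w. \<bar>Im w\<bar> \<le> s * norm w}"
  have Nm: "N \<in> sets borel" unfolding N_def by measurable
  have small: "eventually (\<lambda>t. emeasure \<nu> (cball 0 t - N) \<le> ennreal (\<delta> * t)) at_top" if \<delta>: "\<delta> > 0" for \<delta>
    using cases
  proof
    assume "Limsup at_top (\<lambda>r. circle_integral v 0 r / ereal (2 * pi * r)) \<le> ereal b \<and>
        (\<exists>r0>0. (\<integral>\<^sup>+ z. ennreal (Im (1 / cnj z)) * indicator ({z. Im z > 0} - ball 0 r0) z \<partial>\<nu>) < \<infinity> \<and>
                 (\<integral>\<^sup>+ z. ennreal \<bar>Im (1 / z)\<bar> * indicator ({z. Im z < 0} - ball 0 r0) z \<partial>\<nu>) < \<infinity>)"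
    then show ?thesis unfolding N_def using s \<delta> by (blast intro: small_of_Blaschke)
  next
    assume A: "(\<forall>\<beta>. 0 < \<beta> \<and> \<beta> \<le> pi / 4 \<longrightarrow>
           Limsup at_top (\<lambda>r. enn2ereal (emeasure \<nu> (cball 0 r - U_angle \<beta>)) / ereal r) = 0) \<and>
         Limsup at_top (\<lambda>r. enn2ereal (emeasure \<nu> (cball 0 r)) / ereal r) \<le> ereal (exp 1 * b)"
    have \<beta>: "0 < \<epsilon> / 4" "\<epsilon> / 4 \<le> pi / 4" using \<epsilon> pi_gt3 by auto
    then have "Limsup at_top (\<lambda>r. enn2ereal (emeasure \<nu> (cball 0 r - U_angle (\<epsilon> / 4))) / ereal r) \<le> ereal 0" using A by (simp add: zero_ereal_def)
    from eventually_emeasure_le_of_Limsup[OF this \<delta>]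
    show ?thesis
    proof (rule eventually_mono)
      fix t assume t: "emeasure \<nu> (cball 0 t - U_angle (\<epsilon> / 4)) \<le> ennreal (\<delta> * t)"
      have "emeasure \<nu> (cball 0 t - N) \<le> emeasure \<nu> (cball 0 t - U_angle (\<epsilon> / 4))"
      proof (rule emeasure_mono)
        show "cball 0 t - N \<subseteq> cball 0 t - U_angle (\<epsilon> / 4)" using U_angle_narrow[OF \<beta>] by (auto simp: N_def s_def)
        have "U_angle (\<epsilon> / 4) = N" unfolding N_def s_def using \<beta> by (rule U_angle_eq)
        then have "U_angle (\<epsilon> / 4) \<in> sets borel" using Nm by simp
        then show "cball 0 t - U_angle (\<epsilon> / 4) \<in> sets \<nu>" by simp
      qed
      then show "emeasure \<nu> (cball 0 t - N) \<le> ennreal (\<delta> * t)" using t by (rule order_trans)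
    qed
  qed
  \<comment> \<open>For b = 0 the slack cannot be taken proportional to b, and B = 0 would demand
    vanishing mass in the angles. Then, however, the total mass is already sublinear, so all of it
    is treated as outer mass.\<close>
  define M where "M = (if b = 0 then {} else N)"
  \<comment> \<open>The last bound holds because sin(\<epsilon>/2) is at least \<epsilon>/4 and
    \<epsilon>^2 at most \<epsilon>.\<close>
  have \<rho>: "0 < \<epsilon>\<^sup>2 / 100" "\<epsilon>\<^sup>2 / 100 \<le> 1/4" "3 * (\<epsilon>\<^sup>2 / 100) \<le> sin (\<epsilon> / 2)"
  proof -
    have e2: "\<epsilon>\<^sup>2 \<le> \<epsilon>" using \<epsilon> mult_left_mono[of \<epsilon> 1 \<epsilon>] by (simp add: power2_eq_square)
    show "0 < \<epsilon>\<^sup>2 / 100" "\<epsilon>\<^sup>2 / 100 \<le> 1/4" using \<epsilon> e2 by auto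
    show "3 * (\<epsilon>\<^sup>2 / 100) \<le> sin (\<epsilon> / 2)" using sin_ge_half[of "\<epsilon> / 2"] \<epsilon> e2 by auto
  qed
  have Mm: "M \<in> sets borel" using Nm by (simp add: M_def)
  have narrow: "\<bar>Im w\<bar> \<le> sin (\<epsilon> / 2 / 2) * norm w" if "w \<in> M" for w using that by (simp add: M_def N_def s_def split: if_splits)
  have growth: "eventually (\<lambda>t. emeasure \<nu> (M \<inter> cball 0 t) \<le> ennreal (7 * b * t)) at_top"
  proof (cases "b = 0")
    case False
    then have "b > 0" using b by simp
    from total[OF this] show ?thesis
    proof (rule eventually_mono)
      fix t assume t: "emeasure \<nu> (cball 0 t) \<le> ennreal ((6 * b + b) * t)"
      have "emeasure \<nu> (M \<inter> cball 0 t) \<le> emeasure \<nu> (cball 0 t)" by (intro emeasure_mono) auto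
      also note t
      finally show "emeasure \<nu> (M \<inter> cball 0 t) \<le> ennreal (7 * b * t)" by (simp add: algebra_simps)
    qed
  qed (simp add: M_def)
  have smallM: "eventually (\<lambda>t. emeasure \<nu> (cball 0 t - M) \<le> ennreal (\<delta> * t)) at_top" if "\<delta> > 0" for \<delta>
    using total[OF that] small[OF that] by (cases "b = 0") (simp_all add: M_def)
  have \<eta>: "0 < \<epsilon> / 2" "\<epsilon> / 2 \<le> 1/2" and B: "7 * b \<ge> 0" using \<epsilon> b by auto
  obtain g where g: "g holomorphic_on UNIV" "g 0 \<noteq> 0"
    "\<And>\<theta>. Limsup at_top (\<lambda>r. (v (of_real r * cis \<theta>) + log_abs g (of_real r * cis \<theta>)) / ereal r)
       \<le> ereal ((1 - cos (\<epsilon> / 2)) * (7 * b * pi) + (6 * (7 * b) / (\<epsilon> / 2)) * (pi * (\<bar>sin \<theta>\<bar> + 2 * (\<epsilon>\<^sup>2 / 100)))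
         + (2 * (7 * b) * (\<epsilon> / 2)) * (pi * (\<bar>cos \<theta>\<bar> + 2 * (\<epsilon>\<^sup>2 / 100))))"
    using exists_multiplier[OF Mm \<eta> B narrow growth smallM \<rho>] by blast
  show "\<exists>g. g holomorphic_on UNIV \<and> (\<exists>z. g z \<noteq> 0) \<and>
              (\<forall>\<theta>\<in>{0..2*pi}.
                 Limsup at_top (\<lambda>r. (v (of_real r * cis \<theta>) + log_abs g (of_real r * cis \<theta>)) / ereal r)
                   \<le> ereal (1000 * b * (\<epsilon> * \<bar>cos \<theta>\<bar> + \<bar>sin \<theta>\<bar> / \<epsilon>)))"
  proof (intro exI[of _ g] conjI ballI)
    show "g holomorphic_on UNIV" "\<exists>z. g z \<noteq> 0" using g(1,2) by blast+
    fix \<theta> :: real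
    show "Limsup at_top (\<lambda>r. (v (of_real r * cis \<theta>) + log_abs g (of_real r * cis \<theta>)) / ereal r)
                   \<le> ereal (1000 * b * (\<epsilon> * \<bar>cos \<theta>\<bar> + \<bar>sin \<theta>\<bar> / \<epsilon>))"
      using g(3)[of \<theta>] indicator_constant_le[OF b \<epsilon>, of \<theta>] by (auto intro: order_trans)
  qed
qed

end
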